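(* Let $l,k\ge 1$ be integers, $n=l+k$, $E=\mathbb{C}^n$ and $X=\operatorname{Gr}(l,E)$. Let $\mathbb{Z}[c_1,\dots,c_l,q]$ be the polynomial ring in independent variables, put $c_0=1$ and $c_i=0$ for $i<0$ and $i>l$, and for $p\ge1$ set $\sigma_p=\det(c_{1+j-i})_{1\le i,j\le p}\in\mathbb{Z}[c_1,\dots,c_l]$. Then $$QH^*X=\mathbb{Z}[c_1,\dots,c_l,q]/(\sigma_{k+1},\dots,\sigma_{n-1},\sigma_n+(-1)^l q),$$ that is, the $\mathbb{Z}[q]$-algebra homomorphism $\mathbb{Z}[c_1,\dots,c_l,q]\to QH^*X$ sending $c_i$ to the Schubert class $\sigma_{(1^i)}$ for $1\le i\le l$ is surjective with kernel the ideal generated by $\sigma_{k+1},\dots,\sigma_{n-1},\sigma_n+(-1)^lq$.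
   Context: $\operatorname{Gr}(l,E)$ is the Grassmannian of $l$-dimensional subspaces of $E=\mathbb{C}^n$. For a partition $\lambda$ write $|\lambda|=\sum\lambda_i$; $(1^i)$ is the partition with $i$ parts equal to $1$. For a complete flag $F_1\subset F_2\subset\dots\subset F_n=E$ ($\dim F_i=i$) and a partition $\lambda=(\lambda_1\ge\dots\ge\lambda_l\ge0)$ with $\lambda_1\le k$ (i.e. contained in the $l\times k$ rectangle), the Schubert variety is $\Omega_\lambda(F_\bullet)=\{V\in X\mid \dim(V\cap F_{k+i-\lambda_i})\ge i\ \ \forall\,1\le i\le l\}$; it has codimension $|\lambda|$, and $\Omega_\lambda\in H^*X=H^*(X;\mathbb{Z})$ denotes its class. The classes $\Omega_\lambda$, for $\lambda$ contained in the $l\times k$ rectangle, form a $\mathbb{Z}$-basis of $H^*X$. The degree of a regular map $f:\mathbb{P}^1\to\mathbb{P}^N$ is the number of points in the inverse image of a general hyperplane; the degree of a map $\mathbb{P}^1\to X$ is that of its composition with the Plücker embedding $X\subset\mathbb{P}(\bigwedge^l E)$. For partitions $\lambda,\mu,\nu$ in the $l\times k$ rectangle and $d\ge0$ with $|\lambda|+|\mu|+|\nu|=lk+dn$, the Gromov-Witten invariant $\langle\Omega_\lambda,\Omega_\mu,\Omega_\nu\rangle_d$ is the number of rational curves $f:\mathbb{P}^1\to X$ of degree $d$ which meet all of $\Omega_\lambda(F_\bullet),\Omega_\mu(G_\bullet),\Omega_\nu(H_\bullet)$ for general flags $F_\bullet,G_\bullet,H_\bullet$, up to automorphisms of $\mathbb{P}^1$.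 If $|\lambda|+|\mu|+|\nu|\ne lk+dn$ the invariant is $0$. The (small) quantum cohomology ring $QH^*X$ is $H^*X\otimes_{\mathbb{Z}}\mathbb{Z}[q]$ as a $\mathbb{Z}[q]$-module, with Schubert classes $\sigma_\lambda=\Omega_\lambda\otimes1$ and $\mathbb{Z}[q]$-bilinear product $\sigma_\lambda\cdot\sigma_\mu=\sum_{\nu,\,d\ge0}\langle\Omega_\lambda,\Omega_\mu,\Omega_{\nu^\vee}\rangle_d\,q^d\,\sigma_\nu$, where $\nu^\vee=(k-\nu_l,\dots,k-\nu_1)$. It is a known fact, assumed here, that this defines an associative (commutative) ring. *)

theory Defs
  imports
    "HOL-Analysis.Cartesian_Space"
    "HOL-Algebra.RingHom"
    "HOL-Library.Poly_Mapping"
    "HOL-Library.FuncSet"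
    "HOL-Computational_Algebra.Polynomial"
    "Jordan_Normal_Form.Determinant"
begin

no_notation vec_index (infixl "$" 100)

section \<open>Multivariate polynomials\<close>

type_synonym ('v, 'a) mpol = "('v \<Rightarrow>\<^sub>0 nat) \<Rightarrow>\<^sub>0 'a"

definition mpols :: "'v set \<Rightarrow> ('v, 'a::zero) mpol set" where
  "mpols I = {p. \<forall>m \<in> Poly_Mapping.keys p. Poly_Mapping.keys m \<subseteq> I}"

definition mvar :: "'v \<Rightarrow> ('v, 'a::zero_neq_one) mpol" where
  "mvar v = Poly_Mapping.single (Poly_Mapping.single v 1) 1"

definition mpeval :: "('v, 'a::comm_semiring_1) mpol \<Rightarrow> ('v \<Rightarrow> 'a) \<Rightarrow> 'a" where
  "mpeval p x = (\<Sum>m \<in> Poly_Mapping.keys p. Poly_Mapping.lookup p m *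
     (\<Prod>v \<in> Poly_Mapping.keys m. x v ^ Poly_Mapping.lookup m v))"

definition homogeneous :: "nat \<Rightarrow> ('v, 'a::zero) mpol \<Rightarrow> bool" where
  "homogeneous e p \<longleftrightarrow> (\<forall>m \<in> Poly_Mapping.keys p.
     (\<Sum>v \<in> Poly_Mapping.keys m. Poly_Mapping.lookup m v) = e)"


section \<open>Complex projective spaces and regular maps\<close>

text \<open>A point of projective space with homogeneous coordinates indexed by \<open>I\<close> is the punctured
  line of all its coordinate vectors; coordinate vectors vanish off \<open>I\<close>.\<close>

type_synonym 'i ppoint = "('i \<Rightarrow> complex) set"

definition proj_point :: "('i \<Rightarrow> complex) \<Rightarrow> 'i ppoint" where
  "proj_point w = {\<lambda>i. c * w i | c. c \<noteq> 0}"

definition proj_space :: "'i set \<Rightarrow> 'i ppoint set" where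
  "proj_space I = {proj_point w | w. w \<noteq> (\<lambda>_. 0) \<and> (\<forall>i. i \<notin> I \<longrightarrow> w i = 0)}"

definition zariski_open :: "'i set \<Rightarrow> 'i ppoint set \<Rightarrow> bool" where
  "zariski_open I U \<longleftrightarrow> (\<exists>S. S \<subseteq> mpols I \<and> (\<forall>g \<in> S. \<exists>e. homogeneous e g) \<and>
     U = {x \<in> proj_space I. \<exists>g \<in> S. \<forall>w \<in> x. mpeval g w \<noteq> 0})"

definition regular_map ::
    "'i set \<Rightarrow> 'j set \<Rightarrow> ('i ppoint \<Rightarrow> 'j ppoint) \<Rightarrow> bool" where
  "regular_map I J f \<longleftrightarrow> f \<in> proj_space I \<rightarrow> proj_space J \<and>
     (\<forall>x \<in> proj_space I. \<exists>U e P. zariski_open I U \<and> x \<in> U \<and>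
        (\<forall>j \<in> J. P j \<in> mpols I \<and> homogeneous e (P j)) \<and>
        (\<forall>y \<in> U. \<forall>w \<in> y. (\<lambda>j. if j \<in> J then mpeval (P j) w else 0) \<in> f y))"

abbreviation P1 :: "nat ppoint set" where
  "P1 \<equiv> proj_space {..1}"

definition hyperplane :: "'j set \<Rightarrow> ('j \<Rightarrow> complex) \<Rightarrow> 'j ppoint set" where
  "hyperplane J a = {y \<in> proj_space J. \<forall>w \<in> y. (\<Sum>j\<in>J. a j * w j) = 0}"

text \<open>A general hyperplane is one whose coefficient vector lies in some nonempty Zariski open set;
  it suffices to consider basic open sets, the complements of the zero loci of single nonzero
  polynomials.\<close>

definition has_degree :: "'j set \<Rightarrow> (nat ppoint \<Rightarrow> 'j ppoint) \<Rightarrow> nat \<Rightarrow> bool" where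
  "has_degree J f d \<longleftrightarrow> (\<exists>g :: ('j, complex) mpol. g \<in> mpols J \<and> g \<noteq> 0 \<and>
     (\<forall>a. (\<exists>j\<in>J. a j \<noteq> 0) \<and> mpeval g a \<noteq> 0 \<longrightarrow>
        finite {x \<in> P1. f x \<in> hyperplane J a} \<and> card {x \<in> P1. f x \<in> hyperplane J a} = d))"

definition automorphism_P1 :: "(nat ppoint \<Rightarrow> nat ppoint) \<Rightarrow> bool" where
  "automorphism_P1 \<phi> \<longleftrightarrow> bij_betw \<phi> P1 P1 \<and> regular_map {..1} {..1} \<phi> \<and>
     regular_map {..1} {..1} (inv_into P1 \<phi>)"


section \<open>Grassmannians and Schubert varieties\<close>

text \<open>The ambient space is \<^typ>\<open>complex^'n\<close>, of dimension \<^term>\<open>CARD('n)\<close>.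
  The linear order on the index type only serves to order the
  columns of the minors below.\<close>

type_synonym 'n cspace = "(complex, 'n) Finite_Cartesian_Product.vec"

type_synonym 'n cflag = "nat \<Rightarrow> 'n cspace set"

definition Gr :: "nat \<Rightarrow> 'n::{finite,linorder} cspace set set" where
  "Gr l = {V. vec.subspace V \<and> vec.dim V = l}"

definition minors :: "nat \<Rightarrow> (nat \<Rightarrow> 'n::{finite,linorder} cspace) \<Rightarrow> 'n set \<Rightarrow> complex" where
  "minors l b J = (if card J = l
     then Determinant.det (Matrix.mat l l (\<lambda>(i, j). b i $ (sorted_list_of_set J ! j))) else 0)"

abbreviation plucker_index :: "nat \<Rightarrow> 'n set set" where
  "plucker_index l \<equiv> {J. card J = l}"

text \<open>The Pluecker embedding of \<^term>\<open>Gr l\<close> into the projective space of the exterior power,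
  in the standard basis of the latter. The vectors of minors of two bases of the same subspace
  differ by the determinant of the base change, which can be any nonzero number when \<open>l \<ge> 1\<close>; so
  the set of all of them is a point of projective space.\<close>

definition plucker :: "nat \<Rightarrow> 'n::{finite,linorder} cspace set \<Rightarrow> 'n set ppoint" where
  "plucker l V = {minors l b | b. vec.span (b ` {..<l}) = V}"

definition complete_flag :: "'n::{finite,linorder} cflag \<Rightarrow> bool" where
  "complete_flag F \<longleftrightarrow> (\<forall>i \<in> {1..CARD('n)}. vec.subspace (F i) \<and> vec.dim (F i) = i) \<and>
     (\<forall>i \<in> {1..<CARD('n)}. F i \<subseteq> F (Suc i))"

definition rect_partitions :: "nat \<Rightarrow> nat \<Rightarrow> nat list set" where
  "rect_partitions l k = {p. length p = l \<and> sorted_wrt (\<ge>) p \<and> (\<forall>x \<in> set p. x \<le> k)}"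

definition dual_partition :: "nat \<Rightarrow> nat list \<Rightarrow> nat list" where
  "dual_partition k p = rev (map (\<lambda>x. k - x) p)"

definition column :: "nat \<Rightarrow> nat \<Rightarrow> nat list" where
  "column l i = replicate i 1 @ replicate (l - i) 0"

definition schubert_variety ::
    "nat \<Rightarrow> nat \<Rightarrow> nat list \<Rightarrow> 'n::{finite,linorder} cflag \<Rightarrow> 'n cspace set set" where
  "schubert_variety l k p F =
     {V \<in> Gr l. \<forall>i \<in> {1..l}. i \<le> vec.dim (V \<inter> F (k + i - p ! (i - 1)))}"


section \<open>Gromov-Witten invariants\<close>

definition rational_curves ::
    "nat \<Rightarrow> nat \<Rightarrow> (nat ppoint \<Rightarrow> 'n::{finite,linorder} cspace set) set" where
  "rational_curves l d = {f \<in> P1 \<rightarrow>\<^sub>E Gr l.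
     regular_map {..1} (plucker_index l) (plucker l \<circ> f) \<and>
     has_degree (plucker_index l) (plucker l \<circ> f) d}"

definition curves_meeting ::
    "nat \<Rightarrow> nat \<Rightarrow> 'n::{finite,linorder} cspace set set list
      \<Rightarrow> (nat ppoint \<Rightarrow> 'n cspace set) set" where
  "curves_meeting l d Ys = {f \<in> rational_curves l d. \<forall>Y \<in> set Ys. f ` P1 \<inter> Y \<noteq> {}}"

definition reparam_rel ::
    "(nat ppoint \<Rightarrow> 'b) set
      \<Rightarrow> ((nat ppoint \<Rightarrow> 'b) \<times> (nat ppoint \<Rightarrow> 'b)) set" where
  "reparam_rel A = {(f, g). f \<in> A \<and> g \<in> A \<and>
     (\<exists>\<phi>. automorphism_P1 \<phi> \<and> (\<forall>x \<in> P1. g x = f (\<phi> x)))}"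

text \<open>General triples of flags. The variety of complete flags is a quotient of the general linear
  group, the quotient map sending an ordered basis \<open>b\<close> to the flag of the spans of its initial
  segments. This map is open and continuous, so a property of triples of flags holds on a nonempty
  Zariski open set iff it holds for the triples coming from a nonempty Zariski open set of triples
  of ordered bases, and the latter may again be taken to be basic open.\<close>

definition adapted_basis :: "(nat \<Rightarrow> 'n::{finite,linorder} cspace) \<Rightarrow> 'n cflag \<Rightarrow> bool" where
  "adapted_basis b F \<longleftrightarrow> (\<forall>i \<in> {1..CARD('n)}. F i = vec.span (b ` {..<i}))"

definition for_general_flags ::
    "('n::{finite,linorder} cflag \<Rightarrow> 'n cflag \<Rightarrow> 'n cflag \<Rightarrow> bool) \<Rightarrow> bool" where
  "for_general_flags Q \<longleftrightarrow> (\<exists>g :: (nat \<times> nat \<times> 'n, complex) mpol.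
     g \<in> mpols ({..<3} \<times> {..<CARD('n)} \<times> UNIV) \<and> g \<noteq> 0 \<and>
     (\<forall>F G H b. complete_flag F \<and> complete_flag G \<and> complete_flag H \<and>
        adapted_basis (b 0) F \<and> adapted_basis (b 1) G \<and> adapted_basis (b 2) H \<and>
        mpeval g (\<lambda>(m, i, j). b m i $ j) \<noteq> 0 \<longrightarrow> Q F G H))"

definition gromov_witten ::
    "'n::{finite,linorder} itself \<Rightarrow> nat \<Rightarrow> nat \<Rightarrow> nat list \<Rightarrow> nat list \<Rightarrow> nat list \<Rightarrow> nat \<Rightarrow> nat" where
  "gromov_witten _ l k p1 p2 p3 d =
     (if sum_list p1 + sum_list p2 + sum_list p3 = l * k + d * CARD('n) then
        (THE N. for_general_flags (\<lambda>F G (H :: 'n cflag).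
           let A = curves_meeting l d
                 [schubert_variety l k p1 F, schubert_variety l k p2 G, schubert_variety l k p3 H]
           in finite (A // reparam_rel A) \<and> card (A // reparam_rel A) = N))
      else 0)"


section \<open>The quantum cohomology ring\<close>

text \<open>The integral cohomology of the Grassmannian is represented as the free abelian group on the
  Schubert classes, i.e. on the partitions in the rectangle. Its scalar extension to the polynomials
  in \<open>q\<close>, which are modelled by \<^typ>\<open>int poly\<close>, consists of the \<^typ>\<open>int poly\<close>-linear
  combinations of these partitions.\<close>

definition schubert_class :: "nat list \<Rightarrow> (nat list \<Rightarrow>\<^sub>0 int poly)" where
  "schubert_class p = Poly_Mapping.single p 1"

definition qscale :: "int poly \<Rightarrow> (nat list \<Rightarrow>\<^sub>0 int poly) \<Rightarrow> (nat list \<Rightarrow>\<^sub>0 int poly)" where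
  "qscale f x = Poly_Mapping.map (\<lambda>a. f * a) x"

definition schubert_qprod ::
    "'n::{finite,linorder} itself \<Rightarrow> nat \<Rightarrow> nat \<Rightarrow> nat list \<Rightarrow> nat list \<Rightarrow> (nat list \<Rightarrow>\<^sub>0 int poly)" where
  "schubert_qprod T l k p1 p2 = (\<Sum>p3 \<in> rect_partitions l k. Sum_any (\<lambda>d.
     qscale (Polynomial.monom (int (gromov_witten T l k p1 p2 (dual_partition k p3) d)) d)
       (schubert_class p3)))"

definition QH ::
    "'n::{finite,linorder} itself \<Rightarrow> nat \<Rightarrow> nat \<Rightarrow> (nat list \<Rightarrow>\<^sub>0 int poly) ring" where
  "QH T l k =
     \<lparr> carrier = {x. Poly_Mapping.keys x \<subseteq> rect_partitions l k},
       monoid.mult = (\<lambda>x y. \<Sum>p1 \<in> rect_partitions l k. \<Sum>p2 \<in> rect_partitions l k.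
         qscale (Poly_Mapping.lookup x p1 * Poly_Mapping.lookup y p2) (schubert_qprod T l k p1 p2)),
       one = schubert_class (replicate l 0),
       zero = 0,
       add = (+) \<rparr>"


section \<open>The presentation\<close>

text \<open>In the polynomial ring of the presentation, the variable with index \<open>0\<close> is \<open>q\<close> and the one
  with index \<open>i\<close>, where \<open>1 \<le> i \<le> l\<close>, is the \<open>i\<close>-th Chern variable.\<close>

definition cq_ring :: "nat \<Rightarrow> (nat, int) mpol ring" where
  "cq_ring l = \<lparr> carrier = mpols {0..l}, monoid.mult = (*), one = 1, zero = 0, add = (+) \<rparr>"

definition q_var :: "(nat, int) mpol" where
  "q_var = mvar 0"

definition c_var :: "nat \<Rightarrow> int \<Rightarrow> (nat, int) mpol" where
  "c_var l i = (if i = 0 then 1 else if 1 \<le> i \<and> i \<le> int l then mvar (nat i) else 0)"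

text \<open>Shifting both matrix indices to start at \<open>0\<close> does not change \<open>1 + j - i\<close>.\<close>

definition sigma_det :: "nat \<Rightarrow> nat \<Rightarrow> (nat, int) mpol" where
  "sigma_det l p = Determinant.det (Matrix.mat p p (\<lambda>(i, j). c_var l (1 + int j - int i)))"

definition relations :: "nat \<Rightarrow> nat \<Rightarrow> (nat, int) mpol set" where
  "relations l k = sigma_det l ` {k + 1..l + k - 1} \<union> {sigma_det l (l + k) + (- 1) ^ l * q_var}"

definition Zq_embed :: "int poly \<Rightarrow> (nat, int) mpol" where
  "Zq_embed f = Polynomial.poly (Polynomial.map_poly of_int f) q_var"

definition chern_hom ::
    "'n::{finite,linorder} itself \<Rightarrow> nat \<Rightarrow> nat
      \<Rightarrow> ((nat, int) mpol \<Rightarrow> (nat list \<Rightarrow>\<^sub>0 int poly)) \<Rightarrow> bool" where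
  "chern_hom T l k \<phi> \<longleftrightarrow> \<phi> \<in> Ring.ring_hom (cq_ring l) (QH T l k) \<and>
     (\<forall>f. \<forall>x \<in> carrier (cq_ring l). \<phi> (Zq_embed f * x) = qscale f (\<phi> x)) \<and>
     (\<forall>i \<in> {1..l}. \<phi> (c_var l (int i)) = schubert_class (column l i))"

end

theory Submission
  imports Defs "HOL-Computational_Algebra.Fundamental_Theorem_Algebra"
begin

text \<open>Two families of Gromov-Witten invariants determine the presentation: the degree zero invariants
  with a one-row partition, given by Pieri's rule, and the degree one invariant of the classes of
  the partitions \<open>(k)\<close>, \<open>(1\<^sup>l)\<close> and \<open>(k\<^sup>l)\<close>, which is \<open>1\<close>. For degree reasons no other
  correction occurs in the products of \<open>(1\<^sup>i)\<close> and \<open>(p)\<close>, so expanding the determinants along the first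
  row shows inductively that \<open>\<sigma>\<^sub>p\<close> maps to the class of \<open>(p)\<close> for \<open>p < n\<close> (to \<open>0\<close> if \<open>p > k\<close>) and
  that \<open>\<sigma>\<^sub>n\<close> maps to \<open>(-1)\<^sup>l\<^sup>-\<^sup>1 q\<close>. Modulo the relations every polynomial is a \<open>\<int>[q]\<close>-combination of
  the monomials in the \<open>c\<^sub>i\<close> with at most \<open>k\<close> factors. These are as many as there are partitions in
  the rectangle and their images generate, hence they map to a basis.

  Two general flags are opposite and define coordinates. The spaces \<open>V\<close> in the intersection of
  their Schubert varieties split along intervals of coordinates, which leaves exactly one \<open>V\<close> or
  none once \<open>V\<close> also has to meet a third general space. A curve of degree one is a pencil of spaces between an
  \<open>(l - 1)\<close>-dimensional and an \<open>(l + 1)\<close>-dimensional one, and the three conditions of the degree one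
  invariant determine both.\<close>

section \<open>Evaluating multivariate polynomials\<close>

text \<open>Giving q weight zero makes the inhomogeneous last relation useful: modulo the relations
  every sigma_s with s > k loses weight n, so a Schur determinant with more than k columns is
  congruent to terms of smaller weight. The resulting rewriting terminates by weight first and by
  the sum of squares of the indices second. Linear independence of the surviving monomials is never
  attacked directly: a square matrix over Z[q] with a one-sided inverse has nonzero determinant.

  On the geometric side the invariants are honest counts of maps, and two obstacles shape the proof.
  Degree counts the points over a general hyperplane without multiplicity, so it must be compared
  with the degree of representing polynomials; only degrees 0 and 1 are needed. And a general triple
  of flags is one off the zero locus of a nonzero polynomial, so general position is written as the
  nonvanishing of determinants, each of which is tested at an explicit triple built from a single
  basis.\<close>

lemma poly_mapping_eq_sum_single:
  fixes p :: "'a \<Rightarrow>\<^sub>0 'b::comm_monoid_add"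
  shows "p = (\<Sum>m \<in> Poly_Mapping.keys p. Poly_Mapping.single m (Poly_Mapping.lookup p m))"
proof (rule poly_mapping_eqI)
  fix m
  show "Poly_Mapping.lookup p m
    = Poly_Mapping.lookup (\<Sum>m \<in> Poly_Mapping.keys p. Poly_Mapping.single m (Poly_Mapping.lookup p m)) m"
    by (simp add: lookup_sum lookup_single when_def in_keys_iff)
qed

lemma additive_sum:
  fixes F :: "'a::comm_monoid_add \<Rightarrow> 'b::comm_monoid_add"
  assumes "F 0 = 0" and "\<And>x y. F (x + y) = F x + F y"
  shows "F (sum f A) = (\<Sum>a\<in>A. F (f a))"
  by (induction A rule: infinite_finite_induct) (use assms in auto)

lemma additive_mult_of_singles:
  fixes F :: "('a::monoid_add \<Rightarrow>\<^sub>0 'b::semiring_0) \<Rightarrow> 'c::comm_monoid_add"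
  assumes F0: "F 0 = 0" and Fadd: "\<And>x y. F (x + y) = F x + F y"
    and M: "\<And>x. M x 0 = 0" "\<And>x. M 0 x = 0"
      "\<And>x y z. M (x + y) z = M x z + M y z" "\<And>x y z. M x (y + z) = M x y + M x z"
    and single: "\<And>m a m' a'. m \<in> Poly_Mapping.keys p \<Longrightarrow> m' \<in> Poly_Mapping.keys q \<Longrightarrow>
      F (Poly_Mapping.single (m + m') (a * a'))
        = M (F (Poly_Mapping.single m a)) (F (Poly_Mapping.single m' a'))"
  shows "F (p * q) = M (F p) (F q)"
proof -
  let ?t = "\<lambda>p m. Poly_Mapping.single m (Poly_Mapping.lookup p m)"
  have M1: "M (sum f A) y = (\<Sum>a\<in>A. M (f a) y)" for f :: "'a \<Rightarrow> 'c" and A y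
    by (rule additive_sum) (use M in auto)
  have M2: "M y (sum f A) = (\<Sum>a\<in>A. M y (f a))" for f :: "'a \<Rightarrow> 'c" and A y
    by (rule additive_sum) (use M in auto)
  have "p * q = (\<Sum>m\<in>Poly_Mapping.keys p. \<Sum>m'\<in>Poly_Mapping.keys q. ?t p m * ?t q m')"
    by (subst poly_mapping_eq_sum_single[of p], subst poly_mapping_eq_sum_single[of q])
      (simp add: sum_product)
  then have "F (p * q)
      = (\<Sum>m\<in>Poly_Mapping.keys p. \<Sum>m'\<in>Poly_Mapping.keys q. F (?t p m * ?t q m'))"
    by (simp add: additive_sum[of F, OF F0 Fadd])
  also have "\<dots> = (\<Sum>m\<in>Poly_Mapping.keys p. \<Sum>m'\<in>Poly_Mapping.keys q. M (F (?t p m)) (F (?t q m')))"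
    by (simp add: mult_single single)
  also have "\<dots> = M (\<Sum>m\<in>Poly_Mapping.keys p. F (?t p m)) (\<Sum>m'\<in>Poly_Mapping.keys q. F (?t q m'))"
    by (simp add: M1 M2) (rule sum.swap)
  also have "(\<Sum>m\<in>Poly_Mapping.keys p. F (?t p m)) = F p"
    by (subst (3) poly_mapping_eq_sum_single[of p]) (simp add: additive_sum[of F, OF F0 Fadd])
  also have "(\<Sum>m\<in>Poly_Mapping.keys q. F (?t q m)) = F q"
    by (subst (3) poly_mapping_eq_sum_single[of q]) (simp add: additive_sum[of F, OF F0 Fadd])
  finally show ?thesis .
qed

definition mono_eval :: "('v \<Rightarrow>\<^sub>0 nat) \<Rightarrow> ('v \<Rightarrow> 'a::comm_semiring_1) \<Rightarrow> 'a" where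
  "mono_eval m x = (\<Prod>v \<in> Poly_Mapping.keys m. x v ^ Poly_Mapping.lookup m v)"

lemma mono_eval_superset:
  assumes "finite S" "Poly_Mapping.keys m \<subseteq> S"
  shows "mono_eval m x = (\<Prod>v \<in> S. x v ^ Poly_Mapping.lookup m v)"
  unfolding mono_eval_def
  by (rule prod.mono_neutral_left) (use assms in \<open>auto simp: in_keys_iff\<close>)

lemma mono_eval_0 [simp]: "mono_eval 0 x = 1"
  by (simp add: mono_eval_def)

lemma mono_eval_add: "mono_eval (m + m') x = mono_eval m x * mono_eval m' x"
proof -
  let ?S = "Poly_Mapping.keys m \<union> Poly_Mapping.keys m'"
  have "Poly_Mapping.keys (m + m') \<subseteq> ?S"
    using keys_add by fastforce
  then show ?thesis
    by (simp add: mono_eval_superset[of ?S] lookup_add power_add prod.distrib)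
qed

lemma mono_eval_single [simp]: "mono_eval (Poly_Mapping.single v e) x = x v ^ e"
  by (cases "e = 0") (simp_all add: mono_eval_def)

lemma mpeval_superset:
  assumes "finite S" "Poly_Mapping.keys p \<subseteq> S"
  shows "mpeval p x = (\<Sum>m \<in> S. Poly_Mapping.lookup p m * mono_eval m x)"
  unfolding mpeval_def mono_eval_def[symmetric]
  by (rule sum.mono_neutral_left) (use assms in \<open>auto simp: in_keys_iff\<close>)

lemma mpeval_0 [simp]: "mpeval 0 x = 0"
  by (simp add: mpeval_def)

lemma mpeval_add: "mpeval (p + q) x = mpeval p x + mpeval q x"
proof -
  let ?S = "Poly_Mapping.keys p \<union> Poly_Mapping.keys q"
  have "Poly_Mapping.keys (p + q) \<subseteq> ?S"
    using keys_add by fastforce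
  then show ?thesis
    by (simp add: mpeval_superset[of ?S] lookup_add distrib_right sum.distrib)
qed

lemma mpeval_single [simp]: "mpeval (Poly_Mapping.single m a) x = a * mono_eval m x"
  by (cases "a = 0") (simp_all add: mpeval_superset[of "{m}"])

lemma mpeval_sum: "mpeval (sum f A) x = (\<Sum>a\<in>A. mpeval (f a) x)"
  by (rule additive_sum[where F = "\<lambda>p. mpeval p x"]) (simp_all add: mpeval_add)

lemma mpeval_mult: "mpeval (p * q) x = mpeval p x * mpeval q x"
  by (rule additive_mult_of_singles[where F = "\<lambda>p. mpeval p x" and M = "(*)"])
    (simp_all add: mpeval_add mono_eval_add algebra_simps)

lemma mpeval_1 [simp]: "mpeval 1 x = 1"
  by (metis mono_eval_0 mpeval_single mult.right_neutral single_one)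

lemma mpeval_mvar [simp]: "mpeval (mvar v) x = x v"
  by (simp add: mvar_def)

lemma mpols_0 [simp]: "0 \<in> mpols I" by (simp add: mpols_def)

lemma mpols_add: "p \<in> mpols I \<Longrightarrow> q \<in> mpols I \<Longrightarrow> p + q \<in> mpols I"
  using keys_add[of p q] by (force simp: mpols_def)

lemma mpols_sum: "(\<And>a. a \<in> A \<Longrightarrow> f a \<in> mpols I) \<Longrightarrow> sum f A \<in> mpols I"
  by (induction A rule: infinite_finite_induct) (auto simp: mpols_add)

lemma mpols_uminus: "(p :: ('v, 'a::ab_group_add) mpol) \<in> mpols I \<Longrightarrow> - p \<in> mpols I"
  by (auto simp: mpols_def in_keys_iff)

lemma mpols_single: "Poly_Mapping.keys m \<subseteq> I \<Longrightarrow> Poly_Mapping.single m a \<in> mpols I"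
  by (auto simp: mpols_def split: if_splits)

lemma mpols_mult: "p \<in> mpols I \<Longrightarrow> q \<in> mpols I \<Longrightarrow> p * q \<in> mpols I"
proof -
  assume a: "p \<in> mpols I" "q \<in> mpols I"
  show ?thesis
    unfolding mpols_def
  proof safe
    fix m v assume m: "m \<in> Poly_Mapping.keys (p * q)" "v \<in> Poly_Mapping.keys m"
    then obtain a b where "m = a + b" "a \<in> Poly_Mapping.keys p" "b \<in> Poly_Mapping.keys q"
      using keys_mult by blast
    then show "v \<in> I"
      using a m(2) keys_add[of a b] unfolding mpols_def by blast
  qed
qed

lemma mpols_1 [simp]: "1 \<in> mpols I"
  by (metis keys_zero empty_subsetI mpols_single single_one)

lemma mpols_mvar: "v \<in> I \<Longrightarrow> mvar v \<in> mpols I"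
  unfolding mvar_def by (rule mpols_single) simp

text \<open>Reduction modulo \<open>B\<close> reads off the digit at index 0, and the remaining
  digits follow by induction. It serves to tell apart the exponents of the Kronecker
  substitution.\<close>

lemma digits_inj:
  fixes f g :: "nat \<Rightarrow> nat"
  assumes "\<And>i. i < N \<Longrightarrow> f i < B" "\<And>i. i < N \<Longrightarrow> g i < B"
    and "(\<Sum>i<N. f i * B ^ i) = (\<Sum>i<N. g i * B ^ i)" "i < N"
  shows "f i = g i"
  using assms
proof (induction N arbitrary: f g i)
  case (Suc N)
  have split: "(\<Sum>i<Suc N. h i * B ^ i) = h 0 + B * (\<Sum>i<N. h (Suc i) * B ^ i)" for h :: "nat \<Rightarrow> nat"
    by (subst sum.lessThan_Suc_shift) (simp add: sum_distrib_left mult_ac)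
  have eq: "f 0 + B * (\<Sum>i<N. f (Suc i) * B ^ i) = g 0 + B * (\<Sum>i<N. g (Suc i) * B ^ i)"
    using Suc.prems(3) unfolding split .
  have B: "f 0 < B" "g 0 < B" using Suc.prems by auto
  have 0: "f 0 = g 0"
    using arg_cong[OF eq, of "\<lambda>x. x mod B"] B by simp
  with eq B have "(\<Sum>i<N. f (Suc i) * B ^ i) = (\<Sum>i<N. g (Suc i) * B ^ i)" by simp
  then have *: "f (Suc i) = g (Suc i)" if "i < N" for i
    using Suc.IH[of "\<lambda>i. f (Suc i)" "\<lambda>i. g (Suc i)" i] Suc.prems(1,2) that by auto
  show ?case
    using 0 * Suc.prems(4) by (cases i) auto
qed simp

text \<open>Kronecker substitution: sending the variables to suitable powers of one indeterminate
  keeps the monomials of \<open>g\<close> apart.\<close>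

lemma mpeval_nonzero_point:
  fixes g :: "('v, complex) mpol"
  assumes "g \<noteq> 0"
  shows "\<exists>x. mpeval g x \<noteq> 0"
proof -
  let ?K = "Poly_Mapping.keys g"
  define V where "V = (\<Union>m\<in>?K. Poly_Mapping.keys m)"
  have finV: "finite V" by (auto simp: V_def)
  then obtain ix where ix: "bij_betw ix {..<card V} V"
    using bij_betw_from_nat_into_finite by blast
  \<comment> \<open>\<open>B\<close> exceeds every exponent occurring in \<open>g\<close>, so that
    the exponents of a monomial are the base-\<open>B\<close> digits of the number
    \<open>e m\<close>.\<close>
  define B where "B = Suc (\<Sum>m\<in>?K. \<Sum>v\<in>V. Poly_Mapping.lookup m v)"
  have B: "Poly_Mapping.lookup m v < B" if "m \<in> ?K" "v \<in> V" for m v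
  proof -
    have "Poly_Mapping.lookup m v \<le> (\<Sum>v\<in>V. Poly_Mapping.lookup m v)"
      by (rule member_le_sum) (use that finV in auto)
    also have "\<dots> \<le> (\<Sum>m\<in>?K. \<Sum>v\<in>V. Poly_Mapping.lookup m v)"
      by (rule member_le_sum[where f = "\<lambda>m. \<Sum>v\<in>V. Poly_Mapping.lookup m v"]) (use that in auto)
    finally show ?thesis by (simp add: B_def)
  qed
  define e where "e m = (\<Sum>i<card V. Poly_Mapping.lookup m (ix i) * B ^ i)" for m
  have inj: "inj_on e ?K"
  proof (rule inj_onI)
    fix m m' assume mm: "m \<in> ?K" "m' \<in> ?K" "e m = e m'"
    have *: "Poly_Mapping.lookup m (ix i) = Poly_Mapping.lookup m' (ix i)" if "i < card V" for i
      by (rule digits_inj[of "card V" "\<lambda>i. Poly_Mapping.lookup m (ix i)" B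
            "\<lambda>i. Poly_Mapping.lookup m' (ix i)"])
        (use mm that ix B in \<open>auto simp: e_def bij_betw_def\<close>)
    show "m = m'"
    proof (rule poly_mapping_eqI)
      fix v
      show "Poly_Mapping.lookup m v = Poly_Mapping.lookup m' v"
      proof (cases "v \<in> V")
        case True
        then obtain i where "i < card V" "v = ix i" using ix by (force simp: bij_betw_def)
        then show ?thesis using * by simp
      next
        case False
        then have "v \<notin> Poly_Mapping.keys m" "v \<notin> Poly_Mapping.keys m'"
          using mm by (auto simp: V_def)
        then show ?thesis by (simp add: in_keys_iff)
      qed
    qed
  qed
  define P where "P = (\<Sum>m\<in>?K. Polynomial.monom (Poly_Mapping.lookup g m) (e m))"
  define jx where "jx = inv_into {..<card V} ix"
  have jx: "jx (ix i) = i" if "i < card V" for i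
    unfolding jx_def using ix that by (simp add: bij_betw_def inv_into_f_f)
  have ev: "mpeval g (\<lambda>v. t ^ (B ^ jx v)) = poly P t" for t
  proof -
    have "mono_eval m (\<lambda>v. t ^ (B ^ jx v)) = t ^ e m" if "m \<in> ?K" for m
    proof -
      have "mono_eval m (\<lambda>v. t ^ (B ^ jx v)) = (\<Prod>v\<in>V. (t ^ (B ^ jx v)) ^ Poly_Mapping.lookup m v)"
        by (rule mono_eval_superset) (use that finV in \<open>auto simp: V_def\<close>)
      also have "\<dots> = (\<Prod>i<card V. (t ^ (B ^ jx (ix i))) ^ Poly_Mapping.lookup m (ix i))"
        by (rule prod.reindex_bij_betw[OF ix, symmetric])
      also have "\<dots> = (\<Prod>i<card V. t ^ (Poly_Mapping.lookup m (ix i) * B ^ i))"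
        by (rule prod.cong) (simp_all add: jx power_mult[symmetric] mult.commute)
      also have "\<dots> = t ^ e m"
        by (simp add: e_def power_sum)
      finally show ?thesis .
    qed
    then show ?thesis
      by (simp add: mpeval_def mono_eval_def[symmetric] P_def poly_sum poly_monom)
  qed
  obtain m0 where m0: "m0 \<in> ?K" using assms by fastforce
  \<comment> \<open>The exponents \<open>e m\<close> are distinct, so only \<open>m0\<close>
    contributes to this coefficient.\<close>
  have "coeff P (e m0) = (\<Sum>m\<in>?K. if m = m0 then Poly_Mapping.lookup g m else 0)"
    unfolding P_def coeff_sum
    by (rule sum.cong) (use m0 inj in \<open>auto simp: inj_on_def\<close>)
  also have "\<dots> \<noteq> 0" using m0 by (simp add: in_keys_iff)
  finally have "P \<noteq> 0" by auto
  then have "\<exists>t. poly P t \<noteq> 0" using poly_all_0_iff_0 by blast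
  then show ?thesis using ev by metis
qed

lemma mpeval_line_poly:
  fixes g :: "('v, complex) mpol"
  shows "\<exists>P. \<forall>t. mpeval g (\<lambda>v. x v + t * y v) = poly P t"
proof -
  let ?P = "\<Sum>m\<in>Poly_Mapping.keys g. smult (Poly_Mapping.lookup g m)
     (\<Prod>v\<in>Poly_Mapping.keys m. [:x v, y v:] ^ Poly_Mapping.lookup m v)"
  have "mpeval g (\<lambda>v. x v + t * y v) = poly ?P t" for t
    by (simp add: mpeval_def poly_sum poly_prod)
  then show ?thesis by blast
qed

lemma mpeval_nonzero_cofinite_line:
  fixes g :: "('v, complex) mpol"
  assumes "mpeval g x \<noteq> 0"
  shows "finite {t. mpeval g (\<lambda>v. x v + t * y v) = 0}"
proof -
  obtain P where P: "\<forall>t. mpeval g (\<lambda>v. x v + t * y v) = poly P t"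
    using mpeval_line_poly by blast
  have "poly P 0 \<noteq> 0" using P[rule_format, of 0] assms by simp
  then have "P \<noteq> 0" by auto
  then show ?thesis using P poly_roots_finite by simp
qed

text \<open>On the line joining a point where \<open>g\<close> is nonzero to one where
  \<open>h\<close> is nonzero, each factor has finitely many zeros, so some point of the line avoids
  both. This irreducibility is what allows general properties to be combined.\<close>

lemma mpol_mult_nonzero:
  fixes g h :: "('v, complex) mpol"
  assumes "g \<noteq> 0" "h \<noteq> 0"
  shows "g * h \<noteq> 0"
proof -
  obtain x y where x: "mpeval g x \<noteq> 0" and y: "mpeval h y \<noteq> 0"
    using assms mpeval_nonzero_point by meson
  let ?z = "\<lambda>t v. x v + t * (y v - x v)"
  have "finite {t. mpeval g (?z t) = 0}"
    by (rule mpeval_nonzero_cofinite_line[OF x])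
  \<comment> \<open>The line is parametrized backwards from \<open>y\<close>, where \<open>h\<close>
    does not vanish; \<open>t\<close> becomes \<open>1 - t\<close>.\<close>
  moreover have "finite {t. mpeval h (?z t) = 0}"
  proof -
    have "finite {t. mpeval h (\<lambda>v. y v + t * (x v - y v)) = 0}" (is "finite ?A")
      by (rule mpeval_nonzero_cofinite_line[OF y])
    moreover have "{t. mpeval h (?z t) = 0} = (\<lambda>t. 1 - t) ` ?A"
    proof -
      have "?z t = (\<lambda>v. y v + (1 - t) * (x v - y v))" for t by (auto simp: algebra_simps)
      then show ?thesis by (force simp: image_iff)
    qed
    ultimately show ?thesis by simp
  qed
  ultimately have "finite ({t. mpeval g (?z t) = 0} \<union> {t. mpeval h (?z t) = 0})" by simp
  then obtain t where "t \<notin> {t. mpeval g (?z t) = 0} \<union> {t. mpeval h (?z t) = 0}"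
    using ex_new_if_finite[OF infinite_UNIV_char_0] by blast
  then have "mpeval (g * h) (?z t) \<noteq> 0" by (simp add: mpeval_mult)
  then show ?thesis by auto
qed

section \<open>Properties of general triples of bases\<close>

type_synonym 'n btriple = "nat \<Rightarrow> nat \<Rightarrow> 'n cspace"

definition basis_vars :: "'n itself \<Rightarrow> (nat \<times> nat \<times> 'n) set" where
  "basis_vars _ = {..<3} \<times> {..<CARD('n)} \<times> UNIV"

text \<open>Only the first \<open>CARD('n)\<close> vectors of the families with index 0, 1, 2 may
  enter, as in \<open>for_general_flags\<close>; a \<open>btriple\<close> itself has infinitely many
  entries.\<close>

definition polyfun :: "('n::{finite,linorder} btriple \<Rightarrow> complex) \<Rightarrow> bool" where
  "polyfun \<Phi> \<longleftrightarrow> (\<exists>g \<in> mpols (basis_vars TYPE('n)). \<forall>b. mpeval g (\<lambda>(m, i, j). b m i $ j) = \<Phi> b)"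

text \<open>The families of \<open>b\<close> are arbitrary here; that they are bases is itself a
  generic condition, added where it is wanted.\<close>

definition generic :: "('n::{finite,linorder} btriple \<Rightarrow> bool) \<Rightarrow> bool" where
  "generic P \<longleftrightarrow> (\<exists>g \<in> mpols (basis_vars TYPE('n)). g \<noteq> 0 \<and>
     (\<forall>b. mpeval g (\<lambda>(m, i, j). b m i $ j) \<noteq> 0 \<longrightarrow> P b))"

lemma polyfun_const: "polyfun (\<lambda>b. c)"
  unfolding polyfun_def by (rule bexI[of _ "Poly_Mapping.single 0 c"]) (auto intro: mpols_single)

lemma polyfun_coord:
  assumes "m < 3" "i < CARD('n)"
  shows "polyfun (\<lambda>b :: 'n::{finite,linorder} btriple. b m i $ j)"
  unfolding polyfun_def
  by (rule bexI[of _ "mvar (m, i, j)"]) (use assms in \<open>auto intro: mpols_mvar simp: basis_vars_def\<close>)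

lemma polyfun_add: "polyfun f \<Longrightarrow> polyfun g \<Longrightarrow> polyfun (\<lambda>b. f b + g b)"
  unfolding polyfun_def by (metis mpeval_add mpols_add)

lemma polyfun_mult: "polyfun f \<Longrightarrow> polyfun g \<Longrightarrow> polyfun (\<lambda>b. f b * g b)"
  unfolding polyfun_def by (metis mpeval_mult mpols_mult)

lemma polyfun_sum: "(\<And>a. a \<in> A \<Longrightarrow> polyfun (f a)) \<Longrightarrow> polyfun (\<lambda>b. \<Sum>a\<in>A. f a b)"
  by (induction A rule: infinite_finite_induct) (auto intro: polyfun_add polyfun_const)

lemma polyfun_prod: "(\<And>a. a \<in> A \<Longrightarrow> polyfun (f a)) \<Longrightarrow> polyfun (\<lambda>b. \<Prod>a\<in>A. f a b)"
  by (induction A rule: infinite_finite_induct) (auto intro: polyfun_mult polyfun_const)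

lemma polyfun_det:
  assumes "\<And>i j. i < r \<Longrightarrow> j < r \<Longrightarrow> polyfun (f i j)"
  shows "polyfun (\<lambda>b. Determinant.det (Matrix.mat r r (\<lambda>(i, j). f i j b)))"
proof -
  have "polyfun (\<lambda>b. \<Sum>p | p permutes {0..<r}. signof p * (\<Prod>i = 0..<r. f i (p i) b))"
    by (intro polyfun_sum polyfun_mult polyfun_const polyfun_prod assms)
      (auto dest: permutes_in_image)
  moreover have "Determinant.det (Matrix.mat r r (\<lambda>(i, j). f i j b))
      = (\<Sum>p | p permutes {0..<r}. signof p * (\<Prod>i = 0..<r. f i (p i) b))" for b
    unfolding Determinant.det_def
    by (auto intro!: sum.cong prod.cong dest: permutes_in_image)
  ultimately show ?thesis by simp
qed

text \<open>One point with \<Phi> nonzero shows that the polynomial behind \<Phi> is nonzero. Every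
  basic general position claim below is reduced to such a sample point \<open>b0\<close>.\<close>

lemma genericI:
  assumes "polyfun \<Phi>" "\<Phi> b0 \<noteq> 0" "\<And>b. \<Phi> b \<noteq> 0 \<Longrightarrow> P b"
  shows "generic P"
proof -
  obtain g where g: "g \<in> mpols (basis_vars TYPE('a))" "\<forall>b. mpeval g (\<lambda>(m, i, j). b m i $ j) = \<Phi> b"
    using assms(1) unfolding polyfun_def by blast
  then have "g \<noteq> 0" using assms(2) by (metis mpeval_0)
  then show ?thesis unfolding generic_def using g assms(3) by auto
qed

lemma generic_mono: "generic P \<Longrightarrow> (\<And>b. P b \<Longrightarrow> Q b) \<Longrightarrow> generic Q"
  unfolding generic_def by blast

lemma generic_conj: "generic P \<Longrightarrow> generic Q \<Longrightarrow> generic (\<lambda>b. P b \<and> Q b)"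
proof -
  assume "generic P" "generic Q"
  then obtain g h where *: "g \<in> mpols (basis_vars TYPE('a))" "g \<noteq> 0"
      "\<forall>b. mpeval g (\<lambda>(m, i, j). b m i $ j) \<noteq> 0 \<longrightarrow> P b"
      "h \<in> mpols (basis_vars TYPE('a))" "h \<noteq> 0"
      "\<forall>b. mpeval h (\<lambda>(m, i, j). b m i $ j) \<noteq> 0 \<longrightarrow> Q b"
    unfolding generic_def by blast
  then show ?thesis
    unfolding generic_def
    by (intro bexI[of _ "g * h"]) (auto simp: mpeval_mult mpol_mult_nonzero mpols_mult)
qed

lemma generic_True: "generic (\<lambda>b. True)"
  by (rule genericI[OF polyfun_const[of 1]]) auto

lemma generic_ball:
  "finite A \<Longrightarrow> (\<And>a. a \<in> A \<Longrightarrow> generic (P a)) \<Longrightarrow> generic (\<lambda>b. \<forall>a\<in>A. P a b)"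
proof (induction A rule: finite_induct)
  case empty
  then show ?case by (simp add: generic_True)
next
  case (insert x F)
  then have "generic (\<lambda>b. P x b \<and> (\<forall>a\<in>F. P a b))" by (intro generic_conj) auto
  then show ?case by simp
qed

lemma generic_exists: "generic P \<Longrightarrow> \<exists>b. P b"
proof -
  assume "generic P"
  then obtain g where g: "g \<in> mpols (basis_vars TYPE('a))" "g \<noteq> 0"
      "\<forall>b. mpeval g (\<lambda>(m, i, j). b m i $ j) \<noteq> 0 \<longrightarrow> P b"
    unfolding generic_def by blast
  then obtain x where x: "mpeval g x \<noteq> 0" using mpeval_nonzero_point by blast
  have "x = (\<lambda>(m, i, j). (\<lambda>m i. \<chi> j. x (m, i, j)) m i $ j)" by auto
  with x g(3) show ?thesis by metis
qed

lemma for_general_flags_generic: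
  "for_general_flags Q \<longleftrightarrow> generic (\<lambda>b. \<forall>F G H :: 'n::{finite,linorder} cflag.
     complete_flag F \<and> complete_flag G \<and> complete_flag H \<and>
     adapted_basis (b 0) F \<and> adapted_basis (b 1) G \<and> adapted_basis (b 2) H \<longrightarrow> Q F G H)"
  unfolding for_general_flags_def generic_def basis_vars_def Bex_def
  by (rule arg_cong[where f = Ex], rule ext) blast

section \<open>Partitions in a rectangle\<close>

definition row :: "nat \<Rightarrow> nat \<Rightarrow> nat list" where
  "row l p = p # replicate (l - 1) 0"

text \<open>The hook partition (a, 1^b), padded with zeros to length \<open>l\<close>.\<close>

definition hook :: "nat \<Rightarrow> nat \<Rightarrow> nat \<Rightarrow> nat list" where
  "hook l a b = map (\<lambda>j. if j = 0 then a else if j \<le> b then 1 else 0) [0..<l]"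

text \<open>The skew shape \<mu>/\<alpha> has at most one box in each column: the parts interlace as
  \<mu>_1 >= \<alpha>_1 >= \<mu>_2 >= \<alpha>_2 >= ... .\<close>

definition horizontal_strip :: "nat list \<Rightarrow> nat list \<Rightarrow> bool" where
  "horizontal_strip \<alpha> \<mu> \<longleftrightarrow> (\<forall>i < length \<alpha>. \<alpha> ! i \<le> \<mu> ! i) \<and>
     (\<forall>i. Suc i < length \<alpha> \<longrightarrow> \<mu> ! Suc i \<le> \<alpha> ! i)"

lemma rect_partitions_nth:
  "p \<in> rect_partitions l k \<longleftrightarrow> length p = l \<and> (\<forall>i<l. p ! i \<le> k) \<and>
     (\<forall>i j. i \<le> j \<longrightarrow> j < l \<longrightarrow> p ! j \<le> p ! i)"
proof -
  have "sorted_wrt (\<ge>) p \<longleftrightarrow> (\<forall>i j. i \<le> j \<longrightarrow> j < length p \<longrightarrow> p ! j \<le> p ! i)"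
    unfolding sorted_wrt_iff_nth_less by (metis le_eq_less_or_eq order_refl)
  then show ?thesis
    unfolding rect_partitions_def by (auto simp: all_set_conv_all_nth)
qed

lemma finite_rect_partitions: "finite (rect_partitions l k)"
  by (rule finite_subset[OF _ finite_lists_length_eq[of "{..k}" l]])
    (auto simp: rect_partitions_def)

lemma sum_list_nth: "length p = l \<Longrightarrow> sum_list p = (\<Sum>i<l. p ! i)"
  by (simp add: sum_list_sum_nth atLeast0LessThan)

lemma dual_partition_nth:
  "length p = l \<Longrightarrow> i < l \<Longrightarrow> dual_partition k p ! i = k - p ! (l - Suc i)"
  by (auto simp: dual_partition_def rev_nth)

lemma sum_list_le: "p \<in> rect_partitions l k \<Longrightarrow> sum_list p \<le> l * k"
  unfolding rect_partitions_nth using sum_bounded_above[of "{..<l}" "\<lambda>i. p ! i" k] by (simp add: sum_list_nth)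

lemma sum_list_dual:
  assumes "p \<in> rect_partitions l k"
  shows "sum_list (dual_partition k p) = l * k - sum_list p"
proof -
  have "sum_list (map (\<lambda>x. k - x) p) + sum_list p = length p * k" if "\<forall>x\<in>set p. x \<le> k" for p
    using that by (induction p) auto
  from this[of p] show ?thesis
    using assms by (simp add: dual_partition_def rect_partitions_def sum_list_rev)
qed

lemma hook_nth: "j < l \<Longrightarrow> hook l a b ! j = (if j = 0 then a else if j \<le> b then 1 else 0)"
  by (simp add: hook_def)

lemma length_hook [simp]: "length (hook l a b) = l"
  by (simp add: hook_def)

lemma sum_list_hook:
  assumes "b < l"
  shows "sum_list (hook l a b) = a + b"
proof -
  have "sum_list (hook l a b) = (\<Sum>j<l. (if j = 0 then a else 0) + (if j \<in> {1..b} then 1 else 0))"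
    by (simp add: sum_list_nth hook_nth) (rule sum.cong, auto simp: hook_nth)
  also have "\<dots> = a + card ({..<l} \<inter> {1..b})"
    using assms by (simp add: sum.distrib sum.If_cases Int_def)
  also have "{..<l} \<inter> {1..b} = {1..b}" using assms by auto
  finally show ?thesis by simp
qed

lemma hook_rect: "1 \<le> a \<Longrightarrow> a \<le> k \<Longrightarrow> hook l a b \<in> rect_partitions l k"
  unfolding rect_partitions_nth by (auto simp: hook_nth)

lemma row_eq_hook: "l \<ge> 1 \<Longrightarrow> row l p = hook l p 0"
  by (rule nth_equalityI) (auto simp: row_def hook_nth nth_Cons split: nat.split)

lemma column_nth: "i \<le> l \<Longrightarrow> j < l \<Longrightarrow> column l i ! j = (if j < i then 1 else 0)"
  by (auto simp: column_def nth_append)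

lemma length_column [simp]: "i \<le> l \<Longrightarrow> length (column l i) = l"
  by (simp add: column_def)

lemma sum_list_column: "i \<le> l \<Longrightarrow> sum_list (column l i) = i"
  by (simp add: column_def sum_list_replicate)

lemma column_eq_hook: "1 \<le> i \<Longrightarrow> i \<le> l \<Longrightarrow> column l i = hook l 1 (i - 1)"
  by (rule nth_equalityI) (auto simp: column_nth hook_nth)

lemma sum_list_row: "sum_list (row l p) = p"
  by (simp add: row_def sum_list_replicate)

lemma zero_partition_rect: "replicate l 0 \<in> rect_partitions l k"
  by (auto simp: rect_partitions_nth)

lemma sum_list_0_partition:
  assumes "p \<in> rect_partitions l k"
  shows "sum_list p = 0 \<longleftrightarrow> p = replicate l 0"
proof
  assume "sum_list p = 0"
  then show "p = replicate l 0"
    using assms by (auto simp: rect_partitions_def intro!: replicate_eqI)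
qed (simp add: sum_list_replicate)

text \<open>Interlacing with (1^i) bounds all parts of \<mu> after the first by 1. Counting
  positions from 0, those from 1 to \<open>i - 1\<close> equal 1 and those after \<open>i\<close>
  vanish. Only the part at position \<open>i\<close> is free, and the size then fixes the first
  part; hence the two hooks.\<close>

lemma strip_over_column:
  assumes mu: "\<mu> \<in> rect_partitions l k" and i: "1 \<le> i" "i \<le> l" and p: "1 \<le> p"
    and s: "sum_list \<mu> = p + i"
  shows "horizontal_strip (column l i) \<mu> \<longleftrightarrow>
    \<mu> = hook l (p + 1) (i - 1) \<or> i < l \<and> \<mu> = hook l p i"
proof
  assume h: "horizontal_strip (column l i) \<mu>"
  have len: "length \<mu> = l" using mu by (simp add: rect_partitions_nth)
  have next_le: "\<mu> ! j \<le> (if j \<le> i then 1 else 0)" if "1 \<le> j" "j < l" for j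
  proof -
    obtain j' where j': "j = Suc j'" using \<open>1 \<le> j\<close> by (cases j) auto
    have "\<mu> ! Suc j' \<le> column l i ! j'"
      using h that i j' by (simp add: horizontal_strip_def)
    then show ?thesis using that i j' by (simp add: column_nth Suc_le_eq split: if_splits)
  qed
  have one: "\<mu> ! j = 1" if "1 \<le> j" "j < i" for j
  proof -
    have "\<mu> ! j \<ge> 1" using h that i by (auto simp: horizontal_strip_def column_nth dest!: spec[of _ j])
    with next_le[of j] that i show ?thesis by simp
  qed
  have zero: "\<mu> ! j = 0" if "i < j" "j < l" for j
    using next_le[of j] that by simp
  have mid: "\<mu> ! i \<le> 1" if "i < l"
    using next_le[of i] that i by simp
  have eq: "\<mu> = hook l (\<mu> ! 0) (if i < l \<and> \<mu> ! i = 1 then i else i - 1)"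
  proof (rule nth_equalityI)
    fix j assume "j < length \<mu>"
    then have j: "j < l" using len by simp
    consider "j = 0" | "1 \<le> j" "j < i" | "j = i" "i \<noteq> 0" | "i < j" by linarith
    then show "\<mu> ! j = hook l (\<mu> ! 0) (if i < l \<and> \<mu> ! i = 1 then i else i - 1) ! j"
      by cases (use one zero mid i j in \<open>auto simp: hook_nth\<close>)
  qed (use len in simp)
  have "sum_list \<mu> = \<mu> ! 0 + (if i < l \<and> \<mu> ! i = 1 then i else i - 1)"
    by (subst eq, subst sum_list_hook) (use i in auto)
  then have a: "\<mu> ! 0 = (if i < l \<and> \<mu> ! i = 1 then p else p + 1)"
    using s i by (auto split: if_splits)
  show "\<mu> = hook l (p + 1) (i - 1) \<or> i < l \<and> \<mu> = hook l p i"
  proof (cases "i < l \<and> \<mu> ! i = 1")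
    case True
    then have "\<mu> = hook l p i" using eq a by simp
    then show ?thesis using True by blast
  next
    case False
    have "\<mu> = hook l (p + 1) (i - 1)"
      using eq a unfolding if_not_P[OF False] by simp
    then show ?thesis by blast
  qed
next
  assume "\<mu> = hook l (p + 1) (i - 1) \<or> i < l \<and> \<mu> = hook l p i"
  then show "horizontal_strip (column l i) \<mu>"
    using i p by (auto simp: horizontal_strip_def hook_nth column_nth)
qed

text \<open>This makes multiplication by special Schubert classes triangular.\<close>

lemma strip_over_tail:
  assumes lam: "a # t \<in> rect_partitions l k" and mu: "\<mu> \<in> rect_partitions l k"
    and s: "sum_list \<mu> = sum_list (a # t)" and h: "horizontal_strip (t @ [0]) \<mu>"
  shows "\<mu> = a # t \<or> \<mu> ! 0 > a"
proof -
  have len: "length \<mu> = l" "Suc (length t) = l" using lam mu by (auto simp: rect_partitions_nth)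
  have le: "\<mu> ! Suc j \<le> t ! j" if "j < length t" for j
  proof -
    have "\<mu> ! Suc j \<le> (t @ [0]) ! j" using h that by (auto simp: horizontal_strip_def)
    then show ?thesis using that by (simp add: nth_append)
  qed
  obtain b u where mu_eq: "\<mu> = b # u" using len by (cases \<mu>) auto
  have lenu: "length u = length t" using len mu_eq by simp
  have le': "u ! j \<le> t ! j" if "j < length t" for j using le[OF that] mu_eq by simp
  have sums: "b + (\<Sum>j<length t. u ! j) = a + (\<Sum>j<length t. t ! j)"
    using s mu_eq lenu by (simp add: sum_list_nth)
  have "(\<Sum>j<length t. u ! j) \<le> (\<Sum>j<length t. t ! j)" by (rule sum_mono) (use le' in auto)
  then have "b \<ge> a" using sums by simp
  moreover have "u = t" if "b = a"
  proof (rule nth_equalityI[OF lenu], rule ccontr)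
    fix j assume "j < length u" "u ! j \<noteq> t ! j"
    then have "(\<Sum>j<length t. u ! j) < (\<Sum>j<length t. t ! j)"
      using le' lenu by (intro sum_strict_mono_ex1) (auto simp: le_neq_implies_less intro!: bexI[of _ j])
    then show False using sums that by simp
  qed
  ultimately show ?thesis using mu_eq by auto
qed

section \<open>The structure of the quantum cohomology ring\<close>

lemma lookup_qscale [simp]: "Poly_Mapping.lookup (qscale f x) p = f * Poly_Mapping.lookup x p"
  by (simp add: qscale_def Poly_Mapping.map.rep_eq when_def)

lemma qscale_add: "qscale f (x + y) = qscale f x + qscale f y"
  by (rule poly_mapping_eqI) (simp add: lookup_add algebra_simps)

lemma qscale_add_left: "qscale (f + g) x = qscale f x + qscale g x"
  by (rule poly_mapping_eqI) (simp add: lookup_add algebra_simps)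

lemma qscale_0 [simp]: "qscale 0 x = 0" "qscale f 0 = 0"
  by (rule poly_mapping_eqI, simp)+

lemma qscale_1 [simp]: "qscale 1 x = x"
  by (rule poly_mapping_eqI, simp)

lemma qscale_qscale [simp]: "qscale f (qscale g x) = qscale (f * g) x"
  by (rule poly_mapping_eqI, simp)

lemma qscale_sum: "qscale f (sum g A) = (\<Sum>a\<in>A. qscale f (g a))"
  by (rule additive_sum) (auto simp: qscale_add)

lemma qscale_sum_left: "qscale (sum g A) x = (\<Sum>a\<in>A. qscale (g a) x)"
  by (rule additive_sum[where F = "\<lambda>f. qscale f x"]) (auto simp: qscale_add_left)

lemma qscale_uminus: "qscale f (- x) = - qscale f x" "qscale (- f) x = - qscale f x"
  by (rule poly_mapping_eqI, simp)+

section \<open>The carrier and the quantum product in coordinates\<close>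

definition qcarrier :: "nat \<Rightarrow> nat \<Rightarrow> (nat list \<Rightarrow>\<^sub>0 int poly) set" where
  "qcarrier l k = {x. Poly_Mapping.keys x \<subseteq> rect_partitions l k}"

lemma qcarrier_iff: "x \<in> qcarrier l k \<longleftrightarrow> (\<forall>p. p \<notin> rect_partitions l k \<longrightarrow> Poly_Mapping.lookup x p = 0)"
  by (auto simp: qcarrier_def in_keys_iff)

lemma qcarrier_add: "x \<in> qcarrier l k \<Longrightarrow> y \<in> qcarrier l k \<Longrightarrow> x + y \<in> qcarrier l k"
  by (simp add: qcarrier_iff lookup_add)

lemma qcarrier_0 [simp]: "0 \<in> qcarrier l k"
  by (simp add: qcarrier_iff)

lemma qcarrier_qscale: "x \<in> qcarrier l k \<Longrightarrow> qscale f x \<in> qcarrier l k"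
  by (simp add: qcarrier_iff)

lemma qcarrier_sum: "(\<And>a. a \<in> A \<Longrightarrow> f a \<in> qcarrier l k) \<Longrightarrow> sum f A \<in> qcarrier l k"
  by (induction A rule: infinite_finite_induct) (auto simp: qcarrier_add)

lemma qcarrier_schubert: "p \<in> rect_partitions l k \<Longrightarrow> schubert_class p \<in> qcarrier l k"
  by (simp add: qcarrier_def schubert_class_def)

lemma qcarrier_expand:
  assumes "x \<in> qcarrier l k"
  shows "x = (\<Sum>p\<in>rect_partitions l k. qscale (Poly_Mapping.lookup x p) (schubert_class p))"
proof (rule poly_mapping_eqI)
  fix p
  show "Poly_Mapping.lookup x p = Poly_Mapping.lookup
      (\<Sum>p\<in>rect_partitions l k. qscale (Poly_Mapping.lookup x p) (schubert_class p)) p"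
    using assms finite_rect_partitions
    by (simp add: lookup_sum schubert_class_def lookup_single when_def qcarrier_iff if_distrib cong: if_cong)
qed

lemma QH_simps [simp]:
  "carrier (QH T l k) = qcarrier l k"
  "one (QH T l k) = schubert_class (replicate l 0)"
  "zero (QH T l k) = 0"
  "add (QH T l k) = (+)"
  by (simp_all add: QH_def qcarrier_def)

definition qmult where "qmult T l k = monoid.mult (QH T l k)"

lemma QH_mult: "monoid.mult (QH T l k) = qmult T l k"
  by (simp add: qmult_def)

lemma qmult_eq: "qmult T l k x y = (\<Sum>p1 \<in> rect_partitions l k. \<Sum>p2 \<in> rect_partitions l k.
         qscale (Poly_Mapping.lookup x p1 * Poly_Mapping.lookup y p2) (schubert_qprod T l k p1 p2))"
  by (simp add: qmult_def QH_def)

lemma qmult_0 [simp]: "qmult T l k 0 y = 0" "qmult T l k x 0 = 0"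
  by (simp_all add: qmult_eq)

lemma qmult_add: "qmult T l k (x + x') y = qmult T l k x y + qmult T l k x' y"
  "qmult T l k x (y + y') = qmult T l k x y + qmult T l k x y'"
  by (simp_all add: qmult_eq lookup_add distrib_left distrib_right qscale_add_left sum.distrib)

lemma qmult_qscale: "qmult T l k (qscale f x) y = qscale f (qmult T l k x y)"
  "qmult T l k x (qscale f y) = qscale f (qmult T l k x y)"
  by (simp_all add: qmult_eq qscale_sum mult_ac)

lemma qmult_schubert:
  assumes "p1 \<in> rect_partitions l k" "p2 \<in> rect_partitions l k"
  shows "qmult T l k (schubert_class p1) (schubert_class p2) = schubert_qprod T l k p1 p2"
proof -
  have "qscale (Poly_Mapping.lookup (schubert_class p1) q1 * Poly_Mapping.lookup (schubert_class p2) q2)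
      (schubert_qprod T l k q1 q2)
    = (if q1 = p1 then (if q2 = p2 then schubert_qprod T l k p1 p2 else 0) else 0)" for q1 q2
    by (auto simp: schubert_class_def lookup_single when_def)
  then have "qmult T l k (schubert_class p1) (schubert_class p2) = (\<Sum>q1\<in>rect_partitions l k.
      \<Sum>q2\<in>rect_partitions l k. if q1 = p1 then (if q2 = p2 then schubert_qprod T l k p1 p2 else 0) else 0)"
    by (simp add: qmult_eq)
  also have "\<dots> = (\<Sum>q1\<in>rect_partitions l k. if q1 = p1 then schubert_qprod T l k p1 p2 else 0)"
    by (rule sum.cong) (use assms finite_rect_partitions in auto)
  finally show ?thesis
    using assms finite_rect_partitions by simp
qed

text \<open>The dual of \<open>p3\<close> has size lk - |p3|, so an invariant can be nonzero only if
  |p1| + |p2| = |p3| + dn. This determines d, and each structure constant is a single monomial in q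
  or zero.\<close>

definition qcoeff :: "'n::{finite,linorder} itself \<Rightarrow> nat \<Rightarrow> nat \<Rightarrow> nat list \<Rightarrow> nat list \<Rightarrow> nat list \<Rightarrow> int poly" where
  "qcoeff T l k p1 p2 p3 = (let N = sum_list p1 + sum_list p2 in
     if sum_list p3 \<le> N \<and> CARD('n) dvd N - sum_list p3 then
       (let d = (N - sum_list p3) div CARD('n) in
         Polynomial.monom (int (gromov_witten T l k p1 p2 (dual_partition k p3) d)) d)
     else 0)"

lemma schubert_qprod_expand:
  fixes T :: "'n::{finite,linorder} itself"
  shows "schubert_qprod T l k p1 p2
    = (\<Sum>p3 \<in> rect_partitions l k. qscale (qcoeff T l k p1 p2 p3) (schubert_class p3))"
  unfolding schubert_qprod_def
proof (rule sum.cong[OF refl])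
  fix p3 assume p3: "p3 \<in> rect_partitions l k"
  let ?N = "sum_list p1 + sum_list p2" and ?n = "CARD('n)"
  let ?f = "\<lambda>d. qscale (Polynomial.monom (int (gromov_witten T l k p1 p2 (dual_partition k p3) d)) d)
       (schubert_class p3)"
  have npos: "?n > 0" by simp
  have gw: "?f d = 0" if "?N \<noteq> sum_list p3 + d * ?n" for d
  proof -
    have "sum_list p1 + sum_list p2 + sum_list (dual_partition k p3) \<noteq> l * k + d * ?n"
      using that sum_list_dual[OF p3] sum_list_le[OF p3] by simp
    then show ?thesis by (simp add: gromov_witten_def)
  qed
  show "Sum_any ?f = qscale (qcoeff T l k p1 p2 p3) (schubert_class p3)"
  proof (cases "sum_list p3 \<le> ?N \<and> ?n dvd ?N - sum_list p3")
    case True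
    define d0 where "d0 = (?N - sum_list p3) div ?n"
    have d0: "?N = sum_list p3 + d0 * ?n" using True unfolding d0_def by simp
    have "?f d = 0" if "d \<noteq> d0" for d
      by (rule gw) (use d0 that npos in auto)
    then have "Sum_any ?f = sum ?f {d0}"
      by (intro Sum_any.expand_superset) auto
    then show ?thesis using True by (simp add: qcoeff_def Let_def d0_def)
  next
    case False
    have "?f d = 0" for d by (rule gw) (use False in auto)
    then have "Sum_any ?f = 0" by simp
    then show ?thesis using False by (auto simp: qcoeff_def Let_def)
  qed
qed

definition qpar :: "int poly" where "qpar = Polynomial.monom 1 1"

lemma qpar_nonzero: "qpar \<noteq> 0"
  by (simp add: qpar_def monom_eq_0_iff)

text \<open>Separates the algebra from the geometry: the two families of invariants on which the
  presentation rests are assumptions here and are computed later by counting curves.\<close>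

locale qh_pieri =
  fixes T :: "'n::{finite,linorder} itself" and l k :: nat
  assumes l: "l \<ge> 1" and k: "k \<ge> 1" and card_n: "CARD('n) = l + k"
    and cring: "cring (QH T l k)"
    and gw_pieri: "\<And>p \<alpha> \<mu>. 1 \<le> p \<Longrightarrow> p \<le> k \<Longrightarrow> \<alpha> \<in> rect_partitions l k \<Longrightarrow>
      \<mu> \<in> rect_partitions l k \<Longrightarrow> sum_list \<mu> = sum_list \<alpha> + p \<Longrightarrow>
      gromov_witten T l k (row l p) \<alpha> (dual_partition k \<mu>) 0 = (if horizontal_strip \<alpha> \<mu> then 1 else 0)"
    and gw_line: "gromov_witten T l k (row l k) (column l l) (dual_partition k (replicate l 0)) 1 = 1"
begin

abbreviation rect where "rect \<equiv> rect_partitions l k"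
abbreviation M where "M \<equiv> QH T l k"
abbreviation cls where "cls \<equiv> schubert_class"
abbreviation qone where "qone \<equiv> schubert_class (replicate l 0)"
abbreviation qm (infixl "\<odot>" 70) where "x \<odot> y \<equiv> qmult T l k x y"

lemma qm_comm: "x \<in> qcarrier l k \<Longrightarrow> y \<in> qcarrier l k \<Longrightarrow> x \<odot> y = y \<odot> x"
  using comm_monoid.m_comm[OF cring.axioms(2)[OF cring]] by (simp add: QH_mult)

lemma qm_one: "x \<in> qcarrier l k \<Longrightarrow> qone \<odot> x = x" "x \<in> qcarrier l k \<Longrightarrow> x \<odot> qone = x"
  using monoid.l_one[OF comm_monoid.axioms(1)[OF cring.axioms(2)[OF cring]]]
    monoid.r_one[OF comm_monoid.axioms(1)[OF cring.axioms(2)[OF cring]]] by (simp_all add: QH_mult)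

lemma qcoeff_classical:
  assumes "1 \<le> p" "p \<le> k" "\<alpha> \<in> rect" "\<mu> \<in> rect" "sum_list \<mu> = sum_list \<alpha> + p"
  shows "qcoeff T l k (row l p) \<alpha> \<mu> = (if horizontal_strip \<alpha> \<mu> then 1 else 0)"
  using gw_pieri[OF assms] assms
  by (auto simp: qcoeff_def Let_def sum_list_row monom_0 one_pCons)

text \<open>The parameter q has degree n = l + k, so a term of nonclassical size comes with d >= 1,
  and its size drops by at least n.\<close>

lemma qcoeff_quantum:
  assumes "sum_list \<mu> \<noteq> sum_list \<alpha> + p"
    and "qcoeff T l k (row l p) \<alpha> \<mu> \<noteq> 0"
  shows "sum_list \<mu> + (l + k) \<le> sum_list \<alpha> + p"
proof -
  have 1: "sum_list \<mu> \<le> p + sum_list \<alpha>" "l + k dvd p + sum_list \<alpha> - sum_list \<mu>"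
    using assms(2) by (auto simp: qcoeff_def Let_def sum_list_row card_n split: if_splits)
  moreover have "p + sum_list \<alpha> - sum_list \<mu> > 0" using 1 assms(1) by simp
  ultimately have "l + k \<le> p + sum_list \<alpha> - sum_list \<mu>" by (intro dvd_imp_le)
  then show ?thesis using 1 by simp
qed

text \<open>Hooks that do not fit into the rectangle, as well as those without an arm, count as
  zero. With the analogous conventions in \<open>colc\<close> and \<open>rowc\<close> the product
  formula and the recursion keep their form at the boundary.\<close>

definition hk :: "nat \<Rightarrow> nat \<Rightarrow> (nat list \<Rightarrow>\<^sub>0 int poly)" where
  "hk a b = (if 1 \<le> a \<and> a \<le> k \<and> b < l then cls (hook l a b) else 0)"

definition colc :: "nat \<Rightarrow> (nat list \<Rightarrow>\<^sub>0 int poly)" where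
  "colc i = (if i = 0 then qone else if i \<le> l then cls (column l i) else 0)"

definition rowc :: "nat \<Rightarrow> (nat list \<Rightarrow>\<^sub>0 int poly)" where
  "rowc p = (if p = 0 then qone else if p \<le> k then cls (row l p) else 0)"

lemma row_rect: "p \<le> k \<Longrightarrow> row l p \<in> rect"
  using l by (auto simp: rect_partitions_nth row_def nth_Cons split: nat.split)

lemma column_rect: "i \<le> l \<Longrightarrow> column l i \<in> rect"
  using k by (auto simp: rect_partitions_nth column_nth)

lemma colc_carrier: "colc i \<in> qcarrier l k"
  by (simp add: colc_def qcarrier_schubert column_rect zero_partition_rect)

lemma rowc_carrier: "rowc i \<in> qcarrier l k"
  by (simp add: rowc_def qcarrier_schubert row_rect zero_partition_rect)

text \<open>The classical terms are the two hooks of Pieri's rule. A quantum term needs i + p >= n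
  by sizes, which leaves only p = k and i = l; its class is then the unit and its coefficient the
  line invariant.\<close>

lemma qm_row_column:
  assumes p: "1 \<le> p" "p \<le> k" and i: "1 \<le> i" "i \<le> l"
  shows "cls (row l p) \<odot> cls (column l i) = hk (p + 1) (i - 1) + hk p i
    + (if p = k \<and> i = l then qscale (qpar) qone else 0)"
proof (rule poly_mapping_eqI)
  fix \<mu>
  let ?c = "qcoeff T l k (row l p) (column l i) \<mu>"
  have lhs: "Poly_Mapping.lookup (cls (row l p) \<odot> cls (column l i)) \<mu> = (if \<mu> \<in> rect then ?c else 0)"
    unfolding qmult_schubert[OF row_rect[OF p(2)] column_rect[OF i(2)]] schubert_qprod_expand
    using finite_rect_partitions
    by (simp add: lookup_sum schubert_class_def lookup_single when_def if_distrib cong: if_cong)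
  have hk: "Poly_Mapping.lookup (hk a b) \<mu> = (if 1 \<le> a \<and> a \<le> k \<and> b < l \<and> \<mu> = hook l a b then 1 else 0)" for a b
    by (auto simp: hk_def schubert_class_def lookup_single when_def)
  have q: "Poly_Mapping.lookup (qscale (qpar) qone) \<mu>
      = (if \<mu> = replicate l 0 then qpar else (0 :: int poly))"
    by (auto simp: schubert_class_def lookup_single when_def)
  have ne: "hook l (p + 1) (i - 1) \<noteq> hook l p i"
    using hook_nth[of 0 l "p + 1" "i - 1"] hook_nth[of 0 l p i] l by auto
  show "Poly_Mapping.lookup (cls (row l p) \<odot> cls (column l i)) \<mu>
    = Poly_Mapping.lookup (hk (p + 1) (i - 1) + hk p i
       + (if p = k \<and> i = l then qscale (qpar) qone else 0)) \<mu>" (is "_ = ?rhs")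
  proof (cases "\<mu> \<in> rect")
    case False
    have "\<mu> \<noteq> hook l a b" if "1 \<le> a" "a \<le> k" for a b using False hook_rect[OF that] by auto
    moreover have "\<mu> \<noteq> replicate l 0" using False zero_partition_rect by auto
    ultimately show ?thesis using False by (auto simp: lhs lookup_add hk q simp del: lookup_qscale)
  next
    case mu: True
    show ?thesis
    proof (cases "sum_list \<mu> = p + i")
      case True
      have nz: "\<mu> \<noteq> replicate l 0" using True p by (auto simp: sum_list_replicate)
      have bound: "p + 1 \<le> k" if "\<mu> = hook l (p + 1) (i - 1)"
        using mu that hook_nth[of 0 l "p + 1" "i - 1"] l by (auto simp: rect_partitions_nth)
      have "?c = (if horizontal_strip (column l i) \<mu> then 1 else 0)"
        by (rule qcoeff_classical) (use p i mu True column_rect in \<open>auto simp: sum_list_column\<close>)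
      also have "\<dots> = ?rhs"
        unfolding strip_over_column[OF mu i p(1) True]
        using nz bound ne i p
        by (auto simp: lookup_add hk q simp del: lookup_qscale)
      finally show ?thesis using mu by (simp add: lhs)
    next
      case False
      have nh: "\<mu> \<noteq> hook l (p + 1) (i - 1)" "i < l \<Longrightarrow> \<mu> \<noteq> hook l p i"
        using False i sum_list_hook[of "i - 1" l "p + 1"] sum_list_hook[of i l p] by auto
      have rhs: "?rhs = (if p = k \<and> i = l \<and> \<mu> = replicate l 0 then qpar else 0)"
      proof (cases "p = k \<and> i = l")
        case True
        then show ?thesis
          using nh by (simp only: lookup_add hk q if_True simp_thms if_False) auto
      next
        case False
        then show ?thesis using nh by (auto simp: lookup_add hk)
      qed
      show ?thesis
      proof (cases "?c = 0")
        case True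
        have "\<not> (p = k \<and> i = l \<and> \<mu> = replicate l 0)"
        proof
          assume *: "p = k \<and> i = l \<and> \<mu> = replicate l 0"
          have "?c = qpar" using * gw_line l
            by (auto simp: qpar_def qcoeff_def Let_def sum_list_row sum_list_column sum_list_replicate card_n add.commute)
          then show False using True qpar_nonzero by simp
        qed
        then have "?rhs = 0" unfolding rhs by auto
        then show ?thesis using True mu lhs by simp
      next
        case nz: False
        have "sum_list \<mu> + (l + k) \<le> i + p"
          using qcoeff_quantum[OF _ nz] False i by (simp add: sum_list_column)
        then have *: "p = k" "i = l" "sum_list \<mu> = 0" using p i by linarith+
        then have m0: "\<mu> = replicate l 0" using mu sum_list_0_partition by blast
        have "?c = qpar" using * m0 gw_line l
          by (auto simp: qpar_def qcoeff_def Let_def sum_list_row sum_list_column sum_list_replicate card_n add.commute)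
        moreover have "?rhs = qpar" unfolding rhs using * m0 by auto
        ultimately show ?thesis using mu lhs by simp
      qed
    qed
  qed
qed

lemma qm_colc_rowc:
  assumes "1 \<le> i"
  shows "colc i \<odot> rowc p = hk (p + 1) (i - 1) + hk p i
    + (if p = k \<and> i = l then qscale (qpar) qone else 0)"
proof -
  consider "i > l" | "i \<le> l" "p = 0" | "i \<le> l" "p > k" | "i \<le> l" "1 \<le> p" "p \<le> k"
    by linarith
  then show ?thesis
  proof cases
    case 2
    have "colc i \<odot> rowc p = colc i" using 2 colc_carrier by (simp add: rowc_def qm_one)
    then show ?thesis using 2 assms k by (auto simp: colc_def hk_def column_eq_hook)
  next
    case 4
    have "colc i \<odot> rowc p = rowc p \<odot> colc i" by (rule qm_comm[OF colc_carrier rowc_carrier])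
    also have "\<dots> = cls (row l p) \<odot> cls (column l i)" using 4 assms by (simp add: rowc_def colc_def)
    finally show ?thesis using qm_row_column[of p i] 4 assms by simp
  qed (use assms in \<open>auto simp: colc_def rowc_def hk_def\<close>)
qed

lemma rowc_eq_hk: "1 \<le> p \<Longrightarrow> rowc p = hk p 0"
  using l by (auto simp: rowc_def hk_def row_eq_hook)

lemma alternating_telescope:
  fixes t :: "nat \<Rightarrow> (nat list \<Rightarrow>\<^sub>0 int poly)"
  shows "(\<Sum>i<p. qscale ((-1) ^ i) (t i + t (Suc i))) = t 0 - qscale ((-1) ^ p) (t p)"
  by (induction p) (auto simp: qscale_add qscale_uminus)

text \<open>The product at index \<open>i\<close> is the sum of the consecutive hooks
  \<open>?t i\<close> and \<open>?t (Suc i)\<close>, so the alternating sum telescopes to the row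
  class. The single quantum term arises at i = l - 1 and p - l = k, which explains both the
  condition p = l + k and the sign.\<close>

lemma colc_rowc_recursion:
  assumes "1 \<le> p"
  shows "(\<Sum>i<p. qscale ((-1) ^ i) (colc (Suc i) \<odot> rowc (p - Suc i)))
    = rowc p + (if p = l + k then qscale ((-1) ^ (l - 1) * qpar) qone else 0)"
proof -
  let ?t = "\<lambda>i. hk (p - i) i" and ?q = "qscale (qpar) qone"
  have "(\<Sum>i<p. qscale ((-1) ^ i) (colc (Suc i) \<odot> rowc (p - Suc i)))
      = (\<Sum>i<p. qscale ((-1) ^ i) (?t i + ?t (Suc i))
          + qscale ((-1) ^ i) (if p - Suc i = k \<and> Suc i = l then ?q else 0))"
    by (rule sum.cong) (auto simp: qm_colc_rowc qscale_add Suc_diff_Suc)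
  also have "\<dots> = (?t 0 - qscale ((-1) ^ p) (?t p))
      + (\<Sum>i<p. qscale ((-1) ^ i) (if p - Suc i = k \<and> Suc i = l then ?q else 0))"
    unfolding sum.distrib by (subst alternating_telescope) (rule refl)
  also have "?t 0 - qscale ((-1) ^ p) (?t p) = rowc p"
    using assms by (simp add: rowc_eq_hk hk_def)
  also have "(\<Sum>i<p. qscale ((-1) ^ i) (if p - Suc i = k \<and> Suc i = l then ?q else 0))
      = (\<Sum>i<p. if i = l - 1 \<and> p = l + k then qscale ((-1) ^ (l - 1) * qpar) qone else 0)"
  proof (rule sum.cong[OF refl])
    fix i assume "i \<in> {..<p}"
    then have "p - Suc i = k \<and> Suc i = l \<longleftrightarrow> i = l - 1 \<and> p = l + k"
      using l k by auto
    then show "qscale ((-1) ^ i) (if p - Suc i = k \<and> Suc i = l then ?q else 0)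
      = (if i = l - 1 \<and> p = l + k then qscale ((-1) ^ (l - 1) * qpar) qone else 0)"
      by auto
  qed
  also have "\<dots> = (if p = l + k then qscale ((-1) ^ (l - 1) * qpar) qone else 0)"
    using l k by (cases "p = l + k") auto
  finally show ?thesis .
qed

text \<open>Removing the first part a of a partition and multiplying the remaining class by the row
  class of a gives back the partition with coefficient 1, together with partitions of the same size
  and longer first row and, from quantum terms, partitions of smaller size.\<close>

lemma schubert_classes_generated:
  assumes add: "\<And>x y. x \<in> S \<Longrightarrow> y \<in> S \<Longrightarrow> x + y \<in> S"
    and scale: "\<And>f x. x \<in> S \<Longrightarrow> qscale f x \<in> S"
    and mult: "\<And>x y. x \<in> S \<Longrightarrow> y \<in> S \<Longrightarrow> x \<odot> y \<in> S"
    and rows: "\<And>p. rowc p \<in> S"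
  shows "qcarrier l k \<subseteq> S"
proof -
  have zero: "0 \<in> S" using scale[OF rows, of 0] by simp
  have sumS: "(\<And>a. a \<in> A \<Longrightarrow> f a \<in> S) \<Longrightarrow> sum f A \<in> S" for f :: "nat list \<Rightarrow> (nat list \<Rightarrow>\<^sub>0 int poly)" and A
    by (induction A rule: infinite_finite_induct) (use add zero in auto)
  \<comment> \<open>The induction compares sizes first and then first parts, a longer first row
    counting as smaller. The factor \<open>Suc k\<close> turns this lexicographic order into one
    number, because k minus the first part is at most k.\<close>
  have "\<alpha> \<in> rect \<Longrightarrow> cls \<alpha> \<in> S" for \<alpha>
  proof (induction "sum_list \<alpha> * Suc k + (k - \<alpha> ! 0)" arbitrary: \<alpha> rule: less_induct)
    case (less \<alpha>)
    have len: "length \<alpha> = l" using less.prems by (simp add: rect_partitions_nth)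
    then obtain a t where at: "\<alpha> = a # t" using l by (cases \<alpha>) auto
    have ak: "a \<le> k" using less.prems at by (auto simp: rect_partitions_def)
    show ?case
    proof (cases "a = 0")
      case True
      then have "\<alpha> = replicate l 0"
        using less.prems at by (auto simp: rect_partitions_def intro!: replicate_eqI)
      then show ?thesis using rows[of 0] by (simp add: rowc_def)
    next
      case False
      let ?\<tau> = "t @ [0]" and ?\<alpha> = "a # t"
      have lam: "?\<alpha> \<in> rect" using less.prems at by simp
      have tau: "?\<tau> \<in> rect"
        using lam by (auto simp: rect_partitions_def sorted_wrt_append)
      have sum_tau: "sum_list ?\<alpha> = sum_list ?\<tau> + a" by simp
      let ?c = "qcoeff T l k (row l a) ?\<tau>"
      have strip: "horizontal_strip ?\<tau> ?\<alpha>"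
        unfolding horizontal_strip_def
      proof safe
        fix i assume "i < length ?\<tau>"
        then show "?\<tau> ! i \<le> ?\<alpha> ! i"
          using lam[unfolded rect_partitions_nth, THEN conjunct2, THEN conjunct2, rule_format, of i "Suc i"] lam
          by (cases "i < length t") (auto simp: nth_append rect_partitions_def)
      next
        fix i assume "Suc i < length ?\<tau>"
        then show "?\<alpha> ! Suc i \<le> ?\<tau> ! i" by (simp add: nth_append)
      qed
      have c_lam: "?c ?\<alpha> = 1"
        using qcoeff_classical[OF _ ak tau lam sum_tau] False strip by simp
      have tauS: "cls ?\<tau> \<in> S"
      proof (rule less.hyps[OF _ tau])
        have "sum_list ?\<tau> < sum_list \<alpha>" using at False by simp
        then have "Suc (sum_list ?\<tau>) * Suc k \<le> sum_list \<alpha> * Suc k" by (intro mult_le_mono1) simp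
        then show "sum_list ?\<tau> * Suc k + (k - ?\<tau> ! 0) < sum_list \<alpha> * Suc k + (k - \<alpha> ! 0)"
          by simp
      qed
      have rest: "qscale (?c \<mu>) (cls \<mu>) \<in> S" if mu: "\<mu> \<in> rect - {?\<alpha>}" for \<mu>
      proof (cases "?c \<mu> = 0")
        case True then show ?thesis by (simp add: zero)
      next
        case nz: False
        have "sum_list \<mu> * Suc k + (k - \<mu> ! 0) < sum_list \<alpha> * Suc k + (k - \<alpha> ! 0)"
        proof (cases "sum_list \<mu> = sum_list ?\<tau> + a")
          case True
          have "horizontal_strip ?\<tau> \<mu>"
            using nz qcoeff_classical[OF _ ak tau _ True] False mu by (auto split: if_splits)
          then have "\<mu> ! 0 > a"
            using strip_over_tail[OF lam, of \<mu>] mu True by auto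
          moreover have "\<mu> ! 0 \<le> k" using mu l by (auto simp: rect_partitions_nth)
          moreover have "sum_list \<mu> = sum_list \<alpha>" using True at by simp
          ultimately show ?thesis using at by simp
        next
          case False
          have "sum_list \<mu> + (l + k) \<le> sum_list \<alpha>" using qcoeff_quantum[OF False nz] at by simp
          then have "Suc (sum_list \<mu>) * Suc k \<le> sum_list \<alpha> * Suc k" using l by (intro mult_le_mono1) simp
          then show ?thesis by simp
        qed
        then show ?thesis using less.hyps mu scale by blast
      qed
      have "cls (row l a) \<odot> cls ?\<tau> = (\<Sum>\<mu>\<in>rect. qscale (?c \<mu>) (cls \<mu>))"
        by (simp add: qmult_schubert row_rect ak tau schubert_qprod_expand)
      also have "\<dots> = cls ?\<alpha> + (\<Sum>\<mu>\<in>rect - {?\<alpha>}. qscale (?c \<mu>) (cls \<mu>))"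
        using lam finite_rect_partitions c_lam by (subst sum.remove[of _ ?\<alpha>]) auto
      finally have "cls ?\<alpha> = cls (row l a) \<odot> cls ?\<tau>
          + qscale (-1) (\<Sum>\<mu>\<in>rect - {?\<alpha>}. qscale (?c \<mu>) (cls \<mu>))"
        by (simp add: qscale_uminus)
      moreover have "cls (row l a) \<in> S" using rows[of a] False ak by (simp add: rowc_def)
      ultimately show ?thesis using at add[OF mult[OF _ tauS, of "cls (row l a)"] scale[OF sumS[OF rest], of "rect - {?\<alpha>}" "\<lambda>\<mu>. \<mu>" "-1"]] by simp
    qed
  qed
  then have "qscale f (cls p) \<in> S" if "p \<in> rect" for f p using that scale by blast
  then show ?thesis
    using qcarrier_expand sumS by (metis (no_types, lifting) subsetI)
qed

end

section \<open>Toeplitz determinants\<close>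

text \<open>For elementary symmetric functions c_i this is the Jacobi-Trudi formula for the complete
  symmetric function h_p; \<open>sigma_det\<close> is the case of the Chern variables.\<close>

definition hdet :: "(int \<Rightarrow> 'a::idom) \<Rightarrow> nat \<Rightarrow> 'a" where
  "hdet c p = Determinant.det (Matrix.mat p p (\<lambda>(i, j). c (1 + int j - int i)))"

lemma hdet_0 [simp]: "hdet c 0 = 1"
  by (simp add: hdet_def)

text \<open>Deleting row 0 and column j leaves a block triangular matrix: a unitriangular block of
  size j, because c_0 = 1 and c_i = 0 for i < 0, and the same Toeplitz matrix of size p - j.\<close>

lemma hdet_Suc:
  assumes c0: "c 0 = 1" and neg: "\<And>i. i < 0 \<Longrightarrow> c i = 0"
  shows "hdet c (Suc p) = (\<Sum>j<Suc p. (-1) ^ j * c (1 + int j) * hdet c (p - j))"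
proof -
  let ?A = "Matrix.mat (Suc p) (Suc p) (\<lambda>(i, j). c (1 + int j - int i))"
  have minor: "Determinant.det (mat_delete ?A 0 j) = hdet c (p - j)" if j: "j < Suc p" for j
  proof -
    let ?A1 = "Matrix.mat j j (\<lambda>(x, y). c (int y - int x))"
    let ?A2 = "Matrix.mat j (p - j) (\<lambda>(x, y). c (1 + int j + int y - int x))"
    let ?A4 = "Matrix.mat (p - j) (p - j) (\<lambda>(x, y). c (1 + int y - int x))"
    have "mat_delete ?A 0 j = four_block_mat ?A1 ?A2 (0\<^sub>m (p - j) j) ?A4"
      by (rule eq_matI) (use j in \<open>auto simp: mat_delete_def Let_def neg of_nat_diff algebra_simps\<close>)
    moreover have "Determinant.det (four_block_mat ?A1 ?A2 (0\<^sub>m (p - j) j) ?A4)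
        = Determinant.det ?A1 * Determinant.det ?A4"
      by (rule det_four_block_mat_lower_left_zero) auto
    moreover have "Determinant.det ?A1 = 1"
      by (subst det_upper_triangular[of _ j])
        (auto simp: upper_triangular_def neg diag_mat_def c0 prod.distinct_set_conv_list[symmetric])
    ultimately show ?thesis by (simp add: hdet_def)
  qed
  have "hdet c (Suc p) = (\<Sum>j<Suc p. ?A $$ (0, j) * cofactor ?A 0 j)"
    unfolding hdet_def by (rule laplace_expansion_row[of _ "Suc p"]) auto
  also have "\<dots> = (\<Sum>j<Suc p. (-1) ^ j * c (1 + int j) * hdet c (p - j))"
    by (rule sum.cong) (simp_all add: cofactor_def minor)
  finally show ?thesis .
qed

text \<open>The expansion along the first row with all terms on one side; for symmetric functions it
  is the relation between the elementary and the complete ones.\<close>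

lemma hdet_recursion:
  assumes c0: "c 0 = 1" and neg: "\<And>i. i < 0 \<Longrightarrow> c i = 0" and "p \<ge> 1"
  shows "(\<Sum>s\<le>p. (-1) ^ s * c (int p - int s) * hdet c s) = 0"
proof -
  obtain p' where p: "p = Suc p'" using assms(3) by (cases p) auto
  have "(\<Sum>s\<le>p. (-1) ^ s * c (int p - int s) * hdet c s)
      = (\<Sum>s<p. (-1) ^ s * c (int p - int s) * hdet c s) + (-1) ^ p * hdet c p"
    by (simp add: lessThan_Suc_atMost[symmetric] c0)
  also have "(\<Sum>s<p. (-1) ^ s * c (int p - int s) * hdet c s)
      = (\<Sum>j<p. (-1) ^ (p - Suc j) * c (int p - int (p - Suc j)) * hdet c (p - Suc j))"
    by (rule sum.nat_diff_reindex[symmetric])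
  also have "\<dots> = - ((-1) ^ p) * (\<Sum>j<p. (-1) ^ j * c (1 + int j) * hdet c (p' - j))"
    unfolding sum_distrib_left
  proof (rule sum.cong[OF refl])
    fix j assume "j \<in> {..<p}"
    then have j: "j < p" by simp
    obtain d where d: "p = Suc j + d" using less_imp_Suc_add[OF j] by auto
    have "(-1 :: 'a) ^ (p - Suc j) = - ((-1) ^ p) * (-1) ^ j"
      by (simp add: d power_add mult.assoc[symmetric] power_mult_distrib[symmetric])
    moreover have "int p - int (p - Suc j) = 1 + int j" using j by simp
    ultimately show "(-1) ^ (p - Suc j) * c (int p - int (p - Suc j)) * hdet c (p - Suc j)
      = - ((-1) ^ p) * ((-1) ^ j * c (1 + int j) * hdet c (p' - j))"
      by (simp add: p mult.assoc)
  qed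
  also have "(\<Sum>j<p. (-1) ^ j * c (1 + int j) * hdet c (p' - j)) = hdet c p"
    unfolding p by (rule hdet_Suc[of c, OF c0 neg, symmetric])
  finally show ?thesis by simp
qed

lemma sigma_det_eq_hdet: "sigma_det l p = hdet (c_var l) p"
  by (simp add: sigma_det_def hdet_def)

lemma c_var_0 [simp]: "c_var l 0 = 1"
  by (simp add: c_var_def)

lemma c_var_neg: "i < 0 \<Longrightarrow> c_var l i = 0"
  by (simp add: c_var_def)

section \<open>Rearrangements\<close>

lemma sum_distinct_ge:
  fixes A :: "nat set"
  assumes "finite A" "card A = t"
  shows "(\<Sum>i<t. i) \<le> (\<Sum>i\<in>A. i)"
  using assms
proof (induction t arbitrary: A)
  case (Suc t)
  from Suc.prems have ne: "A \<noteq> {}" by (metis card.empty nat.distinct(1))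
  define m where "m = Max A"
  have m: "m \<in> A" unfolding m_def using Suc.prems(1) ne by (rule Max_in)
  have "A \<subseteq> {..m}" unfolding m_def using Suc.prems(1) by auto
  then have "card A \<le> card {..m}" by (intro card_mono) auto
  then have tm: "t \<le> m" using Suc.prems(2) by simp
  have "(\<Sum>i<t. i) \<le> (\<Sum>i\<in>A - {m}. i)"
    by (rule Suc.IH) (use Suc.prems m in simp_all)
  moreover have "(\<Sum>i\<in>A. i) = m + (\<Sum>i\<in>A - {m}. i)"
    using sum.remove[OF Suc.prems(1) m, of "\<lambda>i. i"] .
  ultimately show ?case using tm by simp
qed simp

lemma abel_summation:
  fixes \<alpha> d :: "nat \<Rightarrow> int"
  shows "(\<Sum>i<Suc r. \<alpha> i * d i)
    = (\<Sum>t<r. (\<Sum>i<Suc t. d i) * (\<alpha> t - \<alpha> (Suc t))) + (\<Sum>i<Suc r. d i) * \<alpha> r"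
  by (induction r) (simp_all add: algebra_simps)

text \<open>Abel summation writes the difference of the two sides through the partial sums of \<pi>
  i - i. These are nonnegative, because distinct naturals have at least the sum of an initial
  segment, and one of them is positive because \<pi> is not the identity.\<close>

lemma rearrangement_strict:
  fixes \<alpha> :: "nat \<Rightarrow> int"
  assumes dec: "\<And>i. Suc i < r \<Longrightarrow> \<alpha> (Suc i) < \<alpha> i"
    and \<pi>: "\<pi> permutes {0..<r}" and "\<pi> \<noteq> id"
  shows "(\<Sum>i<r. \<alpha> i * int i) < (\<Sum>i<r. \<alpha> i * int (\<pi> i))"
proof -
  define d where "d i = int (\<pi> i) - int i" for i
  have "r \<noteq> 0" using assms by (auto simp: permutes_empty)
  then obtain r' where r: "r = Suc r'" by (cases r) auto
  have P: "(\<Sum>i<t. d i) \<ge> 0" if "t \<le> r" for t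
  proof -
    have inj: "inj_on \<pi> {..<t}" using permutes_inj[OF \<pi>] by (simp add: inj_on_def inj_def)
    have "(\<Sum>i<t. i) \<le> \<Sum>(\<pi> ` {..<t})" by (rule sum_distinct_ge) (simp_all add: card_image[OF inj])
    also have "\<dots> = (\<Sum>i<t. \<pi> i)" by (simp add: sum.reindex[OF inj])
    finally have "int (\<Sum>i<t. i) \<le> int (\<Sum>i<t. \<pi> i)" by (simp only: of_nat_le_iff)
    then show ?thesis by (simp add: d_def sum_subtractf)
  qed
  have Pr: "(\<Sum>i<r. d i) = 0"
  proof -
    have "(\<Sum>i<r. int (\<pi> i)) = (\<Sum>i<r. int i)"
      using sum.permute[OF \<pi>, of int] by (simp add: atLeast0LessThan)
    then show ?thesis by (simp add: d_def sum_subtractf)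
  qed
  have "\<exists>t\<le>r. (\<Sum>i<t. d i) \<noteq> 0"
  proof (rule ccontr)
    assume "\<not> ?thesis"
    then have z: "(\<Sum>i<t. d i) = 0" if "t \<le> r" for t using that by blast
    have "\<pi> i = i" for i
    proof (cases "i < r")
      case True
      then show ?thesis using z[of "Suc i"] z[of i] by (simp add: d_def)
    next
      case False
      then show ?thesis using \<pi> by (simp add: permutes_def)
    qed
    then show False using \<open>\<pi> \<noteq> id\<close> by auto
  qed
  then obtain t where t: "t \<le> r" "(\<Sum>i<t. d i) \<noteq> 0" by blast
  have t': "t \<noteq> 0" "t \<noteq> r"
  proof -
    show "t \<noteq> r" using t Pr by auto
    show "t \<noteq> 0" using t(2) by (metis lessThan_0 sum.empty)
  qed
  then obtain s where s: "t = Suc s" "s < r'" using t r by (cases t) auto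
  have "0 < (\<Sum>t<r'. (\<Sum>i<Suc t. d i) * (\<alpha> t - \<alpha> (Suc t)))"
  proof (rule sum_pos2[of _ s])
    show "0 < (\<Sum>i<Suc s. d i) * (\<alpha> s - \<alpha> (Suc s))"
      using P[of t] t s dec[of s] r by (intro mult_pos_pos) auto
    show "0 \<le> (\<Sum>i<Suc i. d i) * (\<alpha> i - \<alpha> (Suc i))" if "i \<in> {..<r'}" for i
      using P[of "Suc i"] dec[of i] r that by (intro mult_nonneg_nonneg) auto
  qed (use s in auto)
  also have "\<dots> = (\<Sum>i<r. \<alpha> i * d i)"
    using abel_summation[of \<alpha> d r'] Pr by (simp add: r)
  finally show ?thesis by (simp add: d_def right_diff_distrib sum_subtractf)
qed

text \<open>Only the mixed term of the expanded squares depends on the permutation. This provides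
  the termination measure for rewriting monomials.\<close>

lemma sum_squares_permuted:
  fixes \<alpha> :: "nat \<Rightarrow> int"
  assumes dec: "\<And>i. Suc i < r \<Longrightarrow> \<alpha> (Suc i) < \<alpha> i"
    and \<pi>: "\<pi> permutes {0..<r}" and "\<pi> \<noteq> id"
  shows "(\<Sum>i<r. (\<alpha> i + int i)\<^sup>2) < (\<Sum>i<r. (\<alpha> i + int (\<pi> i))\<^sup>2)"
proof -
  have "(\<Sum>i<r. (int (\<pi> i))\<^sup>2) = (\<Sum>i<r. (int i)\<^sup>2)"
    using sum.permute[OF \<pi>, of "\<lambda>i. (int i)\<^sup>2"] by (simp add: atLeast0LessThan o_def)
  moreover have "(\<Sum>i<r. (\<alpha> i + f i)\<^sup>2) = (\<Sum>i<r. (\<alpha> i)\<^sup>2) + 2 * (\<Sum>i<r. \<alpha> i * f i) + (\<Sum>i<r. (f i)\<^sup>2)"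
    for f :: "nat \<Rightarrow> int"
    by (simp add: power2_sum sum.distrib sum_distrib_left mult_ac)
  ultimately show ?thesis
    using rearrangement_strict[of r \<alpha>, OF dec \<pi> assms(3)] by simp
qed

section \<open>Weights of monomials\<close>

definition wt :: "nat \<Rightarrow> (nat \<Rightarrow>\<^sub>0 nat) \<Rightarrow> nat" where
  "wt l m = (\<Sum>i=1..l. i * Poly_Mapping.lookup m i)"

definition cnt :: "nat \<Rightarrow> (nat \<Rightarrow>\<^sub>0 nat) \<Rightarrow> nat" where
  "cnt l m = (\<Sum>i=1..l. Poly_Mapping.lookup m i)"

lemma wt_add: "wt l (m + m') = wt l m + wt l m'"
  by (simp add: wt_def lookup_add distrib_left sum.distrib)

lemma cnt_add: "cnt l (m + m') = cnt l m + cnt l m'"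
  by (simp add: cnt_def lookup_add sum.distrib)

lemma wt_0 [simp]: "wt l 0 = 0" and cnt_0 [simp]: "cnt l 0 = 0"
  by (simp_all add: wt_def cnt_def)

lemma wt_single: "i \<le> l \<Longrightarrow> wt l (Poly_Mapping.single i e) = i * e"
  by (simp add: wt_def lookup_single when_def if_distrib cong: if_cong)

lemma cnt_single: "cnt l (Poly_Mapping.single i e) = (if 1 \<le> i \<and> i \<le> l then e else 0)"
  by (simp add: cnt_def lookup_single when_def if_distrib cong: if_cong)

text \<open>The variable \<open>q\<close> gets weight zero, so that these are modules over \<open>\<int>[q]\<close>.\<close>

definition wmod :: "nat \<Rightarrow> int \<Rightarrow> (nat, int) mpol set" where
  "wmod l z = {x \<in> mpols {0..l}. \<forall>m \<in> Poly_Mapping.keys x. int (wt l m) \<le> z}"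

lemma wmod_0 [simp]: "0 \<in> wmod l z"
  by (simp add: wmod_def)

lemma wmod_add: "x \<in> wmod l z \<Longrightarrow> y \<in> wmod l z \<Longrightarrow> x + y \<in> wmod l z"
  using keys_add[of x y] by (auto simp: wmod_def mpols_add)

lemma wmod_uminus: "x \<in> wmod l z \<Longrightarrow> - x \<in> wmod l z"
  by (simp add: wmod_def mpols_uminus)

lemma wmod_sum: "(\<And>a. a \<in> A \<Longrightarrow> f a \<in> wmod l z) \<Longrightarrow> sum f A \<in> wmod l z"
  by (induction A rule: infinite_finite_induct) (auto simp: wmod_add)

lemma wmod_mult:
  assumes "x \<in> wmod l y" "x' \<in> wmod l z"
  shows "x * x' \<in> wmod l (y + z)"
proof -
  have "int (wt l m) \<le> y + z" if m: "m \<in> Poly_Mapping.keys (x * x')" for m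
  proof -
    have "m \<in> {a + b | a b. a \<in> Poly_Mapping.keys x \<and> b \<in> Poly_Mapping.keys x'}"
      using m keys_mult[of x x'] by (rule rev_subsetD)
    then obtain u v where uv: "m = u + v" "u \<in> Poly_Mapping.keys x" "v \<in> Poly_Mapping.keys x'"
      by auto
    have "int (wt l u) \<le> y" "int (wt l v) \<le> z"
      using assms uv by (simp_all add: wmod_def)
    then show ?thesis by (simp add: uv wt_add)
  qed
  then show ?thesis using assms by (simp add: wmod_def mpols_mult)
qed

lemma wmod_single: "Poly_Mapping.keys m \<subseteq> {0..l} \<Longrightarrow> int (wt l m) \<le> z \<Longrightarrow> Poly_Mapping.single m a \<in> wmod l z"
  by (simp add: wmod_def mpols_single)

lemma wmod_1: "1 \<in> wmod l 0"
  using wmod_single[of 0 l 0 1] by simp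

text \<open>Indices and weight bounds are integers because the determinants contain entries of
  negative index; these vanish and so satisfy any bound.\<close>

lemma wmod_c_var: "c_var l i \<in> wmod l i"
  using wmod_1 by (auto simp: c_var_def mvar_def wt_single intro!: wmod_single)

lemma wmod_q_var: "q_var \<in> wmod l 0"
  by (auto simp: q_var_def mvar_def wt_single intro!: wmod_single)

lemma wmod_sign: "x \<in> wmod l z \<Longrightarrow> (-1) ^ i * x \<in> wmod l z"
  by (cases "even i") (auto simp: wmod_uminus)

lemma wmod_mpols: "x \<in> wmod l z \<Longrightarrow> x \<in> mpols {0..l}"
  by (simp add: wmod_def)

lemma wmod_prod: "finite A \<Longrightarrow> (\<And>a. a \<in> A \<Longrightarrow> f a \<in> wmod l (g a)) \<Longrightarrow> prod f A \<in> wmod l (sum g A)"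
  by (induction A rule: finite_induct) (auto simp: wmod_1 wmod_mult)

lemma mpols_c_var: "c_var l i \<in> mpols {0..l}"
  using wmod_c_var wmod_mpols by blast

text \<open>Each Leibniz term obeys the same bound: the contributions of rows and columns add up to
  sums that no permutation changes.\<close>

lemma wmod_det:
  assumes "\<And>i j. i < r \<Longrightarrow> j < r \<Longrightarrow> f i j \<in> wmod l (b j - a i)"
  shows "Determinant.det (Matrix.mat r r (\<lambda>(i, j). f i j)) \<in> wmod l (sum b {0..<r} - sum a {0..<r})"
  unfolding det_def'[OF mat_carrier]
proof (intro wmod_sum)
  fix \<pi> assume "\<pi> \<in> {\<pi>. \<pi> permutes {0..<r}}"
  then have \<pi>: "\<pi> permutes {0..<r}" by simp
  have "(\<Prod>i = 0..<r. Matrix.mat r r (\<lambda>(i, j). f i j) $$ (i, \<pi> i)) \<in> wmod l (\<Sum>i = 0..<r. b (\<pi> i) - a i)"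
    by (rule wmod_prod) (use \<pi> permutes_in_image[OF \<pi>] assms in auto)
  also have "(\<Sum>i = 0..<r. b (\<pi> i) - a i) = sum b {0..<r} - sum a {0..<r}"
    using sum.permute[OF \<pi>, of b] by (simp add: sum_subtractf o_def)
  finally show "signof \<pi> * (\<Prod>i = 0..<r. Matrix.mat r r (\<lambda>(i, j). f i j) $$ (i, \<pi> i))
    \<in> wmod l (sum b {0..<r} - sum a {0..<r})"
    by (auto simp: sign_def wmod_uminus)
qed

lemma wmod_sigma_det: "sigma_det l p \<in> wmod l (int p)"
proof -
  have "sigma_det l p \<in> wmod l (sum (\<lambda>j. 1 + int j) {0..<p} - sum int {0..<p})"
    unfolding sigma_det_def by (rule wmod_det) (rule wmod_c_var)
  then show ?thesis by (simp add: sum.distrib)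
qed

section \<open>Normal forms modulo the relations\<close>

lemma cq_ring_simps [simp]:
  "carrier (cq_ring l) = mpols {0..l}" "monoid.mult (cq_ring l) = (*)"
  "one (cq_ring l) = 1" "zero (cq_ring l) = 0" "add (cq_ring l) = (+)"
  by (simp_all add: cq_ring_def)

lemma cq_ring_cring: "cring (cq_ring l)"
proof (rule cringI)
  show "abelian_group (cq_ring l)"
    by (rule abelian_groupI) (auto simp: mpols_add add_ac intro: bexI[of _ "- x" for x] mpols_uminus)
  show "Group.comm_monoid (cq_ring l)"
    by (rule comm_monoidI) (auto simp: mpols_mult mult_ac)
qed (auto simp: distrib_right)

lemma relations_subset: "relations l k \<subseteq> mpols {0..l}"
proof -
  have "q_var \<in> mpols {0..l}" using wmod_q_var wmod_mpols by blast
  then have "(-1) ^ l * q_var \<in> mpols {0..l}"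
    by (cases "even l") (auto simp: mpols_uminus)
  then show ?thesis
    unfolding relations_def using wmod_mpols[OF wmod_sigma_det] by (auto simp: mpols_add)
qed

definition relideal :: "nat \<Rightarrow> nat \<Rightarrow> (nat, int) mpol set" where
  "relideal l k = genideal (cq_ring l) (relations l k)"

lemma relideal_ideal: "ideal (relideal l k) (cq_ring l)"
  unfolding relideal_def
  by (rule ring.genideal_ideal) (use relations_subset cring.axioms(1)[OF cq_ring_cring] in auto)

lemma relideal_relations: "relations l k \<subseteq> relideal l k"
  unfolding relideal_def
  by (rule ring.genideal_self) (use relations_subset cring.axioms(1)[OF cq_ring_cring] in auto)

lemma relideal_mpols: "x \<in> relideal l k \<Longrightarrow> x \<in> mpols {0..l}"
  using ideal.Icarr[OF relideal_ideal] by auto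

lemma relideal_0 [simp]: "0 \<in> relideal l k"
  using additive_subgroup.zero_closed[OF ideal.axioms(1)[OF relideal_ideal]] by simp

lemma relideal_add: "x \<in> relideal l k \<Longrightarrow> y \<in> relideal l k \<Longrightarrow> x + y \<in> relideal l k"
  using additive_subgroup.a_closed[OF ideal.axioms(1)[OF relideal_ideal]] by simp

lemma relideal_mult: "x \<in> mpols {0..l} \<Longrightarrow> y \<in> relideal l k \<Longrightarrow> x * y \<in> relideal l k"
  using ideal.I_l_closed[OF relideal_ideal] by simp

text \<open>The filtration by weight on the quotient ring, pulled back to polynomials.\<close>

definition imod :: "nat \<Rightarrow> nat \<Rightarrow> int \<Rightarrow> (nat, int) mpol set" where
  "imod l k z = {a + w | a w. a \<in> relideal l k \<and> w \<in> wmod l z}"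

lemma imodI: "a \<in> relideal l k \<Longrightarrow> w \<in> wmod l z \<Longrightarrow> a + w \<in> imod l k z"
  by (auto simp: imod_def)

lemma imod_ideal: "a \<in> relideal l k \<Longrightarrow> a \<in> imod l k z"
  using imodI[of a l k 0 z] by simp

lemma imod_0 [simp]: "0 \<in> imod l k z"
  by (simp add: imod_ideal)

lemma imod_add: "x \<in> imod l k z \<Longrightarrow> y \<in> imod l k z \<Longrightarrow> x + y \<in> imod l k z"
proof -
  assume "x \<in> imod l k z" "y \<in> imod l k z"
  then obtain a w a' w' where *: "x = a + w" "y = a' + w'" "a \<in> relideal l k" "a' \<in> relideal l k"
      "w \<in> wmod l z" "w' \<in> wmod l z" unfolding imod_def by auto
  have "(a + a') + (w + w') \<in> imod l k z"
    using * by (intro imodI relideal_add wmod_add)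
  then show ?thesis using * by (simp add: add_ac)
qed

lemma imod_sum: "(\<And>a. a \<in> A \<Longrightarrow> f a \<in> imod l k z) \<Longrightarrow> sum f A \<in> imod l k z"
  by (induction A rule: infinite_finite_induct) (auto simp: imod_add)

lemma imod_mult: "y \<in> wmod l u \<Longrightarrow> x \<in> imod l k z \<Longrightarrow> y * x \<in> imod l k (u + z)"
proof -
  assume y: "y \<in> wmod l u" and "x \<in> imod l k z"
  then obtain a w where "x = a + w" "a \<in> relideal l k" "w \<in> wmod l z" unfolding imod_def by blast
  moreover from this have "y * a + y * w \<in> imod l k (u + z)"
    using y wmod_mpols[OF y] by (intro imodI relideal_mult wmod_mult)
  ultimately show ?thesis by (simp add: distrib_left)
qed

lemma imod_uminus: "x \<in> imod l k z \<Longrightarrow> - x \<in> imod l k z"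
  using imod_mult[OF wmod_uminus[OF wmod_1], of x l k z] by simp

lemma imod_sign: "x \<in> imod l k z \<Longrightarrow> (-1) ^ i * x \<in> imod l k z"
  by (cases "even i") (auto simp: imod_uminus)

text \<open>Modulo the relations, the determinants of large size drop in weight by \<open>n = l + k\<close>.\<close>

lemma sigma_det_imod:
  assumes "s \<ge> k + 1" "l \<ge> 1"
  shows "sigma_det l s \<in> imod l k (int s - int (l + k))"
  using assms(1)
proof (induction s rule: less_induct)
  case (less s)
  consider "s < l + k" | "s = l + k" | "s > l + k" by linarith
  then show ?case
  proof cases
    case 1
    then have "sigma_det l s \<in> relations l k" using less.prems by (auto simp: relations_def)
    then show ?thesis using relideal_relations imod_ideal by blast
  next
    case 2
    \<comment> \<open>The last relation replaces sigma_n by a multiple of q; since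
      \<open>q_var\<close> has weight zero, this is exactly the drop by n.\<close>
    have "sigma_det l s + (-1) ^ l * q_var \<in> relideal l k"
      using relideal_relations 2 by (auto simp: relations_def)
    then have "(sigma_det l s + (-1) ^ l * q_var) + - ((-1) ^ l * q_var) \<in> imod l k 0"
      by (intro imodI wmod_uminus wmod_sign wmod_q_var)
    then show ?thesis using 2 by simp
  next
    case 3
    \<comment> \<open>Since c_i = 0 for i > l, the recursion expresses sigma_s through sigma_t with
      t >= s - l > k only, and to these the induction hypothesis applies.\<close>
    have "(\<Sum>t\<le>s. (-1) ^ t * c_var l (int s - int t) * sigma_det l t) = 0"
      unfolding sigma_det_eq_hdet by (rule hdet_recursion) (use 3 c_var_neg in auto)
    then have "(-1) ^ s * sigma_det l s
        = - (\<Sum>t<s. (-1) ^ t * (c_var l (int s - int t) * sigma_det l t))"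
      by (simp add: lessThan_Suc_atMost[symmetric] mult.assoc add_eq_0_iff)
    moreover have "(\<Sum>t<s. (-1) ^ t * (c_var l (int s - int t) * sigma_det l t))
        \<in> imod l k (int s - int (l + k))"
    proof (intro imod_sum imod_sign)
      fix t assume "t \<in> {..<s}"
      then have t: "t < s" by simp
      show "c_var l (int s - int t) * sigma_det l t \<in> imod l k (int s - int (l + k))"
      proof (cases "s - t > l")
        case True
        then have "\<not> int s - int t \<le> int l" "int s - int t \<noteq> 0" by linarith+
        then have "c_var l (int s - int t) = 0" by (simp add: c_var_def)
        then show ?thesis by simp
      next
        case False
        have "sigma_det l t \<in> imod l k (int t - int (l + k))"
          by (rule less.IH) (use t False 3 in auto)
        from imod_mult[OF wmod_c_var this, of "int s - int t"] show ?thesis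
          by (simp only: add_diff_eq diff_add_cancel)
      qed
    qed
    ultimately have "(-1) ^ s * sigma_det l s \<in> imod l k (int s - int (l + k))"
      by (simp only: imod_uminus)
    then have "(-1) ^ s * ((-1) ^ s * sigma_det l s) \<in> imod l k (int s - int (l + k))"
      by (rule imod_sign)
    then show ?thesis by (simp add: mult.assoc[symmetric] power_mult_distrib[symmetric])
  qed
qed

text \<open>For weakly decreasing \<open>L\<close> this is the dual Jacobi-Trudi form of the Schur
  polynomial with columns of lengths \<open>L\<close>. The identity permutation contributes the
  product of the c_x for x in \<open>L\<close>, which is why the determinant can rewrite that
  monomial.\<close>

definition partdet :: "nat \<Rightarrow> nat list \<Rightarrow> (nat, int) mpol" where
  "partdet l L = Determinant.det (Matrix.mat (length L) (length L)
     (\<lambda>(i, j). c_var l (int (L ! i) + int j - int i)))"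

text \<open>Column operations with the \<open>\<sigma>\<^sub>s\<close> as coefficients replace the last column by one that
  lies in the ideal up to terms of smaller weight.\<close>

lemma partdet_imod:
  assumes l: "l \<ge> 1" and len: "length L \<ge> k + 1" and pos: "\<And>x. x \<in> set L \<Longrightarrow> x \<ge> 1"
  shows "partdet l L \<in> imod l k (int (sum_list L) - int (l + k))"
proof -
  define r where "r = length L"
  have r: "r \<ge> k + 1" "r > 0" using len by (auto simp: r_def)
  define A where "A = Matrix.mat r r (\<lambda>(i, j). c_var l (int (L ! i) + int j - int i))"
  \<comment> \<open>Right multiplication by \<open>U\<close> alters only the last column. Its
    diagonal entry there is \<open>sigma_det l 0\<close>, which is 1, so the determinant stays the
    same.\<close>
  define U where "U = Matrix.mat r r (\<lambda>(j, j'). if j' = r - 1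
    then (-1) ^ (r - 1 - j) * sigma_det l (r - 1 - j) else if j = j' then 1 else 0)"
  have dims: "A \<in> carrier_mat r r" "U \<in> carrier_mat r r" by (simp_all add: A_def U_def)
  have "Determinant.det U = prod_list (diag_mat U)"
    by (rule det_upper_triangular[OF _ dims(2)]) (auto simp: U_def)
  also have "\<dots> = 1"
    by (auto simp: prod.distinct_set_conv_list[symmetric] diag_mat_def U_def sigma_det_eq_hdet
        intro!: prod.neutral)
  finally have detAU: "Determinant.det (A * U) = partdet l L"
    using det_mult[OF dims] by (simp add: partdet_def A_def r_def)
  let ?a = "\<lambda>i. int (L ! i) - int i"
  let ?z = "- int (l + k)"
  have AU: "(A * U) $$ (i, j) = (if j = r - 1
      then (\<Sum>s<r. (-1) ^ s * c_var l (?a i + int (r - 1) - int s) * sigma_det l s)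
      else c_var l (?a i + int j))" if ij: "i < r" "j < r" for i j
  proof -
    let ?S1 = "\<Sum>x<r. c_var l (?a i + int x) * ((-1) ^ (r - 1 - x) * sigma_det l (r - 1 - x))"
    let ?S2 = "\<Sum>s<r. (-1) ^ s * c_var l (?a i + int (r - 1) - int s) * sigma_det l s"
    have "(A * U) $$ (i, j) = (\<Sum>x<r. c_var l (?a i + int x) * U $$ (x, j))"
    proof -
      have "(A * U) $$ (i, j) = (\<Sum>x = 0..<r. A $$ (i, x) * U $$ (x, j))"
        using ij dims by (simp add: scalar_prod_def)
      also have "\<dots> = (\<Sum>x = 0..<r. c_var l (?a i + int x) * U $$ (x, j))"
        by (rule sum.cong) (use ij in \<open>auto simp: A_def diff_add_eq\<close>)
      finally show ?thesis by (simp add: atLeast0LessThan)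
    qed
    also have "\<dots> = (if j = r - 1 then ?S1 else c_var l (?a i + int j))"
    proof (cases "j = r - 1")
      case True
      have "U $$ (x, j) = (-1) ^ (r - 1 - x) * sigma_det l (r - 1 - x)" if "x < r" for x
        using True that ij by (simp add: U_def)
      then have "(\<Sum>x<r. c_var l (?a i + int x) * U $$ (x, j)) = ?S1"
        by (intro sum.cong) auto
      then show ?thesis by (simp only: if_P[OF True])
    next
      case False
      then have "(\<Sum>x<r. c_var l (?a i + int x) * U $$ (x, j))
          = (\<Sum>x<r. if x = j then c_var l (?a i + int j) else 0)"
        by (intro sum.cong) (use ij in \<open>auto simp: U_def\<close>)
      then show ?thesis using False ij by simp
    qed
    finally have 1: "(A * U) $$ (i, j) = (if j = r - 1 then ?S1 else c_var l (?a i + int j))" .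
    have 2: "?S1 = ?S2"
    proof (subst sum.nat_diff_reindex[symmetric], rule sum.cong[OF refl])
      fix s assume "s \<in> {..<r}"
      then have s: "r - 1 - (r - Suc s) = s" "int (r - Suc s) = int (r - 1) - int s"
        by (auto simp: of_nat_diff)
      show "c_var l (?a i + int (r - Suc s)) * ((-1) ^ (r - 1 - (r - Suc s)) * sigma_det l (r - 1 - (r - Suc s)))
        = (-1) ^ s * c_var l (?a i + int (r - 1) - int s) * sigma_det l s"
        unfolding s by (simp add: mult_ac add_diff_eq)
    qed
    show ?thesis unfolding 1 2 ..
  qed
  have last: "(A * U) $$ (i, r - 1) \<in> imod l k (?a i + int (r - 1) + ?z)" if i: "i < r" for i
  proof -
    define p where "p = L ! i + (r - 1 - i)"
    have p: "int p = ?a i + int (r - 1)" using i unfolding p_def by linarith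
    have "L ! i \<ge> 1" using pos i by (simp add: r_def)
    then have p1: "p \<ge> 1" by (simp add: p_def)
    let ?f = "\<lambda>s. (-1) ^ s * c_var l (int p - int s) * sigma_det l s"
    have eq: "(A * U) $$ (i, r - 1) = (\<Sum>s<r. ?f s)"
      unfolding p by (subst AU[OF i]) (use r in simp, rule if_P, rule refl)
    have tot: "(\<Sum>s\<le>p. ?f s) = 0"
      unfolding sigma_det_eq_hdet by (rule hdet_recursion) (use p1 c_var_neg in auto)
    \<comment> \<open>The recursion of order \<open>p\<close> makes the full sum zero, so what
      remains are the terms with s >= r >= k + 1, whose determinants drop in weight.\<close>
    have "(\<Sum>s<r. ?f s) = - (\<Sum>s\<in>{r..p}. ?f s)"
    proof (cases "p < r")
      case True
      then have "(\<Sum>s<r. ?f s) = (\<Sum>s\<le>p. ?f s)"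
        by (intro sum.mono_neutral_right) (auto simp: c_var_neg)
      then show ?thesis using tot True by simp
    next
      case False
      then have un: "{..p} = {..<r} \<union> {r..p}" by auto
      have "(\<Sum>s\<le>p. ?f s) = (\<Sum>s<r. ?f s) + (\<Sum>s\<in>{r..p}. ?f s)"
        unfolding un by (rule sum.union_disjoint) auto
      then show ?thesis using tot by (simp add: add_eq_0_iff2)
    qed
    moreover have "(\<Sum>s\<in>{r..p}. ?f s) \<in> imod l k (int p + ?z)"
    proof (rule imod_sum)
      fix s assume s: "s \<in> {r..p}"
      have "c_var l (int p - int s) * sigma_det l s \<in> imod l k ((int p - int s) + (int s - int (l + k)))"
        by (intro imod_mult wmod_c_var sigma_det_imod) (use s r l in auto)
      then show "?f s \<in> imod l k (int p + ?z)"
        using imod_sign by (simp add: mult.assoc)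
    qed
    ultimately show ?thesis unfolding eq p[symmetric] by (simp only: imod_uminus)
  qed
  have "Determinant.det (A * U) \<in> imod l k (int (sum_list L) + ?z)"
    unfolding det_def'[OF mult_carrier_mat[OF dims]]
  proof (rule imod_sum)
    fix \<pi> assume "\<pi> \<in> {\<pi>. \<pi> permutes {0..<r}}"
    then have \<pi>: "\<pi> permutes {0..<r}" by simp
    have "r - 1 \<in> \<pi> ` {0..<r}" using permutes_image[OF \<pi>] r by simp
    \<comment> \<open>Each Leibniz term has exactly one factor from the last column, and this factor
      supplies the drop.\<close>
    then obtain i0 where i0: "i0 < r" "\<pi> i0 = r - 1" by auto
    have \<pi>lt: "i < r \<Longrightarrow> \<pi> i < r" for i using permutes_in_image[OF \<pi>] by auto
    have other: "(A * U) $$ (i, \<pi> i) \<in> wmod l (?a i + int (\<pi> i))" if "i < r" "i \<noteq> i0" for i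
    proof -
      have "\<pi> i \<noteq> r - 1" using that i0 permutes_inj[OF \<pi>] by (metis injD)
      then show ?thesis using AU[OF that(1) \<pi>lt[OF that(1)]] wmod_c_var by simp
    qed
    let ?R = "\<Prod>i\<in>{0..<r} - {i0}. (A * U) $$ (i, \<pi> i)"
    have R: "?R \<in> wmod l (\<Sum>i\<in>{0..<r} - {i0}. ?a i + int (\<pi> i))"
      by (rule wmod_prod) (use other in auto)
    have "(\<Prod>i = 0..<r. (A * U) $$ (i, \<pi> i)) = ?R * (A * U) $$ (i0, \<pi> i0)"
      using prod.remove[of "{0..<r}" i0 "\<lambda>i. (A * U) $$ (i, \<pi> i)"] i0 by (simp add: mult.commute)
    moreover have "?R * (A * U) $$ (i0, \<pi> i0) \<in> imod l k
        ((\<Sum>i\<in>{0..<r} - {i0}. ?a i + int (\<pi> i)) + (?a i0 + int (\<pi> i0) + ?z))"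
      using imod_mult[OF R] last i0 by simp
    moreover have "(\<Sum>i\<in>{0..<r} - {i0}. ?a i + int (\<pi> i)) + (?a i0 + int (\<pi> i0) + ?z)
        = (\<Sum>i\<in>{0..<r}. ?a i + int (\<pi> i)) + ?z"
      using sum.remove[OF finite_atLeastLessThan, of i0 0 r "\<lambda>i. ?a i + int (\<pi> i)"] i0 by simp
    moreover have "(\<Sum>i\<in>{0..<r}. ?a i + int (\<pi> i)) = int (sum_list L)"
    proof -
      have "(\<Sum>i\<in>{0..<r}. int (\<pi> i)) = (\<Sum>i\<in>{0..<r}. int i)"
        using sum.permute[OF \<pi>, of int] by (simp add: o_def)
      then show ?thesis
        by (simp add: sum.distrib sum_subtractf sum_list_sum_nth r_def)
    qed
    ultimately have "(\<Prod>i = 0..<r. (A * U) $$ (i, \<pi> i)) \<in> imod l k (int (sum_list L) + ?z)"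
      by (simp only:)
    then show "signof \<pi> * (\<Prod>i = 0..<r. (A * U) $$ (i, \<pi> i)) \<in> imod l k (int (sum_list L) + ?z)"
      by (auto simp: sign_def imod_uminus)
  qed
  then show ?thesis unfolding detAU by (simp only: add_uminus_conv_diff)
qed

section \<open>Monomials as lists of indices\<close>

definition mlist :: "nat list \<Rightarrow> (nat \<Rightarrow>\<^sub>0 nat)" where
  "mlist L = sum_list (map (\<lambda>x. Poly_Mapping.single x 1) L)"

lemma mlist_simps [simp]: "mlist [] = 0" "mlist (x # L) = Poly_Mapping.single x 1 + mlist L"
  by (simp_all add: mlist_def)

lemma wt_mlist: "set L \<subseteq> {1..l} \<Longrightarrow> wt l (mlist L) = sum_list L"
  by (induction L) (auto simp: wt_add wt_single)

lemma cnt_mlist: "set L \<subseteq> {1..l} \<Longrightarrow> cnt l (mlist L) = length L"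
  by (induction L) (auto simp: cnt_add cnt_single)

lemma keys_mlist: "Poly_Mapping.keys (mlist L) \<subseteq> set L"
proof (induction L)
  case (Cons x L)
  have "Poly_Mapping.keys (mlist (x # L)) \<subseteq> Poly_Mapping.keys (Poly_Mapping.single x (1::nat)) \<union> Poly_Mapping.keys (mlist L)"
    unfolding mlist_simps by (rule keys_add)
  then show ?case using Cons by auto
qed simp

lemma mlist_perm: "mset L = mset L' \<Longrightarrow> mlist L = mlist L'"
  unfolding mlist_def by (metis mset_map sum_mset_sum_list)

lemma monomial_as_list:
  assumes "Poly_Mapping.keys m \<subseteq> {0..l}"
  shows "\<exists>L. set L \<subseteq> {1..l} \<and> m = Poly_Mapping.single 0 (Poly_Mapping.lookup m 0) + mlist L"
  using assms
proof (induction "cnt l m" arbitrary: m)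
  case 0
  have "m = Poly_Mapping.single 0 (Poly_Mapping.lookup m 0)"
  proof (rule poly_mapping_eqI)
    fix i
    show "Poly_Mapping.lookup m i = Poly_Mapping.lookup (Poly_Mapping.single 0 (Poly_Mapping.lookup m 0)) i"
    proof (cases "i \<in> {1..l}")
      case True
      then have "Poly_Mapping.lookup m i = 0" using 0(1) by (simp add: cnt_def)
      then show ?thesis using True by (simp add: lookup_single when_def)
    next
      case False
      then have "i = 0 \<or> i \<notin> Poly_Mapping.keys m" using 0(2) by force
      then show ?thesis by (auto simp: lookup_single when_def in_keys_iff)
    qed
  qed
  then show ?case by (intro exI[of _ "[]"]) simp
next
  case (Suc N)
  have "\<exists>i\<in>{1..l}. Poly_Mapping.lookup m i \<noteq> 0"
  proof (rule ccontr)
    assume "\<not> ?thesis"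
    then have "cnt l m = 0" by (simp add: cnt_def)
    then show False using Suc(2) by simp
  qed
  then obtain i where i: "i \<in> {1..l}" "Poly_Mapping.lookup m i \<noteq> 0" by blast
  define m' where "m' = m - Poly_Mapping.single i 1"
  have m: "m = Poly_Mapping.single i 1 + m'"
    by (rule poly_mapping_eqI) (use i in \<open>auto simp: m'_def lookup_add lookup_minus lookup_single when_def\<close>)
  have "Poly_Mapping.keys m' \<subseteq> {0..l}"
  proof
    fix j assume "j \<in> Poly_Mapping.keys m'"
    then have "j \<in> Poly_Mapping.keys m"
      by (simp add: m in_keys_iff lookup_add)
    then show "j \<in> {0..l}" using Suc(3) by blast
  qed
  moreover have "N = cnt l m'" using Suc(2) i by (simp add: m cnt_add cnt_single)
  ultimately obtain L where L: "set L \<subseteq> {1..l}" "m' = Poly_Mapping.single 0 (Poly_Mapping.lookup m' 0) + mlist L"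
    using Suc(1) by blast
  have "Poly_Mapping.lookup m 0 = Poly_Mapping.lookup m' 0" using i by (simp add: m lookup_add lookup_single when_def)
  then have "m = Poly_Mapping.single 0 (Poly_Mapping.lookup m 0) + mlist (i # L)"
    using L(2) m by (metis add.left_commute mlist_simps(2))
  then show ?case using L(1) i(1) by (intro exI[of _ "i # L"]) auto
qed

text \<open>Factors with index 0 equal 1 and are filtered out, so a Leibniz term may have fewer
  factors than the determinant has rows.\<close>

lemma prod_c_var_as_monomial:
  "\<forall>x\<in>set ps. 0 \<le> x \<and> x \<le> int l \<Longrightarrow>
   prod_list (map (c_var l) ps) = Poly_Mapping.single (mlist (filter (\<lambda>x. x \<ge> 1) (map nat ps))) 1"
proof (induction ps)
  case (Cons p ps)
  show ?case
  proof (cases "p = 0")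
    case True
    then show ?thesis using Cons by simp
  next
    case False
    then have "c_var l p = Poly_Mapping.single (Poly_Mapping.single (nat p) 1) 1" "nat p \<ge> 1"
      using Cons.prems by (auto simp: c_var_def mvar_def)
    then show ?thesis using Cons by (simp add: mult_single)
  qed
qed simp

lemma sum_list_filter_pos: "sum_list (filter (\<lambda>x. x \<ge> 1) L) = sum_list (L :: nat list)"
  by (induction L) auto

lemma sum_squares_filter_pos:
  "sum_list (map (\<lambda>x. x\<^sup>2) (filter (\<lambda>x. x \<ge> 1) L)) = sum_list (map (\<lambda>x. x\<^sup>2) (L :: nat list))"
  by (induction L) auto

lemma sum_squares_le: "sum_list (map (\<lambda>x. x\<^sup>2) L) \<le> (sum_list (L :: nat list))\<^sup>2"
  by (induction L) (auto simp: power2_sum)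

section \<open>Reduced polynomials and normal forms\<close>

definition reduced :: "nat \<Rightarrow> nat \<Rightarrow> (nat, int) mpol set" where
  "reduced l k = {y \<in> mpols {0..l}. \<forall>m \<in> Poly_Mapping.keys y. cnt l m \<le> k}"

definition nform :: "nat \<Rightarrow> nat \<Rightarrow> (nat, int) mpol set" where
  "nform l k = {a + y | a y. a \<in> relideal l k \<and> y \<in> reduced l k}"

lemma reduced_0 [simp]: "0 \<in> reduced l k"
  by (simp add: reduced_def)

lemma reduced_add: "x \<in> reduced l k \<Longrightarrow> y \<in> reduced l k \<Longrightarrow> x + y \<in> reduced l k"
  using keys_add[of x y] by (auto simp: reduced_def mpols_add)

lemma reduced_scalar:
  assumes "c \<in> mpols {0}" "y \<in> reduced l k"
  shows "c * y \<in> reduced l k"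
proof -
  have "cnt l m \<le> k" if m: "m \<in> Poly_Mapping.keys (c * y)" for m
  proof -
    have "m \<in> {a + b | a b. a \<in> Poly_Mapping.keys c \<and> b \<in> Poly_Mapping.keys y}"
      using m keys_mult[of c y] by (rule rev_subsetD)
    then obtain u v where uv: "m = u + v" "u \<in> Poly_Mapping.keys c" "v \<in> Poly_Mapping.keys y"
      by auto
    have "Poly_Mapping.lookup u i = 0" if "i \<in> {1..l}" for i
      using assms(1) uv(2) that unfolding mpols_def by (force simp: in_keys_iff)
    then have "cnt l u = 0" by (simp add: cnt_def)
    moreover have "cnt l v \<le> k" using assms(2) uv by (simp add: reduced_def)
    ultimately show ?thesis by (simp add: uv cnt_add)
  qed
  moreover have "c \<in> mpols {0..l}" using assms(1) unfolding mpols_def by fastforce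
  ultimately show ?thesis using assms(2) by (simp add: reduced_def mpols_mult)
qed

lemma nformI: "a \<in> relideal l k \<Longrightarrow> y \<in> reduced l k \<Longrightarrow> a + y \<in> nform l k"
  by (auto simp: nform_def)

lemma nform_reduced: "y \<in> reduced l k \<Longrightarrow> y \<in> nform l k"
  using nformI[of 0 l k y] by simp

lemma nform_ideal: "a \<in> relideal l k \<Longrightarrow> a \<in> nform l k"
  using nformI[of a l k 0] by simp

lemma nform_add:
  assumes "x \<in> nform l k" "y \<in> nform l k"
  shows "x + y \<in> nform l k"
proof -
  obtain a w a' w' where *: "x = a + w" "y = a' + w'" "a \<in> relideal l k" "a' \<in> relideal l k"
      "w \<in> reduced l k" "w' \<in> reduced l k" using assms unfolding nform_def by auto
  have "(a + a') + (w + w') \<in> nform l k"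
    using * by (intro nformI relideal_add reduced_add)
  then show ?thesis using * by (simp add: add_ac)
qed

lemma nform_sum: "(\<And>a. a \<in> A \<Longrightarrow> f a \<in> nform l k) \<Longrightarrow> sum f A \<in> nform l k"
  by (induction A rule: infinite_finite_induct) (auto simp: nform_add nform_reduced)

lemma nform_scalar:
  assumes "c \<in> mpols {0}" "x \<in> nform l k"
  shows "c * x \<in> nform l k"
proof -
  obtain a w where *: "x = a + w" "a \<in> relideal l k" "w \<in> reduced l k"
    using assms(2) unfolding nform_def by auto
  have "c \<in> mpols {0..l}" using assms(1) unfolding mpols_def by fastforce
  then have "c * a + c * w \<in> nform l k"
    using * assms(1) by (intro nformI relideal_mult reduced_scalar)
  then show ?thesis using * by (simp add: distrib_left)
qed

lemma nform_uminus: "x \<in> nform l k \<Longrightarrow> - x \<in> nform l k"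
  using nform_scalar[of "-1" x l k] by (simp add: mpols_uminus)

text \<open>Powers of q act as scalars on normal forms, so only the part of each monomial in the
  Chern variables has to be treated.\<close>

lemma nform_of_lists:
  assumes lists: "\<And>L. set L \<subseteq> {1..l} \<Longrightarrow> int (sum_list L) \<le> z \<Longrightarrow> Poly_Mapping.single (mlist L) 1 \<in> nform l k"
    and x: "x \<in> wmod l z"
  shows "x \<in> nform l k"
proof -
  have "Poly_Mapping.single m (Poly_Mapping.lookup x m) \<in> nform l k" if m: "m \<in> Poly_Mapping.keys x" for m
  proof -
    have "Poly_Mapping.keys m \<subseteq> {0..l}" using x m by (simp add: wmod_def mpols_def)
    then obtain L where L: "set L \<subseteq> {1..l}" "m = Poly_Mapping.single 0 (Poly_Mapping.lookup m 0) + mlist L"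
      using monomial_as_list by blast
    have "wt l m = sum_list L"
      using arg_cong[OF L(2), of "wt l"] by (simp add: wt_add wt_single wt_mlist[OF L(1)])
    then have "int (sum_list L) \<le> z" using x m by (auto simp: wmod_def)
    then have "Poly_Mapping.single (mlist L) 1 \<in> nform l k" using lists L(1) by simp
    then have "Poly_Mapping.single (Poly_Mapping.single 0 (Poly_Mapping.lookup m 0)) (Poly_Mapping.lookup x m)
        * Poly_Mapping.single (mlist L) 1 \<in> nform l k"
      by (intro nform_scalar mpols_single) auto
    then show ?thesis using L(2) by (simp add: mult_single)
  qed
  then show ?thesis by (subst poly_mapping_eq_sum_single) (rule nform_sum)
qed

text \<open>Expanding \<open>partdet l L\<close> rewrites a monomial with more than \<open>k\<close> factors in terms of
  monomials of the same weight whose exponent vectors have a larger sum of squares.\<close>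

lemma nform_list:
  assumes l: "l \<ge> 1"
  shows "set L \<subseteq> {1..l} \<Longrightarrow> Poly_Mapping.single (mlist L) 1 \<in> nform l k"
proof (induction "sum_list L" arbitrary: L rule: less_induct)
  case (less L0)
  note outer = less.hyps
  define N where "N = sum_list L0"
  \<comment> \<open>Among lists of the same sum \<open>N\<close> the sum of squares is at most N^2,
    so the difference of the two can serve as a decreasing measure for an inner induction.\<close>
  have "set L \<subseteq> {1..l} \<Longrightarrow> sum_list L = N \<Longrightarrow> Poly_Mapping.single (mlist L) 1 \<in> nform l k" for L
  proof (induction "N\<^sup>2 - sum_list (map (\<lambda>x. x\<^sup>2) L)" arbitrary: L rule: less_induct)
    case (less L)
    show ?case
    proof (cases "length L \<le> k")
      case True
      have "Poly_Mapping.keys (mlist L) \<subseteq> {0..l}" using keys_mlist[of L] less.prems by auto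
      then show ?thesis
        using True less.prems by (intro nform_reduced) (simp add: reduced_def mpols_single cnt_mlist)
    next
      case False
      \<comment> \<open>Decreasing order makes the numbers \<alpha> i strictly decreasing, as the
        comparison of sums of squares requires; the monomial does not depend on the order.\<close>
      define L' where "L' = rev (sort L)"
      have ms: "mset L' = mset L" by (simp add: L'_def)
      have set': "set L' = set L" by (simp add: L'_def)
      have sum': "sum_list L' = N" using less.prems ms by (metis sum_mset_sum_list)
      have sq': "sum_list (map (\<lambda>x. x\<^sup>2) L') = sum_list (map (\<lambda>x. x\<^sup>2) L)"
        using ms by (metis mset_map sum_mset_sum_list)
      have dec: "L' ! Suc i \<le> L' ! i" if "Suc i < length L'" for i
        using sorted_nth_mono[of "sort L" "length L - Suc (Suc i)" "length L - Suc i"] that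
        by (simp add: L'_def rev_nth)
      define r where "r = length L'"
      have r: "r \<ge> k + 1" using False by (simp add: r_def L'_def)
      define \<alpha> where "\<alpha> i = int (L' ! i) - int i" for i
      let ?P = "{\<pi>. \<pi> permutes {0..<r}}"
      let ?t = "\<lambda>\<pi>. signof \<pi> * (\<Prod>i = 0..<r. c_var l (\<alpha> i + int (\<pi> i)))"
      have pd: "partdet l L' = (\<Sum>\<pi>\<in>?P. ?t \<pi>)"
        unfolding partdet_def det_def'[OF mat_carrier] r_def[symmetric]
        by (intro sum.cong refl arg_cong2[where f = "(*)"] prod.cong)
          (auto simp: \<alpha>_def algebra_simps dest: permutes_in_image)
      have fin: "finite ?P" by (simp add: finite_permutations)
      have idP: "id \<in> ?P" by (simp add: permutes_id)
      have idt: "?t id = Poly_Mapping.single (mlist L) 1"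
      proof -
        have "?t id = prod_list (map (c_var l) (map (\<lambda>i. \<alpha> i + int i) [0..<r]))"
          by (simp add: prod.distinct_set_conv_list[symmetric] o_def)
        also have "map (\<lambda>i. \<alpha> i + int i) [0..<r] = map int L'"
          by (rule nth_equalityI) (auto simp: r_def \<alpha>_def)
        also have "prod_list (map (c_var l) (map int L'))
            = Poly_Mapping.single (mlist (filter (\<lambda>x. x \<ge> 1) (map nat (map int L')))) 1"
          by (rule prod_c_var_as_monomial) (use less.prems set' in auto)
        also have "filter (\<lambda>x. x \<ge> 1) (map nat (map int L')) = L'"
          using less.prems set' by (auto simp: o_def filter_id_conv)
        finally show ?thesis using mlist_perm[OF ms] by simp
      qed
      have other: "?t \<pi> \<in> nform l k" if \<pi>: "\<pi> \<in> ?P - {id}" for \<pi>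
      proof -
        have \<pi>': "\<pi> permutes {0..<r}" "\<pi> \<noteq> id" using \<pi> by auto
        let ?ps = "map (\<lambda>i. \<alpha> i + int (\<pi> i)) [0..<r]"
        have pr: "(\<Prod>i = 0..<r. c_var l (\<alpha> i + int (\<pi> i))) = prod_list (map (c_var l) ?ps)"
          by (simp add: prod.distinct_set_conv_list[symmetric] o_def)
        have "prod_list (map (c_var l) ?ps) \<in> nform l k"
        proof (cases "\<forall>x\<in>set ?ps. 0 \<le> x \<and> x \<le> int l")
          case False
          then obtain x where x: "x \<in> set ?ps" "x < 0 \<or> x > int l" by fastforce
          then have "c_var l x = 0" by (auto simp: c_var_def)
          then have "0 \<in> set (map (c_var l) ?ps)" using x(1) by force
          then have "prod_list (map (c_var l) ?ps) = 0" by (simp only: prod_list_zero_iff)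
          then show ?thesis by (simp only: nform_reduced[OF reduced_0])
        next
          case True
          define L'' where "L'' = filter (\<lambda>x. x \<ge> 1) (map nat ?ps)"
          have nn: "\<forall>x\<in>set ?ps. 0 \<le> x" using True by blast
          have int_sum: "int (sum_list (map nat xs)) = sum_list xs"
              "int (sum_list (map (\<lambda>x. x\<^sup>2) (map nat xs))) = sum_list (map (\<lambda>x. x\<^sup>2) xs)"
            if "\<forall>x\<in>set xs. 0 \<le> x" for xs :: "int list"
            using that by (induction xs) auto
          have "int (sum_list L'') = sum_list ?ps"
            unfolding L''_def sum_list_filter_pos by (rule int_sum(1)[OF nn])
          also have "\<dots> = (\<Sum>i = 0..<r. \<alpha> i + int (\<pi> i))"
            by (simp add: sum.distinct_set_conv_list[symmetric])
          also have "\<dots> = (\<Sum>i = 0..<r. int (L' ! i))"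
            using sum.permute[OF \<pi>'(1), of int] by (simp add: \<alpha>_def sum.distrib sum_subtractf o_def)
          also have "\<dots> = int (\<Sum>i = 0..<r. L' ! i)" by simp
          also have "\<dots> = int N" using sum' by (simp only: sum_list_sum_nth r_def)
          finally have sumL'': "sum_list L'' = N" by simp
          have setL'': "set L'' \<subseteq> {1..l}" using True by (auto simp: L''_def)
          have "int (sum_list (map (\<lambda>x. x\<^sup>2) L')) = (\<Sum>i<r. (\<alpha> i + int i)\<^sup>2)"
            by (simp add: sum_list_sum_nth r_def \<alpha>_def atLeast0LessThan)
          also have "\<dots> < (\<Sum>i<r. (\<alpha> i + int (\<pi> i))\<^sup>2)"
          proof (rule sum_squares_permuted[OF _ \<pi>'])
            fix i assume "Suc i < r"
            then show "\<alpha> (Suc i) < \<alpha> i" using dec[of i] by (simp add: \<alpha>_def r_def)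
          qed
          also have "\<dots> = sum_list (map (\<lambda>x. x\<^sup>2) ?ps)"
            by (simp add: sum.distinct_set_conv_list[symmetric] o_def atLeast0LessThan)
          also have "\<dots> = int (sum_list (map (\<lambda>x. x\<^sup>2) L''))"
            unfolding L''_def sum_squares_filter_pos by (rule int_sum(2)[OF nn, symmetric])
          finally have "sum_list (map (\<lambda>x. x\<^sup>2) L) < sum_list (map (\<lambda>x. x\<^sup>2) L'')" using sq' by simp
          moreover have "sum_list (map (\<lambda>x. x\<^sup>2) L'') \<le> N\<^sup>2" using sum_squares_le[of L''] sumL'' by simp
          ultimately have "N\<^sup>2 - sum_list (map (\<lambda>x. x\<^sup>2) L'') < N\<^sup>2 - sum_list (map (\<lambda>x. x\<^sup>2) L)" by simp
          then have "Poly_Mapping.single (mlist L'') 1 \<in> nform l k"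
            using less.hyps setL'' sumL'' by blast
          then show ?thesis using prod_c_var_as_monomial[OF True] by (simp only: L''_def)
        qed
        then show ?thesis unfolding pr by (auto simp: sign_def nform_uminus)
      qed
      have "partdet l L' \<in> imod l k (int (sum_list L') - int (l + k))"
        by (rule partdet_imod) (use l r less.prems set' in \<open>auto simp: r_def\<close>)
      then obtain a w where aw: "partdet l L' = a + w" "a \<in> relideal l k" "w \<in> wmod l (int N - int (l + k))"
        unfolding imod_def sum' by auto
      \<comment> \<open>The remainder has weight at most N - n, and the outer induction on the
        weight takes over.\<close>
      have "w \<in> nform l k"
      proof (rule nform_of_lists[OF _ aw(3)])
        fix L1 :: "nat list" assume L1: "set L1 \<subseteq> {1..l}" "int (sum_list L1) \<le> int N - int (l + k)"
        then have "sum_list L1 < sum_list L0" using l by (simp add: N_def)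
        then show "Poly_Mapping.single (mlist L1) 1 \<in> nform l k" using outer L1 by blast
      qed
      then have pdn: "partdet l L' \<in> nform l k" using aw by (simp add: nform_add nform_ideal)
      have "(\<Sum>\<pi>\<in>?P. ?t \<pi>) = ?t id + (\<Sum>\<pi>\<in>?P - {id}. ?t \<pi>)"
        by (rule sum.remove[OF fin idP])
      then have "Poly_Mapping.single (mlist L) 1 = partdet l L' + - (\<Sum>\<pi>\<in>?P - {id}. ?t \<pi>)"
        unfolding pd idt by simp
      moreover have "(\<Sum>\<pi>\<in>?P - {id}. ?t \<pi>) \<in> nform l k" by (rule nform_sum[OF other])
      ultimately show ?thesis using nform_add[OF pdn nform_uminus] by (simp only:)
    qed
  qed
  then show ?case using less.prems by (simp add: N_def)
qed

lemma mpols_nform: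
  assumes "l \<ge> 1" "x \<in> mpols {0..l}"
  shows "x \<in> nform l k"
proof -
  have "int (wt l m) \<le> (\<Sum>m\<in>Poly_Mapping.keys x. int (wt l m))" if "m \<in> Poly_Mapping.keys x" for m
    by (rule member_le_sum) (use that in auto)
  then have "x \<in> wmod l (\<Sum>m\<in>Poly_Mapping.keys x. int (wt l m))"
    using assms(2) by (simp add: wmod_def)
  then show ?thesis using nform_list[OF assms(1)] by (rule nform_of_lists[rotated])
qed

section \<open>Counting the reduced monomials\<close>

definition rmonos :: "nat \<Rightarrow> nat \<Rightarrow> (nat \<Rightarrow>\<^sub>0 nat) set" where
  "rmonos l k = {m. Poly_Mapping.keys m \<subseteq> {1..l} \<and> cnt l m \<le> k}"

text \<open>The exponent of c_j is the number of columns of length j, so the rows are the partial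
  sums from the top index down; the inverse takes differences of consecutive parts. At most k
  factors means at most k columns.\<close>

lemma rmonos_bij:
  "bij_betw (\<lambda>m. map (\<lambda>i. \<Sum>j=Suc i..l. Poly_Mapping.lookup m j) [0..<l]) (rmonos l k) (rect_partitions l k)"
proof -
  define g where "g p = (\<Sum>j=1..l. Poly_Mapping.single j (p ! (j - 1) - (if j < l then p ! j else 0)))" for p :: "nat list"
  let ?f = "\<lambda>m. map (\<lambda>i. \<Sum>j=Suc i..l. Poly_Mapping.lookup m j) [0..<l]"
  have lg: "Poly_Mapping.lookup (g p) i = (if i \<in> {1..l} then p ! (i - 1) - (if i < l then p ! i else 0) else 0)" for p i
    by (simp add: g_def lookup_sum lookup_single when_def)
  show ?thesis
  proof (rule bij_betw_byWitness[where f' = g])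
    show "\<forall>m\<in>rmonos l k. g (?f m) = m"
    proof
      fix m assume m: "m \<in> rmonos l k"
      show "g (?f m) = m"
      proof (rule poly_mapping_eqI)
        fix i
        show "Poly_Mapping.lookup (g (?f m)) i = Poly_Mapping.lookup m i"
        proof (cases "i \<in> {1..l}")
          case True
          then have "(\<Sum>j=i..l. Poly_Mapping.lookup m j)
              = Poly_Mapping.lookup m i + (\<Sum>j=Suc i..l. Poly_Mapping.lookup m j)"
            by (intro sum.atLeast_Suc_atMost) auto
          then show ?thesis using True by (auto simp: lg)
        next
          case False
          then show ?thesis using m unfolding rmonos_def by (auto simp: lg in_keys_iff)
        qed
      qed
    qed
    show "\<forall>p\<in>rect_partitions l k. ?f (g p) = p"
    proof
      fix p assume p: "p \<in> rect_partitions l k"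
      have anti: "i < l \<Longrightarrow> (if Suc i < l then p ! Suc i else 0) \<le> p ! i" for i
        using p by (auto simp: rect_partitions_nth)
      have tele: "(\<Sum>j=Suc i..l. Poly_Mapping.lookup (g p) j) = p ! i" if "i < l" for i
        using that
      proof (induction "l - i" arbitrary: i)
        case (Suc d)
        have "(\<Sum>j=Suc i..l. Poly_Mapping.lookup (g p) j)
            = Poly_Mapping.lookup (g p) (Suc i) + (\<Sum>j=Suc (Suc i)..l. Poly_Mapping.lookup (g p) j)"
          using Suc.prems by (intro sum.atLeast_Suc_atMost) auto
        also have "(\<Sum>j=Suc (Suc i)..l. Poly_Mapping.lookup (g p) j) = (if Suc i < l then p ! Suc i else 0)"
          using Suc.hyps(1)[of "Suc i"] Suc.hyps(2) by auto
        finally show ?case using anti[OF Suc.prems] Suc.prems by (simp add: lg)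
      qed simp
      show "?f (g p) = p"
        by (rule nth_equalityI) (use p tele in \<open>auto simp: rect_partitions_nth\<close>)
    qed
    show "?f ` rmonos l k \<subseteq> rect_partitions l k"
    proof safe
      fix m assume m: "m \<in> rmonos l k"
      have "(\<Sum>j=Suc i..l. Poly_Mapping.lookup m j) \<le> k" for i
      proof -
        have "(\<Sum>j=Suc i..l. Poly_Mapping.lookup m j) \<le> cnt l m"
          unfolding cnt_def by (rule sum_mono2) auto
        then show ?thesis using m by (simp add: rmonos_def)
      qed
      moreover have "(\<Sum>j=Suc i'..l. Poly_Mapping.lookup m j) \<le> (\<Sum>j=Suc i..l. Poly_Mapping.lookup m j)"
        if "i \<le> i'" for i i'
        by (rule sum_mono2) (use that in auto)
      ultimately show "?f m \<in> rect_partitions l k"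
        by (simp add: rect_partitions_nth)
    qed
    show "g ` rect_partitions l k \<subseteq> rmonos l k"
    proof safe
      fix p assume p: "p \<in> rect_partitions l k"
      have anti: "i < l \<Longrightarrow> (if Suc i < l then p ! Suc i else 0) \<le> p ! i" for i
        using p by (auto simp: rect_partitions_nth)
      have le: "(\<Sum>j=1..t. Poly_Mapping.lookup (g p) j) + (if t < l then p ! t else 0) \<le> (if l = 0 then 0 else p ! 0)"
        if "t \<le> l" for t
        using that
      proof (induction t)
        case (Suc t)
        then show ?case using anti[of t] by (simp add: lg)
      qed simp
      have "cnt l (g p) \<le> (if l = 0 then 0 else p ! 0)"
        using le[of l] by (simp add: cnt_def)
      also have "\<dots> \<le> k" using p by (auto simp: rect_partitions_nth)
      finally have "cnt l (g p) \<le> k" .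
      moreover have "Poly_Mapping.keys (g p) \<subseteq> {1..l}" by (auto simp: in_keys_iff lg split: if_splits)
      ultimately show "g p \<in> rmonos l k" by (simp add: rmonos_def)
    qed
  qed
qed

section \<open>Polynomials in q as coefficients\<close>

lemma q_var_power: "q_var ^ i = Poly_Mapping.single (Poly_Mapping.single 0 i) 1"
proof (induction i)
  case (Suc i)
  then show ?case
    by (simp add: q_var_def mvar_def mult_single single_add[symmetric])
qed simp

lemma Zq_embed_expand:
  assumes "degree f \<le> N"
  shows "Zq_embed f = (\<Sum>i\<le>N. Poly_Mapping.single (Poly_Mapping.single 0 i) (coeff f i))"
proof -
  let ?p = "map_poly of_int f :: (nat, int) mpol poly"
  have "Zq_embed f = (\<Sum>i\<le>degree ?p. coeff ?p i * q_var ^ i)"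
    unfolding Zq_embed_def by (rule poly_altdef)
  also have "\<dots> = (\<Sum>i\<le>N. coeff ?p i * q_var ^ i)"
  proof (rule sum.mono_neutral_left)
    have "degree ?p \<le> degree f" by (rule map_poly_degree_leq)
    then show "{..degree ?p} \<subseteq> {..N}" using assms by auto
  qed (auto simp: coeff_eq_0)
  also have "\<dots> = (\<Sum>i\<le>N. Poly_Mapping.single (Poly_Mapping.single 0 i) (coeff f i))"
    by (rule sum.cong) (simp_all add: coeff_map_poly q_var_power single_of_int[symmetric] mult_single
        del: single_of_int)
  finally show ?thesis .
qed

lemma Zq_embed_add: "Zq_embed (f + g) = Zq_embed f + Zq_embed g"
proof -
  let ?N = "max (degree f) (degree g)"
  have "degree (f + g) \<le> ?N" by (rule degree_add_le_max)
  then show ?thesis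
    by (simp add: Zq_embed_expand[of _ ?N] single_add sum.distrib)
qed

lemma Zq_embed_0 [simp]: "Zq_embed 0 = 0"
  by (simp add: Zq_embed_def)

lemma Zq_embed_monom: "Zq_embed (Polynomial.monom b e) = Poly_Mapping.single (Poly_Mapping.single 0 e) b"
proof -
  have "Zq_embed (Polynomial.monom b e)
      = (\<Sum>i\<le>e. if i = e then Poly_Mapping.single (Poly_Mapping.single 0 e) b else 0)"
    unfolding Zq_embed_expand[OF degree_monom_le] by (rule sum.cong) auto
  then show ?thesis by simp
qed

lemma Zq_embed_mpols: "Zq_embed f \<in> mpols {0..l}"
  by (subst Zq_embed_expand[OF order_refl]) (intro mpols_sum mpols_single, simp)

lemma finite_rmonos: "finite (rmonos l k)"
  using bij_betw_finite[OF rmonos_bij] finite_rect_partitions by blast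

lemma reduced_expand:
  assumes "y \<in> reduced l k"
  shows "\<exists>F. y = (\<Sum>m\<in>rmonos l k. Zq_embed (F m) * Poly_Mapping.single m 1)"
proof -
  let ?E = "\<lambda>y. \<exists>F. y = (\<Sum>m\<in>rmonos l k. Zq_embed (F m) * Poly_Mapping.single m (1::int))"
  have E0: "?E 0" by (rule exI[of _ "\<lambda>_. 0"]) simp
  have Eadd: "?E (x + y)" if "?E x" "?E y" for x y
  proof -
    from \<open>?E x\<close> obtain F where "x = (\<Sum>m\<in>rmonos l k. Zq_embed (F m) * Poly_Mapping.single m 1)" ..
    moreover from \<open>?E y\<close> obtain G where "y = (\<Sum>m\<in>rmonos l k. Zq_embed (G m) * Poly_Mapping.single m 1)" ..
    ultimately show ?thesis
      by (intro exI[of _ "\<lambda>m. F m + G m"]) (simp add: Zq_embed_add distrib_right sum.distrib)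
  qed
  have Esum: "?E (sum f A)" if "\<And>a. a \<in> A \<Longrightarrow> ?E (f a)" for f and A :: "(nat \<Rightarrow>\<^sub>0 nat) set"
    using that
  proof (induction A rule: infinite_finite_induct)
    case (insert a A)
    have "?E (f a + sum f A)" by (rule Eadd) (use insert in auto)
    then show ?case using insert by simp
  qed (use E0 in auto)
  have "?E (Poly_Mapping.single m (Poly_Mapping.lookup y m))" if m: "m \<in> Poly_Mapping.keys y" for m
  proof -
    have km: "Poly_Mapping.keys m \<subseteq> {0..l}" "cnt l m \<le> k" using assms m by (auto simp: reduced_def mpols_def)
    then obtain L where L: "set L \<subseteq> {1..l}" "m = Poly_Mapping.single 0 (Poly_Mapping.lookup m 0) + mlist L"
      using monomial_as_list by blast
    have "cnt l m = cnt l (mlist L)" using arg_cong[OF L(2), of "cnt l"] by (simp add: cnt_add cnt_single)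
    then have rm: "mlist L \<in> rmonos l k" using keys_mlist[of L] L(1) km(2) by (auto simp: rmonos_def)
    let ?F = "\<lambda>m'. if m' = mlist L then Polynomial.monom (Poly_Mapping.lookup y m) (Poly_Mapping.lookup m 0) else 0"
    have "(\<Sum>m'\<in>rmonos l k. Zq_embed (?F m') * Poly_Mapping.single m' 1)
        = (\<Sum>m'\<in>rmonos l k. if m' = mlist L then Poly_Mapping.single m (Poly_Mapping.lookup y m) else 0)"
      by (rule sum.cong) (use L(2) in \<open>auto simp: Zq_embed_monom mult_single\<close>)
    also have "\<dots> = Poly_Mapping.single m (Poly_Mapping.lookup y m)"
      using rm finite_rmonos by simp
    finally show ?thesis by (intro exI[of _ ?F]) (rule sym)
  qed
  then have "?E (\<Sum>m\<in>Poly_Mapping.keys y. Poly_Mapping.single m (Poly_Mapping.lookup y m))"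
    by (rule Esum)
  then show ?thesis using poly_mapping_eq_sum_single[of y] by simp
qed

section \<open>Image and kernel of a homomorphism with the prescribed values\<close>

context qh_pieri
begin

context
  fixes \<phi> :: "(nat, int) mpol \<Rightarrow> (nat list \<Rightarrow>\<^sub>0 int poly)"
  assumes chern: "chern_hom T l k \<phi>"
begin

lemma phi_hom: "\<phi> \<in> Ring.ring_hom (cq_ring l) M"
  using chern by (simp add: chern_hom_def)

lemma phi_carrier: "x \<in> mpols {0..l} \<Longrightarrow> \<phi> x \<in> qcarrier l k"
  using ring_hom_closed[OF phi_hom] by simp

lemma phi_add: "x \<in> mpols {0..l} \<Longrightarrow> y \<in> mpols {0..l} \<Longrightarrow> \<phi> (x + y) = \<phi> x + \<phi> y"
  using ring_hom_add[OF phi_hom] by simp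

lemma phi_mult: "x \<in> mpols {0..l} \<Longrightarrow> y \<in> mpols {0..l} \<Longrightarrow> \<phi> (x * y) = \<phi> x \<odot> \<phi> y"
  using ring_hom_mult[OF phi_hom] by (simp add: QH_mult)

lemma phi_one: "\<phi> 1 = qone"
  using ring_hom_one[OF phi_hom] by simp

lemma phi_zero: "\<phi> 0 = 0"
proof -
  have "\<phi> 0 = \<phi> 0 + \<phi> 0" using phi_add[OF mpols_0 mpols_0] unfolding add_0 .
  then show ?thesis by (rule add_cancel_right_right[THEN iffD1])
qed

lemma phi_uminus:
  assumes "x \<in> mpols {0..l}"
  shows "\<phi> (- x) = - \<phi> x"
proof -
  have "\<phi> (- x) + \<phi> x = 0"
    using phi_add[of "- x" x] assms by (simp add: mpols_uminus phi_zero)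
  then show ?thesis by (rule eq_neg_iff_add_eq_0[THEN iffD2])
qed

lemma phi_sum: "(\<And>a. a \<in> A \<Longrightarrow> f a \<in> mpols {0..l}) \<Longrightarrow> \<phi> (sum f A) = (\<Sum>a\<in>A. \<phi> (f a))"
  by (induction A rule: infinite_finite_induct) (auto simp: phi_zero phi_add mpols_sum)

lemma phi_sign: "x \<in> mpols {0..l} \<Longrightarrow> \<phi> ((-1) ^ i * x) = qscale ((-1) ^ i) (\<phi> x)"
  by (cases "even i") (auto simp: phi_uminus qscale_uminus)

lemma mpols_sign: "x \<in> mpols {0..l} \<Longrightarrow> ((-1) ^ i * x :: (nat, int) mpol) \<in> mpols {0..l}"
  by (cases "even i") (auto simp: mpols_uminus)

lemma phi_scale: "x \<in> mpols {0..l} \<Longrightarrow> \<phi> (Zq_embed f * x) = qscale f (\<phi> x)"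
  using chern by (simp add: chern_hom_def)

lemma phi_q_var: "\<phi> q_var = qscale qpar qone"
proof -
  have "q_var = Zq_embed qpar * 1"
    using q_var_power[of 1] by (simp add: qpar_def Zq_embed_monom)
  then show ?thesis using phi_scale[of 1 qpar] by (simp add: phi_one)
qed

lemma phi_c_var: "\<phi> (c_var l (int i)) = colc i"
proof (cases "1 \<le> i \<and> i \<le> l")
  case True
  then show ?thesis using chern by (simp add: chern_hom_def colc_def)
next
  case False
  then have "i = 0 \<or> c_var l (int i) = 0 \<and> i > l" by (auto simp: c_var_def)
  then show ?thesis by (auto simp: colc_def phi_one phi_zero)
qed

lemma mpols_sigma: "sigma_det l p \<in> mpols {0..l}"
  using wmod_mpols[OF wmod_sigma_det] .

text \<open>Kept apart from the induction over \<open>p\<close> because the same step is taken once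
  more at p = l + k, where the quantum term appears.\<close>

lemma phi_sigma_expand:
  assumes rows: "\<And>s. s < p \<Longrightarrow> \<phi> (sigma_det l s) = rowc s" and p: "p \<ge> 1"
  shows "\<phi> (sigma_det l p) = rowc p
    + (if p = l + k then qscale ((-1) ^ (l - 1) * qpar) qone else 0)"
proof -
  obtain p' where p': "p = Suc p'" using p by (cases p) auto
  have "sigma_det l p = (\<Sum>j<p. (-1) ^ j * (c_var l (int (Suc j)) * sigma_det l (p - Suc j)))"
    unfolding sigma_det_eq_hdet p' by (subst hdet_Suc) (auto simp: c_var_neg mult.assoc)
  then have "\<phi> (sigma_det l p) = (\<Sum>j<p. \<phi> ((-1) ^ j * (c_var l (int (Suc j)) * sigma_det l (p - Suc j))))"
    by (simp only:) (rule phi_sum, intro mpols_sign mpols_mult mpols_c_var mpols_sigma)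
  also have "\<dots> = (\<Sum>j<p. qscale ((-1) ^ j) (colc (Suc j) \<odot> rowc (p - Suc j)))"
  proof (rule sum.cong[OF refl])
    fix j assume "j \<in> {..<p}"
    then have "p - Suc j < p" by simp
    then have r: "\<phi> (sigma_det l (p - Suc j)) = rowc (p - Suc j)" by (rule rows)
    have "\<phi> ((-1) ^ j * (c_var l (int (Suc j)) * sigma_det l (p - Suc j)))
        = qscale ((-1) ^ j) (\<phi> (c_var l (int (Suc j)) * sigma_det l (p - Suc j)))"
      by (rule phi_sign) (intro mpols_mult mpols_c_var mpols_sigma)
    also have "\<phi> (c_var l (int (Suc j)) * sigma_det l (p - Suc j))
        = \<phi> (c_var l (int (Suc j))) \<odot> \<phi> (sigma_det l (p - Suc j))"
      by (rule phi_mult) (rule mpols_c_var mpols_sigma)+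
    finally show "\<phi> ((-1) ^ j * (c_var l (int (Suc j)) * sigma_det l (p - Suc j)))
        = qscale ((-1) ^ j) (colc (Suc j) \<odot> rowc (p - Suc j))"
      unfolding r phi_c_var .
  qed
  also have "\<dots> = rowc p + (if p = l + k then qscale ((-1) ^ (l - 1) * qpar) qone else 0)"
    by (rule colc_rowc_recursion[OF p])
  finally show ?thesis .
qed

lemma phi_sigma: "p < l + k \<Longrightarrow> \<phi> (sigma_det l p) = rowc p"
proof (induction p rule: less_induct)
  case (less p)
  show ?case
  proof (cases "p = 0")
    case True
    then show ?thesis by (simp add: sigma_det_eq_hdet phi_one rowc_def)
  next
    case False
    then show ?thesis using phi_sigma_expand[of p] less by simp
  qed
qed

lemma phi_relations:
  assumes "x \<in> relations l k"
  shows "\<phi> x = 0"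
proof -
  have q: "q_var \<in> mpols {0..l}" using wmod_mpols[OF wmod_q_var] .
  consider p where "k + 1 \<le> p" "p < l + k" "x = sigma_det l p"
    | "x = sigma_det l (l + k) + (- 1) ^ l * q_var"
    using assms l by (auto simp: relations_def)
  then show ?thesis
  proof cases
    case 1
    then show ?thesis using phi_sigma[of p] by (simp add: rowc_def)
  next
    case 2
    have "\<phi> (sigma_det l (l + k)) = rowc (l + k) + qscale ((-1) ^ (l - 1) * qpar) qone"
      using phi_sigma_expand[of "l + k"] phi_sigma l by simp
    moreover have "rowc (l + k) = 0" using l by (simp add: rowc_def)
    \<comment> \<open>The signs (-1)^(l - 1) from the recursion and (-1)^l from the relation
      cancel.\<close>
    moreover have "(-1 :: int poly) ^ l = - ((-1) ^ (l - 1))"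
      using l by (cases l) auto
    ultimately show ?thesis
      unfolding 2 by (subst phi_add[OF mpols_sigma mpols_sign[OF q]])
        (simp add: phi_sign[OF q] phi_q_var qscale_uminus)
  qed
qed

lemma phi_relideal:
  assumes "x \<in> relideal l k"
  shows "\<phi> x = 0"
proof -
  have "ring_hom_ring (cq_ring l) M \<phi>"
    by (intro ring_hom_ringI2 phi_hom cring.axioms(1) cq_ring_cring cring)
  then have "ideal (a_kernel (cq_ring l) M \<phi>) (cq_ring l)"
    by (rule ring_hom_ring.kernel_is_ideal)
  then have "relideal l k \<subseteq> a_kernel (cq_ring l) M \<phi>"
    unfolding relideal_def
    by (intro ring.genideal_minimal cring.axioms(1)[OF cq_ring_cring])
      (use phi_relations relations_subset in \<open>auto simp: a_kernel_def'\<close>)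
  then show ?thesis using assms by (auto simp: a_kernel_def')
qed

text \<open>The image contains the row classes, as images of the determinants
  \<open>sigma_det\<close>, and is closed under the ring operations and scalars, so the generation
  of the ring by row classes applies.\<close>

lemma phi_surj: "qcarrier l k \<subseteq> \<phi> ` mpols {0..l}"
proof (rule schubert_classes_generated)
  fix x y assume "x \<in> \<phi> ` mpols {0..l}" "y \<in> \<phi> ` mpols {0..l}"
  then obtain u v where uv: "u \<in> mpols {0..l}" "v \<in> mpols {0..l}" "x = \<phi> u" "y = \<phi> v" by auto
  have "x + y = \<phi> (u + v)" "x \<odot> y = \<phi> (u * v)"
    using uv by (simp_all add: phi_add phi_mult)
  then show "x + y \<in> \<phi> ` mpols {0..l}" "x \<odot> y \<in> \<phi> ` mpols {0..l}"
    using uv by (simp_all add: mpols_add mpols_mult)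
next
  fix f x assume "x \<in> \<phi> ` mpols {0..l}"
  then obtain u where u: "u \<in> mpols {0..l}" "x = \<phi> u" by blast
  then have "qscale f x = \<phi> (Zq_embed f * u)" by (simp add: phi_scale)
  then show "qscale f x \<in> \<phi> ` mpols {0..l}" using u mpols_mult[OF Zq_embed_mpols] by blast
next
  fix p
  show "rowc p \<in> \<phi> ` mpols {0..l}"
  proof (cases "p < l + k")
    case True
    then show ?thesis using phi_sigma[OF True] mpols_sigma by (metis imageI)
  next
    case False
    then have "rowc p = \<phi> 0" using l by (simp add: rowc_def phi_zero)
    then show ?thesis by simp
  qed
qed

lemma phi_reduced_expand:
  assumes y: "y = (\<Sum>m\<in>rmonos l k. Zq_embed (F m) * Poly_Mapping.single m 1)"
  shows "\<phi> y = (\<Sum>m\<in>rmonos l k. qscale (F m) (\<phi> (Poly_Mapping.single m 1)))"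
proof -
  have m: "Poly_Mapping.single m (1::int) \<in> mpols {0..l}" if "m \<in> rmonos l k" for m
    using that by (intro mpols_single) (auto simp: rmonos_def)
  have "\<phi> y = (\<Sum>m\<in>rmonos l k. \<phi> (Zq_embed (F m) * Poly_Mapping.single m 1))"
    unfolding y by (rule phi_sum) (intro mpols_mult Zq_embed_mpols m)
  also have "\<dots> = (\<Sum>m\<in>rmonos l k. qscale (F m) (\<phi> (Poly_Mapping.single m 1)))"
    by (rule sum.cong) (simp_all add: phi_scale m)
  finally show ?thesis .
qed

text \<open>The reduced monomials are as many as the Schubert classes, and their images span; so the
  transition matrix is invertible.\<close>

lemma phi_reduced_inj:
  assumes y: "y \<in> reduced l k" and 0: "\<phi> y = 0"
  shows "y = 0"
proof -
  define N where "N = card rect"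
  have cardr: "card (rmonos l k) = N" unfolding N_def by (rule bij_betw_same_card[OF rmonos_bij])
  obtain e where e: "bij_betw e {..<N} (rmonos l k)"
    using bij_betw_from_nat_into_finite[OF finite_rmonos] cardr by blast
  obtain r where r: "bij_betw r {..<N} rect"
    using bij_betw_from_nat_into_finite[OF finite_rect_partitions] N_def by blast
  have rr: "r i \<in> rect" if "i < N" for i using r that by (auto simp: bij_betw_def)
  let ?w = "\<lambda>m. \<phi> (Poly_Mapping.single m 1)"
  define W where "W = Matrix.mat N N (\<lambda>(t, j). Poly_Mapping.lookup (?w (e t)) (r j))"
  have coords: "Poly_Mapping.lookup (\<Sum>m\<in>rmonos l k. qscale (F m) (?w m)) (r j)
      = (\<Sum>t = 0..<N. F (e t) * W $$ (t, j))" if "j < N" for F j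
  proof -
    have "Poly_Mapping.lookup (\<Sum>m\<in>rmonos l k. qscale (F m) (?w m)) (r j)
        = (\<Sum>m\<in>rmonos l k. F m * Poly_Mapping.lookup (?w m) (r j))"
      by (simp add: lookup_sum)
    also have "\<dots> = (\<Sum>t<N. F (e t) * Poly_Mapping.lookup (?w (e t)) (r j))"
      by (rule sum.reindex_bij_betw[OF e, symmetric])
    also have "\<dots> = (\<Sum>t = 0..<N. F (e t) * W $$ (t, j))"
      unfolding atLeast0LessThan by (rule sum.cong) (use that in \<open>auto simp: W_def\<close>)
    finally show ?thesis .
  qed
  have "\<exists>F. cls p = (\<Sum>m\<in>rmonos l k. qscale (F m) (?w m))" if "p \<in> rect" for p
  proof -
    have "cls p \<in> \<phi> ` mpols {0..l}"
      using phi_surj qcarrier_schubert[OF \<open>p \<in> rect\<close>] by (rule subsetD)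
    then obtain x where x: "x \<in> mpols {0..l}" "cls p = \<phi> x" by auto
    obtain a u where au: "x = a + u" "a \<in> relideal l k" "u \<in> reduced l k"
      using mpols_nform[OF l x(1)] unfolding nform_def by blast
    have "u \<in> mpols {0..l}" using au by (simp add: reduced_def)
    then have "\<phi> x = \<phi> u" using au relideal_mpols phi_relideal by (simp add: phi_add)
    moreover obtain F where "u = (\<Sum>m\<in>rmonos l k. Zq_embed (F m) * Poly_Mapping.single m 1)"
      using reduced_expand[OF au(3)] by blast
    ultimately show ?thesis using phi_reduced_expand[of u F] x(2) by (intro exI[of _ F]) simp
  qed
  then obtain F where F: "\<And>p. p \<in> rect \<Longrightarrow> cls p = (\<Sum>m\<in>rmonos l k. qscale (F p m) (?w m))"
    using bchoice[of rect "\<lambda>p F. cls p = (\<Sum>m\<in>rmonos l k. qscale (F m) (?w m))"] by auto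
  \<comment> \<open>\<open>W\<close> expresses the images of the reduced monomials in Schubert
    classes, \<open>G\<close> the Schubert classes in these images; so \<open>G * W\<close> is the
    identity.\<close>
  define G where "G = Matrix.mat N N (\<lambda>(i, t). F (r i) (e t))"
  have GW: "G * W = 1\<^sub>m N"
  proof (rule eq_matI)
    fix i j assume "i < dim_row (1\<^sub>m N :: int poly mat)" "j < dim_col (1\<^sub>m N :: int poly mat)"
    then have ij: "i < N" "j < N" by auto
    have "(G * W) $$ (i, j) = (\<Sum>t = 0..<N. F (r i) (e t) * W $$ (t, j))"
      using ij by (simp add: G_def W_def scalar_prod_def)
    also have "\<dots> = Poly_Mapping.lookup (cls (r i)) (r j)"
      unfolding F[OF rr[OF ij(1)]] by (rule coords[OF ij(2), symmetric])
    also have "\<dots> = (if i = j then 1 else 0)"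
      using r ij by (auto simp: schubert_class_def lookup_single when_def bij_betw_def inj_on_def)
    finally show "(G * W) $$ (i, j) = 1\<^sub>m N $$ (i, j)" using ij by simp
  qed (auto simp: G_def W_def)
  have dims: "G \<in> carrier_mat N N" "W \<in> carrier_mat N N" by (auto simp: G_def W_def)
  have "Determinant.det G * Determinant.det W = 1"
    using det_mult[OF dims] GW by simp
  \<comment> \<open>Z[q] is a domain, so a nonzero determinant already excludes a linear relation
    between the rows of \<open>W\<close>.\<close>
  then have "Determinant.det W \<noteq> 0" by auto
  then have detT: "Determinant.det (transpose_mat W) \<noteq> 0" using det_transpose[OF dims(2)] by simp
  obtain H where H: "y = (\<Sum>m\<in>rmonos l k. Zq_embed (H m) * Poly_Mapping.single m 1)"
    using reduced_expand[OF y] by blast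
  define v where "v = Matrix.vec N (\<lambda>t. H (e t))"
  have "transpose_mat W *\<^sub>v v = 0\<^sub>v N"
  proof (rule eq_vecI)
    fix j assume "j < dim_vec (0\<^sub>v N :: int poly Matrix.vec)"
    then have j: "j < N" by simp
    have "vec_index (transpose_mat W *\<^sub>v v) j = (\<Sum>t = 0..<N. W $$ (t, j) * H (e t))"
      using j dims by (simp add: v_def scalar_prod_def)
    also have "\<dots> = Poly_Mapping.lookup (\<phi> y) (r j)"
      unfolding phi_reduced_expand[OF H] by (subst coords[OF j]) (simp add: mult.commute)
    finally show "vec_index (transpose_mat W *\<^sub>v v) j = vec_index (0\<^sub>v N) j" using j 0 by simp
  qed (use dims in auto)
  note * = this
  have v0: "v = 0\<^sub>v N"
  proof -
    have "v \<in> carrier_vec N" by (simp add: v_def)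
    with * detT show ?thesis
      using det_0_iff_vec_prod_zero[OF transpose_carrier_mat[THEN iffD2, OF dims(2)]] by blast
  qed
  have "H m = 0" if "m \<in> rmonos l k" for m
  proof -
    have "m \<in> e ` {..<N}" using e that by (simp add: bij_betw_def)
    then obtain t where t: "t < N" "m = e t" by auto
    have "vec_index v t = 0" using t(1) unfolding v0 by simp
    then show ?thesis using t by (simp add: v_def)
  qed
  then show ?thesis unfolding H by simp
qed

lemma phi_presentation:
  "\<phi> ` carrier (cq_ring l) = carrier M" "a_kernel (cq_ring l) M \<phi> = genideal (cq_ring l) (relations l k)"
proof -
  show "\<phi> ` carrier (cq_ring l) = carrier M"
    using phi_surj phi_carrier by auto
  have "x \<in> relideal l k" if x: "x \<in> mpols {0..l}" "\<phi> x = 0" for x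
  proof -
    obtain a u where au: "x = a + u" "a \<in> relideal l k" "u \<in> reduced l k"
      using mpols_nform[OF l x(1)] unfolding nform_def by blast
    have "u \<in> mpols {0..l}" using au by (simp add: reduced_def)
    then have "\<phi> u = 0" using au x(2) relideal_mpols[of a l k] phi_relideal by (simp add: phi_add)
    then have "u = 0" by (rule phi_reduced_inj[OF au(3)])
    then show ?thesis using au by simp
  qed
  then show "a_kernel (cq_ring l) M \<phi> = genideal (cq_ring l) (relations l k)"
    unfolding relideal_def[symmetric] using relideal_mpols phi_relideal by (auto simp: a_kernel_def')
qed

end

section \<open>Existence of the homomorphism\<close>

definition mono_class :: "(nat \<Rightarrow>\<^sub>0 nat) \<Rightarrow> (nat list \<Rightarrow>\<^sub>0 int poly)" where
  "mono_class m = qscale (Polynomial.monom 1 (Poly_Mapping.lookup m 0))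
     (finprod M (\<lambda>i. colc i [^]\<^bsub>M\<^esub> Poly_Mapping.lookup m i) {1..l})"

text \<open>Variables of index above \<open>l\<close> go to the unit, as \<open>mono_class\<close>
  multiplies over the indices from 1 to \<open>l\<close>; this makes the map additive and
  multiplicative on all polynomials.\<close>

definition eval_class :: "(nat, int) mpol \<Rightarrow> (nat list \<Rightarrow>\<^sub>0 int poly)" where
  "eval_class p = (\<Sum>m\<in>Poly_Mapping.keys p. qscale [:Poly_Mapping.lookup p m:] (mono_class m))"

lemma comm_monoid_M: "Group.comm_monoid M"
  by (rule cring.axioms(2)[OF cring])

lemma colc_pow_carrier: "colc i [^]\<^bsub>M\<^esub> (e::nat) \<in> carrier M"
  using monoid.nat_pow_closed[OF comm_monoid.axioms(1)[OF comm_monoid_M]] colc_carrier by simp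

lemma mono_class_carrier: "mono_class m \<in> qcarrier l k"
proof -
  have "finprod M (\<lambda>i. colc i [^]\<^bsub>M\<^esub> Poly_Mapping.lookup m i) {1..l} \<in> carrier M"
    by (rule comm_monoid.finprod_closed[OF comm_monoid_M]) (use colc_pow_carrier in auto)
  then show ?thesis unfolding mono_class_def by (simp add: qcarrier_qscale)
qed

lemma mono_class_add: "mono_class (m + m') = mono_class m \<odot> mono_class m'"
proof -
  let ?f = "\<lambda>m i. colc i [^]\<^bsub>M\<^esub> Poly_Mapping.lookup m i"
  have "finprod M (?f (m + m')) {1..l} = finprod M (\<lambda>i. ?f m i \<otimes>\<^bsub>M\<^esub> ?f m' i) {1..l}"
    using monoid.nat_pow_mult[OF comm_monoid.axioms(1)[OF comm_monoid_M]] colc_carrier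
    by (simp add: lookup_add)
  also have "\<dots> = finprod M (?f m) {1..l} \<odot> finprod M (?f m') {1..l}"
    by (subst comm_monoid.finprod_multf[OF comm_monoid_M]) (use colc_pow_carrier in \<open>auto simp: QH_mult\<close>)
  finally show ?thesis
    by (simp add: mono_class_def qmult_qscale lookup_add mult_monom add.commute)
qed

lemma mono_class_q: "mono_class (Poly_Mapping.single 0 e) = qscale (Polynomial.monom 1 e) qone"
proof -
  have "finprod M (\<lambda>i. colc i [^]\<^bsub>M\<^esub> Poly_Mapping.lookup (Poly_Mapping.single 0 e) i) {1..l} = \<one>\<^bsub>M\<^esub>"
    by (rule comm_monoid.finprod_one_eqI[OF comm_monoid_M]) (auto simp: lookup_single)
  then show ?thesis by (simp add: mono_class_def)
qed

lemma mono_class_c: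
  assumes "i \<in> {1..l}"
  shows "mono_class (Poly_Mapping.single i 1) = colc i"
proof -
  have mon: "monoid M" by (rule comm_monoid.axioms(1)[OF comm_monoid_M])
  have p0: "colc j [^]\<^bsub>M\<^esub> (0::nat) = \<one>\<^bsub>M\<^esub>" for j
    by (rule monoid.nat_pow_0[OF mon])
  have p1: "colc j [^]\<^bsub>M\<^esub> (1::nat) = colc j" for j
    using monoid.nat_pow_Suc[OF mon, of "colc j" 0] monoid.l_one[OF mon, of "colc j"] colc_carrier[of j]
    by (simp add: p0)
  have "finprod M (\<lambda>j. colc j [^]\<^bsub>M\<^esub> Poly_Mapping.lookup (Poly_Mapping.single i (1::nat)) j) {1..l}
      = finprod M (\<lambda>j. if i = j then colc j else \<one>\<^bsub>M\<^esub>) {1..l}"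
  proof (rule comm_monoid.finprod_cong'[OF comm_monoid_M refl])
    show "(\<lambda>j. if i = j then colc j else \<one>\<^bsub>M\<^esub>) \<in> {1..l} \<rightarrow> carrier M"
      using colc_carrier monoid.one_closed[OF mon] by auto
  next
    fix j
    show "colc j [^]\<^bsub>M\<^esub> Poly_Mapping.lookup (Poly_Mapping.single i (1::nat)) j
        = (if i = j then colc j else \<one>\<^bsub>M\<^esub>)"
      by (cases "i = j") (simp_all only: lookup_single when_simps p0 p1 if_True if_False simp_thms)
  qed
  also have "\<dots> = colc i"
    by (rule comm_monoid.finprod_singleton[OF comm_monoid_M]) (use assms colc_carrier in auto)
  finally show ?thesis using assms by (simp add: mono_class_def lookup_single One_nat_def[symmetric] del: One_nat_def)
qed

lemma eval_class_superset:
  assumes "finite S" "Poly_Mapping.keys p \<subseteq> S"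
  shows "eval_class p = (\<Sum>m\<in>S. qscale [:Poly_Mapping.lookup p m:] (mono_class m))"
  unfolding eval_class_def
  by (rule sum.mono_neutral_left) (use assms in \<open>auto simp: in_keys_iff\<close>)

lemma eval_class_0 [simp]: "eval_class 0 = 0"
  by (simp add: eval_class_def)

lemma eval_class_add: "eval_class (p + q) = eval_class p + eval_class q"
proof -
  let ?S = "Poly_Mapping.keys p \<union> Poly_Mapping.keys q"
  have "Poly_Mapping.keys (p + q) \<subseteq> ?S" by (rule keys_add)
  moreover have "[:a + b:] = [:a:] + [:b:]" for a b :: int by simp
  ultimately show ?thesis
    by (simp only: eval_class_superset[of ?S] finite_Un finite_keys Un_upper1 Un_upper2 simp_thms
        lookup_add qscale_add_left sum.distrib)
qed

lemma eval_class_single: "eval_class (Poly_Mapping.single m a) = qscale [:a:] (mono_class m)"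
  by (cases "a = 0") (simp_all add: eval_class_superset[of "{m}"])

lemma eval_class_sum: "eval_class (sum f A) = (\<Sum>a\<in>A. eval_class (f a))"
  by (rule additive_sum) (simp_all add: eval_class_add)

lemma eval_class_mult: "eval_class (p * q) = eval_class p \<odot> eval_class q"
  by (rule additive_mult_of_singles)
    (simp_all add: eval_class_add qmult_add eval_class_single mono_class_add qmult_qscale mult.commute)

lemma eval_class_carrier: "eval_class p \<in> qcarrier l k"
  unfolding eval_class_def by (intro qcarrier_sum qcarrier_qscale mono_class_carrier)

lemma eval_class_scale: "eval_class (Zq_embed f * x) = qscale f (eval_class x)"
proof -
  have "eval_class (Zq_embed f) = (\<Sum>i\<le>degree f. qscale ([:coeff f i:] * Polynomial.monom 1 i) qone)"
    by (subst Zq_embed_expand[OF order_refl]) (simp add: eval_class_sum eval_class_single mono_class_q)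
  also have "\<dots> = qscale (\<Sum>i\<le>degree f. Polynomial.monom (coeff f i) i) qone"
    by (simp add: qscale_sum_left smult_monom)
  also have "(\<Sum>i\<le>degree f. Polynomial.monom (coeff f i) i) = f"
    by (rule poly_as_sum_of_monoms)
  finally show ?thesis
    using qm_one(1)[OF eval_class_carrier] by (simp add: eval_class_mult qmult_qscale)
qed

lemma eval_class_chern_hom: "chern_hom T l k eval_class"
  unfolding chern_hom_def
proof (intro conjI ballI allI ring_hom_memI)
  show "eval_class \<one>\<^bsub>cq_ring l\<^esub> = \<one>\<^bsub>M\<^esub>"
    using eval_class_single[of 0 1] mono_class_q[of 0] by (simp add: one_pCons[symmetric])
next
  fix i assume i: "i \<in> {1..l}"
  then have "c_var l (int i) = Poly_Mapping.single (Poly_Mapping.single i 1) 1"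
    by (simp add: c_var_def mvar_def)
  then show "eval_class (c_var l (int i)) = cls (column l i)"
    using i mono_class_c[OF i] by (simp add: eval_class_single colc_def one_pCons[symmetric])
next
  fix f x
  show "eval_class (Zq_embed f * x) = qscale f (eval_class x)" by (rule eval_class_scale)
qed (simp_all add: eval_class_carrier eval_class_mult eval_class_add QH_mult)

theorem presentation:
  "(\<exists>\<phi>. chern_hom T l k \<phi>) \<and> (\<forall>\<phi>. chern_hom T l k \<phi> \<longrightarrow>
     \<phi> ` carrier (cq_ring l) = carrier (QH T l k) \<and>
     a_kernel (cq_ring l) (QH T l k) \<phi> = genideal (cq_ring l) (relations l k))"
  using eval_class_chern_hom phi_presentation by blast

end

text \<open>Subspaces are given as spans below, and their dimensions are read off from independent
  families; rewriting to the dimension of the spanning set would hide these spans.\<close>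

declare vec.dim_span [simp del]

section \<open>Points of projective space\<close>

lemma proj_point_self: "w \<in> proj_point w"
  unfolding proj_point_def by (auto intro: exI[of _ 1])

lemma proj_point_iff: "v \<in> proj_point w \<longleftrightarrow> (\<exists>c. c \<noteq> 0 \<and> v = (\<lambda>i. c * w i))"
  unfolding proj_point_def by auto

lemma proj_point_eq:
  assumes "v \<in> proj_point w"
  shows "proj_point v = proj_point w"
proof -
  obtain c where c: "c \<noteq> 0" "v = (\<lambda>i. c * w i)" using assms unfolding proj_point_iff by blast
  show ?thesis
  proof (rule Set.set_eqI)
    fix u
    have "(\<exists>d. d \<noteq> 0 \<and> u = (\<lambda>i. d * (c * w i))) \<longleftrightarrow> (\<exists>d. d \<noteq> 0 \<and> u = (\<lambda>i. d * w i))" (is "?L \<longleftrightarrow> ?R")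
    proof
      assume ?L
      then obtain d where "d \<noteq> 0" "u = (\<lambda>i. d * (c * w i))" by blast
      then show ?R using c(1) by (intro exI[of _ "d * c"]) (simp add: mult.assoc)
    next
      assume ?R
      then obtain d where "d \<noteq> 0" "u = (\<lambda>i. d * w i)" by blast
      then show ?L using c(1) by (intro exI[of _ "d / c"]) simp
    qed
    then show "u \<in> proj_point v \<longleftrightarrow> u \<in> proj_point w"
      unfolding proj_point_iff c(2) .
  qed
qed

lemma proj_space_rep:
  assumes "x \<in> proj_space I" "w \<in> x"
  shows "x = proj_point w" "w \<noteq> (\<lambda>_. 0)" "\<And>i. i \<notin> I \<Longrightarrow> w i = 0"
proof -
  obtain w0 where w0: "x = proj_point w0" "w0 \<noteq> (\<lambda>_. 0)" "\<forall>i. i \<notin> I \<longrightarrow> w0 i = 0"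
    using assms(1) unfolding proj_space_def by blast
  have "w \<in> proj_point w0" using assms(2) unfolding w0(1) .
  then show "x = proj_point w" unfolding w0(1) by (rule proj_point_eq[symmetric])
  obtain c where c: "c \<noteq> 0" "w = (\<lambda>i. c * w0 i)" using assms(2) unfolding w0(1) proj_point_iff by blast
  show "w \<noteq> (\<lambda>_. 0)" using c w0(2) by (simp add: fun_eq_iff)
  show "w i = 0" if "i \<notin> I" for i using c w0(3) that by simp
qed

lemma proj_space_nonempty: "x \<in> proj_space I \<Longrightarrow> \<exists>w. w \<in> x"
  unfolding proj_space_def using proj_point_self by blast

lemma proj_space_point: "w \<noteq> (\<lambda>_. 0) \<Longrightarrow> (\<And>i. i \<notin> I \<Longrightarrow> w i = 0) \<Longrightarrow> proj_point w \<in> proj_space I"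
  unfolding proj_space_def by blast

lemma proj_space_scalar:
  assumes "x \<in> proj_space I" "w \<in> x" "v \<in> x"
  shows "\<exists>c. c \<noteq> 0 \<and> v = (\<lambda>i. c * w i)"
  using proj_space_rep(1)[OF assms(1,2)] assms(3) by (simp add: proj_point_iff)

lemma proj_space_closed:
  assumes "x \<in> proj_space I" "w \<in> x" "c \<noteq> 0"
  shows "(\<lambda>i. c * w i) \<in> x"
  using proj_space_rep(1)[OF assms(1,2)] assms(3) proj_point_iff by blast

section \<open>Linear combinations of families of vectors\<close>

abbreviation lincomb :: "nat \<Rightarrow> (nat \<Rightarrow> 'n::{finite,linorder} cspace) \<Rightarrow> (nat \<Rightarrow> complex) \<Rightarrow> 'n cspace" where
  "lincomb r b x \<equiv> \<Sum>i<r. x i *s b i"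

abbreviation spn :: "nat \<Rightarrow> (nat \<Rightarrow> 'n::{finite,linorder} cspace) \<Rightarrow> 'n cspace set" where
  "spn r b \<equiv> vec.span (b ` {..<r})"

text \<open>Independence of an indexed family, so that a repeated vector makes it dependent; this
  matches the rows of a matrix.\<close>

definition indep :: "nat \<Rightarrow> (nat \<Rightarrow> 'n::{finite,linorder} cspace) \<Rightarrow> bool" where
  "indep r b \<longleftrightarrow> (\<forall>x. lincomb r b x = 0 \<longrightarrow> (\<forall>i<r. x i = 0))"

lemma indepD: "indep r b \<Longrightarrow> lincomb r b x = 0 \<Longrightarrow> i < r \<Longrightarrow> x i = 0"
  unfolding indep_def by blast

lemma spn_eq: "spn r b = range (lincomb r b)"
proof
  have "vec.subspace (range (lincomb r b))"
    unfolding vec.subspace_def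
  proof (intro conjI ballI allI)
    show "0 \<in> range (lincomb r b)" by (rule range_eqI[of _ _ "\<lambda>_. 0"]) simp
  next
    fix u v assume "u \<in> range (lincomb r b)" "v \<in> range (lincomb r b)"
    then obtain x y where "u = lincomb r b x" "v = lincomb r b y" by auto
    then show "u + v \<in> range (lincomb r b)"
      by (intro range_eqI[of _ _ "\<lambda>i. x i + y i"]) (simp add: vec.scale_left_distrib sum.distrib)
  next
    fix c u assume "u \<in> range (lincomb r b)"
    then obtain x where "u = lincomb r b x" by auto
    then show "c *s u \<in> range (lincomb r b)"
      by (intro range_eqI[of _ _ "\<lambda>i. c * x i"]) (simp add: vec.scale_sum_right)
  qed
  moreover have "b ` {..<r} \<subseteq> range (lincomb r b)"
  proof
    fix v assume "v \<in> b ` {..<r}"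
    then obtain i where i: "i < r" "v = b i" by auto
    have "lincomb r b (\<lambda>j. if j = i then 1 else 0) = (\<Sum>j<r. if j = i then b i else 0)"
      by (rule sum.cong) auto
    then have eq: "lincomb r b (\<lambda>j. if j = i then 1 else 0) = v" using i by simp
    have "lincomb r b (\<lambda>j. if j = i then 1 else 0) \<in> range (lincomb r b)" by (rule rangeI)
    then show "v \<in> range (lincomb r b)" unfolding eq .
  qed
  ultimately show "spn r b \<subseteq> range (lincomb r b)"
    by (intro vec.span_minimal)
next
  show "range (lincomb r b) \<subseteq> spn r b"
    unfolding image_subset_iff by (intro ballI vec.span_sum vec.span_scale vec.span_base) simp
qed

lemma spn_memE:
  assumes "v \<in> spn r b" obtains x where "v = lincomb r b x"
  using assms unfolding spn_eq by blast

lemma spn_memI: "lincomb r b x \<in> spn r b"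
  unfolding spn_eq by blast

lemma indep_imp:
  assumes "indep r b"
  shows "inj_on b {..<r}" "vec.independent (b ` {..<r})"
proof -
  show inj: "inj_on b {..<r}"
  proof (rule inj_onI, rule ccontr)
    fix i j assume ij: "i \<in> {..<r}" "j \<in> {..<r}" "b i = b j" "i \<noteq> j"
    let ?x = "\<lambda>m. (if m = i then 1 else 0) + (if m = j then - 1 else (0::complex))"
    have "lincomb r b ?x = (\<Sum>m<r. (if m = i then b i else 0)) + (\<Sum>m<r. (if m = j then - b j else 0))"
      unfolding sum.distrib[symmetric] by (rule sum.cong) (use ij in auto)
    also have "\<dots> = 0" using ij by simp
    finally have z: "lincomb r b ?x = 0" .
    have "?x i = 0" by (rule indepD[OF assms z, where i = i]) (use ij in simp)
    then show False using ij by simp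
  qed
  show "vec.independent (b ` {..<r})"
  proof (rule vec.independent_if_scalars_zero)
    fix f v assume s: "(\<Sum>v\<in>b ` {..<r}. f v *s v) = 0" and v: "v \<in> b ` {..<r}"
    have "lincomb r b (\<lambda>i. f (b i)) = 0"
      using s by (simp add: sum.reindex[OF inj])
    then show "f v = 0" using indepD[OF assms, of "\<lambda>i. f (b i)"] v by auto
  qed simp
qed

lemma indep_dim: "indep r b \<Longrightarrow> vec.dim (spn r b) = r"
  using indep_imp[of r b] vec.dim_span_eq_card_independent[of "b ` {..<r}"] card_image[of b "{..<r}"]
  by simp

lemma dim_spn_le: "vec.dim (spn r b) \<le> r"
proof -
  have "vec.dim (spn r b) \<le> card (b ` {..<r})" by (rule vec.dim_le_card) auto
  also have "\<dots> \<le> r" using card_image_le[of "{..<r}" b] by simp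
  finally show ?thesis .
qed

lemma dim_indep:
  assumes "vec.dim (spn r b) = r"
  shows "indep r b"
proof -
  have c: "card (b ` {..<r}) \<le> r" using card_image_le[of "{..<r}" b] by simp
  have ind: "vec.independent (b ` {..<r})"
    by (rule vec.card_le_dim_spanning[of _ "spn r b"]) (simp_all only: assms c vec.span_superset subset_refl finite_imageI finite_lessThan)
  then have "vec.dim (spn r b) = card (b ` {..<r})" by (rule vec.dim_span_eq_card_independent)
  then have inj: "inj_on b {..<r}" using assms by (intro eq_card_imp_inj_on) auto
  show ?thesis
    unfolding indep_def
  proof (intro allI impI)
    fix x i assume x: "lincomb r b x = 0" and i: "i < r"
    have "(\<Sum>v\<in>b ` {..<r}. x (inv_into {..<r} b v) *s v) = lincomb r b x"
      by (simp add: sum.reindex[OF inj] inv_into_f_f[OF inj])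
    then have "x (inv_into {..<r} b (b i)) = 0"
      using vec.independentD[OF ind, of "b ` {..<r}" "\<lambda>v. x (inv_into {..<r} b v)" "b i"] x i by auto
    then show "x i = 0" using i by (simp add: inv_into_f_f[OF inj])
  qed
qed

lemma Gr_iff: "V \<in> Gr l \<longleftrightarrow> vec.subspace V \<and> vec.dim V = l"
  by (simp add: Gr_def)

lemma indep_Gr: "indep l b \<Longrightarrow> spn l b \<in> Gr l"
  by (simp add: Gr_iff indep_dim)

lemma Gr_indep: "spn l b \<in> Gr l \<Longrightarrow> indep l b"
  by (simp add: Gr_iff dim_indep)

lemma subspace_indep_basis:
  assumes "vec.subspace V" "vec.dim V = r"
  shows "\<exists>b. indep r b \<and> V = spn r b"
proof -
  obtain B where B: "finite B" "vec.independent B" "vec.span B = V" "card B = r"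
    using vec.basis_subspace_exists[OF assms(1)] assms(2) by metis
  obtain f where "bij_betw f {..<r} B"
    using bij_betw_from_nat_into_finite[OF B(1)] B(4) by blast
  then have "V = spn r f" using B(3) by (simp add: bij_betw_def)
  moreover have "indep r f" by (rule dim_indep) (use \<open>V = spn r f\<close> assms(2) in simp)
  ultimately show ?thesis by blast
qed

lemma Gr_basis: "V \<in> Gr l \<Longrightarrow> \<exists>b. indep l b \<and> V = spn l b"
  unfolding Gr_iff by (rule subspace_indep_basis) auto

lemma indep_in_subspace:
  assumes "indep r b" "\<And>i. i < r \<Longrightarrow> b i \<in> V" "vec.subspace V" "vec.dim V = r"
  shows "V = spn r b"
proof -
  have "spn r b \<subseteq> V" by (rule vec.span_minimal) (use assms in auto)
  then show ?thesis
    using vec.subspace_dim_equal[of "spn r b" V] assms indep_dim[OF assms(1)] by auto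
qed

section \<open>Determinants and linear dependence\<close>

text \<open>The vectors of a family are the rows of its matrices, so the relations wanted are
  between rows, and the kernel criterion is applied to the transpose.\<close>

lemma det_zero_iff_relation:
  fixes M :: "nat \<Rightarrow> nat \<Rightarrow> complex"
  shows "Determinant.det (Matrix.mat a a (\<lambda>(i, j). M i j)) = 0 \<longleftrightarrow>
    (\<exists>x. (\<exists>i<a. x i \<noteq> 0) \<and> (\<forall>j<a. (\<Sum>i<a. x i * M i j) = 0))"
proof -
  let ?A = "Matrix.mat a a (\<lambda>(i, j). M i j)"
  have A: "transpose_mat ?A \<in> carrier_mat a a" by simp
  have mv: "vec_index (transpose_mat ?A *\<^sub>v v) j = (\<Sum>i<a. vec_index v i * M i j)"
    if "v \<in> carrier_vec a" "j < a" for v j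
    using that by (auto simp: scalar_prod_def atLeast0LessThan mult.commute intro!: sum.cong)
  have "Determinant.det ?A = 0 \<longleftrightarrow> Determinant.det (transpose_mat ?A) = 0"
    using det_transpose[of ?A a] by simp
  also have "\<dots> \<longleftrightarrow> (\<exists>v. v \<in> carrier_vec a \<and> v \<noteq> 0\<^sub>v a \<and> transpose_mat ?A *\<^sub>v v = 0\<^sub>v a)"
    by (rule det_0_iff_vec_prod_zero_field[OF A])
  also have "\<dots> \<longleftrightarrow> (\<exists>x. (\<exists>i<a. x i \<noteq> 0) \<and> (\<forall>j<a. (\<Sum>i<a. x i * M i j) = 0))" (is "?L \<longleftrightarrow> ?R")
  proof
    assume ?L
    then obtain v where v: "v \<in> carrier_vec a" "v \<noteq> 0\<^sub>v a" "transpose_mat ?A *\<^sub>v v = 0\<^sub>v a" by blast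
    have "\<exists>i<a. vec_index v i \<noteq> 0"
    proof (rule ccontr)
      assume "\<not> ?thesis"
      then have "v = 0\<^sub>v a" by (intro eq_vecI) (use v(1) in auto)
      then show False using v(2) by simp
    qed
    moreover have "(\<Sum>i<a. vec_index v i * M i j) = 0" if "j < a" for j
      unfolding mv[OF v(1) that, symmetric] v(3) using that by simp
    ultimately show ?R by blast
  next
    assume ?R
    then obtain x i where x: "i < a" "x i \<noteq> 0" "\<forall>j<a. (\<Sum>i<a. x i * M i j) = 0" by blast
    define v where "v = Matrix.vec a x"
    have v: "v \<in> carrier_vec a" by (simp add: v_def)
    have "transpose_mat ?A *\<^sub>v v = 0\<^sub>v a"
    proof (rule eq_vecI)
      fix j assume "j < dim_vec (0\<^sub>v a :: complex Matrix.vec)"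
      then have j: "j < a" by simp
      have "vec_index (transpose_mat ?A *\<^sub>v v) j = (\<Sum>i<a. x i * M i j)"
        unfolding mv[OF v j] by (rule sum.cong) (auto simp: v_def)
      then show "vec_index (transpose_mat ?A *\<^sub>v v) j = vec_index (0\<^sub>v a) j" using x(3) j by simp
    qed simp
    moreover have "v \<noteq> 0\<^sub>v a"
    proof
      assume "v = 0\<^sub>v a"
      then have "vec_index v i = 0" using x(1) by simp
      then show False using x by (simp add: v_def)
    qed
    ultimately show ?L using v by blast
  qed
  finally show ?thesis .
qed

definition enum_list :: "'n::{finite,linorder} itself \<Rightarrow> 'n list" where
  "enum_list _ = sorted_list_of_set UNIV"

lemma enum_list: "length (enum_list TYPE('n::{finite,linorder})) = CARD('n)"
  "distinct (enum_list TYPE('n))" "set (enum_list TYPE('n)) = UNIV"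
  by (simp_all add: enum_list_def)

definition fdet :: "(nat \<Rightarrow> 'n::{finite,linorder} cspace) \<Rightarrow> complex" where
  "fdet b = Determinant.det (Matrix.mat CARD('n) CARD('n) (\<lambda>(i, j). b i $ (enum_list TYPE('n) ! j)))"

lemma lincomb_nth: "lincomb r b x $ m = (\<Sum>i<r. x i * b i $ m)"
  by (simp add: sum_component)

lemma fdet_indep: "fdet (b :: nat \<Rightarrow> 'n::{finite,linorder} cspace) \<noteq> 0 \<longleftrightarrow> indep CARD('n) b"
proof -
  have "(\<forall>j<CARD('n). (\<Sum>i<CARD('n). x i * b i $ (enum_list TYPE('n) ! j)) = 0) \<longleftrightarrow> lincomb CARD('n) b x = 0" for x
  proof -
    have "(\<forall>j<CARD('n). (\<Sum>i<CARD('n). x i * b i $ (enum_list TYPE('n) ! j)) = 0)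
        \<longleftrightarrow> (\<forall>m\<in>set (enum_list TYPE('n)). (\<Sum>i<CARD('n). x i * b i $ m) = 0)"
      by (simp only: all_set_conv_all_nth enum_list(1))
    then show ?thesis by (simp add: enum_list(3) Finite_Cartesian_Product.vec_eq_iff sum_component)
  qed
  then have "fdet b = 0 \<longleftrightarrow> (\<exists>x. (\<exists>i<CARD('n). x i \<noteq> 0) \<and> lincomb CARD('n) b x = 0)"
    unfolding fdet_def det_zero_iff_relation by (simp only:)
  then show ?thesis unfolding indep_def by blast
qed

lemma polyfun_fdet:
  fixes c :: "'n::{finite,linorder} btriple \<Rightarrow> nat \<Rightarrow> 'n cspace"
  assumes "\<And>i m. i < CARD('n) \<Longrightarrow> polyfun (\<lambda>b. c b i $ m)"
  shows "polyfun (\<lambda>b. fdet (c b))"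
  unfolding fdet_def by (rule polyfun_det) (rule assms)

section \<open>Pluecker coordinates\<close>

lemma minors_zero_iff:
  assumes "card J = l"
  shows "minors l b J = 0 \<longleftrightarrow>
    (\<exists>x. (\<exists>i<l. x i \<noteq> 0) \<and> (\<forall>j<l. (\<Sum>i<l. x i * b i $ (sorted_list_of_set J ! j)) = 0))"
  using det_zero_iff_relation[of l "\<lambda>i j. b i $ (sorted_list_of_set J ! j)"] assms
  unfolding minors_def by (simp only: if_P[OF refl])

text \<open>Unlike \<open>minors\<close>, this takes the columns in a given order, so that single
  columns can be replaced.\<close>

definition minorsL :: "nat \<Rightarrow> (nat \<Rightarrow> 'n::{finite,linorder} cspace) \<Rightarrow> 'n list \<Rightarrow> complex" where
  "minorsL l b L = Determinant.det (Matrix.mat l l (\<lambda>(i, j). b i $ (L ! j)))"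

lemma minors_eq: "card J = l \<Longrightarrow> minors l b J = minorsL l b (sorted_list_of_set J)"
  by (simp add: minors_def minorsL_def)

lemma minors_support: "card J \<noteq> l \<Longrightarrow> minors l b J = 0"
  by (simp add: minors_def)

lemma minorsL_change:
  assumes "\<And>i. i < l \<Longrightarrow> b' i = lincomb l b (A i)"
  shows "minorsL l b' L = Determinant.det (Matrix.mat l l (\<lambda>(i, j). A i j)) * minorsL l b L"
proof -
  let ?A = "Matrix.mat l l (\<lambda>(i, j). A i j)" and ?B = "Matrix.mat l l (\<lambda>(i, j). b i $ (L ! j))"
  have "Matrix.mat l l (\<lambda>(i, j). b' i $ (L ! j)) = ?A * ?B"
    by (rule eq_matI) (auto simp: assms lincomb_nth scalar_prod_def atLeast0LessThan)
  then show ?thesis unfolding minorsL_def by (simp add: det_mult[of _ l])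
qed

lemma minors_change:
  assumes "\<And>i. i < l \<Longrightarrow> b' i = lincomb l b (A i)"
  shows "minors l b' J = Determinant.det (Matrix.mat l l (\<lambda>(i, j). A i j)) * minors l b J"
  using minorsL_change[of l b' A b, OF assms] by (cases "card J = l") (simp_all add: minors_eq minors_support)

text \<open>Complete the family to a basis by coordinate vectors; the remaining coordinates carry a
  nonzero minor.\<close>

lemma indep_minor_nonzero:
  fixes b :: "nat \<Rightarrow> 'n::{finite,linorder} cspace"
  assumes ind: "indep l b"
  shows "\<exists>J. card J = l \<and> minors l b J \<noteq> 0"
proof -
  let ?B = "b ` {..<l}" and ?ax = "\<lambda>i::'n. axis i (1::complex)"
  have indB: "vec.independent ?B" by (rule indep_imp(2)[OF ind])
  obtain C where C: "?B \<subseteq> C" "C \<subseteq> ?B \<union> range ?ax" "vec.independent C" "?B \<union> range ?ax \<subseteq> vec.span C"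
    using vec.maximal_independent_subset_extend[OF _ indB, of "?B \<union> range ?ax"] by blast
  have spanax: "vec.span (range ?ax) = UNIV"
    using span_cart_basis by (simp add: cart_basis_def full_SetCompr_eq)
  have "vec.span (range ?ax) \<subseteq> vec.span C"
    by (rule vec.span_minimal) (use C(4) vec.subspace_span in auto)
  then have spanC: "vec.span C = UNIV" using spanax by auto
  have finC: "finite C" using C(2) by (rule finite_subset) simp
  have cardC: "card C = CARD('n)"
    using vec.dim_span_eq_card_independent[OF C(3)] spanC vec_dim_card by metis
  have cardB: "card ?B = l" using card_image[OF indep_imp(1)[OF ind]] by simp
  define K where "K = {i. ?ax i \<in> C - ?B}"
  have injax: "inj ?ax" by (auto simp: inj_def axis_eq_axis)
  have imK: "?ax ` K = C - ?B" using C(2) by (auto simp: K_def)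
  have cardK: "card K = CARD('n) - l"
    using card_image[of ?ax K] imK card_Diff_subset[of ?B C] C(1) cardB cardC
    by (metis finite_imageI finite_lessThan inj_on_subset injax subset_UNIV)
  have lle: "l \<le> CARD('n)" using card_mono[OF finC C(1)] cardB cardC by simp
  define J where "J = - K"
  have cardJ: "card J = l" using cardK lle by (simp add: J_def Compl_eq_Diff_UNIV card_Diff_subset)
  have sums: "{x + y |x y. x \<in> vec.span ?B \<and> y \<in> vec.span (C - ?B)} = UNIV"
  proof -
    have "vec.span (?B \<union> (C - ?B)) = {x + y |x y. x \<in> vec.span ?B \<and> y \<in> vec.span (C - ?B)}"
      unfolding vec.span_Un by auto
    moreover have "?B \<union> (C - ?B) = C" using C(1) by auto
    ultimately show ?thesis using spanC by simp
  qed
  have "vec.dim (vec.span (C - ?B)) \<le> card (C - ?B)"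
    by (rule vec.dim_le_card) (use finC in auto)
  also have "\<dots> = CARD('n) - l" using card_Diff_subset[of ?B C] C(1) cardB cardC by simp
  finally have dimK: "vec.dim (vec.span (C - ?B)) \<le> CARD('n) - l" .
  have dimU: "vec.dim (UNIV :: 'n cspace set) = CARD('n)" by (rule vec_dim_card)
  have "vec.dim (vec.span ?B \<inter> vec.span (C - ?B)) = 0"
    using vec.dim_sums_Int[OF vec.subspace_span[of ?B] vec.subspace_span[of "C - ?B"]] dimK lle
    unfolding sums dimU indep_dim[OF ind] by linarith
  then have int0: "vec.span ?B \<inter> vec.span (C - ?B) \<subseteq> {0}" by (simp only: vec.dim_eq_0)
  have "minors l b J \<noteq> 0"
  proof
    assume "minors l b J = 0"
    then obtain x i where x: "i < l" "x i \<noteq> 0" "\<forall>j<l. (\<Sum>i<l. x i * b i $ (sorted_list_of_set J ! j)) = 0"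
      unfolding minors_zero_iff[OF cardJ] by auto
    \<comment> \<open>The rows of a vanishing minor are related. The corresponding combination
      vanishes on \<open>J\<close>, so it is spanned by the coordinate vectors of \<open>K\<close>
      and lies in both summands.\<close>
    let ?v = "lincomb l b x"
    have "length (sorted_list_of_set J) = l" using cardJ by simp
    then have "\<forall>m\<in>set (sorted_list_of_set J). (\<Sum>i<l. x i * b i $ m) = 0"
      unfolding all_set_conv_all_nth using x(3) by simp
    then have vJ: "?v $ m = 0" if "m \<in> J" for m using that by (simp add: lincomb_nth)
    have "?v = (\<Sum>m\<in>UNIV. ?v $ m *s ?ax m)" by (rule basis_expansion[symmetric])
    also have "\<dots> = (\<Sum>m\<in>K. ?v $ m *s ?ax m)"
      by (rule sum.mono_neutral_right) (use vJ in \<open>auto simp: J_def\<close>)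
    also have "\<dots> \<in> vec.span (C - ?B)"
      by (intro vec.span_sum vec.span_scale vec.span_base) (use imK in auto)
    finally have "?v \<in> vec.span (C - ?B)" .
    then have "?v = 0" using int0 spn_memI[where b = b and r = l and x = x] by auto
    then show False using indepD[OF ind] x by blast
  qed
  then show ?thesis using cardJ by blast
qed

lemma minors_nonzero_indep:
  assumes "minors l b J \<noteq> 0"
  shows "indep l b"
proof (rule ccontr)
  have cJ: "card J = l" using assms minors_support by blast
  assume "\<not> indep l b"
  then obtain x i where x: "lincomb l b x = 0" "i < l" "x i \<noteq> 0" unfolding indep_def by blast
  have z: "(\<Sum>i<l. x i * b i $ m) = 0" for m
    using arg_cong[OF x(1), of "\<lambda>v. v $ m"] by (simp add: lincomb_nth)
  have "minors l b J = 0"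
    unfolding minors_zero_iff[OF cJ] by (intro exI[of _ x] conjI exI[of _ i] allI impI x(2,3) z)
  then show False using assms by simp
qed

lemma spn_basis_change:
  assumes "indep l b" "spn l b' = spn l b"
  shows "\<exists>c. c \<noteq> 0 \<and> minors l b' = (\<lambda>J. c * minors l b J)"
proof -
  have "\<exists>x. b' i = lincomb l b x" if "i < l" for i
  proof -
    have "b' i \<in> spn l b'" by (rule vec.span_base) (use that in simp)
    then show ?thesis using assms(2) unfolding spn_eq by auto
  qed
  then obtain A where A: "\<And>i. i < l \<Longrightarrow> b' i = lincomb l b (A i)" by metis
  have eq: "minors l b' = (\<lambda>J. Determinant.det (Matrix.mat l l (\<lambda>(i, j). A i j)) * minors l b J)"
    by (rule ext) (rule minors_change[of l b' A b, OF A])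
  have "vec.dim (spn l b') = l" using assms indep_dim by simp
  then have "indep l b'" by (rule dim_indep)
  then obtain J where "minors l b' J \<noteq> 0" using indep_minor_nonzero by blast
  then have "Determinant.det (Matrix.mat l l (\<lambda>(i, j). A i j)) \<noteq> 0" unfolding eq by auto
  with eq show ?thesis by blast
qed

lemma scaled_basis:
  assumes "indep l b" "l \<ge> 1" "c \<noteq> 0"
  shows "\<exists>b'. spn l b' = spn l b \<and> minors l b' = (\<lambda>J. c * minors l b J)"
proof -
  define A where "A i j = (if i = j then (if i = 0 then c else 1) else (0::complex))" for i j :: nat
  define b' where "b' i = lincomb l b (A i)" for i
  have eq: "minors l b' J = Determinant.det (Matrix.mat l l (\<lambda>(i, j). A i j)) * minors l b J" for J
    by (rule minors_change) (simp add: b'_def)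
  have "Determinant.det (Matrix.mat l l (\<lambda>(i, j). A i j)) = prod_list (diag_mat (Matrix.mat l l (\<lambda>(i, j). A i j)))"
    by (rule det_upper_triangular[of _ l]) (auto simp: A_def)
  also have "\<dots> = (\<Prod>i\<in>{0..<l}. if i = 0 then c else 1)"
    by (auto simp: diag_mat_def prod.distinct_set_conv_list[symmetric] A_def intro!: prod.cong)
  also have "\<dots> = c" using assms(2) by simp
  finally have eq': "minors l b' = (\<lambda>J. c * minors l b J)" using eq by auto
  obtain J where "minors l b J \<noteq> 0" using indep_minor_nonzero[OF assms(1)] by blast
  then have "minors l b' J \<noteq> 0" using eq' assms(3) by simp
  then have "indep l b'" by (rule minors_nonzero_indep)
  then have "spn l b = spn l b'"
    by (rule indep_in_subspace) (use spn_memI indep_dim[OF assms(1)] in \<open>auto simp: b'_def\<close>)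
  then show ?thesis using eq' by blast
qed

lemma plucker_eq:
  assumes "indep l b" "l \<ge> 1"
  shows "plucker l (spn l b) = proj_point (minors l b)"
proof (rule Set.set_eqI)
  fix w
  show "w \<in> plucker l (spn l b) \<longleftrightarrow> w \<in> proj_point (minors l b)"
    unfolding plucker_def proj_point_iff
    using spn_basis_change[OF assms(1)] scaled_basis[OF assms] by (simp only: mem_Collect_eq) metis
qed

lemma plucker_proj_space:
  assumes "V \<in> Gr l" "l \<ge> 1"
  shows "plucker l V \<in> proj_space (plucker_index l)"
proof -
  obtain b where b: "indep l b" "V = spn l b" using Gr_basis[OF assms(1)] by blast
  obtain J where "minors l b J \<noteq> 0" using indep_minor_nonzero[OF b(1)] by blast
  then show ?thesis unfolding b(2) plucker_eq[OF b(1) assms(2)]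
    by (intro proj_space_point) (auto simp: minors_support)
qed

text \<open>Reordering the columns of a minor changes it by a sign that does not depend on the vectors.\<close>

lemma minorsL_sort:
  fixes L :: "'n::{finite,linorder} list"
  assumes "distinct L" "length L = l"
  shows "\<exists>\<epsilon>::complex. \<epsilon> \<noteq> 0 \<and> (\<forall>b. minorsL l b L = \<epsilon> * minors l b (set L))"
proof -
  let ?S = "sorted_list_of_set (set L)"
  have cardL: "card (set L) = l" using assms distinct_card by blast
  have lenS: "length ?S = l" using cardL by simp
  have "mset ?S = mset L"
    using assms(1) by (metis distinct_sorted_list_of_set finite_set set_eq_iff_mset_eq_distinct set_sorted_list_of_set)
  then obtain p where p: "p permutes {..<length ?S}" "permute_list p ?S = L"
    using mset_eq_permutation by metis
  have p': "p permutes {0..<l}" using p(1) lenS by (simp add: atLeast0LessThan)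
  have nth: "L ! j = ?S ! p j" if "j < l" for j
    using permute_list_nth[OF p(1), of j] p(2) lenS that by simp
  have "minorsL l b L = signof p * minors l b (set L)" for b :: "nat \<Rightarrow> 'n cspace"
  proof -
    let ?A = "Matrix.mat l l (\<lambda>(i, j). b j $ (?S ! i))"
    have "minorsL l b L = Determinant.det (transpose_mat (Matrix.mat l l (\<lambda>(i, j). b i $ (L ! j))))"
      unfolding minorsL_def by (subst det_transpose[of _ l]) auto
    also have "transpose_mat (Matrix.mat l l (\<lambda>(i, j). b i $ (L ! j))) = Matrix.mat l l (\<lambda>(i, j). ?A $$ (p i, j))"
      by (rule eq_matI) (use permutes_in_image[OF p'] in \<open>auto simp: nth\<close>)
    also have "Determinant.det \<dots> = signof p * Determinant.det ?A"
      by (rule det_permute_rows[OF _ p']) simp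
    also have "Determinant.det ?A = Determinant.det (transpose_mat ?A)"
      by (subst det_transpose[of _ l]) auto
    also have "transpose_mat ?A = Matrix.mat l l (\<lambda>(i, j). b i $ (?S ! j))"
      by (rule eq_matI) auto
    also have "Determinant.det \<dots> = minors l b (set L)"
      using cardL by (simp add: minors_def)
    finally show ?thesis .
  qed
  moreover have "(signof p :: complex) \<noteq> 0" by (simp add: sign_def)
  ultimately show ?thesis by blast
qed

text \<open>The rows describing a point of the standard affine chart of the Grassmannian where the
  Pluecker coordinate of \<open>L\<close> is nonzero; the entries outside \<open>L\<close> are the
  chart coordinates.\<close>

definition normalized :: "nat \<Rightarrow> 'n::{finite,linorder} list \<Rightarrow> (nat \<Rightarrow> 'n cspace) \<Rightarrow> bool" where
  "normalized l L b \<longleftrightarrow> (\<forall>i<l. \<forall>j<l. b i $ (L ! j) = (if i = j then 1 else 0))"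

text \<open>Cramer's rule for the identity matrix; thus each chart coordinate is a Pluecker
  coordinate up to sign.\<close>

lemma normalized_minor:
  assumes "normalized l L b" "length L = l" "i < l"
  shows "minorsL l b (L[i := m]) = b i $ m"
proof -
  let ?x = "Matrix.vec l (\<lambda>r. b r $ m)"
  have "Matrix.mat l l (\<lambda>(r, j). b r $ (L[i := m] ! j)) = replace_col (1\<^sub>m l) (1\<^sub>m l *\<^sub>v ?x) i"
    by (rule eq_matI) (use assms in \<open>auto simp: replace_col_def normalized_def nth_list_update\<close>)
  moreover have "Determinant.det (replace_col (1\<^sub>m l) (1\<^sub>m l *\<^sub>v ?x) i) = vec_index ?x i * Determinant.det (1\<^sub>m l)"
    by (rule cramer_lemma_mat) (use assms in auto)
  ultimately show ?thesis using assms by (simp add: minorsL_def)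
qed

lemma normalized_minor_id:
  assumes "normalized l L b"
  shows "minorsL l b L = 1"
proof -
  have "Matrix.mat l l (\<lambda>(i, j). b i $ (L ! j)) = 1\<^sub>m l"
    by (rule eq_matI) (use assms in \<open>auto simp: normalized_def\<close>)
  then show ?thesis by (simp add: minorsL_def)
qed

lemma normalized_minor2:
  assumes "normalized l L b" "length L = l" "i < l" "i' < l" "i \<noteq> i'" and nz: "b i $ m \<noteq> 0"
  shows "minorsL l b (L[i := m, i' := m']) = b i $ m * b i' $ m' - b i' $ m * b i $ m'"
proof -
  let ?A = "Matrix.mat l l (\<lambda>(r, j). b r $ (L[i := m] ! j))"
  \<comment> \<open>\<open>z\<close> solves the system with matrix \<open>?A\<close> and right side
    the column \<open>m'\<close>: row \<open>i\<close> has the pivot \<open>b i $ m\<close>, and the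
    other rows are those of the identity apart from column \<open>i\<close>. Cramer's rule then
    gives the minor.\<close>
  define z where "z r = (if r = i then b i $ m' / b i $ m else b r $ m' - b r $ m * (b i $ m' / b i $ m))" for r
  let ?z = "Matrix.vec l z"
  have A: "?A $$ (r, j) = (if j = i then b r $ m else if r = j then 1 else 0)" if "r < l" "j < l" for r j
    using assms that by (auto simp: normalized_def nth_list_update)
  have Az: "vec_index (?A *\<^sub>v ?z) r = b r $ m'" if r: "r < l" for r
  proof -
    have "vec_index (?A *\<^sub>v ?z) r = (\<Sum>j<l. ?A $$ (r, j) * z j)"
      using r by (simp add: scalar_prod_def atLeast0LessThan)
    also have "\<dots> = (\<Sum>j<l. (if j = i then b r $ m * z i else 0) + (if j = r \<and> r \<noteq> i then z r else 0))"
      by (rule sum.cong) (use r A in auto)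
    also have "\<dots> = b r $ m * z i + (if r \<noteq> i then z r else 0)"
      using r assms(3) by (cases "r = i") (simp_all add: sum.distrib)
    also have "\<dots> = b r $ m'" using nz by (simp add: z_def)
    finally show ?thesis .
  qed
  have "Matrix.mat l l (\<lambda>(r, j). b r $ (L[i := m, i' := m'] ! j)) = replace_col ?A (?A *\<^sub>v ?z) i'"
  proof (rule eq_matI)
    fix r j assume "r < dim_row (replace_col ?A (?A *\<^sub>v ?z) i')" "j < dim_col (replace_col ?A (?A *\<^sub>v ?z) i')"
    then have rj: "r < l" "j < l" by (auto simp: replace_col_def)
    show "Matrix.mat l l (\<lambda>(r, j). b r $ (L[i := m, i' := m'] ! j)) $$ (r, j) = replace_col ?A (?A *\<^sub>v ?z) i' $$ (r, j)"
      using rj Az[OF rj(1)] assms(2) unfolding replace_col_def by (cases "j = i'") auto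
  qed (auto simp: replace_col_def)
  moreover have "Determinant.det (replace_col ?A (?A *\<^sub>v ?z) i') = vec_index ?z i' * Determinant.det ?A"
    by (rule cramer_lemma_mat) (use assms in auto)
  moreover have "Determinant.det ?A = b i $ m"
    using normalized_minor[OF assms(1-3)] by (simp add: minorsL_def)
  ultimately have "minorsL l b (L[i := m, i' := m']) = z i' * b i $ m"
    using assms(4) by (simp add: minorsL_def)
  also have "\<dots> = b i $ m * b i' $ m' - b i' $ m * b i $ m'"
    using nz assms(5) by (simp add: z_def field_simps)
  finally show ?thesis .
qed

lemma normalized_basis_exists:
  assumes "minors l b J \<noteq> 0"
  shows "\<exists>b'. normalized l (sorted_list_of_set J) b' \<and> spn l b' = spn l b"
proof -
  let ?S = "sorted_list_of_set J"
  have cJ: "card J = l" using assms minors_support by blast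
  let ?M = "Matrix.mat l l (\<lambda>(i, j). b i $ (?S ! j))"
  have M: "?M \<in> carrier_mat l l" by simp
  have "Determinant.det ?M \<noteq> 0" using assms cJ by (simp add: minors_def)
  then have "?M \<in> Units (ring_mat TYPE(complex) l l)" by (rule det_non_zero_imp_unit[OF M])
  then obtain B where B: "B \<in> carrier_mat l l" "B * ?M = 1\<^sub>m l"
    unfolding Units_def by (auto simp: ring_mat_def)
  define b' where "b' i = lincomb l b (\<lambda>k. B $$ (i, k))" for i
  have "b' i $ (?S ! j) = (if i = j then 1 else 0)" if "i < l" "j < l" for i j
  proof -
    have "b' i $ (?S ! j) = (B * ?M) $$ (i, j)"
      using that B(1) by (simp add: b'_def lincomb_nth scalar_prod_def atLeast0LessThan)
    then show ?thesis using that unfolding B(2) by simp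
  qed
  then have n: "normalized l ?S b'" by (simp add: normalized_def)
  then have "minors l b' J \<noteq> 0" using normalized_minor_id[OF n] cJ by (simp add: minors_eq)
  then have "indep l b'" by (rule minors_nonzero_indep)
  then have "spn l b = spn l b'"
    by (rule indep_in_subspace)
      (use spn_memI indep_dim[OF minors_nonzero_indep[OF assms]] in \<open>auto simp: b'_def\<close>)
  with n show ?thesis by metis
qed

lemma plucker_normalized:
  assumes "V \<in> Gr l" "l \<ge> 1" "w \<in> plucker l V" "w J \<noteq> 0"
  shows "\<exists>b. normalized l (sorted_list_of_set J) b \<and> V = spn l b \<and> indep l b \<and> minors l b = (\<lambda>K. w K / w J)"
proof -
  obtain b where b: "V = spn l b" "w = minors l b" using assms(3) unfolding plucker_def by blast
  have ind: "indep l b" using assms(1) b(1) Gr_indep by blast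
  obtain b' where b': "normalized l (sorted_list_of_set J) b'" "spn l b' = spn l b"
    using normalized_basis_exists assms(4) b(2) by blast
  have ind': "indep l b'" using assms(1) Gr_indep[where b = b' and l = l] unfolding b(1) b'(2) by blast
  obtain c where c: "c \<noteq> 0" "minors l b' = (\<lambda>J. c * minors l b J)"
    using spn_basis_change[OF ind b'(2)] by blast
  have "card J = l" using assms(4) b(2) minors_support by blast
  then have "minors l b' J = 1" using normalized_minor_id[OF b'(1)] by (simp add: minors_eq)
  then have "c * w J = 1" using c(2) b(2) by metis
  then have "c = 1 / w J" using assms(4) by (simp add: field_simps)
  then have "minors l b' = (\<lambda>K. w K / w J)" using c(2) b(2) by simp
  then show ?thesis using b' b ind' by metis
qed

text \<open>The index set and the factor do not depend on the basis. Hence chart coordinates are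
  fixed linear functions of the Pluecker coordinates, which yields the injectivity of the embedding
  and, later, affine dependence along a line.\<close>

lemma normalized_coord:
  fixes J :: "'n::{finite,linorder} set"
  assumes "card J = l" "i < l" "m \<notin> J"
  shows "\<exists>K \<epsilon>. \<forall>b. normalized l (sorted_list_of_set J) b \<longrightarrow> b i $ m = \<epsilon> * minors l b K"
proof -
  let ?L = "(sorted_list_of_set J)[i := m]"
  have len: "length (sorted_list_of_set J) = l" using assms(1) by simp
  have "distinct ?L" by (rule distinct_list_update) (use assms(3) in auto)
  then obtain \<epsilon> where "\<And>b. minorsL l b ?L = \<epsilon> * minors l b (set ?L)"
    using minorsL_sort[of ?L l] len by auto
  then show ?thesis using normalized_minor[OF _ len assms(2)] by metis
qed

lemma normalized_unique:
  assumes "normalized l (sorted_list_of_set J) b" "normalized l (sorted_list_of_set J) b'" "card J = l"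
    "minors l b = minors l b'" "i < l"
  shows "b i = b' i"
proof -
  have "b i $ m = b' i $ m" for m
  proof (cases "m \<in> J")
    case True
    then obtain j where "j < l" "m = sorted_list_of_set J ! j"
      using assms(3) by (metis finite in_set_conv_nth set_sorted_list_of_set sorted_list_of_set.length_sorted_key_list_of_set)
    then show ?thesis using assms by (simp add: normalized_def)
  next
    case False
    then show ?thesis using normalized_coord[OF assms(3,5) False] assms by metis
  qed
  then show ?thesis by (simp add: Finite_Cartesian_Product.vec_eq_iff)
qed

lemma plucker_inj:
  assumes "V \<in> Gr l" "V' \<in> Gr l" "l \<ge> 1" "plucker l V = plucker l V'"
  shows "V = V'"
proof -
  obtain w where w: "w \<in> plucker l V"
    using proj_space_nonempty[OF plucker_proj_space[OF assms(1,3)]] by blast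
  have "w \<noteq> (\<lambda>_. 0)" using proj_space_rep(2)[OF plucker_proj_space[OF assms(1,3)] w] .
  then obtain J where J: "w J \<noteq> 0" by auto
  then have cJ: "card J = l" using proj_space_rep(3)[OF plucker_proj_space[OF assms(1,3)] w] by blast
  obtain b where b: "normalized l (sorted_list_of_set J) b" "V = spn l b" "minors l b = (\<lambda>K. w K / w J)"
    using plucker_normalized[OF assms(1,3) w J] by blast
  obtain b' where b': "normalized l (sorted_list_of_set J) b'" "V' = spn l b'" "minors l b' = (\<lambda>K. w K / w J)"
    using plucker_normalized[OF assms(2,3), of w J] w J assms(4) by auto
  have "b i = b' i" if "i < l" for i
    by (rule normalized_unique[OF b(1) b'(1) cJ _ that]) (simp add: b(3) b'(3))
  then have "b ` {..<l} = b' ` {..<l}" by auto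
  then show ?thesis using b(2) b'(2) by simp
qed

section \<open>The projective line\<close>

definition pv :: "complex \<Rightarrow> complex \<Rightarrow> nat \<Rightarrow> complex" where
  "pv s t = (\<lambda>i. if i = 0 then s else if i = 1 then t else 0)"

definition pt :: "complex \<Rightarrow> complex \<Rightarrow> nat ppoint" where
  "pt s t = proj_point (pv s t)"

lemma pv_simps [simp]: "pv s t 0 = s" "pv s t (Suc 0) = t"
  by (simp_all add: pv_def)

lemma pv_scale: "(\<lambda>i. c * pv s t i) = pv (c * s) (c * t)"
  by (auto simp: pv_def)

lemma pv_nonzero: "pv s t \<noteq> (\<lambda>_. 0) \<longleftrightarrow> s \<noteq> 0 \<or> t \<noteq> 0"
proof
  assume a: "pv s t \<noteq> (\<lambda>_. 0)"
  show "s \<noteq> 0 \<or> t \<noteq> 0"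
  proof (rule ccontr)
    assume "\<not> ?thesis"
    then have "pv s t = (\<lambda>_. 0)" by (intro ext) (simp add: pv_def)
    with a show False by simp
  qed
next
  assume a: "s \<noteq> 0 \<or> t \<noteq> 0"
  show "pv s t \<noteq> (\<lambda>_. 0)"
  proof
    assume "pv s t = (\<lambda>_. 0)"
    from fun_cong[OF this, of 0] fun_cong[OF this, of 1] a show False by simp
  qed
qed

lemma pt_P1: "s \<noteq> 0 \<or> t \<noteq> 0 \<Longrightarrow> pt s t \<in> P1"
proof -
  assume "s \<noteq> 0 \<or> t \<noteq> 0"
  then have "pv s t \<noteq> (\<lambda>_. 0)" by (simp only: pv_nonzero)
  then show ?thesis unfolding pt_def by (rule proj_space_point) (auto simp: pv_def)
qed

lemma mem_pt: "w \<in> pt s t \<longleftrightarrow> (\<exists>c. c \<noteq> 0 \<and> w = pv (c * s) (c * t))"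
  unfolding pt_def proj_point_iff pv_scale ..

lemma pv_mem_pt: "pv s t \<in> pt s t"
  unfolding pt_def by (rule proj_point_self)

lemma P1_vec:
  assumes "x \<in> P1" "w \<in> x"
  shows "w = pv (w 0) (w 1)" "x = pt (w 0) (w 1)" "w 0 \<noteq> 0 \<or> w 1 \<noteq> 0"
proof -
  show w: "w = pv (w 0) (w 1)"
  proof
    fix i
    show "w i = pv (w 0) (w 1) i"
      using proj_space_rep(3)[OF assms, of i] by (auto simp: pv_def)
  qed
  then show "x = pt (w 0) (w 1)"
    using proj_space_rep(1)[OF assms] unfolding pt_def by simp
  show "w 0 \<noteq> 0 \<or> w 1 \<noteq> 0"
    using proj_space_rep(2)[OF assms] w pv_nonzero by metis
qed

lemma P1_coords:
  assumes "x \<in> P1"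
  obtains s t where "x = pt s t" "s \<noteq> 0 \<or> t \<noteq> 0"
  using proj_space_nonempty[OF assms] P1_vec(2,3)[OF assms] by blast

lemma pt_scale: "c \<noteq> 0 \<Longrightarrow> pt (c * s) (c * t) = pt s t"
  unfolding pt_def by (rule proj_point_eq) (auto simp: proj_point_iff pv_scale[symmetric])

lemma P1_cases:
  assumes "x \<in> P1"
  obtains t where "x = pt 1 t" | "x = pt 0 1"
proof -
  obtain s t where x: "x = pt s t" "s \<noteq> 0 \<or> t \<noteq> 0" using P1_coords[OF assms] by blast
  show ?thesis
  proof (cases "s = 0")
    case True
    then have "x = pt 0 1" using x pt_scale[of t 0 1] by simp
    then show ?thesis using that by blast
  next
    case False
    then have "x = pt 1 (t / s)" using x pt_scale[of s 1 "t / s"] by simp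
    then show ?thesis using that by blast
  qed
qed

lemma pt_eqD: "pt s t = pt s' t' \<Longrightarrow> s * t' = s' * t"
proof -
  assume "pt s t = pt s' t'"
  then have "pv s t \<in> pt s' t'" using pv_mem_pt by metis
  then obtain c where c: "pv s t = pv (c * s') (c * t')" unfolding mem_pt by blast
  have "s = c * s'" "t = c * t'" using fun_cong[OF c, of 0] fun_cong[OF c, of 1] by simp_all
  then show ?thesis by simp
qed

lemma pt_eqI:
  assumes "s * t' = s' * t" "s \<noteq> 0 \<or> t \<noteq> 0" "s' \<noteq> 0 \<or> t' \<noteq> 0"
  shows "pt s t = pt s' t'"
proof (cases "s' = 0")
  case True
  then have "s = 0" "t' \<noteq> 0" "t \<noteq> 0" using assms by auto
  then show ?thesis using True pt_scale[of "t / t'" 0 t'] by simp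
next
  case False
  then have "s \<noteq> 0" using assms by auto
  then show ?thesis using pt_scale[of "s / s'" s' t'] False assms(1) by (simp add: field_simps)
qed

section \<open>Binary forms as univariate polynomials\<close>

text \<open>Dehomogenization: the variable with index 0 is set to 1.\<close>

definition uni :: "(nat, complex) mpol \<Rightarrow> complex poly" where
  "uni p = (\<Sum>m\<in>Poly_Mapping.keys p. Polynomial.monom (Poly_Mapping.lookup p m) (Poly_Mapping.lookup m 1))"

text \<open>For a form of degree \<open>e\<close> the value at the point [0 : 1] at infinity is the
  coefficient of t^e; the degree of \<open>uni p\<close> may be smaller than
  \<open>e\<close>.\<close>

lemma uni_facts:
  assumes p: "p \<in> mpols {..1}" and h: "homogeneous e p"
  shows "mpeval p (pv 1 t) = poly (uni p) t" "mpeval p (pv 0 1) = coeff (uni p) e"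
    "degree (uni p) \<le> e" "mpeval p (pv (c * s) (c * t)) = c ^ e * mpeval p (pv s t)"
proof -
  have sum_e: "Poly_Mapping.lookup m 0 + Poly_Mapping.lookup m 1 = e" if m: "m \<in> Poly_Mapping.keys p" for m
  proof -
    have "(\<Sum>v\<in>Poly_Mapping.keys m. Poly_Mapping.lookup m v) = (\<Sum>v\<in>{..1}. Poly_Mapping.lookup m v)"
      by (rule sum.mono_neutral_left) (use m p in \<open>auto simp: mpols_def in_keys_iff\<close>)
    then show ?thesis using h m by (simp add: homogeneous_def)
  qed
  have me: "mono_eval m (pv s t) = s ^ Poly_Mapping.lookup m 0 * t ^ Poly_Mapping.lookup m 1"
    if m: "m \<in> Poly_Mapping.keys p" for m s t
  proof -
    have "mono_eval m (pv s t) = (\<Prod>v\<in>{..1}. pv s t v ^ Poly_Mapping.lookup m v)"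
      by (rule mono_eval_superset) (use m p in \<open>auto simp: mpols_def\<close>)
    then show ?thesis by simp
  qed
  have ev: "mpeval p (pv s t) = (\<Sum>m\<in>Poly_Mapping.keys p. Poly_Mapping.lookup p m *
      (s ^ Poly_Mapping.lookup m 0 * t ^ Poly_Mapping.lookup m 1))" for s t
    unfolding mpeval_def mono_eval_def[symmetric] by (rule sum.cong) (simp_all add: me)
  show "mpeval p (pv 1 t) = poly (uni p) t"
    unfolding ev uni_def poly_sum by (rule sum.cong) (simp_all add: poly_monom)
  show "mpeval p (pv 0 1) = coeff (uni p) e"
    unfolding ev uni_def coeff_sum
  proof (rule sum.cong[OF refl])
    fix m assume "m \<in> Poly_Mapping.keys p"
    from sum_e[OF this]
    show "Poly_Mapping.lookup p m * (0 ^ Poly_Mapping.lookup m 0 * 1 ^ Poly_Mapping.lookup m 1)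
      = coeff (Polynomial.monom (Poly_Mapping.lookup p m) (Poly_Mapping.lookup m 1)) e"
      by (cases "Poly_Mapping.lookup m 0 = 0") auto
  qed
  show "degree (uni p) \<le> e"
    unfolding uni_def
  proof (rule degree_sum_le)
    fix m assume "m \<in> Poly_Mapping.keys p"
    from sum_e[OF this] have "Poly_Mapping.lookup m 1 \<le> e" by simp
    then show "degree (Polynomial.monom (Poly_Mapping.lookup p m) (Poly_Mapping.lookup m 1)) \<le> e"
      using degree_monom_le order_trans by blast
  qed simp
  show "mpeval p (pv (c * s) (c * t)) = c ^ e * mpeval p (pv s t)"
    unfolding ev sum_distrib_left
  proof (rule sum.cong[OF refl])
    fix m assume "m \<in> Poly_Mapping.keys p"
    from sum_e[OF this] have "c ^ e = c ^ Poly_Mapping.lookup m 0 * c ^ Poly_Mapping.lookup m 1"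
      by (simp add: power_add[symmetric])
    then show "Poly_Mapping.lookup p m * ((c * s) ^ Poly_Mapping.lookup m 0 * (c * t) ^ Poly_Mapping.lookup m 1)
      = c ^ e * (Poly_Mapping.lookup p m * (s ^ Poly_Mapping.lookup m 0 * t ^ Poly_Mapping.lookup m 1))"
      by (simp add: power_mult_distrib mult_ac)
  qed
qed

text \<open>Some form of the defining set does not vanish at \<open>x\<close>, and its
  dehomogenization is then a nonzero polynomial with finitely many roots.\<close>

lemma zariski_open_cofinite:
  assumes U: "zariski_open {..1} U" and x: "x \<in> U"
  shows "finite {t. pt 1 t \<notin> U}"
proof -
  obtain S where S: "S \<subseteq> mpols {..1}" "\<forall>g\<in>S. \<exists>e. homogeneous e g"
      "U = {x \<in> P1. \<exists>g\<in>S. \<forall>w\<in>x. mpeval g w \<noteq> 0}"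
    using U unfolding zariski_open_def by blast
  obtain g where g: "g \<in> S" "\<forall>w\<in>x. mpeval g w \<noteq> 0" and xP: "x \<in> P1" using x S(3) by blast
  obtain e where e: "homogeneous e g" using S(2) g(1) by blast
  have gm: "g \<in> mpols {..1}" using S(1) g(1) by blast
  note u = uni_facts[OF gm e]
  have "uni g \<noteq> 0"
  proof
    assume 0: "uni g = 0"
    show False
    proof (rule P1_cases[OF xP])
      fix t assume "x = pt 1 t"
      then have "mpeval g (pv 1 t) \<noteq> 0" using g(2) pv_mem_pt by metis
      then show False using u(1) 0 by simp
    next
      assume "x = pt 0 1"
      then have "mpeval g (pv 0 1) \<noteq> 0" using g(2) pv_mem_pt by metis
      then show False using u(2) 0 by simp
    qed
  qed
  then have "finite {t. poly (uni g) t = 0}" by (rule poly_roots_finite)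
  moreover have "{t. pt 1 t \<notin> U} \<subseteq> {t. poly (uni g) t = 0}"
  proof
    fix t assume t: "t \<in> {t. pt 1 t \<notin> U}"
    show "t \<in> {t. poly (uni g) t = 0}"
    proof (rule ccontr)
      assume nz: "t \<notin> {t. poly (uni g) t = 0}"
      have "mpeval g w \<noteq> 0" if "w \<in> pt 1 t" for w
      proof -
        obtain c where c: "c \<noteq> 0" "w = pv (c * 1) (c * t)" using \<open>w \<in> pt 1 t\<close> unfolding mem_pt by blast
        have "mpeval g w = c ^ e * poly (uni g) t"
          unfolding c(2) u(4) u(1) ..
        then show ?thesis using c(1) nz by simp
      qed
      then have "pt 1 t \<in> U" unfolding S(3) using g(1) pt_P1[of 1 t] by auto
      then show False using t by simp
    qed
  qed
  ultimately show ?thesis by (rule finite_subset[rotated])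
qed

section \<open>Regular maps from the projective line\<close>

definition vecp :: "'j set \<Rightarrow> ('j \<Rightarrow> complex poly) \<Rightarrow> complex \<Rightarrow> 'j \<Rightarrow> complex" where
  "vecp J Q t = (\<lambda>j. if j \<in> J then poly (Q j) t else 0)"

definition vecinf :: "'j set \<Rightarrow> ('j \<Rightarrow> complex poly) \<Rightarrow> nat \<Rightarrow> 'j \<Rightarrow> complex" where
  "vecinf J Q d = (\<lambda>j. if j \<in> J then coeff (Q j) d else 0)"

text \<open>A global description by forms of one degree \<open>d\<close>, written in the chart
  [1 : t]; the value at infinity consists of the coefficients of t^d.\<close>

definition represents ::
    "'j set \<Rightarrow> (nat ppoint \<Rightarrow> 'j ppoint) \<Rightarrow> ('j \<Rightarrow> complex poly) \<Rightarrow> nat \<Rightarrow> bool" where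
  "represents J F Q d \<longleftrightarrow> (\<forall>j\<in>J. degree (Q j) \<le> d) \<and> (\<forall>t. vecp J Q t \<in> F (pt 1 t)) \<and>
     vecinf J Q d \<in> F (pt 0 1)"

lemma regular_map_local:
  assumes F: "regular_map {..1} J F" and x: "x \<in> P1"
  obtains R e where "\<forall>j\<in>J. degree (R j) \<le> e" "finite {t. vecp J R t \<notin> F (pt 1 t)}"
    "\<And>t. x = pt 1 t \<Longrightarrow> vecp J R t \<in> F x" "x = pt 0 1 \<Longrightarrow> vecinf J R e \<in> F x"
proof -
  obtain U e P where U: "zariski_open {..1} U" "x \<in> U"
    and P: "\<forall>j\<in>J. P j \<in> mpols {..1} \<and> homogeneous e (P j)"
    and FP: "\<forall>y\<in>U. \<forall>w\<in>y. (\<lambda>j. if j \<in> J then mpeval (P j) w else 0) \<in> F y"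
    using F x unfolding regular_map_def by blast
  define R where "R j = uni (P j)" for j
  have vp: "(\<lambda>j. if j \<in> J then mpeval (P j) (pv 1 t) else 0) = vecp J R t" for t
    unfolding vecp_def R_def using uni_facts(1) P by fastforce
  have vi: "(\<lambda>j. if j \<in> J then mpeval (P j) (pv 0 1) else 0) = vecinf J R e"
    unfolding vecinf_def R_def using uni_facts(2) P by fastforce
  have in1: "vecp J R t \<in> F (pt 1 t)" if "pt 1 t \<in> U" for t
    unfolding vp[symmetric] using FP that pv_mem_pt by blast
  show ?thesis
  proof (rule that)
    show "\<forall>j\<in>J. degree (R j) \<le> e" unfolding R_def using uni_facts(3) P by blast
    show "finite {t. vecp J R t \<notin> F (pt 1 t)}"
      by (rule finite_subset[OF _ zariski_open_cofinite[OF U]]) (use in1 in blast)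
    show "vecp J R t \<in> F x" if "x = pt 1 t" for t using in1[of t] U(2) that by simp
    show "vecinf J R e \<in> F x" if "x = pt 0 1"
      unfolding vi[symmetric] using FP U(2) that pv_mem_pt by blast
  qed
qed

lemma poly_cofinite_zero:
  fixes p :: "complex poly"
  assumes "finite {t. poly p t \<noteq> 0}"
  shows "p = 0"
proof (rule ccontr)
  assume "p \<noteq> 0"
  then have "finite {t. poly p t = 0}" by (rule poly_roots_finite)
  with assms have "finite ({t. poly p t \<noteq> 0} \<union> {t. poly p t = 0})" by (rule finite_UnI)
  moreover have "{t. poly p t \<noteq> 0} \<union> {t. poly p t = 0} = UNIV" by auto
  ultimately show False using infinite_UNIV_char_0[where 'a = complex] by simp
qed

lemma coeff_mult_bounds:
  fixes p q :: "'a::comm_ring_1 poly"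
  assumes "degree p \<le> d" "degree q \<le> e"
  shows "coeff (p * q) (d + e) = coeff p d * coeff q e"
proof -
  have "coeff (p * q) (d + e) = (\<Sum>i\<le>d + e. coeff p i * coeff q (d + e - i))"
    by (rule coeff_mult)
  also have "\<dots> = (\<Sum>i\<in>{d}. coeff p i * coeff q (d + e - i))"
  proof (rule sum.mono_neutral_right)
    show "\<forall>i\<in>{..d + e} - {d}. coeff p i * coeff q (d + e - i) = 0"
    proof
      fix i assume i: "i \<in> {..d + e} - {d}"
      show "coeff p i * coeff q (d + e - i) = 0"
      proof (cases "i > d")
        case True
        then have "coeff p i = 0" using assms(1) by (intro coeff_eq_0) simp
        then show ?thesis by simp
      next
        case False
        then have "coeff q (d + e - i) = 0" using assms(2) i by (intro coeff_eq_0) auto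
        then show ?thesis by simp
      qed
    qed
  qed auto
  finally show ?thesis by simp
qed

text \<open>A local representation of minimal degree has no common zeros and is valid everywhere.\<close>

lemma regular_map_represents:
  fixes F :: "nat ppoint \<Rightarrow> 'j ppoint"
  assumes F: "regular_map {..1} J F"
  shows "\<exists>Q d. represents J F Q d"
proof -
  have FJ: "F x \<in> proj_space J" if "x \<in> P1" for x
    using F that unfolding regular_map_def by blast
  have F1: "F (pt 1 t) \<in> proj_space J" for t by (rule FJ, rule pt_P1) simp
  \<comment> \<open>Descriptions that may fail at finitely many points; every local description of
    the map is one of them.\<close>
  define Fam where "Fam d Q \<longleftrightarrow> (\<forall>j\<in>J. degree (Q j) \<le> d) \<and> finite {t. vecp J Q t \<notin> F (pt 1 t)}"
    for d and Q :: "'j \<Rightarrow> complex poly"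
  obtain R0 e0 where "Fam e0 R0"
    using regular_map_local[OF F pt_P1[of 1 0]] unfolding Fam_def by (metis one_neq_zero)
  then have ex: "\<exists>d. \<exists>Q. Fam d Q" by blast
  define d where "d = (LEAST d. \<exists>Q. Fam d Q)"
  have "\<exists>Q. Fam d Q" unfolding d_def by (rule LeastI_ex[OF ex])
  then obtain Q where Q: "Fam d Q" by blast
  have minimal: "\<not> Fam d' Q'" if "d' < d" for d' Q'
    using not_less_Least[of d' "\<lambda>d. \<exists>Q. Fam d Q"] that unfolding d_def by blast
  have deg: "degree (Q j) \<le> d" if "j \<in> J" for j using Q that unfolding Fam_def by blast
  have fin: "finite {t. vecp J Q t \<notin> F (pt 1 t)}" using Q unfolding Fam_def by blast
  have nz: "\<exists>j\<in>J. Q j \<noteq> 0"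
  proof (rule ccontr)
    assume a: "\<not> ?thesis"
    obtain t where t: "vecp J Q t \<in> F (pt 1 t)"
      using ex_new_if_finite[OF infinite_UNIV_char_0 fin] by blast
    have "vecp J Q t = (\<lambda>_. 0)" using a by (auto simp: vecp_def)
    then show False using proj_space_rep(2)[OF F1 t] by simp
  qed
  have no_common: "\<exists>j\<in>J. poly (Q j) t \<noteq> 0" for t
  proof (rule ccontr)
    assume a: "\<not> ?thesis"
    have "\<exists>q. Q j = [:- t, 1:] * q" if "j \<in> J" for j
      using a that poly_eq_0_iff_dvd[of "Q j" t] unfolding dvd_def by blast
    then obtain Q' where Q': "\<And>j. j \<in> J \<Longrightarrow> Q j = [:- t, 1:] * Q' j" by metis
    have dQ': "degree (Q' j) \<le> d - 1" if "j \<in> J" for j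
    proof (cases "Q' j = 0")
      case False
      then have "degree (Q j) = 1 + degree (Q' j)"
        unfolding Q'[OF that] by (subst degree_mult_eq) auto
      then show ?thesis using deg[OF that] by simp
    qed simp
    have d1: "d \<ge> 1"
    proof -
      obtain j where j: "j \<in> J" "Q j \<noteq> 0" using nz by blast
      then have "Q' j \<noteq> 0" using Q'[OF j(1)] by auto
      then have "degree (Q j) = 1 + degree (Q' j)"
        unfolding Q'[OF j(1)] by (subst degree_mult_eq) auto
      then show ?thesis using deg[OF j(1)] by simp
    qed
    have "{s. vecp J Q' s \<notin> F (pt 1 s)} \<subseteq> insert t {s. vecp J Q s \<notin> F (pt 1 s)}"
    proof
      fix s assume s: "s \<in> {s. vecp J Q' s \<notin> F (pt 1 s)}"
      show "s \<in> insert t {s. vecp J Q s \<notin> F (pt 1 s)}"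
      proof (rule ccontr)
        assume b: "s \<notin> insert t {s. vecp J Q s \<notin> F (pt 1 s)}"
        then have st: "s \<noteq> t" and "vecp J Q s \<in> F (pt 1 s)" by auto
        then have "(\<lambda>j. (1 / (s - t)) * vecp J Q s j) \<in> F (pt 1 s)"
          by (intro proj_space_closed[OF F1]) auto
        moreover have "(\<lambda>j. (1 / (s - t)) * vecp J Q s j) = vecp J Q' s"
        proof
          fix j
          have "(1 / (s - t)) * poly (Q j) s = poly (Q' j) s" if "j \<in> J"
          proof -
            have "poly (Q j) s = (s - t) * poly (Q' j) s" unfolding Q'[OF that] by (simp add: algebra_simps)
            then show ?thesis using st by simp
          qed
          then show "(1 / (s - t)) * vecp J Q s j = vecp J Q' s j" by (simp add: vecp_def)
        qed
        ultimately show False using s by simp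
      qed
    qed
    then have "Fam (d - 1) Q'" unfolding Fam_def using dQ' fin finite_subset by blast
    then show False using minimal[of "d - 1"] d1 by simp
  qed
  have no_inf: "\<exists>j\<in>J. coeff (Q j) d \<noteq> 0"
  proof (rule ccontr)
    assume a: "\<not> ?thesis"
    obtain j where j: "j \<in> J" "Q j \<noteq> 0" using nz by blast
    have lt: "degree (Q i) < d" if "i \<in> J" "Q i \<noteq> 0" for i
    proof -
      have "degree (Q i) \<noteq> d" using a that leading_coeff_neq_0[OF that(2)] by metis
      then show ?thesis using deg[OF that(1)] by simp
    qed
    have "degree (Q i) \<le> d - 1" if "i \<in> J" for i
      using lt[OF that] by (cases "Q i = 0") auto
    then have "Fam (d - 1) Q" unfolding Fam_def using fin by blast
    then show False using minimal[of "d - 1"] lt[OF j] by simp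
  qed
  \<comment> \<open>Two descriptions valid at almost all points are proportional there, hence
    proportional as polynomials. In this way a local description around any point, infinity
    included, is compared with the minimal one.\<close>
  have cross: "Q i * R j = Q j * R i"
    if R: "finite {t. vecp J R t \<notin> F (pt 1 t)}" and ij: "i \<in> J" "j \<in> J" for R i j
  proof -
    have "{t. poly (Q i * R j - Q j * R i) t \<noteq> 0}
        \<subseteq> {t. vecp J R t \<notin> F (pt 1 t)} \<union> {t. vecp J Q t \<notin> F (pt 1 t)}"
    proof (rule subsetI, rule ccontr)
      fix t assume t: "t \<in> {t. poly (Q i * R j - Q j * R i) t \<noteq> 0}"
        "t \<notin> {t. vecp J R t \<notin> F (pt 1 t)} \<union> {t. vecp J Q t \<notin> F (pt 1 t)}"
      then have "vecp J Q t \<in> F (pt 1 t)" "vecp J R t \<in> F (pt 1 t)" by auto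
      then obtain c where c: "vecp J R t = (\<lambda>i. c * vecp J Q t i)"
        using proj_space_scalar[OF F1] by blast
      have "poly (R i) t = c * poly (Q i) t" "poly (R j) t = c * poly (Q j) t"
        using fun_cong[OF c, of i] fun_cong[OF c, of j] ij by (simp_all add: vecp_def)
      then show False using t(1) by simp
    qed
    then have "finite {t. poly (Q i * R j - Q j * R i) t \<noteq> 0}"
      using R fin finite_subset finite_UnI by blast
    then have "Q i * R j - Q j * R i = 0" by (rule poly_cofinite_zero)
    then show ?thesis by simp
  qed
  have "vecp J Q t \<in> F (pt 1 t)" for t
  proof -
    have P: "pt 1 t \<in> P1" by (rule pt_P1) simp
    obtain R e where R: "finite {t. vecp J R t \<notin> F (pt 1 t)}" "\<And>t'. pt 1 t = pt 1 t' \<Longrightarrow> vecp J R t' \<in> F (pt 1 t)"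
      using regular_map_local[OF F P] by metis
    have v: "vecp J R t \<in> F (pt 1 t)" by (rule R(2)) simp
    obtain j0 where j0: "vecp J R t j0 \<noteq> 0" using proj_space_rep(2)[OF F1 v] by auto
    then have j0J: "j0 \<in> J" "poly (R j0) t \<noteq> 0" by (auto simp: vecp_def split: if_splits)
    define c where "c = poly (Q j0) t / poly (R j0) t"
    have eq: "poly (Q i) t = c * poly (R i) t" if "i \<in> J" for i
    proof -
      have "poly (Q i) t * poly (R j0) t = poly (Q j0) t * poly (R i) t"
        using arg_cong[OF cross[OF R(1) that j0J(1)], of "\<lambda>p. poly p t"] by simp
      then show ?thesis using j0J(2) by (simp add: c_def field_simps)
    qed
    have "c \<noteq> 0" using no_common[of t] eq by auto
    then have "(\<lambda>i. c * vecp J R t i) \<in> F (pt 1 t)" by (rule proj_space_closed[OF F1 v])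
    moreover have "(\<lambda>i. c * vecp J R t i) = vecp J Q t" using eq by (auto simp: vecp_def)
    ultimately show ?thesis by simp
  qed
  moreover have "vecinf J Q d \<in> F (pt 0 1)"
  proof -
    have P: "pt 0 1 \<in> P1" by (rule pt_P1) simp
    have F0: "F (pt 0 1) \<in> proj_space J" by (rule FJ[OF P])
    obtain R e where R: "\<forall>j\<in>J. degree (R j) \<le> e" "finite {t. vecp J R t \<notin> F (pt 1 t)}"
        "pt 0 1 = pt 0 1 \<Longrightarrow> vecinf J R e \<in> F (pt 0 1)"
      using regular_map_local[OF F P] by metis
    have v: "vecinf J R e \<in> F (pt 0 1)" by (rule R(3)) simp
    obtain j0 where j0: "vecinf J R e j0 \<noteq> 0" using proj_space_rep(2)[OF F0 v] by auto
    then have j0J: "j0 \<in> J" "coeff (R j0) e \<noteq> 0" by (auto simp: vecinf_def split: if_splits)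
    define c where "c = coeff (Q j0) d / coeff (R j0) e"
    have eq: "coeff (Q i) d = c * coeff (R i) e" if "i \<in> J" for i
    proof -
      have "coeff (Q i * R j0) (d + e) = coeff (Q j0 * R i) (d + e)"
        using cross[OF R(2) that j0J(1)] by simp
      then have "coeff (Q i) d * coeff (R j0) e = coeff (Q j0) d * coeff (R i) e"
        using coeff_mult_bounds[OF deg[OF that]] coeff_mult_bounds[OF deg[OF j0J(1)]] R(1) that j0J(1)
        by simp
      then show ?thesis using j0J(2) by (simp add: c_def field_simps)
    qed
    have "c \<noteq> 0" using no_inf eq by auto
    then have "(\<lambda>i. c * vecinf J R e i) \<in> F (pt 0 1)" by (rule proj_space_closed[OF F0 v])
    moreover have "(\<lambda>i. c * vecinf J R e i) = vecinf J Q d" using eq by (auto simp: vecinf_def)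
    ultimately show ?thesis by simp
  qed
  ultimately have "represents J F Q d" unfolding represents_def using deg by blast
  then show ?thesis by blast
qed

section \<open>Degrees\<close>

definition linform :: "'j set \<Rightarrow> ('j \<Rightarrow> complex) \<Rightarrow> ('j, complex) mpol" where
  "linform J c = (\<Sum>j\<in>J. Poly_Mapping.single (Poly_Mapping.single j 1) (c j))"

lemma mpeval_linform: "mpeval (linform J c) a = (\<Sum>j\<in>J. c j * a j)"
  unfolding linform_def mpeval_sum by simp

lemma linform_mpols: "linform J c \<in> mpols J"
  unfolding linform_def by (intro mpols_sum mpols_single) auto

lemma linform_nonzero:
  assumes "finite J" "j \<in> J" "c j \<noteq> 0"
  shows "linform J c \<noteq> 0"
proof
  assume 0: "linform J c = 0"
  have "mpeval (linform J c) (\<lambda>i. if i = j then 1 else 0) = (\<Sum>i\<in>J. if i = j then c j else 0)"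
    unfolding mpeval_linform by (rule sum.cong) auto
  also have "\<dots> = c j" using assms(1,2) by simp
  finally show False using assms(3) 0 by simp
qed

text \<open>The pullback of the linear form with coefficients \<open>a\<close> to the chart [1 : t];
  its zeros are the parameters mapped into the hyperplane.\<close>

definition comb :: "'j set \<Rightarrow> ('j \<Rightarrow> complex poly) \<Rightarrow> ('j \<Rightarrow> complex) \<Rightarrow> complex poly" where
  "comb J Q a = (\<Sum>j\<in>J. smult (a j) (Q j))"

lemma poly_comb: "poly (comb J Q a) t = (\<Sum>j\<in>J. a j * vecp J Q t j)"
  unfolding comb_def poly_sum by (rule sum.cong) (auto simp: vecp_def)

lemma coeff_comb: "coeff (comb J Q a) d = (\<Sum>j\<in>J. a j * vecinf J Q d j)"
  unfolding comb_def coeff_sum by (rule sum.cong) (auto simp: vecinf_def)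

lemma degree_comb: "finite J \<Longrightarrow> \<forall>j\<in>J. degree (Q j) \<le> d \<Longrightarrow> degree (comb J Q a) \<le> d"
  unfolding comb_def by (intro degree_sum_le) (auto intro: order_trans[OF degree_smult_le])

lemma hyperplane_iff:
  assumes "y \<in> proj_space J" "w \<in> y"
  shows "y \<in> hyperplane J a \<longleftrightarrow> (\<Sum>j\<in>J. a j * w j) = 0"
proof
  assume "y \<in> hyperplane J a"
  then show "(\<Sum>j\<in>J. a j * w j) = 0" using assms(2) by (simp add: hyperplane_def)
next
  assume 0: "(\<Sum>j\<in>J. a j * w j) = 0"
  have "(\<Sum>j\<in>J. a j * v j) = 0" if v: "v \<in> y" for v
  proof -
    obtain c where c: "v = (\<lambda>i. c * w i)" using proj_space_scalar[OF assms v] by blast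
    have "(\<Sum>j\<in>J. a j * v j) = c * (\<Sum>j\<in>J. a j * w j)"
      unfolding c sum_distrib_left by (rule sum.cong) auto
    then show ?thesis using 0 by simp
  qed
  then show "y \<in> hyperplane J a" using assms(1) by (simp add: hyperplane_def)
qed

lemma represents_hyperplane:
  assumes rep: "represents J F Q d" and F: "regular_map {..1} J F"
  shows "F (pt 1 t) \<in> hyperplane J a \<longleftrightarrow> poly (comb J Q a) t = 0"
    "F (pt 0 1) \<in> hyperplane J a \<longleftrightarrow> coeff (comb J Q a) d = 0"
proof -
  have FJ: "F x \<in> proj_space J" if "x \<in> P1" for x
    using F that unfolding regular_map_def by blast
  show "F (pt 1 t) \<in> hyperplane J a \<longleftrightarrow> poly (comb J Q a) t = 0"
    unfolding poly_comb by (rule hyperplane_iff) (use rep FJ[OF pt_P1] in \<open>auto simp: represents_def\<close>)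
  show "F (pt 0 1) \<in> hyperplane J a \<longleftrightarrow> coeff (comb J Q a) d = 0"
    unfolding coeff_comb by (rule hyperplane_iff) (use rep FJ[OF pt_P1] in \<open>auto simp: represents_def\<close>)
qed

lemma represents_nonzero:
  assumes rep: "represents J F Q d" and F: "regular_map {..1} J F"
  shows "\<exists>j\<in>J. vecp J Q t j \<noteq> 0" "\<exists>j\<in>J. vecinf J Q d j \<noteq> 0"
proof -
  have FJ: "F x \<in> proj_space J" if "x \<in> P1" for x
    using F that unfolding regular_map_def by blast
  have "vecp J Q t \<noteq> (\<lambda>_. 0)"
    using proj_space_rep(2)[OF FJ[OF pt_P1[of 1 t]]] rep by (auto simp: represents_def)
  then obtain j where "vecp J Q t j \<noteq> 0" by blast
  then show "\<exists>j\<in>J. vecp J Q t j \<noteq> 0" by (intro bexI[of _ j]) (auto simp: vecp_def split: if_splits)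
  have "vecinf J Q d \<noteq> (\<lambda>_. 0)"
    using proj_space_rep(2)[OF FJ[OF pt_P1[of 0 1]]] rep by (auto simp: represents_def)
  then obtain j where "vecinf J Q d j \<noteq> 0" by blast
  then show "\<exists>j\<in>J. vecinf J Q d j \<noteq> 0" by (intro bexI[of _ j]) (auto simp: vecinf_def split: if_splits)
qed

text \<open>The general coefficient vectors of hyperplanes, made to avoid in addition the point at
  infinity.\<close>

lemma has_degree_generic:
  assumes rep: "represents J F Q d" and F: "regular_map {..1} J F" and J: "finite J"
    and deg: "has_degree J F m"
  obtains g where "g \<noteq> 0" "\<And>a. mpeval g a \<noteq> 0 \<Longrightarrow> coeff (comb J Q a) d \<noteq> 0 \<and> degree (comb J Q a) = d \<and>
      finite {t. poly (comb J Q a) t = 0} \<and> card {t. poly (comb J Q a) t = 0} = m"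
proof -
  obtain g where g: "g \<noteq> 0" "\<And>a. (\<exists>j\<in>J. a j \<noteq> 0) \<Longrightarrow> mpeval g a \<noteq> 0 \<Longrightarrow>
      finite {x \<in> P1. F x \<in> hyperplane J a} \<and> card {x \<in> P1. F x \<in> hyperplane J a} = m"
    using deg unfolding has_degree_def by blast
  obtain j0 where j0: "j0 \<in> J" "vecinf J Q d j0 \<noteq> 0" using represents_nonzero(2)[OF rep F] by blast
  let ?g = "g * linform J (vecinf J Q d)"
  show ?thesis
  proof (rule that[of ?g])
    show "?g \<noteq> 0"
      using mpol_mult_nonzero[OF g(1) linform_nonzero[of J j0 "vecinf J Q d"]] J j0 by blast
  next
    fix a assume "mpeval ?g a \<noteq> 0"
    then have a: "mpeval g a \<noteq> 0" "(\<Sum>j\<in>J. vecinf J Q d j * a j) \<noteq> 0"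
      unfolding mpeval_mult mpeval_linform by simp_all
    have c: "coeff (comb J Q a) d \<noteq> 0"
      using a(2) unfolding coeff_comb by (simp add: mult.commute)
    have "\<exists>j\<in>J. a j \<noteq> 0"
    proof (rule ccontr)
      assume "\<not> ?thesis"
      then have "(\<Sum>j\<in>J. vecinf J Q d j * a j) = 0" by (intro sum.neutral) simp
      with a(2) show False by simp
    qed
    note fin = g(2)[OF this a(1)]
    have eq: "{x \<in> P1. F x \<in> hyperplane J a} = pt 1 ` {t. poly (comb J Q a) t = 0}" (is "?X = ?Y")
    proof (rule Set.set_eqI, rule iffI)
      fix x assume "x \<in> ?X"
      then have x: "x \<in> P1" "F x \<in> hyperplane J a" by auto
      show "x \<in> ?Y"
      proof (rule P1_cases[OF x(1)])
        fix t assume "x = pt 1 t"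
        then show ?thesis using x(2) represents_hyperplane(1)[OF rep F] by auto
      next
        assume "x = pt 0 1"
        then show ?thesis using x(2) represents_hyperplane(2)[OF rep F] c by auto
      qed
    next
      fix x assume "x \<in> ?Y"
      then show "x \<in> ?X" using represents_hyperplane(1)[OF rep F] pt_P1[of 1] by auto
    qed
    have inj: "inj_on (pt 1) A" for A
    proof (rule inj_onI)
      fix x y assume "pt 1 x = pt 1 y"
      from pt_eqD[OF this] show "x = y" by simp
    qed
    have "degree (comb J Q a) = d"
      using le_degree[OF c] degree_comb[OF J] rep unfolding represents_def by (metis le_antisym)
    then show "coeff (comb J Q a) d \<noteq> 0 \<and> degree (comb J Q a) = d \<and>
      finite {t. poly (comb J Q a) t = 0} \<and> card {t. poly (comb J Q a) t = 0} = m"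
      using fin c unfolding eq by (simp add: finite_image_iff[OF inj] card_image[OF inj])
  qed
qed

lemma complex_poly_root: "degree (p :: complex poly) \<ge> 1 \<Longrightarrow> \<exists>t. poly p t = 0"
  using fundamental_theorem_of_algebra[of p] constant_degree[of p] by auto

text \<open>A general hyperplane pulls back to a polynomial of degree exactly \<open>d\<close>
  without roots, which is constant by the fundamental theorem of algebra.\<close>

lemma has_degree_0:
  assumes rep: "represents J F Q d" and F: "regular_map {..1} J F" and J: "finite J"
    and deg: "has_degree J F 0"
  shows "d = 0"
proof (rule ccontr)
  assume "d \<noteq> 0"
  obtain g where g: "g \<noteq> 0" "\<And>a. mpeval g a \<noteq> 0 \<Longrightarrow> coeff (comb J Q a) d \<noteq> 0 \<and> degree (comb J Q a) = d \<and>
      finite {t. poly (comb J Q a) t = 0} \<and> card {t. poly (comb J Q a) t = 0} = 0"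
    using has_degree_generic[OF assms] by blast
  obtain a where "mpeval g a \<noteq> 0" using mpeval_nonzero_point[OF g(1)] by blast
  from g(2)[OF this] have "degree (comb J Q a) = d" "{t. poly (comb J Q a) t = 0} = {}" by auto
  then show False using complex_poly_root[of "comb J Q a"] \<open>d \<noteq> 0\<close> by auto
qed

lemma unique_root_power:
  fixes p :: "complex poly"
  assumes "\<And>t. poly p t = 0 \<Longrightarrow> t = r" "degree p = d"
  shows "p = smult (lead_coeff p) ([:- r, 1:] ^ d)"
  using assms
proof (induction d arbitrary: p)
  case 0
  then obtain c where "p = [:c:]" using degree_eq_zeroE by blast
  then show ?case by simp
next
  case (Suc d)
  then have "\<exists>t. poly p t = 0" by (intro complex_poly_root) simp
  then have "poly p r = 0" using Suc.prems(1) by metis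
  then obtain q where q: "p = [:- r, 1:] * q" unfolding poly_eq_0_iff_dvd by (rule dvdE)
  have "q \<noteq> 0" using q Suc.prems(2) by auto
  then have "degree p = 1 + degree q" unfolding q by (subst degree_mult_eq) auto
  then have "degree q = d" using Suc.prems(2) by simp
  moreover have "t = r" if "poly q t = 0" for t using Suc.prems(1)[of t] that q by simp
  ultimately have qeq: "q = smult (lead_coeff q) ([:- r, 1:] ^ d)" by (rule Suc.IH[rotated])
  have lc: "lead_coeff p = lead_coeff q" unfolding q lead_coeff_mult by simp
  have "p = [:- r, 1:] * smult (lead_coeff p) ([:- r, 1:] ^ d)"
    unfolding lc qeq[symmetric] by (rule q)
  then show ?case unfolding mult_smult_right power_Suc .
qed

lemma poly_pderiv_power_root:
  fixes u r :: complex
  shows "poly (pderiv ([:- r, 1:] ^ Suc d)) u = of_nat (Suc d) * (u - r) ^ d"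
  unfolding pderiv_power_Suc by (simp add: pderiv_pCons)

text \<open>A general member of the pencil spanned by two distinct \<open>d\<close>-th powers of linear forms has no
  multiple zero.\<close>

lemma has_degree_1:
  assumes rep: "represents J F Q d" and F: "regular_map {..1} J F" and J: "finite J"
    and deg: "has_degree J F 1"
  shows "d = 1"
proof (rule ccontr)
  assume d1: "d \<noteq> 1"
  obtain g where g: "g \<noteq> 0" "\<And>a. mpeval g a \<noteq> 0 \<Longrightarrow> coeff (comb J Q a) d \<noteq> 0 \<and> degree (comb J Q a) = d \<and>
      finite {t. poly (comb J Q a) t = 0} \<and> card {t. poly (comb J Q a) t = 0} = 1"
    using has_degree_generic[OF assms] by blast
  have one: "\<exists>r. poly (comb J Q a) r = 0 \<and> (\<forall>t. poly (comb J Q a) t = 0 \<longrightarrow> t = r)" if "mpeval g a \<noteq> 0" for a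
  proof -
    have "card {t. poly (comb J Q a) t = 0} = 1" using g(2)[OF that] by simp
    then obtain r where "{t. poly (comb J Q a) t = 0} = {r}" by (rule card_1_singletonE)
    then show ?thesis by (intro exI[of _ r]) auto
  qed
  obtain a where a: "mpeval g a \<noteq> 0" using mpeval_nonzero_point[OF g(1)] by blast
  obtain r where r: "poly (comb J Q a) r = 0" "\<forall>t. poly (comb J Q a) t = 0 \<longrightarrow> t = r" using one[OF a] by blast
  have "d \<noteq> 0"
  proof
    assume "d = 0"
    then have "degree (comb J Q a) = 0" using g(2)[OF a] by simp
    then obtain c where c: "comb J Q a = [:c:]" by (rule degree_eq_zeroE)
    have "c = 0" using r(1) unfolding c by simp
    moreover have "coeff (comb J Q a) d \<noteq> 0" using g(2)[OF a] by simp
    ultimately show False unfolding c by simp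
  qed
  then have "d = Suc (Suc (d - 2))" using d1 by linarith
  then obtain e where e: "d = Suc (Suc e)" by blast
  obtain j0 where j0: "j0 \<in> J" "vecp J Q r j0 \<noteq> 0" using represents_nonzero(1)[OF rep F] by blast
  \<comment> \<open>The additional linear factor ensures that \<open>comb J Q b\<close> does not
    vanish at \<open>r\<close>, so that its only root \<open>s\<close> differs from
    \<open>r\<close>.\<close>
  have "g * linform J (vecp J Q r) \<noteq> 0"
    by (intro mpol_mult_nonzero g(1) linform_nonzero[of J j0 "vecp J Q r"] J j0)
  then obtain b where b: "mpeval (g * linform J (vecp J Q r)) b \<noteq> 0"
    using mpeval_nonzero_point by blast
  then have b1: "mpeval g b \<noteq> 0" and b2: "poly (comb J Q b) r \<noteq> 0"
  proof -
    have 1: "mpeval g b * (\<Sum>j\<in>J. vecp J Q r j * b j) \<noteq> 0"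
      using b unfolding mpeval_mult mpeval_linform .
    then show "mpeval g b \<noteq> 0" by auto
    have "(\<Sum>j\<in>J. b j * vecp J Q r j) = (\<Sum>j\<in>J. vecp J Q r j * b j)"
      by (rule sum.cong) (simp_all add: mult.commute)
    then show "poly (comb J Q b) r \<noteq> 0" using 1 unfolding poly_comb by auto
  qed
  obtain s where s: "poly (comb J Q b) s = 0" "\<forall>t. poly (comb J Q b) t = 0 \<longrightarrow> t = s" using one[OF b1] by blast
  have rs: "r \<noteq> s" using s(1) b2 by blast
  have "finite (insert 0 {c. mpeval g (\<lambda>v. a v + c * b v) = 0})"
    unfolding finite_insert by (rule mpeval_nonzero_cofinite_line[OF a])
  then obtain c where "c \<notin> insert 0 {c. mpeval g (\<lambda>v. a v + c * b v) = 0}"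
    using ex_new_if_finite[OF infinite_UNIV_char_0] by blast
  then have c: "c \<noteq> 0" "mpeval g (\<lambda>v. a v + c * b v) \<noteq> 0" by auto
  let ?ab = "\<lambda>v. a v + c * b v"
  obtain u where u: "poly (comb J Q ?ab) u = 0" "\<forall>t. poly (comb J Q ?ab) t = 0 \<longrightarrow> t = u" using one[OF c(2)] by blast
  have comb_add: "comb J Q ?ab = comb J Q a + smult c (comb J Q b)"
  proof -
    have "comb J Q ?ab = (\<Sum>j\<in>J. smult (a j) (Q j) + smult c (smult (b j) (Q j)))"
      unfolding comb_def by (rule sum.cong) (simp_all add: smult_add_left)
    also have "\<dots> = (\<Sum>j\<in>J. smult (a j) (Q j)) + (\<Sum>j\<in>J. smult c (smult (b j) (Q j)))"
      by (rule sum.distrib)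
    also have "(\<Sum>j\<in>J. smult c (smult (b j) (Q j))) = smult c (comb J Q b)"
      unfolding comb_def by (induction J rule: infinite_finite_induct) (simp_all add: smult_add_right)
    finally show ?thesis by (simp only: comb_def)
  qed
  define \<alpha> \<beta> \<gamma> where "\<alpha> = lead_coeff (comb J Q a)" and "\<beta> = lead_coeff (comb J Q b)"
    and "\<gamma> = lead_coeff (comb J Q ?ab)"
  have pa: "comb J Q a = smult \<alpha> ([:- r, 1:] ^ d)"
    unfolding \<alpha>_def by (rule unique_root_power) (use r g(2)[OF a] in auto)
  have pb: "comb J Q b = smult \<beta> ([:- s, 1:] ^ d)"
    unfolding \<beta>_def by (rule unique_root_power) (use s g(2)[OF b1] in auto)
  have pab: "comb J Q ?ab = smult \<gamma> ([:- u, 1:] ^ d)"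
    unfolding \<gamma>_def by (rule unique_root_power) (use u g(2)[OF c(2)] in auto)
  have \<alpha>0: "\<alpha> \<noteq> 0" and \<beta>0: "\<beta> \<noteq> 0" using g(2)[OF a] g(2)[OF b1] by (auto simp: \<alpha>_def \<beta>_def)
  have eq: "smult \<gamma> ([:- u, 1:] ^ d) = smult \<alpha> ([:- r, 1:] ^ d) + smult (c * \<beta>) ([:- s, 1:] ^ d)"
    using comb_add unfolding pa pb pab by simp
  have e1: "0 = \<alpha> * (u - r) ^ d + c * \<beta> * (u - s) ^ d"
  proof -
    have "poly (smult \<gamma> ([:- u, 1:] ^ d)) u
        = poly (smult \<alpha> ([:- r, 1:] ^ d) + smult (c * \<beta>) ([:- s, 1:] ^ d)) u"
      unfolding eq ..
    moreover have "poly [:- x, 1:] u = u - x" for x by simp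
    ultimately show ?thesis
      unfolding poly_smult poly_add poly_power using \<open>d \<noteq> 0\<close> by (simp add: zero_power)
  qed
  have "poly (pderiv (smult \<gamma> ([:- u, 1:] ^ d))) u
      = poly (pderiv (smult \<alpha> ([:- r, 1:] ^ d) + smult (c * \<beta>) ([:- s, 1:] ^ d))) u"
    unfolding eq ..
  then have e2': "0 = \<alpha> * (of_nat d * (u - r) ^ Suc e) + c * \<beta> * (of_nat d * (u - s) ^ Suc e)"
    unfolding pderiv_smult pderiv_add poly_smult poly_add e poly_pderiv_power_root by simp
  have gen: "\<alpha> * (n * x) + c * \<beta> * (n * y) = n * (\<alpha> * x + c * \<beta> * y)" for n x y
    by (simp add: algebra_simps)
  have "(of_nat d :: complex) \<noteq> 0" using \<open>d \<noteq> 0\<close> by simp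
  with e2' have e2: "\<alpha> * (u - r) ^ Suc e + c * \<beta> * (u - s) ^ Suc e = 0"
    unfolding gen by simp
  \<comment> \<open>A zero \<open>u\<close> of order d >= 2 annihilates the value and the derivative
    of the combination. Subtracting (u - r) times the latter eliminates the term with \<alpha> and
    leaves a multiple of (u - s)^(d - 1) (r - s).\<close>
  have gen2: "c * \<beta> * y * (r - s)
      = (\<alpha> * ((u - r) * x) + c * \<beta> * ((u - s) * y)) - (u - r) * (\<alpha> * x + c * \<beta> * y)" for x y
    by (simp add: algebra_simps)
  have e1': "\<alpha> * ((u - r) * (u - r) ^ Suc e) + c * \<beta> * ((u - s) * (u - s) ^ Suc e) = 0"
    using e1 unfolding e power_Suc[of _ "Suc e"] by (rule sym)
  have "c * \<beta> * (u - s) ^ Suc e * (r - s) = 0"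
    unfolding gen2[of "(u - s) ^ Suc e" "(u - r) ^ Suc e"] e1' e2 by simp
  then have "(u - s) ^ Suc e = 0" using c(1) \<beta>0 rs by (simp del: power_Suc)
  then have "u - s = 0" by (rule power_eq_0_iff[THEN iffD1, THEN conjunct1])
  then have "u = s" by simp
  then have "0 = \<alpha> * (s - r) ^ d + c * \<beta> * (s - s) ^ d" using e1 by (simp only:)
  then have "\<alpha> * (s - r) ^ d = 0" using \<open>d \<noteq> 0\<close> by (simp add: zero_power)
  then show False using \<alpha>0 rs by simp
qed

section \<open>Linear maps and automorphisms of the projective line\<close>

lemma zariski_open_P1: "zariski_open {..1} P1"
proof -
  have "homogeneous 0 (1 :: (nat, complex) mpol)"
    unfolding homogeneous_def by simp
  then show ?thesis
    unfolding zariski_open_def by (intro exI[of _ "{1}"]) auto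
qed

lemma keys_linform: "Poly_Mapping.keys (linform I c) \<subseteq> (\<lambda>j. Poly_Mapping.single j 1) ` I"
proof -
  have "Poly_Mapping.keys (linform I c)
      \<subseteq> (\<Union>j\<in>I. Poly_Mapping.keys (Poly_Mapping.single (Poly_Mapping.single j (1::nat)) (c j)))"
    unfolding linform_def
  proof (induction I rule: infinite_finite_induct)
    case (insert x F)
    let ?t = "\<lambda>j. Poly_Mapping.single (Poly_Mapping.single j (1::nat)) (c j)"
    have "Poly_Mapping.keys (?t x + sum ?t F) \<subseteq> Poly_Mapping.keys (?t x) \<union> Poly_Mapping.keys (sum ?t F)"
      by (rule keys_add)
    also have "\<dots> \<subseteq> Poly_Mapping.keys (?t x) \<union> (\<Union>j\<in>F. Poly_Mapping.keys (?t j))"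
      using insert.IH by (rule Un_mono[OF subset_refl])
    finally show ?case using insert.hyps by (simp only: sum.insert UN_insert simp_thms)
  qed simp_all
  also have "\<dots> \<subseteq> (\<lambda>j. Poly_Mapping.single j 1) ` I"
    by (rule UN_least) (simp add: keys_single)
  finally show ?thesis .
qed

lemma homogeneous_linform: "homogeneous 1 (linform I c)"
  unfolding homogeneous_def
proof
  fix m assume "m \<in> Poly_Mapping.keys (linform I c)"
  then obtain j where "m = Poly_Mapping.single j 1" using keys_linform[of I c] by blast
  then show "(\<Sum>v\<in>Poly_Mapping.keys m. Poly_Mapping.lookup m v) = 1" by simp
qed

lemma linear_map_regular:
  fixes J :: "'j set"
  assumes F: "F \<in> P1 \<rightarrow> proj_space J"
    and lin: "\<And>s t. s \<noteq> 0 \<or> t \<noteq> 0 \<Longrightarrow> (\<lambda>j. s * \<alpha> j + t * \<beta> j) \<in> F (pt s t)"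
  shows "regular_map {..1} J F"
proof -
  define P where "P j = linform {..1} (pv (\<alpha> j) (\<beta> j))" for j
  have ev: "(\<lambda>j. if j \<in> J then mpeval (P j) w else 0) \<in> F y" if y: "y \<in> P1" "w \<in> y" for y w
  proof -
    have Fy: "F y \<in> proj_space J" using F y(1) by blast
    have lw: "(\<lambda>j. w 0 * \<alpha> j + w 1 * \<beta> j) \<in> F y"
      using lin[OF P1_vec(3)[OF y]] unfolding P1_vec(2)[OF y, symmetric] .
    have "(\<lambda>j. if j \<in> J then mpeval (P j) w else 0) = (\<lambda>j. w 0 * \<alpha> j + w 1 * \<beta> j)"
    proof
      fix j
      show "(if j \<in> J then mpeval (P j) w else 0) = w 0 * \<alpha> j + w 1 * \<beta> j"
        using proj_space_rep(3)[OF Fy lw, of j] by (simp add: P_def mpeval_linform mult.commute)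
    qed
    then show ?thesis using lw by simp
  qed
  have "\<forall>j\<in>J. P j \<in> mpols {..1} \<and> homogeneous 1 (P j)"
    unfolding P_def using linform_mpols homogeneous_linform by blast
  then show ?thesis
    unfolding regular_map_def using F zariski_open_P1 ev by blast
qed

text \<open>The pullback of a linear form is s A + t B. If A is nonzero, which holds for general
  \<open>a\<close>, its only zero is the point [-B : A].\<close>

lemma linear_map_degree:
  fixes J :: "'j set"
  assumes F: "F \<in> P1 \<rightarrow> proj_space J" and J: "finite J"
    and lin: "\<And>s t. s \<noteq> 0 \<or> t \<noteq> 0 \<Longrightarrow> (\<lambda>j. s * \<alpha> j + t * \<beta> j) \<in> F (pt s t)"
  shows "has_degree J F 1"
proof -
  have "pt 1 0 \<in> P1" by (rule pt_P1) simp
  then have F10: "F (pt 1 0) \<in> proj_space J" by (rule funcset_mem[OF F])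
  have "(\<lambda>j. 1 * \<alpha> j + 0 * \<beta> j) \<in> F (pt 1 0)" by (rule lin) simp
  then have \<alpha>F: "\<alpha> \<in> F (pt 1 0)" by simp
  have "\<exists>j. \<alpha> j \<noteq> 0"
  proof (rule ccontr)
    assume "\<not> ?thesis"
    then have "\<alpha> = (\<lambda>_. 0)" by (intro ext) simp
    then show False using proj_space_rep(2)[OF F10 \<alpha>F] by contradiction
  qed
  then obtain j0 where j0: "\<alpha> j0 \<noteq> 0" by blast
  have j0J: "j0 \<in> J"
  proof (rule ccontr)
    assume "j0 \<notin> J"
    then have "\<alpha> j0 = 0" by (rule proj_space_rep(3)[OF F10 \<alpha>F])
    then show False using j0 by contradiction
  qed
  have main: "finite {x \<in> P1. F x \<in> hyperplane J a} \<and> card {x \<in> P1. F x \<in> hyperplane J a} = 1"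
    if a: "mpeval (linform J \<alpha>) a \<noteq> 0" for a
  proof -
    define A where "A = (\<Sum>j\<in>J. a j * \<alpha> j)"
    define B where "B = (\<Sum>j\<in>J. a j * \<beta> j)"
    have A0: "A \<noteq> 0" using a unfolding mpeval_linform A_def by (simp add: mult.commute)
    have hyp: "F (pt s t) \<in> hyperplane J a \<longleftrightarrow> s * A + t * B = 0" if st: "s \<noteq> 0 \<or> t \<noteq> 0" for s t
    proof -
      have "F (pt s t) \<in> proj_space J" using F pt_P1[OF st] by blast
      then have "F (pt s t) \<in> hyperplane J a \<longleftrightarrow> (\<Sum>j\<in>J. a j * (s * \<alpha> j + t * \<beta> j)) = 0"
        by (rule hyperplane_iff[OF _ lin[OF st]])
      also have "(\<Sum>j\<in>J. a j * (s * \<alpha> j + t * \<beta> j)) = s * A + t * B"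
        unfolding A_def B_def sum_distrib_left sum.distrib[symmetric]
        by (rule sum.cong) (simp_all add: algebra_simps)
      finally show ?thesis .
    qed
    have "{x \<in> P1. F x \<in> hyperplane J a} = {pt (- B) A}"
    proof (rule Set.set_eqI, rule iffI)
      fix x assume "x \<in> {x \<in> P1. F x \<in> hyperplane J a}"
      then have x: "x \<in> P1" "F x \<in> hyperplane J a" by auto
      obtain s t where st: "x = pt s t" "s \<noteq> 0 \<or> t \<noteq> 0" using P1_coords[OF x(1)] by blast
      have "s * A + t * B = 0" using hyp[OF st(2)] x(2) st(1) by simp
      then have "s * A = - (t * B)" by (rule eq_neg_iff_add_eq_0[THEN iffD2])
      then have "s * A = - B * t" by (metis mult.commute mult_minus_left)
      then have "pt s t = pt (- B) A" by (rule pt_eqI) (use st A0 in auto)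
      then show "x \<in> {pt (- B) A}" using st(1) by simp
    next
      fix x assume "x \<in> {pt (- B) A}"
      then show "x \<in> {x \<in> P1. F x \<in> hyperplane J a}"
        using hyp[of "- B" A] A0 pt_P1[of "- B" A] by (simp add: mult.commute)
    qed
    then show ?thesis by simp
  qed
  show ?thesis
    unfolding has_degree_def
  proof (intro exI[of _ "linform J \<alpha>"] conjI)
    show "linform J \<alpha> \<in> mpols J" by (rule linform_mpols)
    show "linform J \<alpha> \<noteq> 0" by (rule linform_nonzero[of J j0 \<alpha>, OF J j0J j0])
    show "\<forall>a. (\<exists>j\<in>J. a j \<noteq> 0) \<and> mpeval (linform J \<alpha>) a \<noteq> 0 \<longrightarrow>
        finite {x \<in> P1. F x \<in> hyperplane J a} \<and> card {x \<in> P1. F x \<in> hyperplane J a} = 1"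
      by (intro allI impI main) (rule conjunct2)
  qed
qed

lemma constant_map:
  fixes J :: "'j set"
  assumes y: "y \<in> proj_space J" and F: "\<And>x. x \<in> P1 \<Longrightarrow> F x = y" and J: "finite J"
  shows "regular_map {..1} J F" "has_degree J F 0"
proof -
  obtain w where w: "w \<in> y" using proj_space_nonempty[OF y] by blast
  have supp: "w j = 0" if "j \<notin> J" for j using proj_space_rep(3)[OF y w that] .
  have cst: "homogeneous 0 (Poly_Mapping.single 0 c :: (nat, complex) mpol)" for c
    unfolding homogeneous_def by (auto split: if_splits)
  have wv: "(\<lambda>j. if j \<in> J then mpeval (Poly_Mapping.single (0 :: nat \<Rightarrow>\<^sub>0 nat) (w j)) v else 0) = w" for v
    by (rule ext) (simp add: supp)
  have ev: "\<forall>x\<in>P1. \<forall>v\<in>x. (\<lambda>j. if j \<in> J then mpeval (Poly_Mapping.single (0 :: nat \<Rightarrow>\<^sub>0 nat) (w j)) v else 0) \<in> F x"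
    unfolding wv using w F by blast
  have P: "\<forall>j\<in>J. (Poly_Mapping.single 0 (w j) :: (nat, complex) mpol) \<in> mpols {..1} \<and> homogeneous 0 (Poly_Mapping.single (0 :: nat \<Rightarrow>\<^sub>0 nat) (w j))"
    using cst by (simp add: mpols_single)
  have FP: "F \<in> P1 \<rightarrow> proj_space J" using F y by simp
  show "regular_map {..1} J F"
    unfolding regular_map_def
  proof (rule conjI[OF FP], rule ballI)
    fix x assume x: "x \<in> P1"
    let ?P = "\<lambda>j. Poly_Mapping.single (0 :: nat \<Rightarrow>\<^sub>0 nat) (w j)"
    show "\<exists>U e P. zariski_open {..1} U \<and> x \<in> U \<and> (\<forall>j\<in>J. P j \<in> mpols {..1} \<and> homogeneous e (P j)) \<and>
        (\<forall>y\<in>U. \<forall>w\<in>y. (\<lambda>j. if j \<in> J then mpeval (P j) w else 0) \<in> F y)"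
      by (rule exI[of _ P1], rule exI[of _ 0], rule exI[of _ ?P], intro conjI zariski_open_P1 x P ev)
  qed
  obtain j0 where j0: "w j0 \<noteq> 0" using proj_space_rep(2)[OF y w] by auto
  then have j0J: "j0 \<in> J" using supp by blast
  have emp: "{x \<in> P1. F x \<in> hyperplane J a} = {}" if "mpeval (linform J w) a \<noteq> 0" for a
  proof -
    have "(\<Sum>j\<in>J. a j * w j) \<noteq> 0" using that unfolding mpeval_linform by (simp add: mult.commute)
    then have "y \<notin> hyperplane J a" unfolding hyperplane_iff[OF y w] .
    then show ?thesis using F by blast
  qed
  show "has_degree J F 0"
    unfolding has_degree_def
  proof (intro exI[of _ "linform J w"] conjI allI impI)
    show "linform J w \<in> mpols J" by (rule linform_mpols)
    show "linform J w \<noteq> 0" by (rule linform_nonzero[of J j0 w, OF J j0J j0])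
    fix a assume "(\<exists>j\<in>J. a j \<noteq> 0) \<and> mpeval (linform J w) a \<noteq> 0"
    then have e: "{x \<in> P1. F x \<in> hyperplane J a} = {}" using emp by blast
    show "finite {x \<in> P1. F x \<in> hyperplane J a}" "card {x \<in> P1. F x \<in> hyperplane J a} = 0"
      unfolding e by simp_all
  qed
qed

text \<open>Acts on all homogeneous coordinate vectors of a point at once, so that no representative
  has to be chosen.\<close>

definition mobius :: "complex \<Rightarrow> complex \<Rightarrow> complex \<Rightarrow> complex \<Rightarrow> nat ppoint \<Rightarrow> nat ppoint" where
  "mobius a b c d x = {pv (a * w 0 + b * w 1) (c * w 0 + d * w 1) | w. w \<in> x}"

lemma mobius_pt: "mobius a b c d (pt s t) = pt (a * s + b * t) (c * s + d * t)"
proof (rule Set.set_eqI)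
  fix v
  have e: "pv (a * pv (e * s) (e * t) 0 + b * pv (e * s) (e * t) 1) (c * pv (e * s) (e * t) 0 + d * pv (e * s) (e * t) 1)
      = pv (e * (a * s + b * t)) (e * (c * s + d * t))" for e
    by (simp add: algebra_simps)
  have "v \<in> mobius a b c d (pt s t) \<longleftrightarrow> (\<exists>w. w \<in> pt s t \<and> v = pv (a * w 0 + b * w 1) (c * w 0 + d * w 1))"
    unfolding mobius_def by blast
  also have "\<dots> \<longleftrightarrow> (\<exists>e. e \<noteq> 0 \<and> v = pv (e * (a * s + b * t)) (e * (c * s + d * t)))"
    unfolding mem_pt e[symmetric] by blast
  also have "\<dots> \<longleftrightarrow> v \<in> pt (a * s + b * t) (c * s + d * t)"
    unfolding mem_pt ..
  finally show "v \<in> mobius a b c d (pt s t) \<longleftrightarrow> v \<in> pt (a * s + b * t) (c * s + d * t)" .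
qed

lemma mobius_nonzero:
  assumes "a * d - b * c \<noteq> (0::complex)" "s \<noteq> 0 \<or> t \<noteq> 0"
  shows "a * s + b * t \<noteq> 0 \<or> c * s + d * t \<noteq> 0"
proof (rule ccontr)
  assume "\<not> ?thesis"
  then have 0: "a * s + b * t = 0" "c * s + d * t = 0" by auto
  have "(a * d - b * c) * s = d * (a * s + b * t) - b * (c * s + d * t)"
    "(a * d - b * c) * t = a * (c * s + d * t) - c * (a * s + b * t)" by (simp_all add: algebra_simps)
  then have "(a * d - b * c) * s = 0" "(a * d - b * c) * t = 0" unfolding 0 by simp_all
  then show False using assms by simp
qed

lemma mobius_P1:
  assumes "a * d - b * c \<noteq> 0" "x \<in> P1"
  shows "mobius a b c d x \<in> P1"
  using assms(2)
proof (rule P1_coords)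
  fix s t assume x: "x = pt s t" and st: "s \<noteq> 0 \<or> t \<noteq> 0"
  show ?thesis unfolding x mobius_pt by (rule pt_P1[OF mobius_nonzero[OF assms(1) st]])
qed

lemma mobius_mobius:
  assumes "x \<in> P1"
  shows "mobius a b c d (mobius a' b' c' d' x)
    = mobius (a * a' + b * c') (a * b' + b * d') (c * a' + d * c') (c * b' + d * d') x"
  using assms
proof (rule P1_coords)
  fix s t assume "x = pt s t"
  then show ?thesis by (simp add: mobius_pt algebra_simps)
qed

lemma mobius_inverse:
  assumes D: "a * d - b * c \<noteq> 0" and x: "x \<in> P1"
  shows "mobius a b c d (mobius d (- b) (- c) a x) = x" "mobius d (- b) (- c) a (mobius a b c d x) = x"
proof -
  obtain s t where st: "x = pt s t" using P1_coords[OF x] by blast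
  have "a * (d * s + - b * t) + b * (- c * s + a * t) = (a * d - b * c) * s"
    "c * (d * s + - b * t) + d * (- c * s + a * t) = (a * d - b * c) * t"
    "d * (a * s + b * t) + - b * (c * s + d * t) = (a * d - b * c) * s"
    "- c * (a * s + b * t) + a * (c * s + d * t) = (a * d - b * c) * t"
    by (simp_all add: algebra_simps)
  then show "mobius a b c d (mobius d (- b) (- c) a x) = x" "mobius d (- b) (- c) a (mobius a b c d x) = x"
    unfolding st mobius_pt by (simp_all only: pt_scale[OF D])
qed

lemma mobius_regular:
  assumes "a * d - b * c \<noteq> 0" "\<And>x. x \<in> P1 \<Longrightarrow> F x = mobius a b c d x"
  shows "regular_map {..1} {..1} F"
proof (rule linear_map_regular[where \<alpha> = "pv a c" and \<beta> = "pv b d"])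
  show "F \<in> P1 \<rightarrow> P1" using assms mobius_P1 by auto
  fix s t :: complex assume "s \<noteq> 0 \<or> t \<noteq> 0"
  then have F: "F (pt s t) = pt (a * s + b * t) (c * s + d * t)"
    using assms(2) pt_P1 mobius_pt by simp
  have "(\<lambda>j. s * pv a c j + t * pv b d j) = pv (a * s + b * t) (c * s + d * t)"
    by (rule ext) (simp add: pv_def mult.commute)
  then show "(\<lambda>j. s * pv a c j + t * pv b d j) \<in> F (pt s t)"
    unfolding F using pv_mem_pt by simp
qed

lemma mobius_automorphism:
  assumes D: "a * d - b * c \<noteq> 0"
  shows "automorphism_P1 (mobius a b c d)"
proof -
  have D': "d * a - (- b) * (- c) \<noteq> 0" using D by (simp add: mult.commute)
  have bij: "bij_betw (mobius a b c d) P1 P1"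
    by (rule bij_betw_byWitness[where f' = "mobius d (- b) (- c) a"])
      (use mobius_inverse[OF D] mobius_P1[OF D] mobius_P1[OF D'] in auto)
  have "inv_into P1 (mobius a b c d) x = mobius d (- b) (- c) a x" if "x \<in> P1" for x
    by (rule inv_into_f_eq[OF bij_betw_imp_inj_on[OF bij] mobius_P1[OF D' that] mobius_inverse(1)[OF D that]])
  then show ?thesis
    unfolding automorphism_P1_def using bij mobius_regular[OF D] mobius_regular[OF D'] by blast
qed

section \<open>Curves of degree zero\<close>

lemma finite_plucker_index: "finite (plucker_index l :: 'n::finite set set)"
  by simp

text \<open>A map of degree zero is described by constants, so its Pluecker image is a point, and
  the Pluecker embedding is injective.\<close>

lemma rational_curves_0:
  assumes l: "l \<ge> 1"
  shows "(rational_curves l 0 :: (nat ppoint \<Rightarrow> 'n::{finite,linorder} cspace set) set) = (\<lambda>V. \<lambda>x\<in>P1. V) ` Gr l"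
proof
  let ?J = "plucker_index l :: 'n set set"
  show "rational_curves l 0 \<subseteq> (\<lambda>V. \<lambda>x\<in>P1. V) ` (Gr l :: 'n cspace set set)"
  proof
    fix f :: "nat ppoint \<Rightarrow> 'n cspace set" assume "f \<in> rational_curves l 0"
    then have f: "f \<in> P1 \<rightarrow>\<^sub>E Gr l" "regular_map {..1} ?J (plucker l \<circ> f)" "has_degree ?J (plucker l \<circ> f) 0"
      unfolding rational_curves_def by auto
    obtain Q d where rep: "represents ?J (plucker l \<circ> f) Q d" using regular_map_represents[OF f(2)] by blast
    have "d = 0" by (rule has_degree_0[OF rep f(2) finite_plucker_index f(3)])
    with rep have rep0: "represents ?J (plucker l \<circ> f) Q 0" by simp
    have FJ: "(plucker l \<circ> f) x \<in> proj_space ?J" if "x \<in> P1" for x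
      using f(2) that unfolding regular_map_def by blast
    let ?w = "vecinf ?J Q 0"
    have same: "?w \<in> (plucker l \<circ> f) x" if x: "x \<in> P1" for x
    proof (rule P1_cases[OF x])
      fix t assume "x = pt 1 t"
      moreover have "vecp ?J Q t = ?w"
      proof
        fix j
        show "vecp ?J Q t j = ?w j"
        proof (cases "j \<in> ?J")
          case True
          then have "degree (Q j) = 0" using rep0 unfolding represents_def by blast
          then obtain c where "Q j = [:c:]" by (rule degree_eq_zeroE)
          then show ?thesis by (simp add: vecp_def vecinf_def)
        qed (simp add: vecp_def vecinf_def)
      qed
      ultimately show ?thesis using rep0 unfolding represents_def by metis
    next
      assume "x = pt 0 1"
      then show ?thesis using rep0 unfolding represents_def by simp
    qed
    have P: "pt 0 1 \<in> P1" by (rule pt_P1) simp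
    have "f x = f (pt 0 1)" if x: "x \<in> P1" for x
    proof (rule plucker_inj[OF _ _ l])
      show "f x \<in> Gr l" "f (pt 0 1) \<in> Gr l" using f(1) x P by auto
      have "(plucker l \<circ> f) x = proj_point ?w" by (rule proj_space_rep(1)[OF FJ[OF x] same[OF x]])
      moreover have "(plucker l \<circ> f) (pt 0 1) = proj_point ?w" by (rule proj_space_rep(1)[OF FJ[OF P] same[OF P]])
      ultimately show "plucker l (f x) = plucker l (f (pt 0 1))" by simp
    qed
    then have "f = (\<lambda>x\<in>P1. f (pt 0 1))" using f(1) by (intro ext) (auto simp: PiE_def extensional_def)
    moreover have "f (pt 0 1) \<in> Gr l" using f(1) P by auto
    ultimately show "f \<in> (\<lambda>V. \<lambda>x\<in>P1. V) ` Gr l" by (rule image_eqI)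
  qed
  show "(\<lambda>V. \<lambda>x\<in>P1. V) ` (Gr l :: 'n cspace set set) \<subseteq> rational_curves l 0"
  proof
    fix f :: "nat ppoint \<Rightarrow> 'n cspace set" assume "f \<in> (\<lambda>V. \<lambda>x\<in>P1. V) ` Gr l"
    then obtain V where V: "V \<in> Gr l" "f = (\<lambda>x\<in>P1. V)" by blast
    have e: "(plucker l \<circ> f) x = plucker l V" if "x \<in> P1" for x using V(2) that by simp
    note c = constant_map[where F = "plucker l \<circ> f", OF plucker_proj_space[OF V(1) l] e finite_plucker_index]
    have "f \<in> P1 \<rightarrow>\<^sub>E Gr l" unfolding V(2) using V(1) by (intro restrict_PiE_iff[THEN iffD2]) simp
    then show "f \<in> rational_curves l 0"
      unfolding rational_curves_def using c by blast
  qed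
qed

lemma curves_meeting_0:
  assumes l: "l \<ge> 1"
  shows "curves_meeting l 0 Ys = (\<lambda>V. \<lambda>x\<in>P1. V) ` {V \<in> Gr l. \<forall>Y\<in>set Ys. V \<in> Y}"
proof -
  have ne: "pt 0 1 \<in> P1" by (rule pt_P1) simp
  have im: "(\<lambda>x\<in>P1. V) ` P1 = {V}" for V :: "'n cspace set"
  proof -
    have "(\<lambda>x\<in>P1. V) ` P1 = (\<lambda>_. V) ` P1" by (rule image_cong) simp_all
    then show ?thesis using ne by blast
  qed
  have iff: "(\<lambda>x\<in>P1. V) ` P1 \<inter> Y \<noteq> {} \<longleftrightarrow> V \<in> Y" for V :: "'n cspace set" and Y
    unfolding im by blast
  have "{f \<in> (\<lambda>V. \<lambda>x\<in>P1. V) ` Gr l. \<forall>Y\<in>set Ys. f ` P1 \<inter> Y \<noteq> {}}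
      = (\<lambda>V. \<lambda>x\<in>P1. V) ` {V \<in> Gr l. \<forall>Y\<in>set Ys. (\<lambda>x\<in>P1. V) ` P1 \<inter> Y \<noteq> {}}" by blast
  then show ?thesis
    unfolding curves_meeting_def rational_curves_0[OF l] iff .
qed

text \<open>A constant curve is equivalent only to itself under reparametrization, so a degree zero
  invariant counts the spaces common to the given varieties.\<close>

lemma quotient_0:
  fixes Ys :: "'n::{finite,linorder} cspace set set list"
  assumes l: "l \<ge> 1"
  defines "A \<equiv> curves_meeting l 0 Ys" and "S \<equiv> {V \<in> Gr l. \<forall>Y\<in>set Ys. V \<in> Y}"
  shows "finite (A // reparam_rel A) \<longleftrightarrow> finite S" "card (A // reparam_rel A) = card S"
proof -
  let ?c = "\<lambda>V :: 'n cspace set. \<lambda>x\<in>P1. V"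
  have A: "A = ?c ` S" unfolding A_def S_def by (rule curves_meeting_0[OF l])
  have ne: "pt 0 1 \<in> P1" by (rule pt_P1) simp
  have id: "automorphism_P1 (mobius 1 0 0 1)" by (rule mobius_automorphism) simp
  have D1: "(1::complex) * 1 - 0 * 0 \<noteq> 0" by simp
  have cls: "reparam_rel A `` {?c V} = {?c V}" if V: "V \<in> S" for V
  proof (rule Set.set_eqI, rule iffI)
    fix g assume "g \<in> reparam_rel A `` {?c V}"
    then obtain \<phi> where g: "g \<in> A" and \<phi>: "automorphism_P1 \<phi>" "\<forall>x\<in>P1. g x = ?c V (\<phi> x)"
      unfolding reparam_rel_def by auto
    obtain W where W: "g = ?c W" using g A by blast
    have "\<phi> (pt 0 1) \<in> P1" using \<phi>(1) ne unfolding automorphism_P1_def bij_betw_def by blast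
    then have "W = V" using \<phi>(2)[rule_format, OF ne] ne unfolding W by simp
    then show "g \<in> {?c V}" using W by simp
  next
    fix g assume "g \<in> {?c V}"
    then have g: "g = ?c V" by simp
    have "\<forall>x\<in>P1. ?c V x = ?c V (mobius 1 0 0 1 x)" using mobius_P1[OF D1] by simp
    then show "g \<in> reparam_rel A `` {?c V}"
      unfolding g reparam_rel_def using id V A by blast
  qed
  have quot: "A // reparam_rel A = (\<lambda>V. {?c V}) ` S"
  proof -
    have "B // r = (\<lambda>f. r `` {f}) ` B" for B and r :: "((nat ppoint \<Rightarrow> 'n cspace set) \<times> _) set"
      unfolding quotient_def by blast
    then have "A // reparam_rel A = (\<lambda>f. reparam_rel A `` {f}) ` A" .
    also have "\<dots> = (\<lambda>V. reparam_rel A `` {?c V}) ` S" 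
    proof -
      have "(\<lambda>f. reparam_rel A `` {f}) ` (?c ` S) = (\<lambda>V. reparam_rel A `` {?c V}) ` S"
        by (rule image_image)
      then show ?thesis unfolding A[symmetric] .
    qed
    also have "\<dots> = (\<lambda>V. {?c V}) ` S" by (rule image_cong[OF refl cls])
    finally show ?thesis .
  qed
  have inj: "inj_on (\<lambda>V. {?c V}) S"
  proof (rule inj_onI)
    fix V W assume "{?c V} = {?c W}"
    then have "?c V (pt 0 1) = ?c W (pt 0 1)" by auto
    then show "V = W" using ne by simp
  qed
  show "finite (A // reparam_rel A) \<longleftrightarrow> finite S" unfolding quot by (rule finite_image_iff[OF inj])
  show "card (A // reparam_rel A) = card S" unfolding quot by (rule card_image[OF inj])
qed

section \<open>Evaluating Gromov-Witten invariants\<close>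

lemma adapted_basis_flag:
  assumes "indep CARD('n) (b :: nat \<Rightarrow> 'n::{finite,linorder} cspace)"
  shows "complete_flag (\<lambda>i. spn i b)" "adapted_basis b (\<lambda>i. spn i b)"
proof -
  have ind: "indep i b" if i: "i \<le> CARD('n)" for i
    unfolding indep_def
  proof (intro allI impI)
    fix x j assume x: "lincomb i b x = 0" and j: "j < i"
    have "lincomb CARD('n) b (\<lambda>m. if m < i then x m else 0) = lincomb i b x"
      by (rule sum.mono_neutral_cong_right) (use i in auto)
    then have "(if j < i then x j else 0) = 0"
      using indepD[OF assms, of "\<lambda>m. if m < i then x m else 0" j] x j i by simp
    then show "x j = 0" using j by simp
  qed
  show "complete_flag (\<lambda>i. spn i b)"
    unfolding complete_flag_def
  proof (intro conjI ballI)
    fix i assume "i \<in> {1..CARD('n)}"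
    then show "vec.dim (spn i b) = i" by (intro indep_dim ind) simp
  next
    fix i
    show "spn i b \<subseteq> spn (Suc i) b" by (intro vec.span_mono image_mono) auto
  qed (rule vec.subspace_span)
  show "adapted_basis b (\<lambda>i. spn i b)"
    unfolding adapted_basis_def by blast
qed

definition adapted3 :: "'n::{finite,linorder} btriple \<Rightarrow> 'n cflag \<Rightarrow> 'n cflag \<Rightarrow> 'n cflag \<Rightarrow> bool" where
  "adapted3 b F G H \<longleftrightarrow> complete_flag F \<and> complete_flag G \<and> complete_flag H \<and>
     adapted_basis (b 0) F \<and> adapted_basis (b 1) G \<and> adapted_basis (b 2) H"

lemma generic_indep:
  assumes "m < 3"
  shows "generic (\<lambda>b :: 'n::{finite,linorder} btriple. indep CARD('n) (b m))"
proof -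
  have "vec.dim (UNIV :: 'n cspace set) = CARD('n)" by (rule vec_dim_card)
  then obtain b0 :: "nat \<Rightarrow> 'n cspace" where b0: "indep CARD('n) b0"
    using subspace_indep_basis[OF vec.subspace_UNIV] by blast
  have 1: "polyfun (\<lambda>b :: 'n btriple. fdet (b m))"
    by (rule polyfun_fdet) (rule polyfun_coord[OF assms])
  have 2: "fdet ((\<lambda>_. b0) m :: nat \<Rightarrow> 'n cspace) \<noteq> 0" using b0 by (simp only: fdet_indep)
  show ?thesis by (rule genericI[OF 1 2]) (simp only: fdet_indep)
qed

text \<open>The description by \<open>THE\<close> is unambiguous because nonempty Zariski open sets meet.\<close>

lemma gromov_witten_eqI:
  fixes T :: "'n::{finite,linorder} itself"
  assumes dim: "sum_list p1 + sum_list p2 + sum_list p3 = l * k + d * CARD('n)"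
    and gen: "generic (\<lambda>b. \<forall>F G (H :: 'n cflag). adapted3 b F G H \<longrightarrow>
      (let A = curves_meeting l d
         [schubert_variety l k p1 F, schubert_variety l k p2 G, schubert_variety l k p3 H]
       in finite (A // reparam_rel A) \<and> card (A // reparam_rel A) = N))"
  shows "gromov_witten T l k p1 p2 p3 d = N"
proof -
  let ?Q = "\<lambda>N F G (H :: 'n cflag). let A = curves_meeting l d
         [schubert_variety l k p1 F, schubert_variety l k p2 G, schubert_variety l k p3 H]
       in finite (A // reparam_rel A) \<and> card (A // reparam_rel A) = N"
  have iff: "for_general_flags (?Q N') \<longleftrightarrow> generic (\<lambda>b. \<forall>F G H. adapted3 b F G H \<longrightarrow> ?Q N' F G H)" for N'
    unfolding for_general_flags_generic adapted3_def ..
  have "(THE N. for_general_flags (?Q N)) = N"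
  proof (rule the_equality)
    show "for_general_flags (?Q N)" unfolding iff by (rule gen)
    fix N' assume "for_general_flags (?Q N')"
    then have gen': "generic (\<lambda>b. \<forall>F G H. adapted3 b F G H \<longrightarrow> ?Q N' F G H)" unfolding iff .
    \<comment> \<open>Independence of the three families is added so that flags with these adapted
      bases exist and the two counts are compared on an actual triple.\<close>
    have "generic (\<lambda>b. ((\<forall>F G H. adapted3 b F G H \<longrightarrow> ?Q N F G H) \<and> (\<forall>F G H. adapted3 b F G H \<longrightarrow> ?Q N' F G H))
        \<and> indep CARD('n) (b 0) \<and> indep CARD('n) (b 1) \<and> indep CARD('n) (b 2))"
      by (intro generic_conj gen gen' generic_indep) simp_all
    then obtain b where b: "\<forall>F G H. adapted3 b F G H \<longrightarrow> ?Q N F G H" "\<forall>F G H. adapted3 b F G H \<longrightarrow> ?Q N' F G H"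
        "indep CARD('n) (b 0)" "indep CARD('n) (b 1)" "indep CARD('n) (b 2)"
      using generic_exists by blast
    have ad: "adapted3 b (\<lambda>i. spn i (b 0)) (\<lambda>i. spn i (b 1)) (\<lambda>i. spn i (b 2))"
      unfolding adapted3_def using b(3-5) adapted_basis_flag by blast
    show "N' = N"
      using b(1)[rule_format, OF ad] b(2)[rule_format, OF ad] by (simp add: Let_def)
  qed
  then show ?thesis using dim unfolding gromov_witten_def by simp
qed

section \<open>Coordinates adapted to two opposite flags\<close>

text \<open>The cofactors along row \<open>r\<close> do not involve that row; this is why
  \<open>C\<close> can be chosen before \<open>u\<close>.\<close>

lemma det_row_expansion:
  assumes "r < n"
  shows "\<exists>C. \<forall>u. Determinant.det (Matrix.mat n n (\<lambda>(i, j). if i = r then u j else M i j))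
    = (\<Sum>j<n. u j * (C j :: complex))"
proof -
  let ?A = "\<lambda>u. Matrix.mat n n (\<lambda>(i, j). if i = r then u j else M i j)"
  have md: "mat_delete (?A u) r j = mat_delete (?A (\<lambda>_. 0)) r j" for u j
    by (rule eq_matI) (auto simp: mat_delete_def)
  have cof: "cofactor (?A u) r j = cofactor (?A (\<lambda>_. 0)) r j" for u j
    unfolding cofactor_def md[of u j] ..
  have "Determinant.det (?A u) = (\<Sum>j<n. u j * cofactor (?A (\<lambda>_. 0)) r j)" for u
  proof -
    have "Determinant.det (?A u) = (\<Sum>j<n. ?A u $$ (r, j) * cofactor (?A u) r j)"
      by (rule laplace_expansion_row[of _ n]) (use assms in auto)
    also have "\<dots> = (\<Sum>j<n. u j * cofactor (?A (\<lambda>_. 0)) r j)"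
      by (rule sum.cong) (use assms cof in auto)
    finally show ?thesis .
  qed
  then show ?thesis by blast
qed

lemma minorsL_row_linear:
  assumes "r < l"
  shows "minorsL l (b(r := c *s u + d *s v)) L = c * minorsL l (b(r := u)) L + d * minorsL l (b(r := v)) L"
proof -
  obtain C where C: "\<And>u. Determinant.det (Matrix.mat l l (\<lambda>(i, j). if i = r then u j else b i $ (L ! j)))
    = (\<Sum>j<l. u j * C j)"
    using det_row_expansion[OF assms, of "\<lambda>i j. b i $ (L ! j)"] by blast
  have m: "minorsL l (b(r := w)) L = (\<Sum>j<l. w $ (L ! j) * C j)" for w
  proof -
    have "Matrix.mat l l (\<lambda>(i, j). (b(r := w)) i $ (L ! j))
        = Matrix.mat l l (\<lambda>(i, j). if i = r then w $ (L ! j) else b i $ (L ! j))"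
      by (rule eq_matI) auto
    then show ?thesis unfolding minorsL_def using C[of "\<lambda>j. w $ (L ! j)"] by (simp only:)
  qed
  show ?thesis
    unfolding m by (simp add: sum.distrib[symmetric] sum_distrib_left algebra_simps)
qed

lemma fdet_minorsL:
  "fdet (b :: nat \<Rightarrow> 'n::{finite,linorder} cspace) = minorsL CARD('n) b (enum_list TYPE('n))"
  by (simp add: fdet_def minorsL_def)

text \<open>If the first n members are independent, the m-th space of the flag of \<open>g\<close>
  and the (n - m)-th space of the flag of \<open>h\<close> are complementary. Demanded for all m <=
  n, this says that the two flags are opposite.\<close>

definition mixed :: "nat \<Rightarrow> (nat \<Rightarrow> 'a) \<Rightarrow> (nat \<Rightarrow> 'a) \<Rightarrow> nat \<Rightarrow> 'a" where
  "mixed m g h i = (if i < m then g i else h (i - m))"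

text \<open>The functional \<open>ycoord g h m\<close> vanishes on \<open>g\<^sub>0, \<dots>, g\<^sub>m\<^sub>-\<^sub>1\<close> and on \<open>h\<^sub>0, \<dots>, h\<^sub>n\<^sub>-\<^sub>m\<^sub>-\<^sub>2\<close>.\<close>

definition ycoord :: "(nat \<Rightarrow> 'n::{finite,linorder} cspace) \<Rightarrow> (nat \<Rightarrow> 'n cspace) \<Rightarrow> nat \<Rightarrow> 'n cspace \<Rightarrow> complex" where
  "ycoord g h m v = fdet ((mixed (Suc m) g h)(m := v))"

lemma ycoord_linear:
  fixes g h :: "nat \<Rightarrow> 'n::{finite,linorder} cspace"
  assumes "m < CARD('n)"
  shows "ycoord g h m (c *s u + d *s v) = c * ycoord g h m u + d * ycoord g h m v"
  unfolding ycoord_def fdet_minorsL by (rule minorsL_row_linear[OF assms])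

lemma fdet_repeat:
  fixes b :: "nat \<Rightarrow> 'n::{finite,linorder} cspace"
  assumes "i < CARD('n)" "j < CARD('n)" "i \<noteq> j" "b i = b j"
  shows "fdet b = 0"
proof (rule ccontr)
  assume "fdet b \<noteq> 0"
  then have "indep CARD('n) b" by (simp only: fdet_indep)
  from inj_onD[OF indep_imp(1)[OF this] assms(4)] assms(1,2,3) show False by simp
qed

lemma ycoord_g:
  fixes g h :: "nat \<Rightarrow> 'n::{finite,linorder} cspace"
  assumes "m < CARD('n)" "i < m"
  shows "ycoord g h m (g i) = 0"
  unfolding ycoord_def by (rule fdet_repeat[of i m]) (use assms in \<open>auto simp: mixed_def\<close>)

lemma ycoord_h:
  fixes g h :: "nat \<Rightarrow> 'n::{finite,linorder} cspace"
  assumes "m < CARD('n)" "i + m + 1 < CARD('n)"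
  shows "ycoord g h m (h i) = 0"
  unfolding ycoord_def by (rule fdet_repeat[of "m + 1 + i" m]) (use assms in \<open>auto simp: mixed_def\<close>)

definition linear_functional :: "('n::{finite,linorder} cspace \<Rightarrow> complex) \<Rightarrow> bool" where
  "linear_functional y \<longleftrightarrow> (\<forall>c d u v. y (c *s u + d *s v) = c * y u + d * y v)"

lemma linear_functionalD:
  assumes "linear_functional y"
  shows "y (c *s u) = c * y u" "y (u + v) = y u + y v" "y 0 = 0" "y (u - v) = y u - y v"
    "y (\<Sum>a\<in>A. f a) = (\<Sum>a\<in>A. y (f a))"
proof -
  have lin: "y (c *s u + d *s v) = c * y u + d * y v" for c d u v
    using assms unfolding linear_functional_def by blast
  show c: "y (c *s u) = c * y u" for c u using lin[of c u 0 u] by simp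
  show a: "y (u + v) = y u + y v" for u v using lin[of 1 u 1 v] by simp
  show z: "y 0 = 0" using c[of 0 0] by simp
  show "y (u - v) = y u - y v" using lin[of 1 u "-1" v] by simp
  show "y (\<Sum>a\<in>A. f a) = (\<Sum>a\<in>A. y (f a))"
    by (rule additive_sum) (rule z a)+
qed

lemma ycoord_functional:
  fixes g h :: "nat \<Rightarrow> 'n::{finite,linorder} cspace"
  assumes "m < CARD('n)"
  shows "linear_functional (ycoord g h m)"
  unfolding linear_functional_def using ycoord_linear[OF assms] by blast

lemma functional_spn_zero:
  assumes "linear_functional y" "\<And>i. i < r \<Longrightarrow> y (b i) = 0" "v \<in> spn r b"
  shows "y v = 0"
proof -
  obtain x where v: "v = lincomb r b x" using spn_memE[OF assms(3)] by blast
  have "y v = (\<Sum>i<r. x i * y (b i))"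
    unfolding v linear_functionalD(5)[OF assms(1)] by (simp only: linear_functionalD(1)[OF assms(1)])
  then show ?thesis using assms(2) by simp
qed

lemma lincomb_Suc: "lincomb (Suc r) b x = lincomb r b x + x r *s b r"
  by simp

text \<open>Descent along the flag of \<open>g\<close>: on the span of g_0, ..., g_m the functional
  of index m reads off the coefficient of g_m up to the factor
  \<open>fdet (mixed (Suc m) g h)\<close>, so its vanishing moves \<open>v\<close> into the previous
  space.\<close>

lemma ycoord_injective:
  fixes g h :: "nat \<Rightarrow> 'n::{finite,linorder} cspace"
  assumes opp: "\<And>m. m \<le> CARD('n) \<Longrightarrow> fdet (mixed m g h) \<noteq> 0"
    and v: "\<And>m. m < CARD('n) \<Longrightarrow> ycoord g h m v = 0"
  shows "v = 0"
proof -
  have UN: "v \<in> spn CARD('n) g"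
  proof -
    have "fdet g = fdet (mixed CARD('n) g h)"
      unfolding fdet_def by (intro arg_cong[where f = Determinant.det] eq_matI) (auto simp: mixed_def)
    then have "fdet g \<noteq> 0" using opp[of "CARD('n)"] by simp
    then have "indep CARD('n) g" by (simp only: fdet_indep)
    moreover have "vec.dim (UNIV :: 'n cspace set) = CARD('n)" by (rule vec_dim_card)
    ultimately have "UNIV = spn CARD('n) g" by (intro indep_in_subspace) simp_all
    then show ?thesis by blast
  qed
  have "v \<in> spn (CARD('n) - t) g" if "t \<le> CARD('n)" for t
    using that
  proof (induction t)
    case 0
    then show ?case using UN by simp
  next
    case (Suc t)
    define m where "m = CARD('n) - Suc t"
    have m: "CARD('n) - t = Suc m" "m < CARD('n)" using Suc.prems by (auto simp: m_def)
    have "v \<in> spn (Suc m) g" using Suc m(1) by simp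
    then obtain x where x: "v = lincomb (Suc m) g x" using spn_memE by blast
    have vx: "v = lincomb m g x + x m *s g m" unfolding x by (rule lincomb_Suc)
    note lf = ycoord_functional[OF m(2), of g h]
    have "ycoord g h m (lincomb m g x) = 0"
      by (rule functional_spn_zero[OF lf ycoord_g[OF m(2)] spn_memI])
    then have "ycoord g h m v = x m * ycoord g h m (g m)"
      unfolding vx linear_functionalD(2)[OF lf] linear_functionalD(1)[OF lf] by simp
    moreover have "ycoord g h m (g m) = fdet (mixed (Suc m) g h)"
    proof -
      have "(mixed (Suc m) g h)(m := g m) = mixed (Suc m) g h" by (rule ext) (simp add: mixed_def)
      then show ?thesis unfolding ycoord_def by simp
    qed
    ultimately have "x m = 0" using v[OF m(2)] opp[of "Suc m"] m(2) by simp
    then have "v = lincomb m g x" using vx by simp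
    then show ?case unfolding m_def[symmetric] using spn_memI by metis
  qed
  from this[of "CARD('n)"] show ?thesis by simp
qed

section \<open>Coordinate subspaces\<close>

text \<open>As many functionals as the dimension, without a common nonzero zero, are the coordinates
  with respect to a basis, obtained below as \<open>e\<close>. The functionals coming from two
  opposite flags are given by determinants, so no basis is at hand in advance.\<close>

locale coordinates =
  fixes y :: "nat \<Rightarrow> 'n::{finite,linorder} cspace \<Rightarrow> complex" and n :: nat
  assumes n: "n = CARD('n)" and lin: "\<And>m. m < n \<Longrightarrow> linear_functional (y m)"
    and inj: "\<And>v. (\<And>m. m < n \<Longrightarrow> y m v = 0) \<Longrightarrow> v = 0"
begin

lemma y_scale: "m < n \<Longrightarrow> y m (c *s u) = c * y m u"
  and y_add: "m < n \<Longrightarrow> y m (u + v) = y m u + y m v"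
  and y_zero: "m < n \<Longrightarrow> y m 0 = 0"
  and y_diff: "m < n \<Longrightarrow> y m (u - v) = y m u - y m v"
  using linear_functionalD[OF lin] by blast+

lemma y_sum: "m < n \<Longrightarrow> y m (\<Sum>a\<in>A. f a) = (\<Sum>a\<in>A. y m (f a))"
  by (rule linear_functionalD(5)[OF lin])

lemma y_eqI: "(\<And>m. m < n \<Longrightarrow> y m u = y m v) \<Longrightarrow> u = v"
  using inj[of "u - v"] by (simp add: y_diff)

text \<open>The values of the functionals on any basis form an invertible matrix; its inverse
  transforms that basis into the dual one.\<close>

lemma dual_basis_exists: "\<exists>e. \<forall>i<n. \<forall>m<n. y m (e i) = (if i = m then 1 else 0)"
proof -
  have "vec.dim (UNIV :: 'n cspace set) = n" unfolding n by (rule vec_dim_card)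
  then obtain c :: "nat \<Rightarrow> 'n cspace" where c: "indep n c"
    using subspace_indep_basis[OF vec.subspace_UNIV, where r = n] by blast
  let ?M = "Matrix.mat n n (\<lambda>(i, m). y m (c i))"
  have M: "?M \<in> carrier_mat n n" by simp
  have "Determinant.det ?M \<noteq> 0"
  proof
    assume "Determinant.det ?M = 0"
    then obtain x i where x: "i < n" "x i \<noteq> 0" "\<forall>m<n. (\<Sum>i<n. x i * y m (c i)) = 0"
      unfolding det_zero_iff_relation by blast
    have "lincomb n c x = 0"
    proof (rule inj)
      fix m assume m: "m < n"
      show "y m (lincomb n c x) = 0" using x(3) m by (simp add: y_sum y_scale)
    qed
    then show False using indepD[OF c] x(1,2) by blast
  qed
  then have "?M \<in> Units (ring_mat TYPE(complex) n n)" by (rule det_non_zero_imp_unit[OF M])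
  then obtain B where B: "B \<in> carrier_mat n n" "B * ?M = 1\<^sub>m n"
    unfolding Units_def by (auto simp: ring_mat_def)
  have "y m (lincomb n c (\<lambda>k. B $$ (i, k))) = (if i = m then 1 else 0)" if im: "i < n" "m < n" for i m
  proof -
    have "y m (lincomb n c (\<lambda>k. B $$ (i, k))) = (B * ?M) $$ (i, m)"
      using im B(1) by (simp add: y_sum y_scale scalar_prod_def atLeast0LessThan)
    then show ?thesis using im unfolding B(2) by simp
  qed
  then show ?thesis by (intro exI[of _ "\<lambda>i. lincomb n c (\<lambda>k. B $$ (i, k))"]) blast
qed

definition e :: "nat \<Rightarrow> 'n cspace" where
  "e = (SOME e. \<forall>i<n. \<forall>m<n. y m (e i) = (if i = m then 1 else 0))"

lemma y_e: "i < n \<Longrightarrow> m < n \<Longrightarrow> y m (e i) = (if i = m then 1 else 0)"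
  using someI_ex[OF dual_basis_exists] unfolding e_def by blast

definition csub :: "nat set \<Rightarrow> 'n cspace set" where
  "csub S = {v. \<forall>m<n. m \<notin> S \<longrightarrow> y m v = 0}"

lemma csubI: "(\<And>m. m < n \<Longrightarrow> m \<notin> S \<Longrightarrow> y m v = 0) \<Longrightarrow> v \<in> csub S"
  unfolding csub_def by blast

lemma csubD: "v \<in> csub S \<Longrightarrow> m < n \<Longrightarrow> m \<notin> S \<Longrightarrow> y m v = 0"
  unfolding csub_def by blast

lemma csub_subspace: "vec.subspace (csub S)"
  unfolding vec.subspace_def csub_def by (auto simp: y_zero y_add y_scale)

lemma csub_mono: "S \<subseteq> T \<Longrightarrow> csub S \<subseteq> csub T"
  unfolding csub_def by blast

definition proj :: "nat set \<Rightarrow> 'n cspace \<Rightarrow> 'n cspace" where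
  "proj S v = (\<Sum>m\<in>S \<inter> {..<n}. y m v *s e m)"

lemma y_proj:
  assumes "m < n"
  shows "y m (proj S v) = (if m \<in> S then y m v else 0)"
proof -
  have "y m (proj S v) = (\<Sum>i\<in>S \<inter> {..<n}. if i = m then y m v else 0)"
    unfolding proj_def y_sum[OF assms]
    by (rule sum.cong) (use assms in \<open>auto simp: y_scale y_e\<close>)
  then show ?thesis using assms by simp
qed

lemma proj_csub: "proj S v \<in> csub S"
  by (rule csubI) (simp add: y_proj)

lemma csub_proj: "v \<in> csub S \<Longrightarrow> v = proj S v"
  by (rule y_eqI) (auto simp: y_proj csubD)

lemma dim_csub:
  assumes "S \<subseteq> {..<n}"
  shows "vec.dim (csub S) = card S"
proof -
  have finS: "finite S" using assms finite_subset by blast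
  obtain s where s: "bij_betw s {..<card S} S" using bij_betw_from_nat_into_finite[OF finS] by blast
  have sS: "s i \<in> S" if "i < card S" for i using s that by (auto simp: bij_betw_def)
  have sn: "s i < n" if "i < card S" for i using sS[OF that] assms by blast
  have sinj: "s i = s j \<Longrightarrow> i = j" if "i < card S" "j < card S" for i j
    using s that by (auto simp: bij_betw_def inj_on_def)
  have ind: "indep (card S) (\<lambda>i. e (s i))"
    unfolding indep_def
  proof (intro allI impI)
    fix x j assume x: "lincomb (card S) (\<lambda>i. e (s i)) x = 0" and j: "j < card S"
    have "y (s j) (lincomb (card S) (\<lambda>i. e (s i)) x) = (\<Sum>i<card S. if i = j then x j else 0)"
      unfolding y_sum[OF sn[OF j]]
      by (rule sum.cong) (use j sn sinj in \<open>auto simp: y_scale y_e\<close>)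
    also have "\<dots> = x j" using j by simp
    finally show "x j = 0" using x y_zero[OF sn[OF j]] by simp
  qed
  have "csub S = spn (card S) (\<lambda>i. e (s i))"
  proof
    show "csub S \<subseteq> spn (card S) (\<lambda>i. e (s i))"
    proof
      fix v assume v: "v \<in> csub S"
      have "S \<inter> {..<n} = S" using assms by blast
      then have "v = (\<Sum>m\<in>S. y m v *s e m)" using csub_proj[OF v] unfolding proj_def by simp
      also have "\<dots> = lincomb (card S) (\<lambda>i. e (s i)) (\<lambda>i. y (s i) v)"
        by (rule sum.reindex_bij_betw[OF s, symmetric])
      finally show "v \<in> spn (card S) (\<lambda>i. e (s i))" using spn_memI by metis
    qed
    show "spn (card S) (\<lambda>i. e (s i)) \<subseteq> csub S"
    proof (rule vec.span_minimal[OF _ csub_subspace])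
      show "(\<lambda>i. e (s i)) ` {..<card S} \<subseteq> csub S"
        using sS sn by (auto intro!: csubI simp: y_e)
    qed
  qed
  then show ?thesis using indep_dim[OF ind] by simp
qed

end

lemma dim_Int_ge:
  fixes V W X :: "'n::{finite,linorder} cspace set"
  assumes "vec.subspace V" "vec.subspace W" "vec.subspace X" "V \<subseteq> X" "W \<subseteq> X"
  shows "vec.dim V + vec.dim W \<le> vec.dim (V \<inter> W) + vec.dim X"
proof -
  let ?S = "{x + y |x y. x \<in> V \<and> y \<in> W}"
  have "?S \<subseteq> X" using assms vec.subspace_add[OF assms(3)] by auto
  then have "vec.dim ?S \<le> vec.dim X" by (rule vec.dim_subset)
  then show ?thesis using vec.dim_sums_Int[OF assms(1,2)] by simp
qed

lemma dim_pos_nonzero: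
  assumes "vec.dim V \<ge> 1"
  shows "\<exists>v\<in>V. v \<noteq> (0 :: 'n::{finite,linorder} cspace)"
proof (rule ccontr)
  assume "\<not> ?thesis"
  then have "V \<subseteq> {0}" by blast
  then have "vec.dim V = 0" by (simp only: vec.dim_eq_0)
  then show False using assms by linarith
qed

lemma nonzero_dim_pos:
  assumes "v \<in> V" "v \<noteq> (0 :: 'n::{finite,linorder} cspace)"
  shows "vec.dim V \<ge> 1"
proof (rule ccontr)
  assume "\<not> ?thesis"
  then have "vec.dim V = 0" by linarith
  then have "V \<subseteq> {0}" by (simp only: vec.dim_eq_0)
  then show False using assms by blast
qed

lemma indep_dim_ge:
  assumes "indep r b" "\<And>i. i < r \<Longrightarrow> b i \<in> V"
  shows "r \<le> vec.dim V"
proof -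
  have "b ` {..<r} \<subseteq> V" using assms(2) by blast
  then have "vec.dim (b ` {..<r}) \<le> vec.dim V" by (rule vec.dim_subset)
  then show ?thesis using indep_dim[OF assms(1)] by (simp add: vec.dim_span)
qed

section \<open>The classical Pieri count\<close>

text \<open>\<open>f\<close> comes from the flag of the one-row partition, whose space of dimension
  a = k + 1 - p enters the only effective condition. The assumption \<open>gen\<close> says that the
  first \<open>a\<close> vectors of \<open>f\<close> are independent and that their span meets every
  coordinate subspace of codimension \<open>a\<close> only in zero.\<close>

locale pieri_position = coordinates y n
  for y :: "nat \<Rightarrow> 'n::{finite,linorder} cspace \<Rightarrow> complex" and n :: nat +
  fixes l k p :: nat and \<alpha> \<mu> :: "nat list" and f :: "nat \<Rightarrow> 'n cspace" and a :: nat
  assumes nlk: "n = l + k" and l: "l \<ge> 1" and p: "1 \<le> p" "p \<le> k" and a: "a = k + 1 - p"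
    and \<alpha>: "\<alpha> \<in> rect_partitions l k" and \<mu>: "\<mu> \<in> rect_partitions l k"
    and size: "sum_list \<mu> = sum_list \<alpha> + p"
    and gen: "\<And>S x i. S \<subseteq> {..<n} \<Longrightarrow> card S = a \<Longrightarrow> (\<And>m. m \<in> S \<Longrightarrow> y m (lincomb a f x) = 0) \<Longrightarrow>
      i < a \<Longrightarrow> x i = 0"
begin

text \<open>Counting from 0, the space of dimension \<open>Hi j + 1\<close> in the flag for \<alpha>
  consists of the vectors supported on the coordinates up to \<open>Hi j\<close>, and the space of
  dimension \<open>n - Lo j\<close> in the flag for the dual of \<mu> of those supported from
  \<open>Lo j\<close> on. The two conditions with index j thus concern the interval from
  \<open>Lo j\<close> to \<open>Hi j\<close>.\<close>

definition Lo :: "nat \<Rightarrow> nat" where "Lo j = k + j - \<mu> ! j"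
definition Hi :: "nat \<Rightarrow> nat" where "Hi j = k + j - \<alpha> ! j"
definition U :: "nat set" where "U = (\<Union>j<l. {Lo j..Hi j})"

definition sol :: "'n cspace set set" where
  "sol = {V \<in> Gr l. 1 \<le> vec.dim (V \<inter> spn a f) \<and>
     (\<forall>j<l. Suc j \<le> vec.dim (V \<inter> csub {..Hi j})) \<and> (\<forall>j<l. l - j \<le> vec.dim (V \<inter> csub {Lo j..}))}"

lemma bounds: "j < l \<Longrightarrow> \<alpha> ! j \<le> k" "j < l \<Longrightarrow> \<mu> ! j \<le> k"
  "i \<le> j \<Longrightarrow> j < l \<Longrightarrow> \<alpha> ! j \<le> \<alpha> ! i" "i \<le> j \<Longrightarrow> j < l \<Longrightarrow> \<mu> ! j \<le> \<mu> ! i"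
  using \<alpha> \<mu> unfolding rect_partitions_nth by blast+

lemma lengths: "length \<alpha> = l" "length \<mu> = l"
  using \<alpha> \<mu> unfolding rect_partitions_nth by blast+

lemma Hi_lt: "j < l \<Longrightarrow> Hi j < n"
  unfolding Hi_def nlk by simp

lemma Hi_mono: "i < j \<Longrightarrow> j < l \<Longrightarrow> Hi i < Hi j"
  using bounds(1)[of j] bounds(1)[of i] bounds(3)[of i j] unfolding Hi_def by simp

lemma Lo_mono: "i < j \<Longrightarrow> j < l \<Longrightarrow> Lo i < Lo j"
  using bounds(2)[of j] bounds(2)[of i] bounds(4)[of i j] unfolding Lo_def by simp

lemma U_sub: "U \<subseteq> {..<n}"
  unfolding U_def using Hi_lt by (auto intro: le_less_trans)

lemma a_bounds: "1 \<le> a" "a \<le> n"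
  using a p nlk by simp_all

lemma gen_zero:
  assumes S: "S \<subseteq> {..<n}" "a \<le> card S" and v: "v \<in> spn a f" "\<And>m. m \<in> S \<Longrightarrow> y m v = 0"
  shows "v = 0"
proof -
  obtain x where x: "v = lincomb a f x" using spn_memE[OF v(1)] by blast
  obtain S' where S': "S' \<subseteq> S" "card S' = a" using obtain_subset_with_card_n[OF S(2)] by blast
  have S'n: "S' \<subseteq> {..<n}" using S'(1) S(1) by (rule order_trans)
  have vS: "y m (lincomb a f x) = 0" if "m \<in> S'" for m
    using v(2)[OF subsetD[OF S'(1) that]] unfolding x .
  have "x i = 0" if "i < a" for i
    using gen[OF S'n S'(2) vS that] .
  then show ?thesis unfolding x by simp
qed

lemma f_indep: "indep a f"
  unfolding indep_def
proof (intro allI impI)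
  fix x i assume x: "lincomb a f x = 0" and i: "i < a"
  show "x i = 0"
  proof (rule gen[OF _ _ _ i])
    show "{..<a} \<subseteq> {..<n}" using a_bounds by simp
    show "y m (lincomb a f x) = 0" if "m \<in> {..<a}" for m
      unfolding x using that a_bounds y_zero by simp
  qed simp
qed

text \<open>The two conditions provide subspaces of \<open>V\<close> of dimensions at least j + 1
  and l - j. These add up to l + 1, so the subspaces share a nonzero vector.\<close>

lemma interval_vector:
  assumes V: "V \<in> sol" and j: "j < l"
  shows "\<exists>v. v \<in> V \<and> v \<in> csub {Lo j..Hi j} \<and> v \<noteq> 0"
proof -
  have VG: "vec.subspace V" "vec.dim V = l" using V by (auto simp: sol_def Gr_iff)
  let ?P = "V \<inter> csub {..Hi j}" and ?Q = "V \<inter> csub {Lo j..}"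
  have dims: "Suc j \<le> vec.dim ?P" "l - j \<le> vec.dim ?Q" using V j by (auto simp: sol_def)
  have sub: "vec.subspace ?P" "vec.subspace ?Q" using VG(1) csub_subspace vec.subspace_inter by blast+
  have "vec.dim ?P + vec.dim ?Q \<le> vec.dim (?P \<inter> ?Q) + vec.dim V"
    by (rule dim_Int_ge[OF sub VG(1)]) auto
  then have "vec.dim (?P \<inter> ?Q) \<ge> 1" using dims VG(2) j by linarith
  then obtain v where v: "v \<in> ?P \<inter> ?Q" "v \<noteq> 0" using dim_pos_nonzero by blast
  have "v \<in> csub {Lo j..Hi j}"
  proof (rule csubI)
    fix m assume m: "m < n" "m \<notin> {Lo j..Hi j}"
    then have "m \<notin> {..Hi j} \<or> m \<notin> {Lo j..}" by auto
    then show "y m v = 0" using v(1) m(1) csubD by blast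
  qed
  then show ?thesis using v by blast
qed

lemma interval_nonempty:
  assumes V: "V \<in> sol" and j: "j < l"
  shows "Lo j \<le> Hi j"
proof (rule ccontr)
  assume "\<not> ?thesis"
  then have e: "{Lo j..Hi j} = {}" by simp
  obtain v where "v \<in> csub {Lo j..Hi j}" "v \<noteq> 0" using interval_vector[OF assms] by blast
  then show False unfolding e using inj csubD by blast
qed

text \<open>A coordinate outside all intervals splits the intervals into those below and those above it;
  by dimensions \<open>V\<close> is the sum of two subspaces on which the coordinate vanishes.\<close>

lemma sol_csub:
  assumes V: "V \<in> sol"
  shows "V \<subseteq> csub U"
proof
  fix v assume v: "v \<in> V"
  have VG: "vec.subspace V" "vec.dim V = l" using V by (auto simp: sol_def Gr_iff)
  show "v \<in> csub U"
  proof (rule csubI)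
    fix m assume m: "m < n" "m \<notin> U"
    \<comment> \<open>\<open>c\<close> is the number of intervals that end before \<open>m\<close>;
      since \<open>m\<close> is in no interval, the remaining ones start after it.\<close>
    define c where "c = (LEAST c. c = l \<or> m \<le> Hi c)"
    have c1: "c = l \<or> m \<le> Hi c" unfolding c_def by (rule LeastI[of _ l]) simp
    have c2: "c \<le> l" unfolding c_def by (rule Least_le) simp
    have below: "Hi j < m" if "j < c" for j
      using not_less_Least[OF that[unfolded c_def]] by simp
    have above: "m < Lo c" if "c < l"
    proof -
      have "m \<le> Hi c" using c1 that by simp
      moreover have "m \<notin> {Lo c..Hi c}" using m(2) that unfolding U_def by blast
      ultimately show ?thesis by simp
    qed
    define P where "P = (if c = 0 then {0} else V \<inter> csub {..Hi (c - 1)})"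
    define Q where "Q = (if c = l then {0} else V \<inter> csub {Lo c..})"
    have sP: "vec.subspace P" unfolding P_def using VG(1) csub_subspace vec.subspace_inter vec.subspace_0 vec.subspace_single_0 by auto
    have sQ: "vec.subspace Q" unfolding Q_def using VG(1) csub_subspace vec.subspace_inter vec.subspace_single_0 by auto
    have V0: "0 \<in> V" using VG(1) by (rule vec.subspace_0)
    have PV: "P \<subseteq> V" "Q \<subseteq> V" unfolding P_def Q_def using V0 by auto
    have dP: "c \<le> vec.dim P"
    proof (cases "c = 0")
      case False
      then have c': "c - 1 < l" "Suc (c - 1) = c" using c2 by auto
      then have "Suc (c - 1) \<le> vec.dim (V \<inter> csub {..Hi (c - 1)})" using V unfolding sol_def by blast
      then show ?thesis using False c'(2) unfolding P_def by (simp only: if_False)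
    qed simp
    have dQ: "l - c \<le> vec.dim Q"
    proof (cases "c = l")
      case False
      then have "c < l" using c2 by simp
      then show ?thesis using V False unfolding sol_def Q_def by simp
    qed simp
    have Pm: "y m u = 0" if "u \<in> P" for u
    proof (cases "c = 0")
      case True
      then show ?thesis using that y_zero[OF m(1)] unfolding P_def by simp
    next
      case False
      then have "m \<notin> {..Hi (c - 1)}" using below[of "c - 1"] by simp
      then show ?thesis using that False csubD[OF _ m(1)] unfolding P_def by auto
    qed
    have Qm: "y m u = 0" if "u \<in> Q" for u
    proof (cases "c = l")
      case True
      then show ?thesis using that y_zero[OF m(1)] unfolding Q_def by simp
    next
      case False
      then have "m \<notin> {Lo c..}" using above c2 by simp
      then show ?thesis using that False csubD[OF _ m(1)] unfolding Q_def by auto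
    qed
    have PQ: "P \<inter> Q \<subseteq> {0}"
    proof (cases "c = 0 \<or> c = l")
      case True
      then show ?thesis unfolding P_def Q_def by auto
    next
      case False
      show ?thesis
      proof
        fix u assume u: "u \<in> P \<inter> Q"
        have "u = 0"
        proof (rule inj)
          fix i assume i: "i < n"
          have "Hi (c - 1) < Lo c" using below[of "c - 1"] above False c2 by simp
          then have "i \<notin> {..Hi (c - 1)} \<or> i \<notin> {Lo c..}" by auto
          then show "y i u = 0" using u False csubD[OF _ i] unfolding P_def Q_def by auto
        qed
        then show "u \<in> {0}" by simp
      qed
    qed
    let ?S = "{x + z |x z. x \<in> P \<and> z \<in> Q}"
    have "vec.dim (P \<inter> Q) = 0" using PQ by (simp only: vec.dim_eq_0)
    then have dS: "vec.dim V \<le> vec.dim ?S" using vec.dim_sums_Int[OF sP sQ] dP dQ VG(2) c2 by linarith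
    have "?S \<subseteq> V" using PV vec.subspace_add[OF VG(1)] by auto
    then have "?S = V" using vec.subspace_sums[OF sP sQ] VG(1) dS by (intro vec.subspace_dim_equal)
    then obtain x z where "v = x + z" "x \<in> P" "z \<in> Q" using v by blast
    then show "y m v = 0" using Pm Qm y_add[OF m(1)] by simp
  qed
qed

lemma sum_lengths:
  assumes "\<And>j. j < l \<Longrightarrow> Lo j \<le> Hi j"
  shows "(\<Sum>j<l. card {Lo j..Hi j}) = l + p"
proof -
  have "int (card {Lo j..Hi j}) = int (\<mu> ! j) - int (\<alpha> ! j) + 1" if j: "j < l" for j
    using assms[OF j] bounds(1,2)[OF j] unfolding Lo_def Hi_def by simp
  then have "int (\<Sum>j<l. card {Lo j..Hi j}) = (\<Sum>j<l. int (\<mu> ! j) - int (\<alpha> ! j) + 1)" by simp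
  also have "\<dots> = int (\<Sum>j<l. \<mu> ! j) - int (\<Sum>j<l. \<alpha> ! j) + int l"
    by (simp add: sum.distrib sum_subtractf)
  also have "\<dots> = int (l + p)" using size lengths by (simp add: sum_list_nth)
  finally show ?thesis by (simp only: of_nat_eq_iff)
qed

text \<open>The vector of \<open>V\<close> in the span of \<open>f\<close> is supported on
  \<open>U\<close>. Fewer than l + p elements in \<open>U\<close> would leave it at least n - (l +
  p) + 1 = a zero coordinates, so it would vanish. The lengths of the intervals sum to l + p, so
  they must be disjoint, which is the interlacing condition.\<close>

lemma sol_strip:
  assumes V: "V \<in> sol"
  shows "horizontal_strip \<alpha> \<mu>"
proof -
  have ne: "Lo j \<le> Hi j" if "j < l" for j by (rule interval_nonempty[OF V that])
  have cardU: "l + p \<le> card U"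
  proof (rule ccontr)
    assume "\<not> ?thesis"
    moreover have "card ({..<n} - U) = n - card U" using U_sub by (simp add: card_Diff_subset finite_subset)
    ultimately have "a \<le> card ({..<n} - U)" using a p nlk by simp
    moreover obtain v where v: "v \<in> V \<inter> spn a f" "v \<noteq> 0"
      using dim_pos_nonzero[of "V \<inter> spn a f"] V unfolding sol_def by blast
    moreover have "y m v = 0" if "m \<in> {..<n} - U" for m
      using subsetD[OF sol_csub[OF V]] v(1) that csubD by blast
    ultimately show False using gen_zero[of "{..<n} - U" v] by blast
  qed
  have gap: "Hi j < Lo (Suc j)" if j: "Suc j < l" for j
  proof (rule ccontr)
    assume not: "\<not> ?thesis"
    \<comment> \<open>If consecutive intervals met, \<open>Hi j\<close> would be covered twice and
      could be removed from one of them without changing the union.\<close>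
    let ?I = "\<lambda>i. if i = j then {Lo i..Hi i} - {Hi j} else {Lo i..Hi i}"
    have "Hi j \<in> {Lo (Suc j)..Hi (Suc j)}" using not Hi_mono[of j "Suc j"] j by simp
    then have "U \<subseteq> (\<Union>i<l. ?I i)"
      unfolding U_def using j by (auto split: if_splits)
    then have "card U \<le> card (\<Union>i<l. ?I i)" by (rule card_mono[rotated]) auto
    also have "\<dots> \<le> (\<Sum>i<l. card (?I i))" by (rule card_UN_le) simp
    also have "\<dots> < (\<Sum>i<l. card {Lo i..Hi i})"
    proof (rule sum_strict_mono_ex1)
      show "\<forall>i\<in>{..<l}. card (?I i) \<le> card {Lo i..Hi i}" by (intro ballI card_mono) auto
      have "Hi j \<in> {Lo j..Hi j}" using ne[of j] j by simp
      then have "card ({Lo j..Hi j} - {Hi j}) < card {Lo j..Hi j}" by (intro card_Diff1_less) simp_all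
      then show "\<exists>i\<in>{..<l}. card (?I i) < card {Lo i..Hi i}" using j by (intro bexI[of _ j]) simp_all
    qed simp
    also have "\<dots> = l + p" by (rule sum_lengths[OF ne])
    finally show False using cardU by simp
  qed
  show ?thesis
    unfolding horizontal_strip_def lengths
  proof (intro conjI allI impI)
    fix i assume "i < l"
    then show "\<alpha> ! i \<le> \<mu> ! i" using ne[of i] bounds(1,2)[of i] unfolding Lo_def Hi_def by simp
  next
    fix i assume "Suc i < l"
    then show "\<mu> ! Suc i \<le> \<alpha> ! i"
      using gap[of i] bounds(1)[of i] bounds(2)[of "Suc i"] unfolding Lo_def Hi_def by simp
  qed
qed

text \<open>The intervals are now disjoint and \<open>U\<close> has l + p elements, so the span of
  \<open>f\<close> meets \<open>csub U\<close> in a line. Its generator \<open>v\<close> has no zero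
  coordinate in \<open>U\<close>, and \<open>V\<close> has to be spanned by the parts of
  \<open>v\<close> on the single intervals.\<close>

lemma sol_card:
  assumes strip: "horizontal_strip \<alpha> \<mu>"
  shows "\<exists>V. sol = {V}"
proof -
  have ne: "Lo j \<le> Hi j" if "j < l" for j
    using strip that bounds(1,2)[OF that] unfolding horizontal_strip_def lengths Lo_def Hi_def by auto
  have gap: "Hi i < Lo j" if ij: "i < j" "j < l" for i j
  proof -
    obtain j' where j': "j = Suc j'" using ij(1) by (cases j) auto
    have "\<mu> ! j \<le> \<alpha> ! j'" using strip ij(2) unfolding horizontal_strip_def lengths j' by blast
    then have "Hi j' < Lo j" using bounds(1)[of j'] bounds(2)[of j] ij(2) unfolding Lo_def Hi_def j' by simp
    moreover have "Hi i \<le> Hi j'" using Hi_mono[of i j'] ij j' by (cases "i = j'") auto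
    ultimately show ?thesis by simp
  qed
  have disj: "m \<notin> {Lo i..Hi i}" if "m \<in> {Lo j..Hi j}" "i < l" "j < l" "i \<noteq> j" for m i j
  proof (cases "i < j")
    case True
    then show ?thesis using gap[of i j] that by simp
  next
    case False
    then show ?thesis using gap[of j i] that by simp
  qed
  have cardU: "card U = l + p"
  proof -
    have "card U = (\<Sum>j<l. card {Lo j..Hi j})"
      unfolding U_def
    proof (rule card_UN_disjoint)
      show "\<forall>i\<in>{..<l}. \<forall>j\<in>{..<l}. i \<noteq> j \<longrightarrow> {Lo i..Hi i} \<inter> {Lo j..Hi j} = {}"
        using disj by blast
    qed simp_all
    then show ?thesis using sum_lengths[OF ne] by simp
  qed
  define Z where "Z = {..<n} - U"
  have finU: "finite U" using U_sub finite_subset by blast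
  have cardZ: "card Z = n - (l + p)" unfolding Z_def using U_sub finU cardU by (simp add: card_Diff_subset)
  have lp: "l + p + a = n + 1" using a p nlk by simp
  \<comment> \<open>A further zero coordinate in \<open>U\<close> brings the number of zeros to n -
    (l + p) + 1 = a.\<close>
  have vanish: "u = 0" if u: "u \<in> spn a f" "u \<in> csub U" "m0 \<in> U" "y m0 u = 0" for u m0
  proof (rule gen_zero[of "insert m0 Z"])
    show "insert m0 Z \<subseteq> {..<n}" using u(3) U_sub unfolding Z_def by blast
    have "m0 \<notin> Z" "finite Z" using u(3) unfolding Z_def by blast+
    then have "card (insert m0 Z) = Suc (card Z)" by simp
    then show "a \<le> card (insert m0 Z)" using cardZ lp by simp
    show "y m u = 0" if "m \<in> insert m0 Z" for m
      using that u(2,4) csubD[of u U m] unfolding Z_def by auto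
  qed (rule u(1))
  have "vec.dim (spn a f) + vec.dim (csub U) \<le> vec.dim (spn a f \<inter> csub U) + vec.dim (UNIV :: 'n cspace set)"
    by (rule dim_Int_ge) (simp_all add: csub_subspace)
  moreover have "vec.dim (UNIV :: 'n cspace set) = n" unfolding n by (rule vec_dim_card)
  ultimately have "vec.dim (spn a f \<inter> csub U) \<ge> 1"
    using indep_dim[OF f_indep] dim_csub[OF U_sub] cardU lp by linarith
  then obtain v where v: "v \<in> spn a f" "v \<in> csub U" "v \<noteq> 0" using dim_pos_nonzero by blast
  have vnz: "y m v \<noteq> 0" if "m \<in> U" for m using vanish[OF v(1,2) that] v(3) by blast
  let ?w = "\<lambda>j. proj {Lo j..Hi j} v"
  have HiU: "Hi j \<in> U" if "j < l" for j using that ne[OF that] unfolding U_def by auto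
  have Hin: "Hi j < n" if "j < l" for j using HiU[OF that] U_sub by blast
  \<comment> \<open>Nonzero vectors supported on different intervals are independent; the offset
    \<open>c\<close> covers both initial and final segments of the intervals.\<close>
  have family: "indep r b" if sub: "\<And>i. i < r \<Longrightarrow> b i \<in> csub {Lo (c + i)..Hi (c + i)} \<and> b i \<noteq> 0"
      and cr: "c + r \<le> l" for r b c
    unfolding indep_def
  proof (intro allI impI)
    fix x j assume x: "lincomb r b x = 0" and j: "j < r"
    obtain m where m: "m < n" "y m (b j) \<noteq> 0" using inj[of "b j"] sub[OF j] by blast
    have mI: "m \<in> {Lo (c + j)..Hi (c + j)}"
    proof (rule ccontr)
      assume "m \<notin> {Lo (c + j)..Hi (c + j)}"
      then have "y m (b j) = 0" using csubD[of "b j" "{Lo (c + j)..Hi (c + j)}" m] sub[OF j] m(1) by blast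
      then show False using m(2) by contradiction
    qed
    have "y m (lincomb r b x) = (\<Sum>i<r. if i = j then x j * y m (b j) else 0)"
      unfolding y_sum[OF m(1)]
    proof (rule sum.cong[OF refl])
      fix i assume "i \<in> {..<r}"
      then have i: "i < r" by simp
      show "y m (x i *s b i) = (if i = j then x j * y m (b j) else 0)"
      proof (cases "i = j")
        case False
        have "m \<notin> {Lo (c + i)..Hi (c + i)}" by (rule disj[OF mI]) (use False i j cr in auto)
        then have "y m (b i) = 0" using csubD[of "b i" "{Lo (c + i)..Hi (c + i)}" m] sub[OF i] m(1) by blast
        then show ?thesis using False y_scale[OF m(1)] by simp
      qed (use y_scale[OF m(1)] in simp)
    qed
    also have "\<dots> = x j * y m (b j)" using j by simp
    finally show "x j = 0" using x m y_zero[OF m(1)] by simp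
  qed
  have w: "?w j \<in> csub {Lo j..Hi j} \<and> ?w j \<noteq> 0" if j: "j < l" for j
  proof
    show "?w j \<in> csub {Lo j..Hi j}" by (rule proj_csub)
    have "y (Hi j) (?w j) = y (Hi j) v" using y_proj[OF Hin[OF j]] ne[OF j] by simp
    then have "y (Hi j) (?w j) \<noteq> 0" using vnz[OF HiU[OF j]] by simp
    then show "?w j \<noteq> 0" using y_zero[OF Hin[OF j]] by metis
  qed
  have windep: "indep l ?w" by (rule family[of l ?w 0]) (use w in simp_all)
  define V0 where "V0 = spn l ?w"
  have V0G: "V0 \<in> Gr l" unfolding V0_def by (rule indep_Gr[OF windep])
  have wV0: "?w j \<in> V0" if "j < l" for j unfolding V0_def by (rule vec.span_base) (use that in simp)
  have vsum: "v = (\<Sum>j<l. ?w j)"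
  proof (rule y_eqI)
    fix m assume m: "m < n"
    have s: "y m (\<Sum>j<l. ?w j) = (\<Sum>j<l. if m \<in> {Lo j..Hi j} then y m v else 0)"
      unfolding y_sum[OF m] y_proj[OF m] ..
    show "y m v = y m (\<Sum>j<l. ?w j)"
    proof (cases "m \<in> U")
      case True
      then obtain j where j: "j < l" "m \<in> {Lo j..Hi j}" unfolding U_def by blast
      have "(\<Sum>i<l. if m \<in> {Lo i..Hi i} then y m v else 0) = (\<Sum>i<l. if i = j then y m v else 0)"
      proof (rule sum.cong[OF refl])
        fix i assume "i \<in> {..<l}"
        then show "(if m \<in> {Lo i..Hi i} then y m v else 0) = (if i = j then y m v else 0)"
          using disj[OF j(2), of i] j by (cases "i = j") auto
      qed
      then show ?thesis unfolding s using j(1) by simp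
    next
      case False
      then have z: "y m v = 0" by (rule csubD[OF v(2) m])
      show ?thesis unfolding s z by simp
    qed
  qed
  have vV0: "v \<in> V0"
    by (subst vsum) (rule vec.subspace_sum, use V0G wV0 in \<open>auto simp: Gr_iff\<close>)
  have V0sol: "V0 \<in> sol"
    unfolding sol_def
  proof (intro CollectI conjI allI impI)
    show "V0 \<in> Gr l" by (rule V0G)
    show "1 \<le> vec.dim (V0 \<inter> spn a f)" by (rule nonzero_dim_pos[of v]) (use vV0 v in auto)
  next
    fix j assume j: "j < l"
    show "Suc j \<le> vec.dim (V0 \<inter> csub {..Hi j})"
    proof (rule indep_dim_ge)
      show "indep (Suc j) ?w" by (rule family[of "Suc j" ?w 0]) (use w j in simp_all)
      fix i assume i: "i < Suc j"
      have "Hi i \<le> Hi j" using Hi_mono[of i j] i j by (cases "i = j") auto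
      then have "?w i \<in> csub {..Hi j}" using w[of i] csub_mono[of "{Lo i..Hi i}" "{..Hi j}"] i j by auto
      then show "?w i \<in> V0 \<inter> csub {..Hi j}" using wV0[of i] i j by simp
    qed
  next
    fix j assume j: "j < l"
    show "l - j \<le> vec.dim (V0 \<inter> csub {Lo j..})"
    proof (rule indep_dim_ge)
      show "indep (l - j) (\<lambda>i. ?w (j + i))" by (rule family[where c = j]) (use w j in simp_all)
      fix i assume i: "i < l - j"
      have "Lo j \<le> Lo (j + i)"
      proof (cases "i = 0")
        case False
        then have "Lo j < Lo (j + i)" by (intro Lo_mono) (use i in simp_all)
        then show ?thesis by simp
      qed simp
      then have "?w (j + i) \<in> csub {Lo j..}"
        using w[of "j + i"] csub_mono[of "{Lo (j + i)..Hi (j + i)}" "{Lo j..}"] i j by auto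
      then show "?w (j + i) \<in> V0 \<inter> csub {Lo j..}" using wV0[of "j + i"] i j by simp
    qed
  qed
  have "V = V0" if V: "V \<in> sol" for V
  proof -
    have VG: "vec.subspace V" "vec.dim V = l" using V by (auto simp: sol_def Gr_iff)
    obtain v' where v': "v' \<in> V" "v' \<in> spn a f" "v' \<noteq> 0"
      using dim_pos_nonzero[of "V \<inter> spn a f"] V unfolding sol_def by blast
    have v'U: "v' \<in> csub U" using sol_csub[OF V] v'(1) by blast
    have "0 < l" using l by simp
    note m0 = HiU[OF this] Hin[OF this]
    let ?c = "y (Hi 0) v" and ?c' = "y (Hi 0) v'"
    have "?c *s v' - ?c' *s v = 0"
    proof (rule vanish[OF _ _ m0(1)])
      show "?c *s v' - ?c' *s v \<in> spn a f"
        using v(1) v'(2) by (intro vec.span_diff vec.span_scale)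
      show "?c *s v' - ?c' *s v \<in> csub U"
        using v(2) v'U by (intro vec.subspace_diff[OF csub_subspace] vec.subspace_scale[OF csub_subspace])
      show "y (Hi 0) (?c *s v' - ?c' *s v) = 0" by (simp add: y_diff y_scale m0(2) mult.commute)
    qed
    then have scal: "?c' *s v = ?c *s v'" by simp
    have c'0: "?c' \<noteq> 0" using vanish[OF v'(2) v'U m0(1)] v'(3) by blast
    have eq: "v = (?c / ?c') *s v'"
    proof -
      have "(1 / ?c') *s (?c' *s v) = (1 / ?c') *s (?c *s v')" unfolding scal ..
      then show ?thesis using c'0 by simp
    qed
    have "(?c / ?c') *s v' \<in> V" by (rule vec.subspace_scale[OF VG(1) v'(1)])
    then have vV: "v \<in> V" unfolding eq[symmetric] .
    have "\<exists>u. \<forall>j<l. u j \<in> V \<and> u j \<in> csub {Lo j..Hi j} \<and> u j \<noteq> 0"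
      using interval_vector[OF V] by (intro choice) blast
    then obtain u where u: "\<And>j. j < l \<Longrightarrow> u j \<in> V \<and> u j \<in> csub {Lo j..Hi j} \<and> u j \<noteq> 0" by blast
    have "indep l u" by (rule family[of l u 0]) (use u in simp_all)
    then have Vu: "V = spn l u" by (rule indep_in_subspace) (use u VG in simp_all)
    obtain x where x: "v = lincomb l u x" using vV unfolding Vu by (rule spn_memE)
    \<comment> \<open>Comparing coordinates on the interval with index j shows that the projection
      of \<open>v\<close> is a multiple of \<open>u j\<close> and hence lies in
      \<open>V\<close>.\<close>
    have "?w j = x j *s u j" if j: "j < l" for j
    proof (rule y_eqI)
      fix m assume m: "m < n"
      show "y m (?w j) = y m (x j *s u j)"
      proof (cases "m \<in> {Lo j..Hi j}")
        case True
        have "y m v = (\<Sum>i<l. if i = j then x j * y m (u j) else 0)"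
          unfolding x y_sum[OF m]
        proof (rule sum.cong[OF refl])
          fix i assume "i \<in> {..<l}"
          then have i: "i < l" by simp
          show "y m (x i *s u i) = (if i = j then x j * y m (u j) else 0)"
          proof (cases "i = j")
            case False
            have "m \<notin> {Lo i..Hi i}" by (rule disj[OF True i j False])
            then have "y m (u i) = 0" using csubD[of "u i" "{Lo i..Hi i}" m] u[OF i] m by blast
            then show ?thesis using False y_scale[OF m] by simp
          qed (use y_scale[OF m] in simp)
        qed
        then show ?thesis using True j y_proj[OF m] y_scale[OF m] by simp
      next
        case False
        then have "y m (u j) = 0" using csubD[of "u j" "{Lo j..Hi j}" m] u[OF j] m by blast
        then show ?thesis unfolding y_proj[OF m] y_scale[OF m] if_not_P[OF False] by simp
      qed
    qed
    then have "?w j \<in> V" if "j < l" for j using that u vec.subspace_scale[OF VG(1)] by simp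
    then have "V = spn l ?w" by (intro indep_in_subspace[OF windep]) (use VG in simp_all)
    then show ?thesis unfolding V0_def .
  qed
  then have "sol = {V0}" using V0sol by blast
  then show ?thesis by blast
qed

lemma pieri_count: "finite sol" "card sol = (if horizontal_strip \<alpha> \<mu> then 1 else 0)"
proof -
  have *: "finite sol \<and> card sol = (if horizontal_strip \<alpha> \<mu> then 1 else 0)"
  proof (cases "horizontal_strip \<alpha> \<mu>")
    case True
    then obtain V where "sol = {V}" using sol_card by blast
    then show ?thesis using True by simp
  next
    case False
    then have "sol = {}" using sol_strip by blast
    then show ?thesis using False by simp
  qed
  then show "finite sol" "card sol = (if horizontal_strip \<alpha> \<mu> then 1 else 0)" by blast+
qed

end

section \<open>Genericity of the position used in the Pieri count\<close>

lemma indep_permute: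
  fixes e :: "nat \<Rightarrow> 'n::{finite,linorder} cspace"
  assumes e: "indep n e" and inj: "inj_on \<sigma> {..<n}" and im: "\<And>i. i < n \<Longrightarrow> \<sigma> i < n"
  shows "indep n (\<lambda>i. e (\<sigma> i))"
  unfolding indep_def
proof (intro allI impI)
  fix x j assume x: "lincomb n (\<lambda>i. e (\<sigma> i)) x = 0" and j: "j < n"
  have "\<sigma> ` {..<n} = {..<n}" by (rule endo_inj_surj) (use inj im in auto)
  then have bij: "bij_betw \<sigma> {..<n} {..<n}" using inj by (simp add: bij_betw_def)
  let ?inv = "inv_into {..<n} \<sigma>"
  have inv: "?inv (\<sigma> i) = i" if "i < n" for i by (rule inv_into_f_f[OF inj]) (use that in simp)
  have "lincomb n e (\<lambda>i. x (?inv i)) = (\<Sum>i<n. x (?inv (\<sigma> i)) *s e (\<sigma> i))"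
    by (rule sum.reindex_bij_betw[OF bij, symmetric])
  also have "\<dots> = lincomb n (\<lambda>i. e (\<sigma> i)) x" by (rule sum.cong) (simp_all add: inv)
  finally have "lincomb n e (\<lambda>i. x (?inv i)) = 0" unfolding x .
  from indepD[OF e this im[OF j]] show "x j = 0" unfolding inv[OF j] .
qed

lemma polyfun_mixed:
  assumes "m \<le> CARD('n)" "i < CARD('n)"
  shows "polyfun (\<lambda>b :: 'n::{finite,linorder} btriple. mixed m (b 1) (b 2) i $ j)"
proof (cases "i < m")
  case True
  then show ?thesis unfolding mixed_def using polyfun_coord[of 1 i j] assms by simp
next
  case False
  then show ?thesis unfolding mixed_def using polyfun_coord[of 2 "i - m" j] assms by simp
qed

lemma polyfun_ycoord:
  assumes m: "m < CARD('n)" and i: "i < CARD('n)"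
  shows "polyfun (\<lambda>b :: 'n::{finite,linorder} btriple. ycoord (b 1) (b 2) m (b 0 i))"
  unfolding ycoord_def
proof (rule polyfun_fdet)
  fix i' and j :: 'n assume i': "i' < CARD('n)"
  show "polyfun (\<lambda>b :: 'n btriple. ((mixed (Suc m) (b 1) (b 2))(m := b 0 i)) i' $ j)"
  proof (cases "i' = m")
    case True
    then show ?thesis using polyfun_coord[of 0 i j] i by simp
  next
    case False
    then show ?thesis using polyfun_mixed[of "Suc m" i' j] m i' by simp
  qed
qed

text \<open>The sample point for general position: a basis, the reversed basis, whose flag is
  opposite, and a family of basis vectors selected by \<open>s\<close>.\<close>

definition base_triple :: "(nat \<Rightarrow> 'n::{finite,linorder} cspace) \<Rightarrow> (nat \<Rightarrow> nat) \<Rightarrow> 'n btriple" where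
  "base_triple e s m i = (if m = 0 then e (s i) else if m = 1 then e i else e (CARD('n) - 1 - i))"

lemma base_triple_simps [simp]:
  "base_triple e s 0 i = e (s i)" "base_triple e s (Suc 0) = e"
  "base_triple (e :: nat \<Rightarrow> 'n::{finite,linorder} cspace) s 2 i = e (CARD('n) - 1 - i)"
  by (auto simp: base_triple_def)

lemma base_opposite:
  fixes e :: "nat \<Rightarrow> 'n::{finite,linorder} cspace"
  assumes e: "indep CARD('n) e" and m: "m \<le> CARD('n)"
  shows "fdet (mixed m (base_triple e s 1) (base_triple e s 2)) \<noteq> 0"
proof -
  let ?n = "CARD('n)"
  let ?\<sigma> = "\<lambda>i. if i < m then i else ?n - 1 - (i - m)"
  have eq: "mixed m (base_triple e s 1) (base_triple e s 2) = (\<lambda>i. e (?\<sigma> i))"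
    by (rule ext) (simp add: mixed_def)
  have "indep ?n (\<lambda>i. e (?\<sigma> i))"
  proof (rule indep_permute[OF e])
    show "inj_on ?\<sigma> {..<?n}" by (rule inj_onI) (use m in \<open>auto split: if_splits\<close>)
    show "?\<sigma> i < ?n" if "i < ?n" for i using that by auto
  qed
  then show ?thesis unfolding eq by (simp only: fdet_indep)
qed

lemma base_ycoord:
  fixes e :: "nat \<Rightarrow> 'n::{finite,linorder} cspace"
  assumes e: "indep CARD('n) e" and m: "m < CARD('n)" and j: "j < CARD('n)"
  shows "ycoord (base_triple e s 1) (base_triple e s 2) m (e j) = 0 \<longleftrightarrow> j \<noteq> m"
proof -
  let ?g = "base_triple e s 1" and ?h = "base_triple e s 2"
  consider "j < m" | "j > m" | "j = m" by linarith
  then show ?thesis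
  proof cases
    case 1
    then show ?thesis using ycoord_g[OF m 1, of ?g ?h] by simp
  next
    case 2
    have "ycoord ?g ?h m (?h (CARD('n) - 1 - j)) = 0" by (rule ycoord_h[OF m]) (use 2 j in simp)
    moreover have "?h (CARD('n) - 1 - j) = e j" using j by simp
    ultimately show ?thesis using 2 by simp
  next
    case 3
    have "(mixed (Suc m) ?g ?h)(m := e m) = mixed (Suc m) ?g ?h" by (rule ext) (simp add: mixed_def)
    then have "ycoord ?g ?h m (e m) = fdet (mixed (Suc m) ?g ?h)" unfolding ycoord_def by simp
    then show ?thesis using 3 base_opposite[OF e, of "Suc m" s] m by simp
  qed
qed

definition pieri_generic :: "nat \<Rightarrow> 'n::{finite,linorder} btriple \<Rightarrow> bool" where
  "pieri_generic a b \<longleftrightarrow> (\<forall>m\<in>{..CARD('n)}. fdet (mixed m (b 1) (b 2)) \<noteq> 0) \<and>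
     (\<forall>S\<in>{S. S \<subseteq> {..<CARD('n)} \<and> card S = a}.
        Determinant.det (Matrix.mat a a (\<lambda>(i, j). ycoord (b 1) (b 2) (sorted_list_of_set S ! j) (b 0 i))) \<noteq> 0)"

lemma sorted_nth_mem:
  assumes "finite S" "card S = a" "j < a"
  shows "sorted_list_of_set S ! j \<in> S"
  using nth_mem[of j "sorted_list_of_set S"] assms by simp

text \<open>There are finitely many conditions, and each may be tested at its own sample point. For
  the set \<open>S\<close> the selected vectors are those with index in \<open>S\<close>; the matrix
  is then diagonal with nonzero diagonal entries.\<close>

lemma generic_pieri_generic:
  assumes a: "a \<le> CARD('n)"
  shows "generic (pieri_generic a :: 'n::{finite,linorder} btriple \<Rightarrow> bool)"
proof -
  have "vec.dim (UNIV :: 'n cspace set) = CARD('n)" by (rule vec_dim_card)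
  then obtain e :: "nat \<Rightarrow> 'n cspace" where e: "indep CARD('n) e"
    using subspace_indep_basis[OF vec.subspace_UNIV] by blast
  have 1: "generic (\<lambda>b :: 'n btriple. fdet (mixed m (b 1) (b 2)) \<noteq> 0)" if "m \<in> {..CARD('n)}" for m
  proof (rule genericI)
    show "polyfun (\<lambda>b :: 'n btriple. fdet (mixed m (b 1) (b 2)))"
      by (rule polyfun_fdet) (use polyfun_mixed that in auto)
    show "fdet (mixed m (base_triple e id 1) (base_triple e id 2)) \<noteq> 0"
      by (rule base_opposite[OF e]) (use that in simp)
  qed
  have 2: "generic (\<lambda>b :: 'n btriple. Determinant.det (Matrix.mat a a
      (\<lambda>(i, j). ycoord (b 1) (b 2) (sorted_list_of_set S ! j) (b 0 i))) \<noteq> 0)"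
    if S: "S \<in> {S. S \<subseteq> {..<CARD('n)} \<and> card S = a}" for S
  proof (rule genericI)
    let ?s = "\<lambda>i. sorted_list_of_set S ! i"
    have finS: "finite S" using S finite_subset by blast
    have s: "?s j < CARD('n)" if "j < a" for j using sorted_nth_mem[OF finS _ that] S by blast
    show "polyfun (\<lambda>b :: 'n btriple. Determinant.det (Matrix.mat a a
      (\<lambda>(i, j). ycoord (b 1) (b 2) (?s j) (b 0 i))))"
      by (rule polyfun_det) (rule polyfun_ycoord, use s a in auto)
    let ?b = "base_triple e ?s"
    show "Determinant.det (Matrix.mat a a (\<lambda>(i, j). ycoord (?b 1) (?b 2) (?s j) (?b 0 i))) \<noteq> 0"
    proof
      assume "Determinant.det (Matrix.mat a a (\<lambda>(i, j). ycoord (?b 1) (?b 2) (?s j) (?b 0 i))) = 0"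
      then obtain x i where x: "i < a" "x i \<noteq> 0"
          "\<forall>j<a. (\<Sum>i<a. x i * ycoord (?b 1) (?b 2) (?s j) (?b 0 i)) = 0"
        unfolding det_zero_iff_relation by blast
      have "distinct (sorted_list_of_set S)" "length (sorted_list_of_set S) = a" using S by simp_all
      then have sinj: "?s i = ?s j \<longleftrightarrow> i = j" if "i < a" "j < a" for i j
        using that nth_eq_iff_index_eq by metis
      have "(\<Sum>j<a. x j * ycoord (?b 1) (?b 2) (?s i) (?b 0 j))
          = (\<Sum>j<a. if j = i then x i * ycoord (?b 1) (?b 2) (?s i) (e (?s i)) else 0)"
      proof (rule sum.cong[OF refl])
        fix j assume "j \<in> {..<a}"
        then have j: "j < a" by simp
        show "x j * ycoord (?b 1) (?b 2) (?s i) (?b 0 j)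
          = (if j = i then x i * ycoord (?b 1) (?b 2) (?s i) (e (?s i)) else 0)"
        proof (cases "j = i")
          case False
          then have "ycoord (?b 1) (?b 2) (?s i) (e (?s j)) = 0"
            using base_ycoord[OF e s[OF x(1)] s[OF j]] sinj[OF j x(1)] by blast
          then show ?thesis using False by simp
        qed simp
      qed
      also have "\<dots> = x i * ycoord (?b 1) (?b 2) (?s i) (e (?s i))" using x(1) by simp
      finally have "x i * ycoord (?b 1) (?b 2) (?s i) (e (?s i)) = 0" using x(1,3) by simp
      then show False using x(2) base_ycoord[OF e s[OF x(1)] s[OF x(1)]] by simp
    qed
  qed
  have fin: "finite {S. S \<subseteq> {..<CARD('n)} \<and> card S = a}" by simp
  have "generic (\<lambda>b :: 'n btriple. (\<forall>m\<in>{..CARD('n)}. fdet (mixed m (b 1) (b 2)) \<noteq> 0) \<and>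
     (\<forall>S\<in>{S. S \<subseteq> {..<CARD('n)} \<and> card S = a}.
        Determinant.det (Matrix.mat a a (\<lambda>(i, j). ycoord (b 1) (b 2) (sorted_list_of_set S ! j) (b 0 i))) \<noteq> 0))"
    by (intro generic_conj generic_ball 1 2 fin) auto
  then show ?thesis unfolding pieri_generic_def .
qed

section \<open>Schubert conditions in coordinates and the degree zero invariants\<close>

lemma complete_flagD:
  assumes "complete_flag (F :: 'n::{finite,linorder} cflag)" "1 \<le> i" "i \<le> CARD('n)"
  shows "vec.subspace (F i)" "vec.dim (F i) = i"
  using assms unfolding complete_flag_def by auto

text \<open>All but the first Schubert condition of a one-row partition hold for dimension reasons.\<close>

lemma schubert_row:
  fixes F :: "'n::{finite,linorder} cflag"
  assumes F: "complete_flag F" and n: "CARD('n) = l + k" and l: "l \<ge> 1" and p: "p \<le> k"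
  shows "V \<in> schubert_variety l k (row l p) F \<longleftrightarrow> V \<in> Gr l \<and> 1 \<le> vec.dim (V \<inter> F (k + 1 - p))"
proof
  assume V: "V \<in> schubert_variety l k (row l p) F"
  then have "1 \<le> vec.dim (V \<inter> F (k + 1 - row l p ! (1 - 1)))"
    unfolding schubert_variety_def using l by (metis (no_types, lifting) atLeastAtMost_iff mem_Collect_eq order_refl)
  then show "V \<in> Gr l \<and> 1 \<le> vec.dim (V \<inter> F (k + 1 - p))"
    using V by (simp add: row_def schubert_variety_def)
next
  assume V: "V \<in> Gr l \<and> 1 \<le> vec.dim (V \<inter> F (k + 1 - p))"
  have "i \<le> vec.dim (V \<inter> F (k + i - row l p ! (i - 1)))" if i: "i \<in> {1..l}" for i
  proof (cases "i = 1")
    case True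
    then show ?thesis using V by (simp add: row_def)
  next
    case False
    have r: "row l p ! (i - 1) = 0" using False i by (cases "i - 1") (auto simp: row_def)
    have ki: "1 \<le> k + i" "k + i \<le> CARD('n)" using i n by auto
    have "vec.dim V + vec.dim (F (k + i)) \<le> vec.dim (V \<inter> F (k + i)) + vec.dim (UNIV :: 'n cspace set)"
      by (rule dim_Int_ge) (use V complete_flagD[OF F ki] in \<open>auto simp: Gr_iff\<close>)
    moreover have "vec.dim (UNIV :: 'n cspace set) = CARD('n)" by (rule vec_dim_card)
    ultimately show ?thesis using V complete_flagD(2)[OF F ki] n unfolding r by (simp add: Gr_iff)
  qed
  then show "V \<in> schubert_variety l k (row l p) F"
    unfolding schubert_variety_def using V by blast
qed

text \<open>The functionals built from the two opposite flags vanish on the expected vectors of each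
  flag; comparing dimensions identifies the flag spaces with coordinate subspaces. The intersection
  of the Schubert varieties then becomes the set \<open>sol\<close>.\<close>

lemma pieri_set:
  fixes b :: "'n::{finite,linorder} btriple"
  assumes cn: "CARD('n) = l + k" and l: "l \<ge> 1" and p: "1 \<le> p" "p \<le> k"
    and \<alpha>: "\<alpha> \<in> rect_partitions l k" and \<mu>: "\<mu> \<in> rect_partitions l k"
    and size: "sum_list \<mu> = sum_list \<alpha> + p"
    and gen: "pieri_generic (k + 1 - p) b" and ad: "adapted3 b F G H"
  defines "S \<equiv> {V \<in> Gr l. \<forall>Y\<in>set [schubert_variety l k (row l p) F, schubert_variety l k \<alpha> G,
      schubert_variety l k (dual_partition k \<mu>) H]. V \<in> Y}"
  shows "finite S \<and> card S = (if horizontal_strip \<alpha> \<mu> then 1 else 0)"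
proof -
  let ?n = "CARD('n)" and ?a = "k + 1 - p"
  define y where "y = ycoord (b 1) (b 2)"
  have opp: "fdet (mixed m (b 1) (b 2)) \<noteq> 0" if "m \<le> ?n" for m
    using gen that unfolding pieri_generic_def by blast
  have coord: "coordinates y ?n"
  proof
    show "linear_functional (y m)" if "m < ?n" for m
      unfolding y_def by (rule ycoord_functional[OF that])
    show "v = 0" if "\<And>m. m < ?n \<Longrightarrow> y m v = 0" for v
      by (rule ycoord_injective[OF opp]) (use that in \<open>auto simp: y_def\<close>)
  qed simp
  interpret pieri_position y ?n l k p \<alpha> \<mu> "b 0" ?a
  proof (intro pieri_position.intro pieri_position_axioms.intro coord)
    fix S x i
    assume S: "S \<subseteq> {..<?n}" "card S = ?a" and z: "\<And>m. m \<in> S \<Longrightarrow> y m (lincomb ?a (b 0) x) = 0" and i: "i < ?a"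
    have finS: "finite S" using S(1) finite_subset by blast
    have nz: "Determinant.det (Matrix.mat ?a ?a (\<lambda>(i, j). y (sorted_list_of_set S ! j) (b 0 i))) \<noteq> 0"
      using gen S unfolding pieri_generic_def y_def by blast
    have "(\<Sum>i<?a. x i * y (sorted_list_of_set S ! j) (b 0 i)) = 0" if j: "j < ?a" for j
    proof -
      have m: "sorted_list_of_set S ! j \<in> S" by (rule sorted_nth_mem[OF finS S(2) j])
      then have lf: "linear_functional (y (sorted_list_of_set S ! j))"
        using coordinates.lin[OF coord] S(1) by blast
      show ?thesis using z[OF m] unfolding linear_functionalD(5)[OF lf] linear_functionalD(1)[OF lf] .
    qed
    then show "x i = 0" using nz i unfolding det_zero_iff_relation by blast
  qed (use cn l p \<alpha> \<mu> size in simp_all)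
  have fl: "complete_flag F" "complete_flag G" "complete_flag H" "adapted_basis (b 0) F"
      "adapted_basis (b 1) G" "adapted_basis (b 2) H" using ad unfolding adapted3_def by blast+
  have Fa: "F ?a = spn ?a (b 0)"
  proof -
    have "?a \<in> {1..?n}" using p cn l by auto
    then show ?thesis using fl(4) unfolding adapted_basis_def by blast
  qed
  have Gi: "G i = csub {..<i}" if i: "1 \<le> i" "i \<le> ?n" for i
  proof (rule vec.subspace_dim_equal)
    have "G i = spn i (b 1)" using fl(5) i unfolding adapted_basis_def by simp
    then show "G i \<subseteq> csub {..<i}"
    proof (intro subsetI csubI)
      fix v m assume v: "v \<in> G i" and G: "G i = spn i (b 1)" and m: "m < ?n" "m \<notin> {..<i}"
      show "y m v = 0" unfolding y_def
        by (rule functional_spn_zero[OF ycoord_functional[OF m(1)] ycoord_g[OF m(1)]])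
          (use v G m in auto)
    qed
    have "vec.dim (csub {..<i}) = card {..<i}" by (rule dim_csub) (use i in auto)
    then show "vec.dim (csub {..<i}) \<le> vec.dim (G i)" using complete_flagD(2)[OF fl(2) i] by simp
  qed (rule complete_flagD(1)[OF fl(2) i] csub_subspace)+
  have Hi': "H i = csub {?n - i..}" if i: "1 \<le> i" "i \<le> ?n" for i
  proof (rule vec.subspace_dim_equal)
    have "H i = spn i (b 2)" using fl(6) i unfolding adapted_basis_def by simp
    then show "H i \<subseteq> csub {?n - i..}"
    proof (intro subsetI csubI)
      fix v m assume v: "v \<in> H i" and H: "H i = spn i (b 2)" and m: "m < ?n" "m \<notin> {?n - i..}"
      show "y m v = 0" unfolding y_def
        by (rule functional_spn_zero[OF ycoord_functional[OF m(1)] ycoord_h[OF m(1)]])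
          (use v H m in auto)
    qed
    have "csub {?n - i..} = csub {?n - i..<?n}" unfolding csub_def by auto
    moreover have "vec.dim (csub {?n - i..<?n}) = card {?n - i..<?n}" by (rule dim_csub) auto
    ultimately show "vec.dim (csub {?n - i..}) \<le> vec.dim (H i)" using complete_flagD(2)[OF fl(3) i] i by simp
  qed (rule complete_flagD(1)[OF fl(3) i] csub_subspace)+
  have G: "V \<in> schubert_variety l k \<alpha> G \<longleftrightarrow> V \<in> Gr l \<and> (\<forall>j<l. Suc j \<le> vec.dim (V \<inter> csub {..Hi j}))" for V
  proof -
    have "G (k + Suc j - \<alpha> ! (Suc j - 1)) = csub {..Hi j}" if j: "j < l" for j
    proof -
      have "k + Suc j - \<alpha> ! j = Suc (Hi j)" using bounds(1)[OF j] unfolding Hi_def by simp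
      then show ?thesis using Gi[of "Suc (Hi j)"] Hi_lt[OF j] by (simp add: lessThan_Suc_atMost)
    qed
    moreover have "(\<forall>i\<in>{1..l}. i \<le> vec.dim (V \<inter> G (k + i - \<alpha> ! (i - 1))))
        \<longleftrightarrow> (\<forall>j<l. Suc j \<le> vec.dim (V \<inter> G (k + Suc j - \<alpha> ! (Suc j - 1))))"
      unfolding image_Suc_lessThan[symmetric] ball_simps by (simp add: Ball_def)
    ultimately show ?thesis unfolding schubert_variety_def by simp
  qed
  have H: "V \<in> schubert_variety l k (dual_partition k \<mu>) H \<longleftrightarrow>
      V \<in> Gr l \<and> (\<forall>j<l. l - j \<le> vec.dim (V \<inter> csub {Lo j..}))" for V
  proof -
    have eq: "H (k + (l - j) - dual_partition k \<mu> ! (l - j - 1)) = csub {Lo j..}" if j: "j < l" for j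
    proof -
      have "dual_partition k \<mu> ! (l - j - 1) = k - \<mu> ! j"
        using dual_partition_nth[OF lengths(2), of "l - j - 1" k] j by simp
      then have i: "k + (l - j) - dual_partition k \<mu> ! (l - j - 1) = l - j + \<mu> ! j"
        using bounds(2)[OF j] by simp
      have "?n - (l - j + \<mu> ! j) = Lo j" using bounds(2)[OF j] j cn unfolding Lo_def by simp
      then show ?thesis unfolding i using Hi'[of "l - j + \<mu> ! j"] bounds(2)[OF j] j cn by simp
    qed
    \<comment> \<open>The dual partition is reversed, so its condition i concerns the part of \<mu>
      at position l - i, counted from 0.\<close>
    have "{1..l} = (\<lambda>j. l - j) ` {..<l}"
    proof
      show "{1..l} \<subseteq> (\<lambda>j. l - j) ` {..<l}"
      proof
        fix i assume "i \<in> {1..l}"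
        then have "i = l - (l - i)" "l - i \<in> {..<l}" by auto
        then show "i \<in> (\<lambda>j. l - j) ` {..<l}" by (rule image_eqI)
      qed
    qed auto
    then have "(\<forall>i\<in>{1..l}. i \<le> vec.dim (V \<inter> H (k + i - dual_partition k \<mu> ! (i - 1))))
        \<longleftrightarrow> (\<forall>j\<in>{..<l}. l - j \<le> vec.dim (V \<inter> H (k + (l - j) - dual_partition k \<mu> ! (l - j - 1))))"
      by (simp only: ball_simps)
    also have "\<dots> \<longleftrightarrow> (\<forall>j<l. l - j \<le> vec.dim (V \<inter> csub {Lo j..}))"
      using eq by (simp add: Ball_def)
    finally show ?thesis unfolding schubert_variety_def by simp
  qed
  have "S = sol"
    unfolding S_def sol_def using G H schubert_row[OF fl(1) cn l p(2)] unfolding Fa by auto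
  then show ?thesis using pieri_count by simp
qed

theorem gw_pieri:
  fixes T :: "'n::{finite,linorder} itself"
  assumes n: "CARD('n) = l + k" and l: "l \<ge> 1" and p: "1 \<le> p" "p \<le> k"
    and \<alpha>: "\<alpha> \<in> rect_partitions l k" and \<mu>: "\<mu> \<in> rect_partitions l k"
    and size: "sum_list \<mu> = sum_list \<alpha> + p"
  shows "gromov_witten T l k (row l p) \<alpha> (dual_partition k \<mu>) 0 = (if horizontal_strip \<alpha> \<mu> then 1 else 0)"
proof (rule gromov_witten_eqI)
  show "sum_list (row l p) + sum_list \<alpha> + sum_list (dual_partition k \<mu>) = l * k + 0 * CARD('n)"
    using size sum_list_dual[OF \<mu>] sum_list_le[OF \<mu>] by (simp add: sum_list_row)
  have "generic (pieri_generic (k + 1 - p) :: 'n btriple \<Rightarrow> bool)"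
    by (rule generic_pieri_generic) (use n p l in simp)
  then show "generic (\<lambda>b. \<forall>F G (H :: 'n cflag). adapted3 b F G H \<longrightarrow>
      (let A = curves_meeting l 0
         [schubert_variety l k (row l p) F, schubert_variety l k \<alpha> G, schubert_variety l k (dual_partition k \<mu>) H]
       in finite (A // reparam_rel A) \<and> card (A // reparam_rel A) = (if horizontal_strip \<alpha> \<mu> then 1 else 0)))"
  proof (rule generic_mono)
    fix b :: "'n btriple" assume gen: "pieri_generic (k + 1 - p) b"
    show "\<forall>F G (H :: 'n cflag). adapted3 b F G H \<longrightarrow>
      (let A = curves_meeting l 0
         [schubert_variety l k (row l p) F, schubert_variety l k \<alpha> G, schubert_variety l k (dual_partition k \<mu>) H]
       in finite (A // reparam_rel A) \<and> card (A // reparam_rel A) = (if horizontal_strip \<alpha> \<mu> then 1 else 0))"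
      unfolding Let_def quotient_0[OF l]
      using pieri_set[OF n l p \<alpha> \<mu> size gen] by blast
  qed
qed

section \<open>Curves of degree one in the Grassmannian\<close>

text \<open>A map of degree one is described by polynomials of degree at most one, which become
  linear forms in s and t after homogenization.\<close>

lemma degree1_linear:
  fixes F :: "nat ppoint \<Rightarrow> 'j ppoint"
  assumes F: "regular_map {..1} J F" and deg: "has_degree J F 1" and J: "finite J"
  shows "\<exists>\<alpha> \<beta>. \<forall>s t. s \<noteq> 0 \<or> t \<noteq> 0 \<longrightarrow> (\<lambda>j. s * \<alpha> j + t * \<beta> j) \<in> F (pt s t)"
proof -
  obtain Q d where Q: "represents J F Q d" using regular_map_represents[OF F] by blast
  then have d: "d = 1" using has_degree_1[OF _ F J deg] by blast
  have ps: "F x \<in> proj_space J" if "x \<in> P1" for x using F that unfolding regular_map_def by blast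
  \<comment> \<open>\<open>vecinf J Q i\<close> collects the coefficients of t^i, so \<alpha> holds
    the constant terms and \<beta> the linear ones.\<close>
  define \<alpha> where "\<alpha> = vecinf J Q 0"
  define \<beta> where "\<beta> = vecinf J Q 1"
  have lin: "vecp J Q t j = \<alpha> j + t * \<beta> j" for t j
  proof (cases "j \<in> J")
    case True
    then have "degree (Q j) \<le> 1" using Q unfolding represents_def d by blast
    then have "poly (\<Sum>i\<le>1. monom (coeff (Q j) i) i) t = poly (Q j) t" by (simp only: poly_as_sum_of_monoms')
    then have "poly (Q j) t = (\<Sum>i\<le>1. coeff (Q j) i * t ^ i)" unfolding poly_sum poly_monom by simp
    then show ?thesis using True unfolding vecp_def vecinf_def \<alpha>_def \<beta>_def by simp
  qed (simp add: vecp_def vecinf_def \<alpha>_def \<beta>_def)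
  have "(\<lambda>j. s * \<alpha> j + t * \<beta> j) \<in> F (pt s t)" if st: "s \<noteq> 0 \<or> t \<noteq> 0" for s t
  proof (cases "s = 0")
    case True
    then have t: "t \<noteq> 0" using st by blast
    have "pt s t = pt 0 1" using pt_scale[OF t, of 0 1] True by simp
    moreover have "\<beta> \<in> F (pt 0 1)" using Q unfolding represents_def d \<beta>_def by blast
    then have "(\<lambda>j. t * \<beta> j) \<in> F (pt 0 1)" using proj_space_closed[OF ps[OF pt_P1] _ t] by simp
    ultimately show ?thesis using True by simp
  next
    case False
    have e: "pt s t = pt 1 (t / s)" using pt_scale[OF False, of 1 "t / s"] False by simp
    have "vecp J Q (t / s) \<in> F (pt 1 (t / s))" using Q unfolding represents_def by blast
    then have "(\<lambda>j. s * vecp J Q (t / s) j) \<in> F (pt 1 (t / s))"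
      using proj_space_closed[OF ps[OF pt_P1] _ False] by simp
    moreover have "(\<lambda>j. s * vecp J Q (t / s) j) = (\<lambda>j. s * \<alpha> j + t * \<beta> j)"
      unfolding lin using False by (intro ext) (simp add: field_simps)
    ultimately show ?thesis unfolding e by simp
  qed
  then show ?thesis by blast
qed

text \<open>Pencils are written with a fixed family \<open>a\<close>, whose first l - 1 members span
  the axis, and a moving vector put at index l - 1.\<close>

lemma spn_last:
  assumes "l \<ge> 1"
  shows "v \<in> spn l (a(l - 1 := w)) \<longleftrightarrow> (\<exists>c. v - c *s w \<in> spn (l - 1) a)"
proof -
  have "{..<l} = insert (l - 1) {..<l - 1}" using assms by auto
  then have "a(l - 1 := w) ` {..<l} = insert ((a(l - 1 := w)) (l - 1)) (a(l - 1 := w) ` {..<l - 1})"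
    by (simp only: image_insert)
  moreover have "a(l - 1 := w) ` {..<l - 1} = a ` {..<l - 1}" by (rule image_cong) auto
  ultimately have "a(l - 1 := w) ` {..<l} = insert w (a ` {..<l - 1})" by (simp only: fun_upd_same)
  then show ?thesis by (simp only: vec.span_insert mem_Collect_eq)
qed

text \<open>A member of a pencil depends on the moving vector only modulo the axis and up to a
  nonzero factor.\<close>

lemma spn_last_cong:
  assumes l: "l \<ge> 1" and a: "spn (l - 1) a = spn (l - 1) a'" and c: "c \<noteq> 0"
    and w: "w' - c *s w \<in> spn (l - 1) a"
  shows "spn l (a(l - 1 := w')) = spn l (a'(l - 1 := w))"
proof (rule Set.set_eqI)
  fix v
  have S: "vec.subspace (spn (l - 1) a)" by (rule vec.subspace_span)
  have "(\<exists>d. v - d *s w' \<in> spn (l - 1) a) \<longleftrightarrow> (\<exists>d. v - d *s w \<in> spn (l - 1) a)"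
  proof
    assume "\<exists>d. v - d *s w' \<in> spn (l - 1) a"
    then obtain d where "v - d *s w' \<in> spn (l - 1) a" by blast
    then have "(v - d *s w') + d *s (w' - c *s w) \<in> spn (l - 1) a"
      by (intro vec.subspace_add[OF S] vec.subspace_scale[OF S] w)
    also have "(v - d *s w') + d *s (w' - c *s w) = v - (d * c) *s w"
      by (simp add: vector_ssub_ldistrib vector_smult_assoc)
    finally show "\<exists>d. v - d *s w \<in> spn (l - 1) a" by blast
  next
    assume "\<exists>d. v - d *s w \<in> spn (l - 1) a"
    then obtain d where "v - d *s w \<in> spn (l - 1) a" by blast
    then have "(v - d *s w) - (d / c) *s (w' - c *s w) \<in> spn (l - 1) a"
      by (rule vec.subspace_diff[OF S _ vec.subspace_scale[OF S w]])
    also have "(v - d *s w) - (d / c) *s (w' - c *s w) = v - (d / c) *s w'"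
      using c by (simp add: vector_ssub_ldistrib vector_smult_assoc)
    finally show "\<exists>d. v - d *s w' \<in> spn (l - 1) a" by blast
  qed
  then show "v \<in> spn l (a(l - 1 := w')) \<longleftrightarrow> v \<in> spn l (a'(l - 1 := w))"
    unfolding spn_last[OF l] a .
qed

lemma minors_row_linear:
  assumes "r < l"
  shows "minors l (b(r := c *s u + d *s v)) K = c * minors l (b(r := u)) K + d * minors l (b(r := v)) K"
  by (cases "card K = l") (simp_all add: minors_eq minors_support minorsL_row_linear[OF assms])

text \<open>The 2 x 2 minor of rows i, i' and columns m, m' is a Pluecker coordinate up to sign and
  so, by assumption, affine in v. The coefficient of v^2 in its expansion is the corresponding minor
  of \<open>M\<close>, which therefore vanishes.\<close>

lemma linear_entries_rank_one:
  fixes b0 M :: "nat \<Rightarrow> 'n::{finite,linorder} cspace" and J :: "'n set"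
  assumes J: "card J = l" and norm: "\<And>v. normalized l (sorted_list_of_set J) (\<lambda>i. b0 i + v *s M i)"
    and lin: "\<And>v K. minors l (\<lambda>i. b0 i + v *s M i) K = \<alpha> K + v * \<beta> K"
    and i: "i < l" "i' < l" "i \<noteq> i'" and nz: "M i $ m \<noteq> 0"
  shows "M i $ m * M i' $ m' = M i' $ m * M i $ m'"
proof -
  let ?L = "sorted_list_of_set J" and ?b = "\<lambda>v i. b0 i + v *s M i"
  have J_zero: "M j $ q = 0" if j: "j < l" and q: "q \<in> J" for j q
  proof -
    obtain p where p: "p < l" "q = ?L ! p"
      using q J by (metis finite in_set_conv_nth length_sorted_list_of_set set_sorted_list_of_set)
    have "?b 1 j $ q = ?b 0 j $ q" using norm[of 1] norm[of 0] p j unfolding normalized_def by simp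
    then show ?thesis by simp
  qed
  have len: "length ?L = l" using J by simp
  have m: "m \<notin> J" using J_zero[OF i(1)] nz by blast
  show ?thesis
  proof (cases "m' \<in> J \<or> m' = m")
    case True
    then show ?thesis using J_zero[OF i(1)] J_zero[OF i(2)] by auto
  next
    case False
    have "distinct (?L[i := m, i' := m'])"
    proof (intro distinct_list_update)
      have "set (?L[i := m]) \<subseteq> insert m J" using set_update_subset_insert[of ?L i m] by simp
      then show "m' \<notin> set (?L[i := m]) - {?L[i := m] ! i'}" using False by auto
      show "m \<notin> set ?L - {?L ! i}" using m by simp
    qed simp
    then obtain \<epsilon> where \<epsilon>: "\<And>b. minorsL l b (?L[i := m, i' := m']) = \<epsilon> * minors l b (set (?L[i := m, i' := m']))"
      using minorsL_sort[of "?L[i := m, i' := m']" l] len by (metis length_list_update)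
    define K where "K = set (?L[i := m, i' := m'])"
    \<comment> \<open>\<open>P\<close> is seen to vanish wherever the pivot in row i and column m is
      nonzero. This excludes only one value of v, so \<open>P\<close> is the zero
      polynomial.\<close>
    define P where "P = [:b0 i $ m, M i $ m:] * [:b0 i' $ m', M i' $ m':]
      - [:b0 i' $ m, M i' $ m:] * [:b0 i $ m', M i $ m':] - [:\<epsilon> * \<alpha> K, \<epsilon> * \<beta> K:]"
    have P: "poly P v = 0" if v: "b0 i $ m + v * M i $ m \<noteq> 0" for v
    proof -
      have "minorsL l (?b v) (?L[i := m, i' := m'])
          = ?b v i $ m * ?b v i' $ m' - ?b v i' $ m * ?b v i $ m'"
        by (rule normalized_minor2[OF norm len i]) (use v in simp)
      then show ?thesis unfolding \<epsilon> lin K_def[symmetric] P_def by (simp add: algebra_simps)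
    qed
    have "{v. poly P v \<noteq> 0} \<subseteq> {- b0 i $ m / M i $ m}"
    proof
      fix v assume "v \<in> {v. poly P v \<noteq> 0}"
      then have "b0 i $ m + v * M i $ m = 0" using P by blast
      then show "v \<in> {- b0 i $ m / M i $ m}" using nz by (simp add: field_simps eq_neg_iff_add_eq_0)
    qed
    then have "P = 0" by (intro poly_cofinite_zero) (rule finite_subset, auto)
    then have "coeff P 2 = 0" by simp
    then show ?thesis unfolding P_def by (simp add: numeral_2_eq_2 mult.commute)
  qed
qed

text \<open>A line on the Grassmannian in the Pluecker embedding is a pencil: on the chart where the
  \<open>J\<close>-th coordinate is \<open>1\<close> the normalized basis depends affinely on the parameter, and by the
  quadratic minors the slope matrix has rank one.\<close>

lemma grassmannian_line:
  fixes X :: "complex \<Rightarrow> complex \<Rightarrow> 'n::{finite,linorder} cspace set"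
  assumes l: "l \<ge> 1" and X: "\<And>u v. u \<noteq> 0 \<or> v \<noteq> 0 \<Longrightarrow> X u v \<in> Gr l"
    and lin: "\<And>u v. u \<noteq> 0 \<or> v \<noteq> 0 \<Longrightarrow> (\<lambda>K. u * \<alpha> K + v * \<beta> K) \<in> plucker l (X u v)"
    and J: "\<alpha> J = 1" "\<beta> J = 0"
  shows "\<exists>a r y. \<forall>u v. u \<noteq> 0 \<or> v \<noteq> 0 \<longrightarrow> X u v = spn l (a(l - 1 := u *s r + v *s y))"
proof -
  note ps = plucker_proj_space[OF X l]
  let ?L = "sorted_list_of_set J"
  have \<alpha>: "\<alpha> \<in> plucker l (X 1 0)" using lin[of 1 0] by simp
  have \<beta>: "\<beta> \<in> plucker l (X 0 1)" using lin[of 0 1] by simp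
  have \<beta>0: "\<beta> \<noteq> (\<lambda>_. 0)" by (rule proj_space_rep(2)[OF ps \<beta>]) simp
  have card: "card J = l"
  proof (rule ccontr)
    assume "card J \<noteq> l"
    then have "\<alpha> J = 0" using proj_space_rep(3)[OF ps \<alpha>, of J] by simp
    then show False using J by simp
  qed
  have "\<forall>v. \<exists>b. normalized l ?L b \<and> X 1 v = spn l b \<and> indep l b \<and> minors l b = (\<lambda>K. \<alpha> K + v * \<beta> K)"
  proof
    fix v
    show "\<exists>b. normalized l ?L b \<and> X 1 v = spn l b \<and> indep l b \<and> minors l b = (\<lambda>K. \<alpha> K + v * \<beta> K)"
      using plucker_normalized[OF X l lin, of 1 v J] J by simp
  qed
  from choice[OF this] obtain b where b: "\<And>v. normalized l ?L (b v)" "\<And>v. X 1 v = spn l (b v)"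
    "\<And>v. indep l (b v)" "\<And>v. minors l (b v) = (\<lambda>K. \<alpha> K + v * \<beta> K)" by blast
  define M where "M i = b 1 i - b 0 i" for i
  have entry: "b v i = b 0 i + v *s M i" if i: "i < l" for v i
  proof (rule Finite_Cartesian_Product.vec_eq_iff[THEN iffD2], intro allI)
    fix m
    show "b v i $ m = (b 0 i + v *s M i) $ m"
    proof (cases "m \<in> J")
      case True
      then obtain p where p: "p < l" "m = ?L ! p"
        using card by (metis finite in_set_conv_nth length_sorted_list_of_set set_sorted_list_of_set)
      then show ?thesis using b(1)[of v] b(1)[of 1] b(1)[of 0] i unfolding normalized_def M_def by (simp del: fun_upd_apply)
    next
      case False
      obtain K \<epsilon> where "\<And>b. normalized l ?L b \<Longrightarrow> b i $ m = \<epsilon> * minors l b K"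
        using normalized_coord[OF card i False] by blast
      then have "b v i $ m = \<epsilon> * (\<alpha> K + v * \<beta> K)" for v using b(1,4) by metis
      then show ?thesis unfolding M_def by (simp add: algebra_simps)
    qed
  qed
  define b' where "b' v i = b 0 i + v *s M i" for v i
  have minors_b': "minors l (b' v) K = \<alpha> K + v * \<beta> K" for v K
  proof -
    have "minors l (b' v) K = minors l (b v) K"
      unfolding minors_def b'_def using entry[of _ v]
      by (intro if_cong refl arg_cong[of _ _ Determinant.det] eq_matI) auto
    then show ?thesis using b(4) by simp
  qed
  have norm_b': "normalized l ?L (b' v)" for v
    using b(1)[of v] entry[of _ v] unfolding normalized_def b'_def by simp
  have "\<exists>i<l. M i \<noteq> 0"
  proof (rule ccontr)
    assume neg: "\<not> (\<exists>i<l. M i \<noteq> 0)"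
    have "\<beta> K = 0" for K
    proof -
      have "minors l (b' 1) K = minors l (b' 0) K"
        unfolding minors_def b'_def using neg
        by (intro if_cong refl arg_cong[of _ _ Determinant.det] eq_matI) auto
      then show ?thesis unfolding minors_b' by simp
    qed
    then show False using \<beta>0 by auto
  qed
  then obtain i0 m0 where i0: "i0 < l" and m0: "M i0 $ m0 \<noteq> 0"
    by (metis Finite_Cartesian_Product.vec_eq_iff zero_index)
  define x where "x i = M i $ m0 / M i0 $ m0" for i
  define y where "y = M i0"
  define r where "r = b 0 i0"
  have M: "M i = x i *s y" if i: "i < l" for i
  proof (cases "i = i0")
    case True
    then show ?thesis unfolding x_def y_def using m0 by simp
  next
    case False
    have "M i0 $ m0 * M i $ m = M i $ m0 * M i0 $ m" for m
      by (rule linear_entries_rank_one[of J l "b 0" M \<alpha> \<beta>, OF card])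
        (use norm_b' minors_b' i i0 False m0 in \<open>auto simp: b'_def[abs_def]\<close>)
    then show ?thesis unfolding x_def y_def using m0 by (simp add: Finite_Cartesian_Product.vec_eq_iff field_simps)
  qed
  \<comment> \<open>The rows other than \<open>i0\<close> are moved to the indices below l - 1, row
    l - 1 taking the place of \<open>i0\<close>; subtracting multiples of row \<open>i0\<close>
    removes their dependence on v.\<close>
  define \<tau> where "\<tau> j = (if j = i0 then l - 1 else j)" for j
  define a where "a j = b 0 (\<tau> j) - x (\<tau> j) *s r" for j
  define Y where "Y w = spn l (a(l - 1 := w))" for w
  have main: "X 1 v = Y (r + v *s y)" for v
  proof (rule vec.subspace_dim_equal)
    let ?w = "r + v *s y"
    have S: "vec.subspace (Y ?w)" unfolding Y_def by (rule vec.subspace_span)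
    have w: "?w \<in> Y ?w" unfolding Y_def spn_last[OF l] by (rule exI[of _ 1]) (simp add: vec.span_zero)
    have "b v i \<in> Y ?w" if i: "i < l" for i
    proof (cases "i = i0")
      case True
      then have "x i = 1" unfolding x_def using m0 by simp
      then show ?thesis using w True unfolding entry[OF i, of v] M[OF i] r_def by simp
    next
      case False
      define j where "j = (if i = l - 1 then i0 else i)"
      have j: "j < l - 1" "\<tau> j = i" using i i0 False unfolding j_def \<tau>_def by auto
      have "a j \<in> Y ?w" unfolding Y_def using j(1) by (intro vec.span_base image_eqI[of _ _ j]) auto
      then have "a j + x i *s ?w \<in> Y ?w" by (intro vec.subspace_add[OF S] vec.subspace_scale[OF S] w)
      moreover have "a j + x i *s ?w = b v i"
        unfolding a_def j(2) entry[OF i, of v] M[OF i] by (simp add: vector_add_ldistrib vector_smult_assoc mult.commute)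
      ultimately show ?thesis by simp
    qed
    then show "X 1 v \<subseteq> Y ?w" unfolding b(2) by (intro vec.span_minimal S) auto
    show "vec.dim (Y ?w) \<le> vec.dim (X 1 v)"
      using dim_spn_le[where r = l and b = "a(l - 1 := ?w)"] X[of 1 v] unfolding Y_def Gr_iff by simp
    show "vec.subspace (X 1 v)" using X[of 1 v] unfolding Gr_iff by simp
    show "vec.subspace (Y ?w)" by (rule S)
  qed
  have eq: "V = V'" if "V \<in> Gr l" "V' \<in> Gr l" "w \<in> plucker l V" "w \<in> plucker l V'" for V V' :: "'n cspace set" and w
    using proj_space_rep(1)[OF plucker_proj_space[OF that(1) l] that(3)]
      proj_space_rep(1)[OF plucker_proj_space[OF that(2) l] that(4)]
    by (intro plucker_inj[OF that(1,2) l]) simp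
  define A B where "A = minors l (a(l - 1 := r))" and "B = minors l (a(l - 1 := y))"
  have l1: "l - 1 < l" using l by simp
  \<comment> \<open>The remaining point u = 0 is reached through minors. Those of the pencil are the
    given coordinates times a factor that is affine in v and has no zeros, hence constant; so the
    minors with last row \<open>y\<close> are proportional to \<beta>.\<close>
  have rel: "A K + v * B K = (A J + v * B J) * (\<alpha> K + v * \<beta> K)" and nz: "A J + v * B J \<noteq> 0" for v K
  proof -
    let ?w = "a(l - 1 := r + v *s y)"
    have "minors l ?w = (\<lambda>K. A K + v * B K)"
      using minors_row_linear[OF l1, of a 1 r v y] unfolding A_def B_def by auto
    moreover have "indep l ?w" using Gr_indep[where l = l and b = ?w] X[of 1 v] main[of v] unfolding Y_def by simp
    then have "minors l ?w \<in> plucker l (X 1 v)"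
      using plucker_eq[OF _ l, of ?w] unfolding main Y_def by (simp only: proj_point_self)
    ultimately have "(\<lambda>K. A K + v * B K) \<in> plucker l (X 1 v)" by simp
    then obtain c where c: "c \<noteq> 0" "(\<lambda>K. A K + v * B K) = (\<lambda>K. c * (\<alpha> K + v * \<beta> K))"
      using proj_space_scalar[OF ps lin[of 1 v]] by auto
    have e: "A K + v * B K = c * (\<alpha> K + v * \<beta> K)" for K using fun_cong[OF c(2)] .
    have "A J + v * B J = c" using e[of J] J by simp
    then show "A K + v * B K = (A J + v * B J) * (\<alpha> K + v * \<beta> K)" "A J + v * B J \<noteq> 0"
      using e c(1) by simp_all
  qed
  have BJ: "B J = 0"
  proof (rule ccontr)
    assume "B J \<noteq> 0"
    then show False using nz[of "- A J / B J"] by simp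
  qed
  have B: "B K = A J * \<beta> K" for K
    using rel[of K 0] rel[of K 1] BJ by (simp add: algebra_simps)
  have AJ: "A J \<noteq> 0" using nz[of 0] by simp
  have indy: "indep l (a(l - 1 := y))"
  proof -
    obtain K where "\<beta> K \<noteq> 0" using \<beta>0 by auto
    then have "B K \<noteq> 0" using B AJ by simp
    then show ?thesis unfolding B_def by (rule minors_nonzero_indep)
  qed
  have "X u v = Y (u *s r + v *s y)" if uv: "u \<noteq> 0 \<or> v \<noteq> 0" for u v
  proof (cases "u = 0")
    case False
    have "(\<lambda>K. u * (1 * \<alpha> K + (v / u) * \<beta> K)) \<in> plucker l (X 1 (v / u))"
      by (rule proj_space_closed[OF ps lin False]) simp_all
    then have "(\<lambda>K. u * \<alpha> K + v * \<beta> K) \<in> plucker l (X 1 (v / u))"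
      using False by (simp add: algebra_simps)
    then have "X u v = X 1 (v / u)" by (intro eq[OF X X lin]) (use uv in simp_all)
    also have "\<dots> = Y (u *s r + v *s y)" unfolding main Y_def
    proof (rule spn_last_cong[OF l refl, symmetric])
      show "u \<noteq> 0" by fact
      have "u *s r + v *s y - u *s (r + (v / u) *s y) = 0"
        using False by (simp add: vector_add_ldistrib vector_smult_assoc)
      then show "u *s r + v *s y - u *s (r + (v / u) *s y) \<in> spn (l - 1) a" by (simp add: vec.span_zero)
    qed
    finally show ?thesis .
  next
    case True
    then have v: "v \<noteq> 0" using uv by blast
    have "Y (u *s r + v *s y) = Y y" unfolding Y_def
      by (rule spn_last_cong[OF l refl v]) (simp add: True vec.span_zero)
    moreover have "X u v = Y y"
    proof (rule eq)
      show "X u v \<in> Gr l" using X[OF uv] .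
      show "Y y \<in> Gr l" unfolding Y_def by (rule indep_Gr[OF indy])
      show "(\<lambda>K. u * \<alpha> K + v * \<beta> K) \<in> plucker l (X u v)" by (rule lin[OF uv])
      have "(\<lambda>K. u * \<alpha> K + v * \<beta> K) = (\<lambda>K. (v / A J) * B K)" using True AJ unfolding B by auto
      moreover have "v / A J \<noteq> 0" using v AJ by simp
      ultimately show "(\<lambda>K. u * \<alpha> K + v * \<beta> K) \<in> plucker l (Y y)"
        unfolding Y_def plucker_eq[OF indy l] proj_point_iff B_def by blast
    qed
    ultimately show ?thesis by simp
  qed
  then show ?thesis unfolding Y_def by blast
qed

definition pencil :: "nat \<Rightarrow> (nat \<Rightarrow> 'n::{finite,linorder} cspace) \<Rightarrow> 'n cspace \<Rightarrow> 'n cspace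
    \<Rightarrow> (nat ppoint \<Rightarrow> 'n cspace set) \<Rightarrow> bool" where
  "pencil l a v w f \<longleftrightarrow> (\<forall>s t. s \<noteq> 0 \<or> t \<noteq> 0 \<longrightarrow> f (pt s t) = spn l (a(l - 1 := s *s v + t *s w)))"

lemma rational_pencil:
  fixes f :: "nat ppoint \<Rightarrow> 'n::{finite,linorder} cspace set"
  assumes f: "f \<in> rational_curves l 1" and l: "l \<ge> 1"
  shows "\<exists>a v w. pencil l a v w f"
proof -
  have fG: "f x \<in> Gr l" if "x \<in> P1" for x using f that unfolding rational_curves_def by (auto simp: PiE_def)
  have f1: "regular_map {..1} (plucker_index l) (plucker l \<circ> f)" "has_degree (plucker_index l) (plucker l \<circ> f) 1"
    using f unfolding rational_curves_def by auto
  obtain \<alpha> \<beta> where lin: "\<And>s t. s \<noteq> 0 \<or> t \<noteq> 0 \<Longrightarrow> (\<lambda>j. s * \<alpha> j + t * \<beta> j) \<in> plucker l (f (pt s t))"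
    using degree1_linear[OF f1 finite_plucker_index] by auto
  have "\<alpha> \<in> plucker l (f (pt 1 0))" using lin[of 1 0] by simp
  from proj_space_rep(2)[OF plucker_proj_space[OF fG[OF pt_P1] l] this]
  obtain J where J: "\<alpha> J \<noteq> 0" by fastforce
  \<comment> \<open>\<open>S u v\<close> solves s \<alpha>_J + v \<beta>_J = u for s. In the
    parameters u, v the J-th coordinate is u, which is the normalization required for a line in the
    chart of \<open>J\<close>.\<close>
  define S where "S u v = (u - v * \<beta> J) / \<alpha> J" for u v
  have S: "S u v * \<alpha> J + v * \<beta> J = u" for u v unfolding S_def using J by simp
  have nz: "S u v \<noteq> 0 \<or> v \<noteq> 0" if "u \<noteq> 0 \<or> v \<noteq> 0" for u v using S[of u v] that by auto
  have "\<exists>a r y. \<forall>u v. u \<noteq> 0 \<or> v \<noteq> 0 \<longrightarrow> f (pt (S u v) v) = spn l (a(l - 1 := u *s r + v *s y))"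
  proof (rule grassmannian_line[OF l, where \<alpha> = "\<lambda>K. \<alpha> K / \<alpha> J" and \<beta> = "\<lambda>K. \<beta> K - \<beta> J * \<alpha> K / \<alpha> J" and J = J])
    fix u v :: complex assume uv: "u \<noteq> 0 \<or> v \<noteq> 0"
    show "f (pt (S u v) v) \<in> Gr l" by (rule fG[OF pt_P1[OF nz[OF uv]]])
    have "(\<lambda>K. u * (\<alpha> K / \<alpha> J) + v * (\<beta> K - \<beta> J * \<alpha> K / \<alpha> J)) = (\<lambda>K. S u v * \<alpha> K + v * \<beta> K)"
      unfolding S_def using J by (simp add: field_simps)
    then show "(\<lambda>K. u * (\<alpha> K / \<alpha> J) + v * (\<beta> K - \<beta> J * \<alpha> K / \<alpha> J)) \<in> plucker l (f (pt (S u v) v))"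
      using lin[OF nz[OF uv]] by simp
  qed (use J in simp_all)
  then obtain a r y where ary: "\<And>u v. u \<noteq> 0 \<or> v \<noteq> 0 \<Longrightarrow> f (pt (S u v) v) = spn l (a(l - 1 := u *s r + v *s y))"
    by blast
  have "pencil l a (\<alpha> J *s r) (\<beta> J *s r + y) f"
    unfolding pencil_def
  proof (intro allI impI)
    fix s t :: complex assume st: "s \<noteq> 0 \<or> t \<noteq> 0"
    let ?u = "s * \<alpha> J + t * \<beta> J"
    have s: "S ?u t = s" unfolding S_def using J by simp
    have "?u \<noteq> 0 \<or> t \<noteq> 0" using st J by auto
    from ary[OF this] have "f (pt s t) = spn l (a(l - 1 := ?u *s r + t *s y))" unfolding s .
    also have "?u *s r + t *s y = s *s (\<alpha> J *s r) + t *s (\<beta> J *s r + y)"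
      by (simp add: vector_add_ldistrib vector_smult_assoc vector_sadd_rdistrib)
    finally show "f (pt s t) = spn l (a(l - 1 := s *s (\<alpha> J *s r) + t *s (\<beta> J *s r + y)))" .
  qed
  then show ?thesis by blast
qed

lemma pencil_rational:
  fixes f :: "nat ppoint \<Rightarrow> 'n::{finite,linorder} cspace set"
  assumes f: "f \<in> P1 \<rightarrow>\<^sub>E Gr l" and p: "pencil l a v w f" and l: "l \<ge> 1"
  shows "f \<in> rational_curves l 1"
proof -
  let ?F = "plucker l \<circ> f"
  have fG: "f x \<in> Gr l" if "x \<in> P1" for x using f that by blast
  have F: "?F \<in> P1 \<rightarrow> proj_space (plucker_index l)" using plucker_proj_space[OF fG l] by auto
  have lin: "(\<lambda>K. s * minors l (a(l - 1 := v)) K + t * minors l (a(l - 1 := w)) K) \<in> ?F (pt s t)"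
    if st: "s \<noteq> 0 \<or> t \<noteq> 0" for s t
  proof -
    let ?b = "a(l - 1 := s *s v + t *s w)"
    have e: "f (pt s t) = spn l ?b" using p st unfolding pencil_def by blast
    have "indep l ?b" using Gr_indep[where l = l and b = ?b] fG[OF pt_P1[OF st]] unfolding e .
    then have "minors l ?b \<in> ?F (pt s t)"
      using plucker_eq[OF _ l, of ?b] unfolding comp_def e by (simp only: proj_point_self)
    moreover have "minors l ?b = (\<lambda>K. s * minors l (a(l - 1 := v)) K + t * minors l (a(l - 1 := w)) K)"
      by (rule ext) (rule minors_row_linear, use l in simp)
    ultimately show ?thesis by simp
  qed
  show ?thesis unfolding rational_curves_def
    by (intro CollectI conjI f linear_map_regular[OF F lin] linear_map_degree[OF F finite_plucker_index lin])
qed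

section \<open>The Schubert conditions of the degree one invariant\<close>

lemma complete_flag_mono:
  fixes F :: "'n::{finite,linorder} cflag"
  assumes F: "complete_flag F" and i: "1 \<le> i" "i \<le> j" "j \<le> CARD('n)"
  shows "F i \<subseteq> F j"
  using i(2,3)
proof (induction rule: dec_induct)
  case (step m)
  then have "F m \<subseteq> F (Suc m)" using F i(1) unfolding complete_flag_def by auto
  then show ?case using step by auto
qed simp

text \<open>Condition i = l puts \<open>V\<close> into the hyperplane G_(n-1); inside it the other
  conditions hold for dimension reasons.\<close>

lemma schubert_column:
  fixes G :: "'n::{finite,linorder} cflag"
  assumes G: "complete_flag G" and n: "CARD('n) = l + k" and l: "l \<ge> 1" and k: "k \<ge> 1"
  shows "V \<in> schubert_variety l k (column l l) G \<longleftrightarrow> V \<in> Gr l \<and> V \<subseteq> G (CARD('n) - 1)"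
proof -
  have e: "k + i - column l l ! (i - 1) = k + i - 1" if "i \<in> {1..l}" for i
  proof -
    have "i - 1 < l" using that by auto
    then show ?thesis unfolding column_def by simp
  qed
  have n1: "k + l - 1 = CARD('n) - 1" "1 \<le> CARD('n) - 1" "CARD('n) - 1 \<le> CARD('n)"
    using n l k by auto
  note G1 = complete_flagD[OF G n1(2,3)]
  show ?thesis
  proof (intro iffI conjI)
    assume V: "V \<in> schubert_variety l k (column l l) G"
    then show VG: "V \<in> Gr l" unfolding schubert_variety_def by blast
    have "l \<le> vec.dim (V \<inter> G (k + l - column l l ! (l - 1)))"
      using V l unfolding schubert_variety_def by simp
    then have "l \<le> vec.dim (V \<inter> G (CARD('n) - 1))" using e[of l] l n1(1) by simp
    then have "V \<inter> G (CARD('n) - 1) = V"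
      by (intro vec.subspace_dim_equal) (use VG G1 in \<open>auto simp: Gr_iff vec.subspace_inter\<close>)
    then show "V \<subseteq> G (CARD('n) - 1)" by blast
  next
    assume V: "V \<in> Gr l \<and> V \<subseteq> G (CARD('n) - 1)"
    have "i \<le> vec.dim (V \<inter> G (k + i - 1))" if i: "i \<in> {1..l}" for i
    proof -
      have i1: "1 \<le> k + i - 1" "k + i - 1 \<le> CARD('n)" "k + i - 1 \<le> CARD('n) - 1" using i n k by auto
      have "G (k + i - 1) \<subseteq> G (CARD('n) - 1)" by (rule complete_flag_mono[OF G i1(1,3) n1(3)])
      then have "vec.dim V + vec.dim (G (k + i - 1)) \<le> vec.dim (V \<inter> G (k + i - 1)) + vec.dim (G (CARD('n) - 1))"
        using V complete_flagD(1)[OF G i1(1,2)] G1(1) by (intro dim_Int_ge) (auto simp: Gr_iff)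
      then show ?thesis using V complete_flagD(2)[OF G i1(1,2)] G1(2) n i k by (simp add: Gr_iff)
    qed
    then show "V \<in> schubert_variety l k (column l l) G" using V e unfolding schubert_variety_def by simp
  qed
qed

text \<open>Condition i = l bounds the dimension of the intersection of \<open>V\<close> and H_l
  below by l, the dimension of both spaces.\<close>

lemma schubert_point:
  fixes H :: "'n::{finite,linorder} cflag"
  assumes H: "complete_flag H" and n: "CARD('n) = l + k" and l: "l \<ge> 1"
  shows "V \<in> schubert_variety l k (dual_partition k (replicate l 0)) H \<longleftrightarrow> V = H l"
proof -
  have e: "k + i - dual_partition k (replicate l 0) ! (i - 1) = i" if "i \<in> {1..l}" for i
  proof -
    have "i - 1 < l" using that by auto
    then show ?thesis using that unfolding dual_partition_def by simp
  qed
  have ln: "l \<le> CARD('n)" using n by simp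
  note Hl = complete_flagD[OF H l ln]
  show ?thesis
  proof
    assume V: "V \<in> schubert_variety l k (dual_partition k (replicate l 0)) H"
    then have VG: "V \<in> Gr l" unfolding schubert_variety_def by blast
    have "l \<le> vec.dim (V \<inter> H (k + l - dual_partition k (replicate l 0) ! (l - 1)))"
      using V l unfolding schubert_variety_def by simp
    then have d: "l \<le> vec.dim (V \<inter> H l)" using e[of l] l by simp
    have "V \<inter> H l = V" "V \<inter> H l = H l"
      by (intro vec.subspace_dim_equal; use VG Hl d in \<open>auto simp: Gr_iff vec.subspace_inter\<close>)+
    then show "V = H l" by blast
  next
    assume V: "V = H l"
    have "i \<le> vec.dim (V \<inter> H i)" if i: "i \<in> {1..l}" for i
    proof -
      have i1: "1 \<le> i" "i \<le> l" "i \<le> CARD('n)" using i ln by auto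
      have "V \<inter> H i = H i" using complete_flag_mono[OF H i1(1,2) ln] V by blast
      then show ?thesis using complete_flagD(2)[OF H i1(1,3)] by simp
    qed
    then show "V \<in> schubert_variety l k (dual_partition k (replicate l 0)) H"
      using V e Hl unfolding schubert_variety_def Gr_iff by simp
  qed
qed

text \<open>Two curves are compared through the fixed curve \<open>f\<close>: one Moebius map is
  composed with the inverse of the other, for which the adjugate matrix suffices
  projectively.\<close>

lemma reparam_quotient_singleton:
  assumes f: "f \<in> A" and rel: "\<And>g. g \<in> A \<Longrightarrow>
    \<exists>a b c d. a * d - b * c \<noteq> 0 \<and> (\<forall>x\<in>P1. f x = g (mobius a b c d x))"
  shows "A // reparam_rel A = {A}"
proof -
  have "(g, h) \<in> reparam_rel A" if g: "g \<in> A" and h: "h \<in> A" for g h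
  proof -
    obtain a b c d where 1: "a * d - b * c \<noteq> 0" "\<And>x. x \<in> P1 \<Longrightarrow> f x = g (mobius a b c d x)"
      using rel[OF g] by blast
    obtain a' b' c' d' where 2: "a' * d' - b' * c' \<noteq> 0" "\<And>x. x \<in> P1 \<Longrightarrow> f x = h (mobius a' b' c' d' x)"
      using rel[OF h] by blast
    have D: "d' * a' - (- b') * (- c') \<noteq> 0" using 2(1) by (simp add: mult.commute)
    let ?\<phi> = "mobius (a * d' + b * (- c')) (a * (- b') + b * a') (c * d' + d * (- c')) (c * (- b') + d * a')"
    have "h x = g (?\<phi> x)" if x: "x \<in> P1" for x
    proof -
      let ?x = "mobius d' (- b') (- c') a' x"
      have P: "?x \<in> P1" by (rule mobius_P1[OF D x])
      have "h x = f ?x" using 2(2)[OF P] mobius_inverse(1)[OF 2(1) x] by simp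
      also have "\<dots> = g (?\<phi> x)" unfolding 1(2)[OF P] mobius_mobius[OF x] ..
      finally show ?thesis .
    qed
    moreover have "automorphism_P1 ?\<phi>"
    proof (rule mobius_automorphism)
      have "(a * d' + b * (- c')) * (c * (- b') + d * a') - (a * (- b') + b * a') * (c * d' + d * (- c'))
          = (a * d - b * c) * (a' * d' - b' * c')" by (simp add: algebra_simps)
      then show "(a * d' + b * (- c')) * (c * (- b') + d * a') - (a * (- b') + b * a') * (c * d' + d * (- c')) \<noteq> 0"
        using 1(1) 2(1) by simp
    qed
    ultimately show ?thesis unfolding reparam_rel_def using g h by blast
  qed
  then have "reparam_rel A `` {g} = A" if "g \<in> A" for g
    using that unfolding reparam_rel_def by blast
  then show ?thesis using f unfolding quotient_def by auto
qed

text \<open>The first vector of the flag H lies off the hyperplane G_(n-1), and the line F_1 is not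
  contained in H_(n-1), hence not in H_l.\<close>

definition line_generic :: "nat \<Rightarrow> 'n::{finite,linorder} btriple \<Rightarrow> bool" where
  "line_generic l b \<longleftrightarrow> indep CARD('n) ((b 1)(CARD('n) - 1 := b 2 0)) \<and>
     indep CARD('n) ((b 2)(CARD('n) - 1 := b 0 0))"

lemma generic_line_generic:
  "generic (line_generic l :: 'n::{finite,linorder} btriple \<Rightarrow> bool)"
proof -
  let ?n = "CARD('n)"
  have "vec.dim (UNIV :: 'n cspace set) = ?n" by (rule vec_dim_card)
  then obtain e :: "nat \<Rightarrow> 'n cspace" where e: "indep ?n e"
    using subspace_indep_basis[OF vec.subspace_UNIV] by blast
  have 0: "0 < ?n" by simp
  have *: "generic (\<lambda>b :: 'n btriple. indep ?n ((b m)(?n - 1 := b m' 0)))" if m: "m < 3" "m' < 3" "m \<noteq> m'" for m m' :: nat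
  proof -
    have 1: "polyfun (\<lambda>b :: 'n btriple. fdet ((b m)(?n - 1 := b m' 0)))"
    proof (rule polyfun_fdet)
      fix i q assume i: "i < ?n"
      show "polyfun (\<lambda>b :: 'n btriple. ((b m)(?n - 1 := b m' 0)) i $ q)"
        using polyfun_coord[OF m(1) i] polyfun_coord[OF m(2) 0] by (cases "i = ?n - 1") simp_all
    qed
    \<comment> \<open>At the sample point one of the two families is a basis, and the other supplies
      its last vector.\<close>
    define B :: "'n btriple" where "B j = (if j = m then e else (\<lambda>_. e (?n - 1)))" for j
    have eq: "(B m)(?n - 1 := B m' 0) = e"
      unfolding B_def by (rule ext) (use m(3) in simp)
    have 2: "fdet ((B m)(?n - 1 := B m' 0)) \<noteq> 0" unfolding eq using e by (simp only: fdet_indep)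
    show ?thesis by (rule genericI[OF 1 2]) (simp only: fdet_indep)
  qed
  show ?thesis unfolding line_generic_def
    by (rule generic_conj[OF *[of 1 2] *[of 2 0]]) simp_all
qed

text \<open>All lines through \<open>W\<close> that contain a subspace of \<open>K\<close> have the axis \<open>W \<inter> K\<close>; so a further
  vector in one of their members determines the line.\<close>

lemma pencil_axis:
  fixes W K :: "'n::{finite,linorder} cspace set"
  assumes l: "l \<ge> 1" and p: "pencil l a v w f" and fG: "\<And>x. x \<in> P1 \<Longrightarrow> f x \<in> Gr l"
    and K: "vec.subspace K" and ax: "indep (l - 1) a0" "spn (l - 1) a0 = W \<inter> K"
    and y: "y \<in> P1" "f y \<subseteq> K" and z: "z \<in> P1" "f z = W"
  shows "spn (l - 1) a = spn (l - 1) a0"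
proof -
  have sub: "spn (l - 1) a \<subseteq> f x" if x: "x \<in> P1" for x
  proof -
    obtain s t where st: "x = pt s t" "s \<noteq> 0 \<or> t \<noteq> 0" using P1_coords[OF x] .
    have "f x = spn l (a(l - 1 := s *s v + t *s w))" using p st unfolding pencil_def by blast
    then show ?thesis using spn_last[OF l, of _ a "s *s v + t *s w"] by (auto intro!: exI[of _ 0])
  qed
  have "\<exists>b. indep l (a(l - 1 := b))"
  proof -
    have "f (pt 1 0) = spn l (a(l - 1 := 1 *s v + 0 *s w))" using p unfolding pencil_def by simp
    then show ?thesis using Gr_indep[where l = l and b = "a(l - 1 := 1 *s v + 0 *s w)"] fG[OF pt_P1[of 1 0]] by auto
  qed
  then obtain b where b: "indep l (a(l - 1 := b))" ..
  have inda: "indep (l - 1) a"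
    unfolding indep_def
  proof (intro allI impI)
    fix x i assume x: "lincomb (l - 1) a x = 0" and i: "i < l - 1"
    have "{..<l} = insert (l - 1) {..<l - 1}" using l by auto
    then have "lincomb l (a(l - 1 := b)) (x(l - 1 := 0)) = (\<Sum>i<l - 1. (x(l - 1 := 0)) i *s (a(l - 1 := b)) i)"
      by simp
    also have "\<dots> = lincomb (l - 1) a x" by (rule sum.cong) auto
    finally have "(x(l - 1 := 0)) i = 0" using indepD[OF b, of "x(l - 1 := 0)" i] x i by simp
    then show "x i = 0" using i by simp
  qed
  show ?thesis
  proof (rule vec.subspace_dim_equal)
    show "spn (l - 1) a \<subseteq> spn (l - 1) a0" unfolding ax(2) using sub[OF y(1)] sub[OF z(1)] y(2) z(2) by blast
    show "vec.dim (spn (l - 1) a0) \<le> vec.dim (spn (l - 1) a)" unfolding indep_dim[OF ax(1)] indep_dim[OF inda] ..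
  qed (rule vec.subspace_span)+
qed

lemma spn_last_member:
  assumes l: "l \<ge> 1" and w: "w \<in> spn l (a(l - 1 := w'))" "w \<notin> spn (l - 1) a"
  shows "\<exists>c. c \<noteq> 0 \<and> w' - c *s w \<in> spn (l - 1) a"
proof -
  obtain c where c: "w - c *s w' \<in> spn (l - 1) a" using w(1) unfolding spn_last[OF l] by blast
  have c0: "c \<noteq> 0" using c w(2) by auto
  have "(- (1 / c)) *s (w - c *s w') \<in> spn (l - 1) a" using c by (rule vec.span_scale)
  also have "(- (1 / c)) *s (w - c *s w') = w' - (1 / c) *s w"
    using c0 by (simp add: vector_ssub_ldistrib vector_smult_assoc)
  finally show ?thesis using c0 by (intro exI[of _ "1 / c"]) simp
qed

text \<open>Modulo the common axis the moving vectors of both pencils run through the plane spanned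
  by \<open>h\<close> and \<open>u\<close>. The parameters at which \<open>f\<close> contains
  \<open>h\<close> and \<open>u\<close>, suitably scaled, are the columns of the matrix; it is
  invertible because these parameters differ.\<close>

lemma pencil_standard:
  fixes f f0 :: "nat ppoint \<Rightarrow> 'n::{finite,linorder} cspace set"
  assumes l: "l \<ge> 1" and p: "pencil l a v w f" and p0: "pencil l a0 h u f0"
    and a: "spn (l - 1) a = spn (l - 1) a0"
    and z: "z \<in> P1" "h \<in> f z" and x: "x \<in> P1" "u \<in> f x" and xz: "x \<noteq> z"
    and nh: "h \<notin> spn (l - 1) a0" and nu: "u \<notin> spn (l - 1) a0"
  shows "\<exists>a b c d. a * d - b * c \<noteq> 0 \<and> (\<forall>x\<in>P1. f0 x = f (mobius a b c d x))"
proof -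
  obtain z0 z1 where zc: "z = pt z0 z1" "z0 \<noteq> 0 \<or> z1 \<noteq> 0" using P1_coords[OF z(1)] .
  obtain x0 x1 where xc: "x = pt x0 x1" "x0 \<noteq> 0 \<or> x1 \<noteq> 0" using P1_coords[OF x(1)] .
  have f: "f (pt s t) = spn l (a(l - 1 := s *s v + t *s w))" if "s \<noteq> 0 \<or> t \<noteq> 0" for s t
    using p that unfolding pencil_def by blast
  obtain c where c: "c \<noteq> 0" "(z0 *s v + z1 *s w) - c *s h \<in> spn (l - 1) a"
    using spn_last_member[OF l, of h a "z0 *s v + z1 *s w"] z(2) nh unfolding zc(1) f[OF zc(2)] a by blast
  obtain d where d: "d \<noteq> 0" "(x0 *s v + x1 *s w) - d *s u \<in> spn (l - 1) a"
    using spn_last_member[OF l, of u a "x0 *s v + x1 *s w"] x(2) nu unfolding xc(1) f[OF xc(2)] a by blast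
  define D where "D = z0 / c * (x1 / d) - x0 / d * (z1 / c)"
  have D: "D \<noteq> 0"
  proof
    assume "D = 0"
    then have "z0 * x1 = x0 * z1" unfolding D_def using c d by (simp add: field_simps)
    then have "z = x" unfolding zc(1) xc(1) by (intro pt_eqI zc xc)
    then show False using xz by simp
  qed
  have "f0 q = f (mobius (z0 / c) (x0 / d) (z1 / c) (x1 / d) q)" if q: "q \<in> P1" for q
  proof -
    obtain s t where st: "q = pt s t" "s \<noteq> 0 \<or> t \<noteq> 0" using P1_coords[OF q] .
    let ?s = "z0 / c * s + x0 / d * t" and ?t = "z1 / c * s + x1 / d * t"
    have st': "?s \<noteq> 0 \<or> ?t \<noteq> 0" using mobius_nonzero[OF D[unfolded D_def] st(2)] .
    have "(?s *s v + ?t *s w) - 1 *s (s *s h + t *s u)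
        = (s / c) *s ((z0 *s v + z1 *s w) - c *s h) + (t / d) *s ((x0 *s v + x1 *s w) - d *s u)"
      using c(1) d(1)
      by (simp add: vector_ssub_ldistrib vector_smult_assoc vector_add_ldistrib vector_sadd_rdistrib algebra_simps)
    also have "\<dots> \<in> spn (l - 1) a" by (intro vec.span_add vec.span_scale c(2) d(2))
    finally have m: "(?s *s v + ?t *s w) - 1 *s (s *s h + t *s u) \<in> spn (l - 1) a" .
    have "f (pt ?s ?t) = spn l (a0(l - 1 := s *s h + t *s u))"
      unfolding f[OF st'] by (rule spn_last_cong[OF l a _ m]) simp
    moreover have "f0 q = spn l (a0(l - 1 := s *s h + t *s u))" using p0 st unfolding pencil_def by blast
    ultimately show ?thesis unfolding st(1) mobius_pt by simp
  qed
  then show ?thesis using D unfolding D_def by blast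
qed

text \<open>With \<open>u\<close> spanning F_1, \<open>K\<close> the hyperplane G_(n-1) and
  \<open>W\<close> the space H_l, a curve must have a member containing \<open>u\<close>, one inside
  \<open>K\<close>, and \<open>W\<close> itself as a member. The pencil whose axis is the
  intersection of \<open>W\<close> and \<open>K\<close>, with \<open>W\<close> and the span of the
  axis and \<open>u\<close> as two members, does so, and every other curve is a reparametrization of
  it.\<close>

lemma line_curves:
  fixes b :: "'n::{finite,linorder} btriple"
  assumes n: "CARD('n) = l + k" and l: "l \<ge> 1" and k: "k \<ge> 1"
    and gen: "line_generic l b" and ad: "adapted3 b F G H"
  defines "A \<equiv> curves_meeting l 1
         [schubert_variety l k (row l k) F, schubert_variety l k (column l l) G,
          schubert_variety l k (dual_partition k (replicate l 0)) H]"
  shows "\<exists>f. f \<in> A \<and> (\<forall>g\<in>A. \<exists>a b c d. a * d - b * c \<noteq> 0 \<and> (\<forall>x\<in>P1. f x = g (mobius a b c d x)))"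
proof -
  let ?n = "CARD('n)"
  have fl: "complete_flag F" "complete_flag G" "complete_flag H" "adapted_basis (b 0) F"
      "adapted_basis (b 1) G" "adapted_basis (b 2) H" using ad unfolding adapted3_def by blast+
  define W where "W = H l"
  define K where "K = G (?n - 1)"
  define u where "u = b 0 0"
  define h where "h = b 2 0"
  have n1: "1 \<le> ?n - 1" "?n - 1 \<le> ?n" "l \<le> ?n" "?n \<ge> 1" "l \<le> ?n - 1" using n l k by auto
  have W: "W = spn l (b 2)" "vec.subspace W" "vec.dim W = l"
    unfolding W_def using fl(6) l n1(3) complete_flagD[OF fl(3) l n1(3)] unfolding adapted_basis_def by auto
  have K: "K = spn (?n - 1) (b 1)" "vec.subspace K" "vec.dim K = ?n - 1"
    unfolding K_def using fl(5) n1 complete_flagD[OF fl(2) n1(1,2)] unfolding adapted_basis_def by auto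
  have F1: "F 1 = vec.span {u}" using fl(4) n1 unfolding adapted_basis_def u_def by (simp add: lessThan_Suc)
  have indg: "indep ?n ((b 1)(?n - 1 := h))" and indh: "indep ?n ((b 2)(?n - 1 := u))"
    using gen unfolding line_generic_def h_def u_def by blast+
  have last: "w \<notin> spn (?n - 1) c" if c: "indep ?n (c(?n - 1 := w))" for c :: "nat \<Rightarrow> 'n cspace" and w
  proof
    assume "w \<in> spn (?n - 1) c"
    then obtain x where x: "w = lincomb (?n - 1) c x" by (rule spn_memE)
    have "{..<?n} = insert (?n - 1) {..<?n - 1}" using n1 by auto
    then have "lincomb ?n (c(?n - 1 := w)) (x(?n - 1 := - 1))
        = - w + (\<Sum>i<?n - 1. (x(?n - 1 := - 1)) i *s (c(?n - 1 := w)) i)" by simp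
    also have "(\<Sum>i<?n - 1. (x(?n - 1 := - 1)) i *s (c(?n - 1 := w)) i) = w"
      unfolding x by (rule sum.cong) auto
    finally have "(x(?n - 1 := - 1)) (?n - 1) = 0"
      using indepD[OF c, of "x(?n - 1 := - 1)" "?n - 1"] n1 by simp
    then show False by simp
  qed
  have hK: "h \<notin> K" unfolding K by (rule last[OF indg])
  have "W \<subseteq> spn (?n - 1) (b 2)" unfolding W(1) using n1 by (intro vec.span_mono image_mono) auto
  then have uW: "u \<notin> W" using last[OF indh] by blast
  have hW: "h \<in> W" unfolding W(1) h_def using l by (intro vec.span_base) auto
  have u0: "u \<noteq> 0" using uW vec.subspace_0[OF W(2)] by auto
  have S: "vec.subspace (W \<inter> K)" by (rule vec.subspace_inter[OF W(2) K(2)])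
  have "vec.dim (W \<inter> K) = l - 1"
  proof (rule antisym)
    have "W \<inter> K \<noteq> W" using hW hK by blast
    then have "\<not> vec.dim W \<le> vec.dim (W \<inter> K)" using vec.subspace_dim_equal[OF S W(2)] by blast
    then show "vec.dim (W \<inter> K) \<le> l - 1" using W(3) by simp
    have "vec.dim W + vec.dim K \<le> vec.dim (W \<inter> K) + vec.dim (UNIV :: 'n cspace set)"
      by (rule dim_Int_ge[OF W(2) K(2) vec.subspace_UNIV]) auto
    moreover have "vec.dim (UNIV :: 'n cspace set) = ?n" by (rule vec_dim_card)
    ultimately show "l - 1 \<le> vec.dim (W \<inter> K)" using W(3) K(3) n1 by simp
  qed
  then obtain a0 where a0: "indep (l - 1) a0" "spn (l - 1) a0 = W \<inter> K"
    using subspace_indep_basis[OF S] by metis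
  have indep_line: "indep l (a0(l - 1 := w))" if w: "w \<notin> W \<inter> K" for w
    unfolding indep_def
  proof (intro allI impI)
    fix x i assume x: "lincomb l (a0(l - 1 := w)) x = 0" and i: "i < l"
    have "{..<l} = insert (l - 1) {..<l - 1}" using l by auto
    then have "lincomb l (a0(l - 1 := w)) x = x (l - 1) *s w + (\<Sum>i<l - 1. x i *s (a0(l - 1 := w)) i)" by simp
    also have "(\<Sum>i<l - 1. x i *s (a0(l - 1 := w)) i) = lincomb (l - 1) a0 x" by (rule sum.cong) auto
    finally have e: "x (l - 1) *s w + lincomb (l - 1) a0 x = 0" using x by simp
    have "x (l - 1) = 0"
    proof (rule ccontr)
      assume c: "x (l - 1) \<noteq> 0"
      have "w = (- 1 / x (l - 1)) *s lincomb (l - 1) a0 x"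
      proof -
        have "lincomb (l - 1) a0 x = (- x (l - 1)) *s w"
          using e by (metis add_eq_0_iff vector_smult_lneg)
        then show ?thesis using c by (simp add: vector_smult_assoc)
      qed
      also have "\<dots> \<in> spn (l - 1) a0" by (intro vec.span_scale spn_memI)
      finally show False using w a0(2) by simp
    qed
    moreover from this have "lincomb (l - 1) a0 x = 0" using e by simp
    then have "\<forall>i<l - 1. x i = 0" using indepD[OF a0(1)] by blast
    ultimately show "x i = 0" using i by (cases "i = l - 1") auto
  qed
  \<comment> \<open>\<open>h\<close> lies in \<open>W\<close> but not in \<open>K\<close>, and
    \<open>u\<close> is not in \<open>W\<close>, so no nontrivial combination falls into the
    axis.\<close>
  have off: "s *s h + t *s u \<notin> W \<inter> K" if st: "s \<noteq> 0 \<or> t \<noteq> 0" for s t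
  proof
    assume m: "s *s h + t *s u \<in> W \<inter> K"
    have "(s *s h + t *s u) - s *s h \<in> W"
      using m by (intro vec.subspace_diff[OF W(2)] vec.subspace_scale[OF W(2)] hW) auto
    then have tu: "t *s u \<in> W" by simp
    have t: "t = 0"
    proof (rule ccontr)
      assume t: "t \<noteq> 0"
      have "(1 / t) *s (t *s u) \<in> W" by (rule vec.subspace_scale[OF W(2) tu])
      then show False using uW t by (simp add: vector_smult_assoc)
    qed
    then have s: "s \<noteq> 0" "s *s h \<in> K" using m st by auto
    have "(1 / s) *s (s *s h) \<in> K" by (rule vec.subspace_scale[OF K(2) s(2)])
    then show False using hK s(1) by (simp add: vector_smult_assoc)
  qed
  \<comment> \<open>Homogeneous coordinates of the point are chosen arbitrarily; another choice
    rescales the moving vector, which leaves the member unchanged.\<close>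
  define f0 where "f0 = (\<lambda>x\<in>P1. let st = (SOME st. x = pt (fst st) (snd st) \<and> (fst st \<noteq> 0 \<or> snd st \<noteq> 0))
    in spn l (a0(l - 1 := fst st *s h + snd st *s u)))"
  have p0: "pencil l a0 h u f0"
    unfolding pencil_def
  proof (intro allI impI)
    fix s t :: complex assume st: "s \<noteq> 0 \<or> t \<noteq> 0"
    define q where "q = (SOME q. pt s t = pt (fst q) (snd q) \<and> (fst q \<noteq> 0 \<or> snd q \<noteq> 0))"
    have q: "pt s t = pt (fst q) (snd q)" "fst q \<noteq> 0 \<or> snd q \<noteq> 0"
      using someI[of "\<lambda>q. pt s t = pt (fst q) (snd q) \<and> (fst q \<noteq> 0 \<or> snd q \<noteq> 0)" "(s, t)"] st
      unfolding q_def by auto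
    have "pv (fst q) (snd q) \<in> pt s t" unfolding q(1) by (rule pv_mem_pt)
    then obtain c where c: "c \<noteq> 0" "pv (fst q) (snd q) = pv (c * s) (c * t)" unfolding mem_pt by blast
    have c': "fst q = c * s" "snd q = c * t"
      using fun_cong[OF c(2), of 0] fun_cong[OF c(2), of "Suc 0"] by simp_all
    have "f0 (pt s t) = spn l (a0(l - 1 := fst q *s h + snd q *s u))"
      using pt_P1[OF st] unfolding f0_def q_def Let_def by simp
    also have "\<dots> = spn l (a0(l - 1 := s *s h + t *s u))"
      by (rule spn_last_cong[OF l refl c(1)])
        (simp add: c' vector_add_ldistrib vector_smult_assoc vec.span_zero)
    finally show "f0 (pt s t) = spn l (a0(l - 1 := s *s h + t *s u))" .
  qed
  have f0: "f0 (pt s t) = spn l (a0(l - 1 := s *s h + t *s u))" if "s \<noteq> 0 \<or> t \<noteq> 0" for s t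
    using p0 that unfolding pencil_def by blast
  have f0G: "f0 x \<in> Gr l" if x: "x \<in> P1" for x
  proof -
    obtain s t where st: "x = pt s t" "s \<noteq> 0 \<or> t \<noteq> 0" using P1_coords[OF x] .
    show ?thesis unfolding st(1) f0[OF st(2)] by (rule indep_Gr[OF indep_line[OF off[OF st(2)]]])
  qed
  have f0E: "f0 \<in> P1 \<rightarrow>\<^sub>E Gr l"
    using f0G by (intro PiE_I) (auto simp: f0_def)
  have f0r: "f0 \<in> rational_curves l 1" by (rule pencil_rational[OF f0E p0 l])
  have Frow: "V \<in> schubert_variety l k (row l k) F \<longleftrightarrow> V \<in> Gr l \<and> u \<in> V" for V
  proof -
    have "1 \<le> vec.dim (V \<inter> F 1) \<longleftrightarrow> u \<in> V" if V: "V \<in> Gr l"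
    proof
      assume "1 \<le> vec.dim (V \<inter> F 1)"
      then obtain v where v: "v \<in> V" "v \<in> F 1" "v \<noteq> 0" using dim_pos_nonzero by blast
      then obtain c where c: "v = c *s u" unfolding F1 vec.span_singleton by blast
      then have c0: "c \<noteq> 0" using v(3) by auto
      have "(1 / c) *s v \<in> V" using V v(1) unfolding Gr_iff by (intro vec.subspace_scale) auto
      then show "u \<in> V" using c0 unfolding c by (simp add: vector_smult_assoc)
    next
      assume "u \<in> V"
      then have "u \<in> V \<inter> F 1" unfolding F1 by (simp add: vec.span_base)
      then show "1 \<le> vec.dim (V \<inter> F 1)" by (rule nonzero_dim_pos[OF _ u0])
    qed
    then show ?thesis unfolding schubert_row[OF fl(1) n l order_refl] by auto
  qed
  note mem = Frow schubert_column[OF fl(2) n l k, folded K_def] schubert_point[OF fl(3) n l, folded W_def]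
  have "f0 (pt 1 0) = W"
  proof (rule vec.subspace_dim_equal[symmetric, THEN sym])
    have e: "f0 (pt 1 0) = spn l (a0(l - 1 := h))" using f0[of 1 0] by simp
    have "a0 i \<in> W" if "i < l - 1" for i
      using a0(2) vec.span_base[of "a0 i" "a0 ` {..<l - 1}"] that by blast
    then show "f0 (pt 1 0) \<subseteq> W" unfolding e using hW by (intro vec.span_minimal W(2)) auto
    show "vec.dim W \<le> vec.dim (f0 (pt 1 0))" using f0G[OF pt_P1[of 1 0]] W(3) unfolding Gr_iff by simp
    show "vec.subspace (f0 (pt 1 0))" using f0G[OF pt_P1[of 1 0]] unfolding Gr_iff by simp
  qed (rule W(2))
  then have W1: "W \<in> f0 ` P1" by (intro image_eqI[where x = "pt 1 0"] pt_P1) simp_all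
  have u1: "u \<in> f0 (pt 0 1)"
  proof -
    have "u - 1 *s u \<in> spn (l - 1) a0" by (simp add: vec.span_zero)
    then have "u \<in> spn l (a0(l - 1 := u))" unfolding spn_last[OF l] by blast
    moreover have "f0 (pt 0 1) = spn l (a0(l - 1 := u))" using f0[of 0 1] by simp
    ultimately show ?thesis by (simp only:)
  qed
  have K1: "\<exists>y\<in>P1. f0 y \<subseteq> K"
  proof -
    have "u \<in> spn ?n ((b 1)(?n - 1 := h))"
      using indep_in_subspace[OF indg UNIV_I vec.subspace_UNIV vec_dim_card] by auto
    \<comment> \<open>Since \<open>h\<close> is off the hyperplane \<open>K\<close>, some
      combination u - c h lies in \<open>K\<close>; it spans with the axis the member contained in
      \<open>K\<close>.\<close>
    then obtain c where c: "u - c *s h \<in> K" unfolding spn_last[OF n1(4)] K by blast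
    have e: "f0 (pt (- c) 1) = spn l (a0(l - 1 := u - c *s h))" using f0[of "- c" 1] by (simp add: vector_smult_lneg)
    have "a0 i \<in> K" if "i < l - 1" for i
      using a0(2) vec.span_base[of "a0 i" "a0 ` {..<l - 1}"] that by blast
    then have "f0 (pt (- c) 1) \<subseteq> K" unfolding e using c by (intro vec.span_minimal K(2)) auto
    moreover have "pt (- c) 1 \<in> P1" by (rule pt_P1) simp
    ultimately show ?thesis by blast
  qed
  have "f0 \<in> A" unfolding A_def curves_meeting_def
  proof (intro CollectI conjI f0r, unfold list.set ball_simps, intro conjI TrueI)
    have p: "pt 0 1 \<in> P1" by (rule pt_P1) simp
    then have "f0 (pt 0 1) \<in> f0 ` P1 \<inter> schubert_variety l k (row l k) F"
      using u1 f0G[OF p] mem(1) by blast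
    then show "f0 ` P1 \<inter> schubert_variety l k (row l k) F \<noteq> {}" by blast
    show "f0 ` P1 \<inter> schubert_variety l k (column l l) G \<noteq> {}" using K1 f0G mem(2) by blast
    show "f0 ` P1 \<inter> schubert_variety l k (dual_partition k (replicate l 0)) H \<noteq> {}"
      using W1 mem(3) by blast
  qed
  moreover have "\<exists>a b c d. a * d - b * c \<noteq> 0 \<and> (\<forall>x\<in>P1. f0 x = g (mobius a b c d x))" if g: "g \<in> A" for g
  proof -
    have gr: "g \<in> rational_curves l 1" using g unfolding A_def curves_meeting_def by blast
    have gG: "g x \<in> Gr l" if "x \<in> P1" for x using gr that unfolding rational_curves_def by blast
    obtain x where x: "x \<in> P1" "u \<in> g x" using g mem(1) unfolding A_def curves_meeting_def by auto
    obtain y where y: "y \<in> P1" "g y \<subseteq> K" using g mem(2) unfolding A_def curves_meeting_def by auto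
    obtain z where z: "z \<in> P1" "g z = W" using g mem(3) unfolding A_def curves_meeting_def by auto
    obtain a v w where p: "pencil l a v w g" using rational_pencil[OF gr l] by blast
    have a: "spn (l - 1) a = spn (l - 1) a0" by (rule pencil_axis[OF l p gG K(2) a0 y z])
    show ?thesis
    proof (rule pencil_standard[OF l p p0 a z(1) _ x])
      show "h \<in> g z" using z hW by simp
      show "x \<noteq> z" using x z uW by auto
      show "h \<notin> spn (l - 1) a0" "u \<notin> spn (l - 1) a0" unfolding a0(2) using hK uW by auto
    qed
  qed
  ultimately show ?thesis by blast
qed

theorem gw_line:
  fixes T :: "'n::{finite,linorder} itself"
  assumes n: "CARD('n) = l + k" and l: "l \<ge> 1" and k: "k \<ge> 1"
  shows "gromov_witten T l k (row l k) (column l l) (dual_partition k (replicate l 0)) 1 = 1"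
proof (rule gromov_witten_eqI)
  have "sum_list (dual_partition k (replicate l 0)) = l * k"
    unfolding dual_partition_def by (simp add: sum_list_replicate)
  then show "sum_list (row l k) + sum_list (column l l) + sum_list (dual_partition k (replicate l 0))
      = l * k + 1 * CARD('n)"
    using n l by (simp add: sum_list_row sum_list_column)
  show "generic (\<lambda>b. \<forall>F G (H :: 'n cflag). adapted3 b F G H \<longrightarrow>
      (let A = curves_meeting l 1
         [schubert_variety l k (row l k) F, schubert_variety l k (column l l) G,
          schubert_variety l k (dual_partition k (replicate l 0)) H]
       in finite (A // reparam_rel A) \<and> card (A // reparam_rel A) = 1))"
  proof (rule generic_mono[OF generic_line_generic], intro allI impI)
    fix b :: "'n btriple" and F G H :: "'n cflag"
    assume b: "line_generic l b" "adapted3 b F G H"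
    define A where "A = curves_meeting l 1
         [schubert_variety l k (row l k) F, schubert_variety l k (column l l) G,
          schubert_variety l k (dual_partition k (replicate l 0)) H]"
    obtain f where "f \<in> A" "\<And>g. g \<in> A \<Longrightarrow> \<exists>a b c d. a * d - b * c \<noteq> 0 \<and> (\<forall>x\<in>P1. f x = g (mobius a b c d x))"
      using line_curves[OF n l k b] unfolding A_def[symmetric] by blast
    then have "A // reparam_rel A = {A}" by (rule reparam_quotient_singleton)
    then show "let A = curves_meeting l 1
         [schubert_variety l k (row l k) F, schubert_variety l k (column l l) G,
          schubert_variety l k (dual_partition k (replicate l 0)) H]
       in finite (A // reparam_rel A) \<and> card (A // reparam_rel A) = 1"
      unfolding A_def[symmetric] Let_def by simp
  qed
qed

section \<open>The presentation of the quantum cohomology ring\<close>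

theorem mainTheorem5:
  fixes l k :: nat
  assumes "l \<ge> 1" and "k \<ge> 1" and "CARD('n::{finite,linorder}) = l + k"
    and "cring (QH TYPE('n) l k)"
  shows "(\<exists>\<phi>. chern_hom TYPE('n) l k \<phi>) \<and>
    (\<forall>\<phi>. chern_hom TYPE('n) l k \<phi> \<longrightarrow>
       \<phi> ` carrier (cq_ring l) = carrier (QH TYPE('n) l k) \<and>
       a_kernel (cq_ring l) (QH TYPE('n) l k) \<phi> = genideal (cq_ring l) (relations l k))"
proof -
  have "qh_pieri TYPE('n) l k"
    using assms gw_pieri[OF assms(3,1)] gw_line[OF assms(3,1,2)] by (intro qh_pieri.intro)
  then show ?thesis by (rule qh_pieri.presentation)
qed

end
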